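(* Let $Z$ be a critical Galton–Watson process of index $1+\alpha$ as described in the context, started from $Z_0=1$. Assume that integers $j_m\geq1$ satisfy $j_m/m\to\eta\in[0,1]$ as $m\uparrow\infty$. (a) If $\eta=0$, then $\mathbf{E}M_m(j_m)\sim j_m\log(m/j_m)$ as $m\uparrow\infty$. (b) If $0<\eta\leq1$, then $\mathbf{E}M_m(j_m)\sim j_m\varphi(\eta)$ as $m\uparrow\infty$, where $$\varphi(\eta):=\frac{\alpha}{2\alpha+1}+\mathbf{E}V^{\ast}(1/\eta).$$ In particular, $\varphi(\eta)\sim\log(1/\eta)$ as $\eta\downarrow0$.
   Context: Let $Z=\{Z_n:n\geq0\}$ be a Galton–Watson process with offspring variable $\xi$ whose generating function satisfies $\mathbf{E}\xi=1$ and $f(s):=\mathbf{E}s^{\xi}=s+(1-s)^{1+\alpha}L(1-s)$ for $0\leq s\leq1$, for some $\alpha\in(0,1]$ and some function $L$ slowly varying at $0$. For $k\geq0$ and $1\leq j\leq m<\infty$ put $S_k(j):=\sum_{l=k}^{k+j-1}Z_l$ and $M_m(j):=\max_{0\leq k\leq m-j}S_k(j)$. When an expression indexed by an integer is evaluated at a non-integer, its integer part is meant. Let $X$ be the continuous-state branching process of index $1+\alpha$: a $[0,\infty)$-valued time-homogeneous Markov process with càdlàg paths and $\mathbf{E}\{e^{-\lambda X(t)}\mid X(0)=x\}=\exp[-x(t+\lambda^{-\alpha})^{-1/\alpha}]$ for $\lambda,t,x\geq0$. Let $\chi\geq0$ be a random variable with $\mathbf{E}e^{-\lambda\chi}=1-(1+\lambda^{-\alpha})^{-1/\alpha}$,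 $\lambda\geq0$. Let $\{X^+(t):0\leq t\leq1\}$ be the Markov process with càdlàg paths, $X^+(0)=0$, obtained by conditioning $X$ (started at $0$) to be positive at time $1$ in the sense of Durrett: for $y>0$, $0<t\leq1$, $\mathbf{P}(X^+(t)\in dy)=t^{-1/\alpha}\mathbf{P}(t^{1/\alpha}\chi\in dy)\,\mathbf{P}\{X(1-t)>0\mid X(0)=y\}$, and for $x>0$, $0<s<t\leq1$, $\mathbf{P}\{X^+(t)\in dy\mid X^+(s)=x\}=\mathbf{P}\{X(t-s)\in dy\mid X(0)=x\}\,\mathbf{P}\{X(1-t)>0\mid X(0)=y\}/\mathbf{P}\{X(1-s)>0\mid X(0)=x\}$. Define $X^{\ast}(t):=X^+(t)$ for $0\leq t\leq1$ and $X^{\ast}(t):=X^{X^+(1)}(t-1)$ for $t\geq1$, where $\{X^x:x>0\}$ is a family of copies of $X$ with $X^x(0)=x$, independent of $X^+$. Finally $V^{\ast}(T):=\sup_{0\leq s\leq T-1}\int_s^{s+1}X^{\ast}(u)\,du$ for $T\geq1$. *)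

theory Defs
  imports "HOL-Probability.Probability" "HOL-Library.Landau_Symbols"
begin

definition slowly_varying_at_0 :: "(real \<Rightarrow> real) \<Rightarrow> bool" where
  "slowly_varying_at_0 L \<longleftrightarrow>
     (\<exists>a>0. \<forall>x\<in>{0<..<a}. L x > 0) \<and>
     (\<forall>c>0. ((\<lambda>x. L (c * x) / L x) \<longlongrightarrow> 1) (at_right 0))"

fun sum_iid :: "nat pmf \<Rightarrow> nat \<Rightarrow> nat pmf" where
  "sum_iid \<xi> 0 = return_pmf 0"
| "sum_iid \<xi> (Suc k) = bind_pmf \<xi> (\<lambda>a. map_pmf ((+) a) (sum_iid \<xi> k))"

fun gw_paths :: "nat pmf \<Rightarrow> nat \<Rightarrow> nat list pmf" where
  "gw_paths \<xi> 0 = return_pmf [1]"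
| "gw_paths \<xi> (Suc n) =
     bind_pmf (gw_paths \<xi> n) (\<lambda>zs. map_pmf (\<lambda>z. zs @ [z]) (sum_iid \<xi> (last zs)))"

definition S_win :: "nat list \<Rightarrow> nat \<Rightarrow> nat \<Rightarrow> nat" where
  "S_win zs k j = (\<Sum>l\<in>{k..<k+j}. zs ! l)"

definition M_max :: "nat list \<Rightarrow> nat \<Rightarrow> nat \<Rightarrow> nat" where
  "M_max zs m j = Max ((\<lambda>k. S_win zs k j) ` {0..m-j})"

definition EM :: "nat pmf \<Rightarrow> nat \<Rightarrow> nat \<Rightarrow> real" where
  "EM \<xi> m j = measure_pmf.expectation (gw_paths \<xi> m) (\<lambda>zs. real (M_max zs m j))"

definition csbp_kernel :: "(real \<Rightarrow> real \<Rightarrow> real measure) \<Rightarrow> real \<Rightarrow> bool" where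
  "csbp_kernel P \<alpha> \<longleftrightarrow>
     (\<forall>t\<ge>0. \<forall>x. prob_space (P t x) \<and> sets (P t x) = sets borel) \<and>
     (\<forall>t\<ge>0. \<forall>A\<in>sets borel. (\<lambda>x. emeasure (P t x) A) \<in> borel_measurable borel) \<and>
     (\<forall>t\<ge>0. \<forall>x\<ge>0. AE y in P t x. y \<ge> 0) \<and>
     (\<forall>t\<ge>0. \<forall>x\<ge>0. \<forall>l>0.
        (\<integral>y. exp (- l * y) \<partial>P t x) = exp (- x * (t + l powr (-\<alpha>)) powr (-1/\<alpha>)))"

definition chi_law :: "real measure \<Rightarrow> real \<Rightarrow> bool" where
  "chi_law ch \<alpha> \<longleftrightarrow> prob_space ch \<and> sets ch = sets borel \<and> (AE c in ch. c \<ge> 0) \<and>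
     (\<forall>l>0. (\<integral>c. exp (- l * c) \<partial>ch) = 1 - (1 + l powr (-\<alpha>)) powr (-1/\<alpha>))"

definition surv :: "(real \<Rightarrow> real \<Rightarrow> real measure) \<Rightarrow> real \<Rightarrow> real \<Rightarrow> real" where
  "surv P r y = measure (P r y) {z. z > 0}"

text \<open>Integral of g against the transition kernel of X* from (s,x) to time t (0 < s < t).\<close>
definition kint :: "(real \<Rightarrow> real \<Rightarrow> real measure) \<Rightarrow> real \<Rightarrow> real \<Rightarrow> real
                     \<Rightarrow> (real \<Rightarrow> ennreal) \<Rightarrow> ennreal" where
  "kint P s t x g =
     (if t \<le> 1 then
        \<integral>\<^sup>+ y. ennreal (surv P (1 - t) y / surv P (1 - s) x) * g y \<partial>P (t - s) x
      else if 1 \<le> s then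
        \<integral>\<^sup>+ y. g y \<partial>P (t - s) x
      else
        \<integral>\<^sup>+ z. ennreal (surv P 0 z / surv P (1 - s) x) * (\<integral>\<^sup>+ y. g y \<partial>P (t - 1) z) \<partial>P (1 - s) x)"

text \<open>Integral of g against the law of X*(t), t > 0.\<close>
definition mu_int :: "(real \<Rightarrow> real \<Rightarrow> real measure) \<Rightarrow> real measure \<Rightarrow> real \<Rightarrow> real
                       \<Rightarrow> (real \<Rightarrow> ennreal) \<Rightarrow> ennreal" where
  "mu_int P ch \<alpha> t g =
     (if t \<le> 1 then
        \<integral>\<^sup>+ c. ennreal (t powr (-1/\<alpha>) * surv P (1 - t) (t powr (1/\<alpha>) * c))
                 * g (t powr (1/\<alpha>) * c) \<partial>ch
      else
        \<integral>\<^sup>+ c. ennreal (surv P 0 c) * (\<integral>\<^sup>+ y. g y \<partial>P (t - 1) c) \<partial>ch)"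

fun fdd_from :: "(real \<Rightarrow> real \<Rightarrow> real measure) \<Rightarrow> real \<Rightarrow> real
                  \<Rightarrow> (real \<times> real set) list \<Rightarrow> ennreal" where
  "fdd_from P s x [] = 1"
| "fdd_from P s x ((t, A) # rest) =
     kint P s t x (\<lambda>y. indicator A y * fdd_from P t y rest)"

fun fdd :: "(real \<Rightarrow> real \<Rightarrow> real measure) \<Rightarrow> real measure \<Rightarrow> real
             \<Rightarrow> (real \<times> real set) list \<Rightarrow> ennreal" where
  "fdd P ch \<alpha> [] = 1"
| "fdd P ch \<alpha> ((t, A) # rest) = mu_int P ch \<alpha> t (\<lambda>y. indicator A y * fdd_from P t y rest)"

definition cadlag_on_nonneg :: "(real \<Rightarrow> real) \<Rightarrow> bool" where
  "cadlag_on_nonneg f \<longleftrightarrow>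
     (\<forall>t\<ge>0. continuous (at_right t) f) \<and> (\<forall>t>0. \<exists>l. (f \<longlongrightarrow> l) (at_left t))"

definition is_Xstar ::
  "(real \<Rightarrow> real \<Rightarrow> real measure) \<Rightarrow> real measure \<Rightarrow> real
   \<Rightarrow> 'a measure \<Rightarrow> (real \<Rightarrow> 'a \<Rightarrow> real) \<Rightarrow> bool" where
  "is_Xstar P ch \<alpha> M Xs \<longleftrightarrow>
     prob_space M \<and>
     (\<forall>t. Xs t \<in> borel_measurable M) \<and>
     (\<forall>\<omega>\<in>space M. Xs 0 \<omega> = 0 \<and> (\<forall>t\<ge>0. Xs t \<omega> \<ge> 0) \<and> cadlag_on_nonneg (\<lambda>t. Xs t \<omega>)) \<and>
     (\<forall>tas. sorted_wrt (<) (map fst tas) \<and> (\<forall>p\<in>set tas. fst p > 0 \<and> snd p \<in> sets borel) \<longrightarrow>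
        emeasure M {\<omega>\<in>space M. \<forall>p\<in>set tas. Xs (fst p) \<omega> \<in> snd p} = fdd P ch \<alpha> tas)"

definition Vstar :: "(real \<Rightarrow> 'a \<Rightarrow> real) \<Rightarrow> real \<Rightarrow> 'a \<Rightarrow> real" where
  "Vstar Xs T \<omega> = (SUP s\<in>{0..T-1}. integral {s..s+1} (\<lambda>u. Xs u \<omega>))"

definition phi :: "real \<Rightarrow> 'a measure \<Rightarrow> (real \<Rightarrow> 'a \<Rightarrow> real) \<Rightarrow> real \<Rightarrow> real" where
  "phi \<alpha> M Xs \<eta> = \<alpha> / (2 * \<alpha> + 1) + (\<integral>\<omega>. Vstar Xs (1 / \<eta>) \<omega> \<partial>M)"

end

theory Submission
  imports Defs
begin

text \<open>Write j for the window length, Q j = P(Z_j > 0), and split according to survival up to time j.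
  If Z_j = 0, every window sum is at most the first one, so M = S_0(j), and the first moments
  E[Z_l; Z_j = 0] alone produce the summand alpha / (2 alpha + 1).
  Given Z_j > 0, the rescaled process u \<mapsto> Q j * Z_{uj} converges to X* in its finite-dimensional
  Laplace transforms, because Phi x = int_x^1 1/g with g x = f(1 - x) - (1 - x) nearly linearises the iteration of f;
  its one-dimensional means converge too. Hence expectations of Lipschitz functions of finitely many
  coordinates converge. No tightness in path space is needed: on both sides the window supremum is compared
  with a maximum over a finite grid, and the expected error is governed by the L1 oscillation
  int E|X_u - X_{u'}| du (u' the next grid point), a functional of two-dimensional marginals.

  The logarithm comes from bounds uniform in 1 \<le> j \<le> m. The function w with generating function
  1 / (f(s) - s) is harmonic for the skip-free random walk with steps distributed as Z_1 - 1, of which the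
  generation sizes form a subsequence, so P_z(max \<le> N) is at least w(N - z) / w(N); since w(1 / Q j) is of order j, the sum of the tails
  1 - w(t - 1) / w(t) over 1 / Q j \<le> t \<le> 1 / Q m is log (m / j) up to a constant. A maximal inequality and
  Chernoff bounds compare window sums with j times the maximum. These bounds give part (a) and, combined with
  part (b), the asymptotics of the constant.\<close>

text \<open>Regular variation is handled without Karamata theory: the index of \<open>Phi\<close>
  comes from L'Hopital's rule, moving arguments are treated by monotonicity, and the size of
  \<open>w\<close> is found up to constants from its monotonicity and subadditivity. Criticality is
  what makes first moments tractable. Since E Z_l = 1, a lower bound for the mean on extinction is
  an upper bound for the mean given survival, so both bounds come from the same elementary
  inequality for Laplace transforms; convergence of means then supplies uniform integrability. The
  mean of Z_{uj} on Z_j = 0 tends to (1 - u)^(1 + 1/\<alpha>), whose integral over [0,1] is \<alpha>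
  / (2 \<alpha> + 1). On survival the conditioning probability equals the scaling factor Q j, so
  this part of E M / j is exactly the conditional mean of the rescaled window maximum. A relative
  error eps with an additive constant depending on eps is enough in the logarithmic bounds, because
  the logarithm diverges.\<close>

abbreviation pexp :: "'b pmf \<Rightarrow> ('b \<Rightarrow> real) \<Rightarrow> real" where
  "pexp p F \<equiv> measure_pmf.expectation p F"
abbreviation pprob :: "'b pmf \<Rightarrow> 'b set \<Rightarrow> real" where
  "pprob p A \<equiv> measure_pmf.prob p A"

section \<open>The iterated generating function\<close>

definition gf :: "nat pmf \<Rightarrow> real \<Rightarrow> real" where
  "gf p s = pexp p (\<lambda>k. s ^ k)"

lemma integrable_pmf_bounded:
  fixes F :: "'b \<Rightarrow> real"
  assumes "\<And>x. \<bar>F x\<bar> \<le> B"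
  shows "integrable (measure_pmf p) F"
  by (rule measure_pmf.integrable_const_bound[where B=B]) (use assms in auto)

lemma power_integrable_pmf: "0 \<le> s \<Longrightarrow> s \<le> 1 \<Longrightarrow> integrable (measure_pmf p) (\<lambda>k. (s::real) ^ (F k))"
  by (rule integrable_pmf_bounded[where B=1]) (auto simp: power_le_one)

lemma gf_eq_suminf:
  assumes "0 \<le> s" "s \<le> 1"
  shows "gf p s = (\<Sum>k. pmf p k * s ^ k)"
proof -
  have i: "integrable (measure_pmf p) (\<lambda>k. s ^ k)"
    using power_integrable_pmf[OF assms, of p "\<lambda>k. k"] by simp
  hence i': "integrable (count_space UNIV) (\<lambda>k. pmf p k * s ^ k)"
    by (simp add: measure_pmf_eq_density integrable_density)
  have "gf p s = (\<integral>k. pmf p k * s ^ k \<partial>count_space UNIV)"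
    by (simp add: gf_def measure_pmf_eq_density integral_density)
  also have "\<dots> = (\<Sum>k. pmf p k * s ^ k)"
    by (rule integral_count_space_nat[OF i'])
  finally show ?thesis .
qed

lemma gf_range: "0 \<le> s \<Longrightarrow> s \<le> 1 \<Longrightarrow> gf p s \<in> {0..1}"
proof -
  assume s: "0 \<le> s" "s \<le> 1"
  have i: "integrable (measure_pmf p) (\<lambda>k. s ^ k)"
    using power_integrable_pmf[OF s, of p "\<lambda>k. k"] by simp
  have "gf p s \<ge> 0" unfolding gf_def by (rule Bochner_Integration.integral_nonneg) (use s in auto)
  moreover have "gf p s \<le> pexp p (\<lambda>_. 1)"
    unfolding gf_def by (rule integral_mono[OF i]) (use s in \<open>auto simp: power_le_one\<close>)
  ultimately show ?thesis by simp
qed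

lemma gf_mono: "0 \<le> s \<Longrightarrow> s \<le> t \<Longrightarrow> t \<le> 1 \<Longrightarrow> gf p s \<le> gf p t"
  unfolding gf_def
  by (rule integral_mono) (use power_integrable_pmf[of _ p "\<lambda>k. k"] in \<open>auto intro!: power_mono\<close>)

lemma gf_0: "gf p 0 = pmf p 0"
proof -
  have "gf p 0 = pexp p (indicator {0})"
    unfolding gf_def by (rule Bochner_Integration.integral_cong) (auto simp: indicator_def power_0_left)
  thus ?thesis by (simp add: measure_pmf_single)
qed

lemma gf_1: "gf p 1 = 1"
  unfolding gf_def by (subst Bochner_Integration.integral_cong[where g="\<lambda>_. 1"]) auto

lemma eventually_pos_less_at_right_0: "0 < c \<Longrightarrow> eventually (\<lambda>x. 0 < x \<and> x < c) (at_right (0::real))"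
  unfolding eventually_at_right_field by auto

lemma power_diff_le:
  fixes s t :: real
  assumes "0 \<le> s" "s \<le> t" "t \<le> 1"
  shows "t ^ k - s ^ k \<le> real k * (t - s)"
proof (induction k)
  case (Suc k)
  have "t ^ Suc k - s ^ Suc k = t * (t ^ k - s ^ k) + s ^ k * (t - s)"
    by (simp add: algebra_simps)
  also have "\<dots> \<le> 1 * (t ^ k - s ^ k) + 1 * (t - s)"
    using assms by (intro add_mono mult_right_mono) (auto simp: power_le_one power_mono)
  also have "\<dots> \<le> real (Suc k) * (t - s)"
    using Suc by (simp add: algebra_simps)
  finally show ?case .
qed simp

text \<open>The constant \<open>C\<close> may depend on \<open>e\<close>: it is absorbed because
  \<open>l\<close> tends to infinity. Both logarithmic asymptotics are deduced from bounds of this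
  kind.\<close>

lemma ratio_tendsto_1:
  fixes a l :: "'b \<Rightarrow> real"
  assumes l: "filterlim l at_top F"
    and b: "\<And>e. 0 < e \<Longrightarrow> e < 1 \<Longrightarrow> \<exists>C. eventually (\<lambda>x. \<bar>a x - l x\<bar> \<le> e * l x + C) F"
  shows "((\<lambda>x. a x / l x) \<longlongrightarrow> 1) F"
proof (rule tendstoI)
  fix r :: real assume r: "0 < r"
  define e where "e = min (r / 2) (1 / 2)"
  have e: "0 < e" "e < 1" "e \<le> r / 2" using r by (auto simp: e_def)
  obtain C where C: "eventually (\<lambda>x. \<bar>a x - l x\<bar> \<le> e * l x + C) F" using b[OF e(1,2)] by blast
  have "eventually (\<lambda>x. max 0 (2 * C / r) < l x) F" using l unfolding filterlim_at_top_dense by blast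
  with C show "eventually (\<lambda>x. dist (a x / l x) 1 < r) F"
  proof eventually_elim
    case (elim x)
    hence l0: "0 < l x" "2 * C / r < l x" by auto
    have "e * l x \<le> r / 2 * l x" using l0 e by (intro mult_right_mono) auto
    moreover have "C < r / 2 * l x" using l0 r by (simp add: field_simps)
    moreover have "r / 2 * l x + r / 2 * l x = r * l x" by (simp add: field_simps)
    ultimately have "\<bar>a x - l x\<bar> < r * l x" using elim(1) by linarith
    hence "\<bar>a x - l x\<bar> / l x < r" using l0 by (simp add: pos_divide_less_eq)
    moreover have "a x / l x - 1 = (a x - l x) / l x" using l0 by (simp add: diff_divide_distrib)
    ultimately show ?case using l0 unfolding dist_real_def by (simp only: abs_divide abs_of_pos)
  qed
qed

locale critical_gw =
  fixes \<xi> :: "nat pmf" and \<alpha> :: real and L :: "real \<Rightarrow> real"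
  assumes alpha: "0 < \<alpha>" "\<alpha> \<le> 1"
    and mean: "measure_pmf.expectation \<xi> real = 1"
    and L_sv: "slowly_varying_at_0 L"
    and genfun: "\<forall>s\<in>{0..1}. (\<Sum>k. pmf \<xi> k * s ^ k) = s + (1 - s) powr (1 + \<alpha>) * L (1 - s)"
begin

text \<open>The generating function seen from its fixed point 1: with x = 1 - s, the n-th iterate of
  \<open>h\<close> at 1 is P(Z_n > 0), and \<open>g\<close> is the loss in one generation.\<close>

definition h :: "real \<Rightarrow> real" where "h x = 1 - gf \<xi> (1 - x)"
definition g :: "real \<Rightarrow> real" where "g x = x - h x"

lemma integrable_xi: "integrable (measure_pmf \<xi>) real"
  using mean not_integrable_integral_eq by fastforce

lemma g_eq: "0 \<le> x \<Longrightarrow> x \<le> 1 \<Longrightarrow> g x = x powr (1 + \<alpha>) * L x"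
  using genfun[rule_format, of "1 - x"] gf_eq_suminf[of "1 - x" \<xi>]
  by (simp add: g_def h_def)

lemma gf_lipschitz:
  assumes "0 \<le> s" "s \<le> t" "t \<le> 1"
  shows "gf \<xi> t - gf \<xi> s \<le> t - s"
proof -
  have i: "integrable (measure_pmf \<xi>) (\<lambda>k. s ^ k)" "integrable (measure_pmf \<xi>) (\<lambda>k. t ^ k)"
    using power_integrable_pmf[of _ \<xi> "\<lambda>k. k"] assms by auto
  have "gf \<xi> t - gf \<xi> s = pexp \<xi> (\<lambda>k. t ^ k - s ^ k)"
    unfolding gf_def using i by simp
  also have "\<dots> \<le> pexp \<xi> (\<lambda>k. real k * (t - s))"
    by (rule integral_mono) (use i integrable_xi power_diff_le[OF assms] in auto)
  also have "\<dots> = t - s" using mean by simp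
  finally show ?thesis .
qed

lemma h_0 [simp]: "h 0 = 0" by (simp add: h_def gf_1)
lemma h_mono: "0 \<le> x \<Longrightarrow> x \<le> y \<Longrightarrow> y \<le> 1 \<Longrightarrow> h x \<le> h y"
  unfolding h_def using gf_mono[of "1 - y" "1 - x" \<xi>] by simp

text \<open>By criticality the generating function is 1-Lipschitz on [0,1], so x - h x cannot
  decrease. This monotonicity stands in for information on \<open>L\<close> away from 0.\<close>

lemma g_mono: "0 \<le> x \<Longrightarrow> x \<le> y \<Longrightarrow> y \<le> 1 \<Longrightarrow> g x \<le> g y"
  unfolding g_def h_def using gf_lipschitz[of "1 - y" "1 - x"] by simp

lemma h_range: "0 \<le> x \<Longrightarrow> x \<le> 1 \<Longrightarrow> h x \<in> {0..x}"
  using g_mono[of 0 x] h_mono[of 0 x] by (auto simp: g_def)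

lemma g_cont: "continuous_on {0..1} g"
proof -
  have "1-lipschitz_on {0..1} (gf \<xi>)"
  proof (rule lipschitz_onI)
    fix x y :: real assume "x \<in> {0..1}" "y \<in> {0..1}"
    thus "dist (gf \<xi> x) (gf \<xi> y) \<le> 1 * dist x y"
      using gf_lipschitz[of x y] gf_lipschitz[of y x] gf_mono[of x y \<xi>] gf_mono[of y x \<xi>]
      by (cases "x \<le> y") (auto simp: dist_real_def)
  qed simp
  hence "continuous_on {0..1} (gf \<xi>)" by (rule lipschitz_on_continuous_on)
  hence "continuous_on {0..1} (\<lambda>x. gf \<xi> (1 - x))"
    by (rule continuous_on_compose2) (auto intro!: continuous_intros)
  thus ?thesis unfolding g_def h_def by (intro continuous_intros)
qed

text \<open>Slow variation makes \<open>L\<close> positive only near 0; monotonicity of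
  \<open>g\<close> carries the positivity up to 1.\<close>

lemma g_pos: assumes "0 < x" "x \<le> 1" shows "0 < g x"
proof -
  obtain a where a: "a > 0" "\<And>x. x \<in> {0<..<a} \<Longrightarrow> L x > 0"
    using L_sv unfolding slowly_varying_at_0_def by blast
  define y where "y = min x (a / 2)"
  have y: "0 < y" "y \<le> x" "y < a" using a assms by (auto simp: y_def)
  have "0 < g y" using g_eq[of y] a(2)[of y] y assms by simp
  also have "\<dots> \<le> g x" using g_mono[of y x] y assms by simp
  finally show ?thesis .
qed

lemma pmf_0_pos: "0 < pmf \<xi> 0"
  using g_pos[of 1] by (simp add: g_def h_def gf_0)

lemma g_rv:
  assumes "c > 0"
  shows "((\<lambda>x. g (c * x) / g x) \<longlongrightarrow> c powr (1 + \<alpha>)) (at_right 0)"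
proof -
  have "((\<lambda>x. c powr (1 + \<alpha>) * (L (c * x) / L x)) \<longlongrightarrow> c powr (1 + \<alpha>) * 1) (at_right 0)"
    using L_sv assms unfolding slowly_varying_at_0_def by (intro tendsto_intros) auto
  moreover have "eventually (\<lambda>x. c powr (1 + \<alpha>) * (L (c * x) / L x) = g (c * x) / g x) (at_right 0)"
  proof -
    have "eventually (\<lambda>x. x > 0 \<and> x < min 1 (1 / c)) (at_right (0::real))"
      using assms by (intro eventually_pos_less_at_right_0) auto
    thus ?thesis
    proof eventually_elim
      case (elim x)
      have "c * x \<le> 1" using elim assms by (auto simp: field_simps)
      thus ?case using elim assms g_eq[of x] g_eq[of "c * x"]
        by (auto simp: powr_mult)
    qed
  qed
  ultimately show ?thesis by (auto intro: Lim_transform_eventually)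
qed

text \<open>This is f'(1) = 1. The difference quotient is the expectation of the geometric sum of (1
  - x)^l over l < k, with k the number of children; it is dominated by k, which is
  integrable.\<close>

lemma h_over_id: "((\<lambda>x. h x / x) \<longlongrightarrow> 1) (at_right 0)"
proof (rule tendsto_at_iff_sequentially[THEN iffD2], intro allI impI)
  fix X :: "nat \<Rightarrow> real" assume X: "\<forall>i. X i \<in> {0<..} - {0}" "X \<longlonglongrightarrow> 0"
  \<comment> \<open>Capping at 1 keeps 1 - Y i in [0,1] for every index, as the domination requires;
    eventually X i < 1 and nothing has changed.\<close>
  define Y where "Y = (\<lambda>i. min (X i) 1)"
  have Yp: "0 < Y i" "Y i \<le> 1" for i using X by (auto simp: Y_def)
  have Y0: "Y \<longlonglongrightarrow> 0"
  proof -
    have "(\<lambda>i. min (X i) 1) \<longlonglongrightarrow> min 0 1" using X by (intro tendsto_intros) auto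
    thus ?thesis by (simp add: Y_def)
  qed
  have lim1: "(\<lambda>i. pexp \<xi> (\<lambda>k. (1 - (1 - Y i) ^ k) / Y i)) \<longlonglongrightarrow> pexp \<xi> real"
  proof (rule integral_dominated_convergence[where w=real])
    show "AE k in measure_pmf \<xi>. (\<lambda>i. (1 - (1 - Y i) ^ k) / Y i) \<longlonglongrightarrow> real k"
    proof (rule AE_I2)
      fix k
      have eq: "(1 - (1 - y) ^ k) / y = (\<Sum>l<k. (1 - y) ^ l)" if "y \<noteq> 0" for y :: real
        using one_diff_power_eq[of "1 - y" k] that by (simp add: field_simps)
      have "(\<lambda>i. \<Sum>l<k. (1 - Y i) ^ l) \<longlonglongrightarrow> (\<Sum>l<k. (1 - 0) ^ l)"
        by (intro tendsto_intros Y0)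
      moreover have "(\<lambda>i. (1 - (1 - Y i) ^ k) / Y i) = (\<lambda>i. \<Sum>l<k. (1 - Y i) ^ l)"
        using Yp(1) by (intro ext eq) (auto simp: less_imp_neq[symmetric])
      ultimately show "(\<lambda>i. (1 - (1 - Y i) ^ k) / Y i) \<longlonglongrightarrow> real k" by simp
    qed
    show "AE k in measure_pmf \<xi>. norm ((1 - (1 - Y i) ^ k) / Y i) \<le> real k" for i
      using power_diff_le[of "1 - Y i" 1] Yp[of i]
      by (intro AE_I2) (auto simp: field_simps power_le_one)
  qed (use integrable_xi in auto)
  have "pexp \<xi> (\<lambda>k. (1 - (1 - Y i) ^ k) / Y i) = h (Y i) / Y i" for i
    using power_integrable_pmf[of "1 - Y i" \<xi> "\<lambda>k. k"] Yp[of i] by (simp add: h_def gf_def)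
  hence lim2: "(\<lambda>i. h (Y i) / Y i) \<longlonglongrightarrow> 1" using lim1 unfolding mean by (simp only:)
  have "eventually (\<lambda>i. X i < 1) sequentially" using X(2) by (rule order_tendstoD) simp
  hence "eventually (\<lambda>i. h (Y i) / Y i = h (X i) / X i) sequentially"
    by eventually_elim (simp add: Y_def)
  thus "((\<lambda>x. h x / x) \<circ> X) \<longlonglongrightarrow> 1"
    using lim2 by (auto simp: o_def intro: Lim_transform_eventually)
qed

lemma h_pos: assumes "0 < x" "x \<le> 1" shows "0 < h x"
proof -
  have "eventually (\<lambda>x. h x / x > 0 \<and> 0 < x) (at_right 0)"
    by (intro eventually_conj order_tendstoD(1)[OF h_over_id] eventually_at_right_less) auto
  then obtain b where b: "b > 0" "\<And>y. 0 < y \<Longrightarrow> y < b \<Longrightarrow> h y / y > 0"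
    unfolding eventually_at_right_field by auto
  define y where "y = min x (b / 2)"
  have "0 < y" "y \<le> x" "y < b" using b assms by (auto simp: y_def)
  hence "0 < h y" using b(2)[of y] by (auto simp: zero_less_divide_iff)
  also have "\<dots> \<le> h x" using h_mono[of y x] \<open>0 < y\<close> \<open>y \<le> x\<close> assms by simp
  finally show ?thesis .
qed

lemma iter_range: "0 \<le> x \<Longrightarrow> x \<le> 1 \<Longrightarrow> (h ^^ n) x \<in> {0..x}"
proof (induction n)
  case (Suc n) thus ?case using h_range[of "(h ^^ n) x"] by auto
qed auto

lemma iter_pos: "0 < x \<Longrightarrow> x \<le> 1 \<Longrightarrow> 0 < (h ^^ n) x"
proof (induction n)
  case (Suc n) thus ?case using h_pos[of "(h ^^ n) x"] iter_range[of x n] by auto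
qed auto

lemma iter_antimono: "0 \<le> x \<Longrightarrow> x \<le> 1 \<Longrightarrow> m \<le> n \<Longrightarrow> (h ^^ n) x \<le> (h ^^ m) x"
proof -
  assume a: "0 \<le> x" "x \<le> 1" "m \<le> n"
  have "(h ^^ n) x = (h ^^ (n - m)) ((h ^^ m) x)" using a(3) by (metis funpow_add le_add_diff_inverse2 o_apply)
  thus ?thesis using iter_range[of "(h ^^ m) x" "n - m"] iter_range[of x m] a by auto
qed

lemma iter_gf: "0 \<le> x \<Longrightarrow> x \<le> 1 \<Longrightarrow> (gf \<xi> ^^ n) (1 - x) = 1 - (h ^^ n) x"
  by (induction n) (auto simp: h_def)

section \<open>The coordinate \<open>Phi\<close>, in which iteration is almost a translation\<close>

definition Phi :: "real \<Rightarrow> real" where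
  "Phi x = integral {x..1} (\<lambda>y. 1 / g y)"

lemma inv_g_integrable: "0 < x \<Longrightarrow> x \<le> y \<Longrightarrow> y \<le> 1 \<Longrightarrow> (\<lambda>y. 1 / g y) integrable_on {x..y}"
proof -
  assume "0 < x" "x \<le> y" "y \<le> 1"
  hence "continuous_on {x..y} (\<lambda>y. 1 / g y)"
    by (intro continuous_intros continuous_on_subset[OF g_cont])
       (auto simp: less_imp_neq[OF g_pos, symmetric])
  thus ?thesis by (rule integrable_continuous_real)
qed

lemma Phi_diff:
  assumes "0 < x" "x \<le> y" "y \<le> 1"
  shows "Phi x - Phi y = integral {x..y} (\<lambda>y. 1 / g y)"
  unfolding Phi_def
  using Henstock_Kurzweil_Integration.integral_combine[of x y 1 "\<lambda>y. 1 / g y"] inv_g_integrable[of x 1] assms by simp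

lemma Phi_diff_bounds:
  assumes "0 < x" "x \<le> y" "y \<le> 1"
  shows "(y - x) / g y \<le> Phi x - Phi y" "Phi x - Phi y \<le> (y - x) / g x"
proof -
  have "integral {x..y} (\<lambda>_. 1 / g y) \<le> integral {x..y} (\<lambda>z. 1 / g z)"
    by (intro integral_le inv_g_integrable) (use assms g_mono g_pos in \<open>auto intro!: divide_left_mono mult_pos_pos\<close>)
  thus "(y - x) / g y \<le> Phi x - Phi y" using assms by (simp add: Phi_diff)
  have "integral {x..y} (\<lambda>z. 1 / g z) \<le> integral {x..y} (\<lambda>_. 1 / g x)"
    by (intro integral_le inv_g_integrable) (use assms g_mono g_pos in \<open>auto intro!: divide_left_mono mult_pos_pos\<close>)
  thus "Phi x - Phi y \<le> (y - x) / g x" using assms by (simp add: Phi_diff)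
qed

lemma Phi_1 [simp]: "Phi 1 = 0" by (simp add: Phi_def)

lemma Phi_less: "0 < x \<Longrightarrow> x < y \<Longrightarrow> y \<le> 1 \<Longrightarrow> Phi y < Phi x"
  using Phi_diff_bounds(1)[of x y] g_pos[of y] by (smt (verit) divide_pos_pos)

lemma Phi_antimono: "0 < x \<Longrightarrow> x \<le> y \<Longrightarrow> y \<le> 1 \<Longrightarrow> Phi y \<le> Phi x"
  using Phi_less[of x y] by fastforce

lemma Phi_nonneg: "0 < x \<Longrightarrow> x \<le> 1 \<Longrightarrow> 0 \<le> Phi x"
  using Phi_antimono[of x 1] by simp

lemma Phi_deriv:
  assumes "0 < x" "x < 1"
  shows "(Phi has_real_derivative (- 1 / g x)) (at x)"
proof -
  define a where "a = x / 2"
  have a: "0 < a" "a < x" using assms by (auto simp: a_def)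
  have c: "continuous_on {a..1} (\<lambda>y. 1 / g y)"
    using a by (intro continuous_intros continuous_on_subset[OF g_cont])
       (auto simp: less_imp_neq[OF g_pos, symmetric])
  have "((\<lambda>u. integral {a..u} (\<lambda>y. 1 / g y)) has_real_derivative 1 / g x) (at x within {a..1})"
    by (rule integral_has_real_derivative[OF c]) (use a assms in auto)
  hence "((\<lambda>u. integral {a..u} (\<lambda>y. 1 / g y)) has_real_derivative 1 / g x) (at x)"
    using a assms by (simp add: at_within_Icc_at)
  hence "((\<lambda>u. Phi a - integral {a..u} (\<lambda>y. 1 / g y)) has_real_derivative 0 - 1 / g x) (at x)"
    by (intro derivative_intros)
  moreover have "eventually (\<lambda>u. Phi a - integral {a..u} (\<lambda>y. 1 / g y) = Phi u) (nhds x)"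
  proof -
    have "eventually (\<lambda>u. u \<in> {a<..<1}) (nhds x)" using a assms by (intro eventually_nhds_in_open) auto
    thus ?thesis
      proof eventually_elim
      case (elim u)
      thus ?case using Phi_diff[of a u] a by simp
    qed
  qed
  ultimately show ?thesis
    by (subst (asm) DERIV_cong_ev[OF refl _ refl]) auto
qed

text \<open>The interval from \<open>h x\<close> to \<open>x\<close> has length \<open>g x\<close>,
  and 1 / g is at least 1 / g x on it: every iteration raises \<open>Phi\<close> by at least
  1.\<close>

lemma Phi_h_lower: "0 < x \<Longrightarrow> x \<le> 1 \<Longrightarrow> Phi x + 1 \<le> Phi (h x)"
  using Phi_diff_bounds(1)[of "h x" x] h_pos[of x] h_range[of x] g_pos[of x]
  by (auto simp: g_def)

lemma Phi_h_upper: "0 < x \<Longrightarrow> x \<le> 1 \<Longrightarrow> Phi (h x) \<le> Phi x + g x / g (h x)"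
  using Phi_diff_bounds(2)[of "h x" x] h_pos[of x] h_range[of x] 
  by (auto simp: g_def)

lemma Phi_iter_lower: "0 < x \<Longrightarrow> x \<le> 1 \<Longrightarrow> Phi x + real n \<le> Phi ((h ^^ n) x)"
proof (induction n)
  case (Suc n)
  thus ?case using Phi_h_lower[of "(h ^^ n) x"] iter_pos[of x n] iter_range[of x n] by auto
qed auto

text \<open>The iterates of 1 already make \<open>Phi\<close> unbounded, one unit per generation,
  and \<open>Phi\<close> is decreasing; the integral near 0 need not be estimated.\<close>

lemma Phi_at_top: "filterlim Phi at_top (at_right 0)"
  unfolding filterlim_at_top
proof
  fix Z :: real
  define n where "n = nat \<lceil>Z\<rceil>"
  have n: "Z \<le> real n" unfolding n_def by linarith
  have "eventually (\<lambda>x. 0 < x \<and> x < (h ^^ n) 1) (at_right (0::real))"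
    using iter_pos[of 1 n] by (intro eventually_pos_less_at_right_0) auto
  thus "eventually (\<lambda>x. Z \<le> Phi x) (at_right 0)"
  proof eventually_elim
    case (elim x)
    thus ?case using Phi_iter_lower[of 1 n] Phi_antimono[of x "(h ^^ n) 1"] iter_range[of 1 n] n by auto
  qed
qed

text \<open>L'Hopital's rule in place of Karamata's theorem: the quotient of the derivatives is c
  g(x) / g(c x), and \<open>g_rv\<close> gives its limit c^(1 - (1 + \<alpha>)).\<close>

lemma Phi_rv:
  assumes "c > 0"
  shows "((\<lambda>x. Phi (c * x) / Phi x) \<longlongrightarrow> c powr (-\<alpha>)) (at_right 0)"
proof (rule lhopital_right_0_at_top[OF Phi_at_top])
  have ev: "eventually (\<lambda>x. 0 < x \<and> x < min 1 (1 / c)) (at_right (0::real))"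
    using assms by (intro eventually_pos_less_at_right_0) auto
  show "eventually (\<lambda>x. - 1 / g x \<noteq> 0) (at_right 0)"
    using ev by eventually_elim (use g_pos in \<open>auto simp: less_imp_neq[symmetric]\<close>)
  show "eventually (\<lambda>x. (Phi has_real_derivative - 1 / g x) (at x)) (at_right 0)"
    using ev by eventually_elim (rule Phi_deriv, auto)
  show "eventually (\<lambda>x. ((\<lambda>x. Phi (c * x)) has_real_derivative (- 1 / g (c * x)) * c) (at x)) (at_right 0)"
    using ev
  proof eventually_elim
    case (elim x)
    hence "(Phi has_real_derivative - 1 / g (c * x)) (at (c * x))"
      using assms by (intro Phi_deriv) (auto simp: field_simps)
    moreover have "((\<lambda>x. c * x) has_real_derivative c) (at x)" by (auto intro!: derivative_eq_intros)
    ultimately show ?case by (rule DERIV_chain2)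
  qed
  have "((\<lambda>x. c * inverse (g (c * x) / g x)) \<longlongrightarrow> c * inverse (c powr (1 + \<alpha>))) (at_right 0)"
    using assms by (intro tendsto_intros g_rv) auto
  also have "c * inverse (c powr (1 + \<alpha>)) = c powr (-\<alpha>)"
    using assms by (simp add: powr_add powr_minus field_simps)
  also have "(\<lambda>x. c * inverse (g (c * x) / g x)) = (\<lambda>x. (- 1 / g (c * x)) * c / (- 1 / g x))"
    by (auto simp: field_simps)
  finally show "((\<lambda>x. (- 1 / g (c * x)) * c / (- 1 / g x)) \<longlongrightarrow> c powr (-\<alpha>)) (at_right 0)" .
qed

text \<open>Near 0 the point h x is close to x, so g x / g (h x), which bounds one increment of
  \<open>Phi\<close>, is at most 1 + e. Iterates only decrease and therefore never leave the
  neighbourhood below \<open>x0\<close>.\<close>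

lemma Phi_iter_upper:
  assumes "e > 0"
  obtains x0 where "0 < x0" "x0 \<le> 1"
    "\<And>x n. 0 < x \<Longrightarrow> x < x0 \<Longrightarrow> Phi ((h ^^ n) x) \<le> Phi x + (1 + e) * real n"
proof -
  \<comment> \<open>\<open>d\<close> will be a lower bound for h x / x near 0; it is taken so close
    to 1 that the factor d^(1 + \<alpha>) lost by \<open>g\<close> costs at most 1 + e.\<close>
  have ev1: "\<exists>d. 0 < d \<and> d < 1 \<and> 1 < (1 + e) * (d powr (1 + \<alpha>))"
  proof -
    have "((\<lambda>d. (1 + e) * (d powr (1 + \<alpha>))) \<longlongrightarrow> (1 + e) * (1 powr (1 + \<alpha>))) (at_left 1)"
      by (intro tendsto_intros) auto
    hence "eventually (\<lambda>d. 1 < (1 + e) * (d powr (1 + \<alpha>))) (at_left 1)"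
      by (rule order_tendstoD) (use assms in auto)
    moreover have "eventually (\<lambda>d. 0 < d \<and> d < 1) (at_left (1::real))"
      by (auto simp: eventually_at_left_field intro!: exI[of _ 0])
    ultimately have "eventually (\<lambda>d. 0 < d \<and> d < 1 \<and> 1 < (1 + e) * (d powr (1 + \<alpha>))) (at_left 1)"
      by eventually_elim auto
    thus ?thesis by (metis (mono_tags, lifting) eventually_happens trivial_limit_at_left_real)
  qed
  then obtain d where d: "0 < d" "d < 1" "1 < (1 + e) * (d powr (1 + \<alpha>))" by blast
  have "d powr (1 + \<alpha>) > 1 / (1 + e)" using d(3) assms by (simp add: field_simps)
  hence "eventually (\<lambda>x. g (d * x) / g x > 1 / (1 + e)) (at_right 0)"
    using order_tendstoD(1)[OF g_rv[OF d(1)]] by blast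
  moreover have "eventually (\<lambda>x. h x / x > d) (at_right 0)"
    using order_tendstoD(1)[OF h_over_id] d by blast
  ultimately have "eventually (\<lambda>x. g (d * x) / g x > 1 / (1 + e) \<and> h x / x > d) (at_right 0)"
    by eventually_elim auto
  then obtain b where b: "b > 0" "\<And>x. 0 < x \<Longrightarrow> x < b \<Longrightarrow> g (d * x) / g x > 1 / (1 + e) \<and> h x / x > d"
    unfolding eventually_at_right_field by auto
  define x0 where "x0 = min b 1"
  have step: "Phi (h x) \<le> Phi x + (1 + e)" if x: "0 < x" "x < x0" for x
  proof -
    have x': "x < b" "x \<le> 1" using x by (auto simp: x0_def)
    have "d * x \<le> h x" using b(2)[OF x(1) x'(1)] x by (auto simp: field_simps)
    hence "g (d * x) \<le> g (h x)" using d x x' h_range[of x] by (intro g_mono) auto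
    moreover have "g x < (1 + e) * g (d * x)" using b(2)[OF x(1) x'(1)] g_pos[of x] x x' assms by (auto simp: field_simps)
    ultimately have "g x \<le> (1 + e) * g (h x)" using assms by (smt (verit) mult_left_mono)
    hence "g x / g (h x) \<le> 1 + e" using g_pos[of "h x"] h_pos[of x] h_range[of x] x x' by (auto simp: field_simps)
    thus ?thesis using Phi_h_upper[of x] x x' by auto
  qed
  have "Phi ((h ^^ n) x) \<le> Phi x + (1 + e) * real n" if x: "0 < x" "x < x0" for x n
  proof (induction n)
    case (Suc n)
    have "x \<le> 1" using x by (auto simp: x0_def)
    hence "Phi (h ((h ^^ n) x)) \<le> Phi ((h ^^ n) x) + (1 + e)"
      using iter_pos[of x n] iter_range[of x n] x by (intro step) auto
    thus ?case using Suc by (simp add: algebra_simps)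
  qed simp
  thus ?thesis using b that[of x0] by (auto simp: x0_def)
qed

text \<open>The survival probability P(Z_n > 0) of the process with one ancestor;
  \<open>path_extinct\<close> makes the identification.\<close>

definition Q :: "nat \<Rightarrow> real" where "Q n = (h ^^ n) 1"

lemma Q_pos: "0 < Q n" and Q_le_1: "Q n \<le> 1" and Q_antimono: "m \<le> n \<Longrightarrow> Q n \<le> Q m"
  using iter_pos[of 1 n] iter_range[of 1 n] iter_antimono[of 1 m n] by (auto simp: Q_def)

lemma Q_tendsto_0: "Q \<longlonglongrightarrow> 0"
proof (rule LIMSEQ_I)
  fix r :: real assume "0 < r"
  define x where "x = min r 1"
  define N where "N = nat \<lceil>Phi x\<rceil> + 1"
  have x: "0 < x" "x \<le> 1" using \<open>0 < r\<close> by (auto simp: x_def)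
  have "Q n < r" if "n \<ge> N" for n
  proof (rule ccontr)
    assume "\<not> Q n < r"
    hence "x \<le> Q n" by (auto simp: x_def)
    hence "Phi (Q n) \<le> Phi x" using Phi_antimono[of x "Q n"] x Q_le_1 by auto
    moreover have "real n \<le> Phi (Q n)" using Phi_iter_lower[of 1 n] by (simp add: Q_def)
    moreover have "Phi x < real n" using that Phi_nonneg[OF x] unfolding N_def by linarith
    ultimately show False by linarith
  qed
  thus "\<exists>N. \<forall>n\<ge>N. norm (Q n - 0) < r" using Q_pos by (auto intro!: exI[of _ N] simp: less_imp_le abs_of_pos)
qed

lemma Phi_Q_lower: "real n \<le> Phi (Q n)"
  using Phi_iter_lower[of 1 n] by (simp add: Q_def)

text \<open>Every generation adds at least 1 to \<open>Phi\<close>, and at most 1 + r/2 once the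
  iterates are below \<open>x0\<close>. What happened before is the constant Phi (Q n0), which
  disappears after division by n.\<close>

lemma Phi_Q_asymp: "(\<lambda>n. Phi (Q n) / real n) \<longlonglongrightarrow> 1"
proof (rule LIMSEQ_I)
  fix r :: real assume r: "0 < r"
  obtain x0 where x0: "0 < x0" "x0 \<le> 1"
    "\<And>x n. 0 < x \<Longrightarrow> x < x0 \<Longrightarrow> Phi ((h ^^ n) x) \<le> Phi x + (1 + r / 2) * real n"
    using Phi_iter_upper[of "r / 2"] r by auto
  have "eventually (\<lambda>n. Q n < x0) sequentially" using Q_tendsto_0 x0(1) by (rule order_tendstoD)
  then obtain n0 where n0: "Q n0 < x0" by (meson eventually_happens trivial_limit_sequentially)
  have "(\<lambda>n. Phi (Q n0) / real n) \<longlonglongrightarrow> 0" by (rule lim_const_over_n)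
  hence "eventually (\<lambda>n. Phi (Q n0) / real n < r / 2) sequentially" by (rule order_tendstoD) (use r in auto)
  moreover have "eventually (\<lambda>n. n \<ge> max 1 n0) sequentially" by (rule eventually_ge_at_top)
  ultimately have "eventually (\<lambda>n. norm (Phi (Q n) / real n - 1) < r) sequentially"
  proof eventually_elim
    case (elim n)
    have "Q n = (h ^^ (n - n0)) (Q n0)" unfolding Q_def using elim 
      by (metis (no_types, opaque_lifting) comp_apply funpow_add le_add_diff_inverse2 max.bounded_iff)
    hence "Phi (Q n) \<le> Phi (Q n0) + (1 + r / 2) * real (n - n0)" using x0(3)[OF Q_pos n0] by simp
    also have "\<dots> \<le> Phi (Q n0) + (1 + r / 2) * real n" using r by (intro add_left_mono mult_left_mono) auto
    finally have "Phi (Q n) / real n \<le> Phi (Q n0) / real n + (1 + r / 2)" using elim by (auto simp: field_simps)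
    moreover have "1 \<le> Phi (Q n) / real n" using Phi_Q_lower[of n] elim by (auto simp: field_simps)
    ultimately show ?case using elim(1) unfolding real_norm_def by linarith
  qed
  thus "\<exists>no. \<forall>n\<ge>no. norm (Phi (Q n) / real n - 1) < r" by (simp add: eventually_sequentially)
qed

end

text \<open>The Laplace exponent of the continuous-state process: the transform at l, started from
  x, is exp (- x psi). The case l <= 0 is separate because \<open>0 powr _\<close> is 0, so that the
  formula would return at l = 0 its value at l = infinity.\<close>

definition psi :: "real \<Rightarrow> real \<Rightarrow> real \<Rightarrow> real" where
  "psi \<alpha> t l = (if l \<le> 0 then 0 else (t + l powr (-\<alpha>)) powr (-1/\<alpha>))"

lemma eventually_ge_imp_bounded_below:
  fixes u :: "nat \<Rightarrow> real"
  assumes "eventually (\<lambda>n. c \<le> u n) sequentially" "c > 0" "\<And>n. 0 < u n"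
  obtains c' where "c' > 0" "\<And>n. c' \<le> u n"
proof -
  obtain N where N: "\<And>n. n \<ge> N \<Longrightarrow> c \<le> u n" using assms(1) by (auto simp: eventually_sequentially)
  define c' where "c' = Min (insert c (u ` {..<N}))"
  have "c' > 0" unfolding c'_def using assms by (subst Min_gr_iff) auto
  moreover have "c' \<le> u n" for n
  proof (cases "n < N")
    case True thus ?thesis unfolding c'_def by (intro Min_le) auto
  next
    case False
    have "c' \<le> c" unfolding c'_def by (intro Min_le) auto
    thus ?thesis using N[of n] False by auto
  qed
  ultimately show ?thesis using that by blast
qed

lemma filterlim_nat_eventually_pos:
  fixes J :: "'b \<Rightarrow> nat"
  assumes "filterlim J at_top F" shows "eventually (\<lambda>m. J m > 0) F"
  using assms eventually_gt_at_top[of "0::nat"] by (rule eventually_compose_filterlim[rotated])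

context critical_gw
begin

lemma at_right_0_seqD:
  assumes "(F \<longlongrightarrow> l) (at_right (0::real))" "x \<longlonglongrightarrow> 0" "\<And>m::nat. 0 < x m"
  shows "(\<lambda>m. F (x m)) \<longlonglongrightarrow> (l::real)"
proof -
  have "filterlim x (at_right 0) sequentially"
    using assms(2,3) by (auto simp: filterlim_at intro!: always_eventually less_imp_neq[symmetric])
  thus ?thesis by (rule filterlim_compose[OF assms(1)])
qed

lemma Phi_seq_pos:
  assumes "x \<longlonglongrightarrow> 0" "\<And>m::nat. 0 < x m"
  shows "eventually (\<lambda>m. Phi (x m) > 0) sequentially"
proof -
  have "eventually (\<lambda>m. x m < 1) sequentially" using assms(1) by (rule order_tendstoD) simp
  thus ?thesis by eventually_elim (use Phi_less[of _ 1] assms(2) in auto)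
qed

text \<open>\<open>Phi\<close> is decreasing and regularly varying of index -\<alpha>. If z m <= a *
  x m, then Phi (z m) / Phi (x m) is at least a quantity tending to a^(-\<alpha>), which exceeds c
  for a below c^(-1/\<alpha>); the other side is symmetric.\<close>

lemma Phi_inversion:
  assumes x: "x \<longlonglongrightarrow> 0" "\<And>m::nat. 0 < x m" and z: "eventually (\<lambda>m. 0 < z m \<and> z m \<le> 1) sequentially"
    and lim: "(\<lambda>m. Phi (z m) / Phi (x m)) \<longlonglongrightarrow> c" and c: "c > 0"
  shows "(\<lambda>m. z m / x m) \<longlonglongrightarrow> c powr (-1/\<alpha>)"
proof (rule order_tendstoI)
  have ax: "eventually (\<lambda>m. a * x m < 1) sequentially" for a
  proof -
    have "(\<lambda>m. a * x m) \<longlonglongrightarrow> a * 0" by (intro tendsto_intros x)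
    thus ?thesis by (rule order_tendstoD) simp
  qed
  fix a assume a: "a < c powr (-1/\<alpha>)"
  show "eventually (\<lambda>m. a < z m / x m) sequentially"
  proof (cases "a \<le> 0")
    case True
    show ?thesis using z
    proof eventually_elim
      case (elim m)
      thus ?case using True x(2)[of m] by (meson divide_pos_pos le_less_trans)
    qed
  next
    case False
    have "(c powr (-1/\<alpha>)) powr (-\<alpha>) < a powr (-\<alpha>)" using False a alpha by (intro powr_less_mono2_neg) auto
    hence "c < a powr (-\<alpha>)" using c alpha by (simp add: powr_powr)
    then obtain d where d: "c < d" "d < a powr (-\<alpha>)" using dense by blast
    have "eventually (\<lambda>m. Phi (z m) / Phi (x m) < d) sequentially" using lim d(1) by (rule order_tendstoD)
    moreover have "eventually (\<lambda>m. d < Phi (a * x m) / Phi (x m)) sequentially"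
      by (rule order_tendstoD(1)[OF at_right_0_seqD[OF Phi_rv x] d(2)]) (use False in auto)
    ultimately show ?thesis using z ax[of a] Phi_seq_pos[OF x]
    proof eventually_elim
      case (elim m)
      hence "Phi (z m) / Phi (x m) < Phi (a * x m) / Phi (x m)" by linarith
      hence "Phi (z m) < Phi (a * x m)" using elim by (simp add: divide_less_cancel)
      hence "a * x m < z m" using Phi_antimono[of "z m" "a * x m"] elim by force
      thus ?case using x(2)[of m] by (simp add: field_simps)
    qed
  qed
next
  have ax: "eventually (\<lambda>m. a * x m < 1) sequentially" for a
  proof -
    have "(\<lambda>m. a * x m) \<longlonglongrightarrow> a * 0" by (intro tendsto_intros x)
    thus ?thesis by (rule order_tendstoD) simp
  qed
  fix a assume a: "c powr (-1/\<alpha>) < a"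
  have a0: "a > 0" by (rule le_less_trans[OF powr_ge_zero a])
  have "a powr (-\<alpha>) < (c powr (-1/\<alpha>)) powr (-\<alpha>)" using a alpha c by (intro powr_less_mono2_neg) auto
  hence "a powr (-\<alpha>) < c" using c alpha by (simp add: powr_powr)
  then obtain d where d: "d < c" "a powr (-\<alpha>) < d" using dense by blast
  have "eventually (\<lambda>m. d < Phi (z m) / Phi (x m)) sequentially" using lim d(1) by (rule order_tendstoD)
  moreover have "eventually (\<lambda>m. Phi (a * x m) / Phi (x m) < d) sequentially"
    by (rule order_tendstoD(2)[OF at_right_0_seqD[OF Phi_rv[OF a0] x] d(2)])
  ultimately show "eventually (\<lambda>m. z m / x m < a) sequentially" using z ax[of a] Phi_seq_pos[OF x]
  proof eventually_elim
    case (elim m)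
    hence "Phi (a * x m) / Phi (x m) < Phi (z m) / Phi (x m)" by linarith
    hence "Phi (a * x m) < Phi (z m)" using elim by (simp add: divide_less_cancel)
    hence "z m < a * x m" using Phi_antimono[of "a * x m" "z m"] elim x(2)[of m] a0 by force
    thus ?case using x(2)[of m] by (simp add: field_simps)
  qed
qed

text \<open>Regular variation along a moving factor: \<open>lam m\<close> is eventually on the right
  side of a fixed y close to l, and monotonicity of \<open>Phi\<close> does the work of the uniform
  convergence theorem.\<close>

lemma Phi_rv_seq:
  assumes x: "x \<longlonglongrightarrow> 0" "\<And>m::nat. 0 < x m" and lam: "lam \<longlonglongrightarrow> l" "l > 0"
  shows "(\<lambda>m. Phi (x m * lam m) / Phi (x m)) \<longlonglongrightarrow> l powr (-\<alpha>)"
proof -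
  have ax: "eventually (\<lambda>m. a * x m < 1) sequentially" for a
  proof -
    have "(\<lambda>m. a * x m) \<longlonglongrightarrow> a * 0" by (intro tendsto_intros x)
    thus ?thesis by (rule order_tendstoD) simp
  qed
  have lx: "eventually (\<lambda>m. x m * lam m < 1) sequentially"
  proof -
    have "(\<lambda>m. x m * lam m) \<longlonglongrightarrow> 0 * l" by (intro tendsto_intros x lam)
    thus ?thesis by (rule order_tendstoD) simp
  qed
  have lp: "eventually (\<lambda>m. lam m > 0) sequentially" by (rule order_tendstoD(1)[OF lam])
  have cont: "((\<lambda>y. y powr (-\<alpha>)) \<longlongrightarrow> l powr (-\<alpha>)) F" if "((\<lambda>y. y) \<longlongrightarrow> l) F" for F
    by (rule tendsto_powr[OF that tendsto_const]) (use lam in auto)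
  show ?thesis
  proof (rule order_tendstoI)
    fix a assume a: "a < l powr (-\<alpha>)"
    have "eventually (\<lambda>y. a < y powr (-\<alpha>)) (at_right l)"
      by (rule order_tendstoD(1)[OF cont a]) auto
    moreover have "eventually (\<lambda>y. y > l) (at_right l)" by (rule eventually_at_right_less)
    ultimately have "eventually (\<lambda>y. a < y powr (-\<alpha>) \<and> y > l) (at_right l)" by eventually_elim auto
    then obtain y where y: "a < y powr (-\<alpha>)" "y > l" using eventually_happens by fastforce
    have "eventually (\<lambda>m. a < Phi (y * x m) / Phi (x m)) sequentially"
      by (rule order_tendstoD(1)[OF at_right_0_seqD[OF Phi_rv x] y(1)]) (use y lam in auto)
    moreover have "eventually (\<lambda>m. lam m < y) sequentially" using lam(1) y(2) by (rule order_tendstoD)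
    ultimately show "eventually (\<lambda>m. a < Phi (x m * lam m) / Phi (x m)) sequentially"
      using ax[of y] lp Phi_seq_pos[OF x]
    proof eventually_elim
      case (elim m)
      have "Phi (y * x m) \<le> Phi (x m * lam m)" using elim x(2)[of m] by (intro Phi_antimono) auto
      hence "Phi (y * x m) / Phi (x m) \<le> Phi (x m * lam m) / Phi (x m)" using elim by (intro divide_right_mono) auto
      thus ?case using elim by linarith
    qed
  next
    fix a assume a: "l powr (-\<alpha>) < a"
    have "eventually (\<lambda>y. y powr (-\<alpha>) < a) (at_left l)"
      by (rule order_tendstoD(2)[OF cont a]) auto
    moreover have "eventually (\<lambda>y. y < l \<and> 0 < y) (at_left l)"
      using lam(2) unfolding eventually_at_left_field by auto
    ultimately have "eventually (\<lambda>y. y powr (-\<alpha>) < a \<and> y < l \<and> 0 < y) (at_left l)" by eventually_elim auto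
    then obtain y where y: "y powr (-\<alpha>) < a" "y < l" "y > 0" using eventually_happens by fastforce
    have "eventually (\<lambda>m. Phi (y * x m) / Phi (x m) < a) sequentially"
      by (rule order_tendstoD(2)[OF at_right_0_seqD[OF Phi_rv x] y(1)]) (use y lam in auto)
    moreover have "eventually (\<lambda>m. y < lam m) sequentially" using lam(1) y(2) by (rule order_tendstoD)
    ultimately show "eventually (\<lambda>m. Phi (x m * lam m) / Phi (x m) < a) sequentially"
      using lx Phi_seq_pos[OF x]
    proof eventually_elim
      case (elim m)
      have "Phi (x m * lam m) \<le> Phi (y * x m)" using elim x(2)[of m] y by (intro Phi_antimono) auto
      hence "Phi (x m * lam m) / Phi (x m) \<le> Phi (y * x m) / Phi (x m)" using elim by (intro divide_right_mono) auto
      thus ?case using elim by linarith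
    qed
  qed
qed

lemma Q_seq_tendsto_0: "filterlim J at_top sequentially \<Longrightarrow> (\<lambda>m. Q (J m)) \<longlonglongrightarrow> 0"
  by (rule filterlim_compose[OF Q_tendsto_0])

lemma nat_over_Phi_Q:
  assumes J: "filterlim J at_top sequentially" and k: "(\<lambda>m. real (k m) / real (J m)) \<longlonglongrightarrow> t"
  shows "(\<lambda>m. real (k m) / Phi (Q (J m))) \<longlonglongrightarrow> t"
proof -
  have "(\<lambda>m. (real (k m) / real (J m)) / (Phi (Q (J m)) / real (J m))) \<longlonglongrightarrow> t / 1"
    by (intro tendsto_intros k filterlim_compose[OF Phi_Q_asymp J]) auto
  moreover have "eventually (\<lambda>m. J m > 0) sequentially" by (rule filterlim_nat_eventually_pos[OF J])
  hence "eventually (\<lambda>m. (real (k m) / real (J m)) / (Phi (Q (J m)) / real (J m)) = real (k m) / Phi (Q (J m))) sequentially"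
    by eventually_elim auto
  ultimately show ?thesis by (auto intro: Lim_transform_eventually)
qed

text \<open>In the coordinate \<open>Phi\<close> the k-fold iteration is a translation by k, up to a
  factor 1 + e. After division by Phi (Q (J m)), which is asymptotic to J m, the translation becomes
  t and the starting point contributes l^(-\<alpha>); \<open>Phi_inversion\<close> returns to the
  original coordinate.\<close>

lemma iter_scaling_pos:
  assumes J: "filterlim J at_top sequentially" and k: "(\<lambda>m. real (k m) / real (J m)) \<longlonglongrightarrow> t"
    and lam: "lam \<longlonglongrightarrow> l" "l > 0" and t: "0 \<le> t"
  shows "(\<lambda>m. (h ^^ k m) (Q (J m) * lam m) / Q (J m)) \<longlonglongrightarrow> (t + l powr (-\<alpha>)) powr (-1/\<alpha>)"
proof -
  define x where "x = (\<lambda>m. Q (J m))"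
  have x: "x \<longlonglongrightarrow> 0" "\<And>m. 0 < x m" using Q_seq_tendsto_0[OF J] Q_pos by (auto simp: x_def)
  define y where "y = (\<lambda>m. x m * lam m)"
  define z where "z = (\<lambda>m. (h ^^ k m) (y m))"
  have y0: "y \<longlonglongrightarrow> 0"
  proof -
    have "(\<lambda>m. x m * lam m) \<longlonglongrightarrow> 0 * l" by (intro tendsto_intros x lam)
    thus ?thesis by (simp add: y_def)
  qed
  have lp: "eventually (\<lambda>m. lam m > 0) sequentially" by (rule order_tendstoD(1)[OF lam])
  hence yp: "eventually (\<lambda>m. y m > 0) sequentially" by eventually_elim (use x in \<open>auto simp: y_def\<close>)
  have y1: "eventually (\<lambda>m. y m < 1) sequentially" using y0 by (rule order_tendstoD) simp
  define a where "a = (\<lambda>m. real (k m) / Phi (x m))"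
  define D where "D = (\<lambda>m. (Phi (z m) - Phi (y m)) / Phi (x m))"
  have a: "a \<longlonglongrightarrow> t" unfolding a_def x_def by (rule nat_over_Phi_Q[OF J k])
  have "(\<lambda>m. D m - a m) \<longlonglongrightarrow> 0"
  proof (rule LIMSEQ_I)
    fix r :: real assume r: "r > 0"
    \<comment> \<open>Eventually \<open>a m\<close> < t + 1, so the error e * a m stays below
      r.\<close>
    define e where "e = r / (t + 1)"
    have e: "e > 0" using r t by (auto simp: e_def)
    obtain x0 where x0: "0 < x0" "x0 \<le> 1"
      "\<And>x n. 0 < x \<Longrightarrow> x < x0 \<Longrightarrow> Phi ((h ^^ n) x) \<le> Phi x + (1 + e) * real n"
      using Phi_iter_upper[OF e] by blast
    have "eventually (\<lambda>m. a m < t + 1) sequentially" using a by (rule order_tendstoD) auto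
    moreover have "eventually (\<lambda>m. y m < x0) sequentially" using y0 x0(1) by (rule order_tendstoD)
    ultimately have "eventually (\<lambda>m. norm (D m - a m - 0) < r) sequentially" using Phi_seq_pos[OF x] yp
    proof eventually_elim
      case (elim m)
      have 1: "Phi (y m) + real (k m) \<le> Phi (z m)"
        using Phi_iter_lower[of "y m" "k m"] elim x0(2) by (auto simp: z_def)
      have 2: "Phi (z m) \<le> Phi (y m) + (1 + e) * real (k m)"
        using x0(3)[of "y m" "k m"] elim by (auto simp: z_def)
      have "D m - a m = (Phi (z m) - Phi (y m) - real (k m)) / Phi (x m)"
        by (simp add: D_def a_def diff_divide_distrib)
      moreover have "0 \<le> (Phi (z m) - Phi (y m) - real (k m)) / Phi (x m)" using 1 elim by auto
      moreover have "(Phi (z m) - Phi (y m) - real (k m)) / Phi (x m) \<le> e * real (k m) / Phi (x m)"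
        using 2 elim by (intro divide_right_mono) (auto simp: algebra_simps)
      moreover have "e * real (k m) / Phi (x m) = e * a m" by (simp add: a_def)
      moreover have "e * a m < e * (t + 1)" using e elim by (intro mult_strict_left_mono) auto
      moreover have "e * (t + 1) = r" using t by (simp add: e_def)
      ultimately show ?case unfolding real_norm_def by linarith
    qed
    thus "\<exists>no. \<forall>n\<ge>no. norm (D n - a n - 0) < r" by (simp add: eventually_sequentially)
  qed
  hence "(\<lambda>m. (D m - a m) + a m) \<longlonglongrightarrow> 0 + t" by (intro tendsto_intros a)
  hence "(\<lambda>m. D m + Phi (y m) / Phi (x m)) \<longlonglongrightarrow> t + l powr (-\<alpha>)"
    unfolding y_def by (intro tendsto_add Phi_rv_seq x lam) auto
  hence lim: "(\<lambda>m. Phi (z m) / Phi (x m)) \<longlonglongrightarrow> t + l powr (-\<alpha>)"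
    by (simp add: D_def add_divide_distrib[symmetric])
  have zz: "eventually (\<lambda>m. 0 < z m \<and> z m \<le> 1) sequentially"
    using yp y1
  proof eventually_elim
    case (elim m)
    thus ?case using iter_pos[of "y m" "k m"] iter_range[of "y m" "k m"] by (auto simp: z_def)
  qed
  have "t + l powr (-\<alpha>) > 0" using t lam by (intro add_nonneg_pos) auto
  from Phi_inversion[OF x zz lim this] show ?thesis by (simp add: x_def y_def z_def)
qed

text \<open>The case l = 0 is out of reach of the inversion; there it suffices that iterates of
  \<open>h\<close> do not exceed their argument, so the quotient lies between 0 and
  \<open>lam m\<close>.\<close>

lemma iter_scaling:
  assumes J: "filterlim J at_top sequentially" and k: "(\<lambda>m. real (k m) / real (J m)) \<longlonglongrightarrow> t"
    and lam: "lam \<longlonglongrightarrow> l" "\<And>m. 0 \<le> lam m" and t: "0 \<le> t"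
  shows "(\<lambda>m. (h ^^ k m) (Q (J m) * lam m) / Q (J m)) \<longlonglongrightarrow> psi \<alpha> t l"
proof (cases "l > 0")
  case True
  thus ?thesis using iter_scaling_pos[OF J k lam(1) True t] by (simp add: psi_def)
next
  case False
  have "l \<ge> 0" using lam by (meson LIMSEQ_le_const)
  with False have l: "l = 0" by simp
  have x: "(\<lambda>m. Q (J m)) \<longlonglongrightarrow> 0" by (rule Q_seq_tendsto_0[OF J])
  have "(\<lambda>m. Q (J m) * lam m) \<longlonglongrightarrow> 0 * l" by (intro tendsto_intros x lam)
  hence "eventually (\<lambda>m. Q (J m) * lam m < 1) sequentially" by (rule order_tendstoD) simp
  hence u1: "eventually (\<lambda>m. (h ^^ k m) (Q (J m) * lam m) / Q (J m) \<le> lam m) sequentially"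
  proof eventually_elim
    case (elim m)
    thus ?case using iter_range[of "Q (J m) * lam m" "k m"] Q_pos[of "J m"] lam(2)[of m] by (auto simp: field_simps)
  qed
  have u2: "eventually (\<lambda>m. 0 \<le> (h ^^ k m) (Q (J m) * lam m) / Q (J m)) sequentially"
    using \<open>eventually (\<lambda>m. Q (J m) * lam m < 1) sequentially\<close>
  proof eventually_elim
    case (elim m)
    thus ?case using iter_range[of "Q (J m) * lam m" "k m"] Q_pos[of "J m"] lam(2)[of m] by (auto simp: field_simps)
  qed
  have "(\<lambda>m. (h ^^ k m) (Q (J m) * lam m) / Q (J m)) \<longlonglongrightarrow> 0"
    by (rule tendsto_sandwich[OF u2 u1 tendsto_const lam(1)[unfolded l]])
  thus ?thesis using l by (simp add: psi_def)
qed

text \<open>t > 0 forces k m to infinity along with J m, so Phi (Q n) ~ n applies to both survival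
  probabilities and the quotient of the \<open>Phi\<close> values tends to t.\<close>

lemma Q_ratio:
  assumes J: "filterlim J at_top sequentially" and k: "(\<lambda>m. real (k m) / real (J m)) \<longlonglongrightarrow> t" and t: "0 < t"
  shows "(\<lambda>m. Q (k m) / Q (J m)) \<longlonglongrightarrow> t powr (-1/\<alpha>)"
proof -
  have rJ: "filterlim (\<lambda>m. real (J m)) at_top sequentially"
    using J by (rule filterlim_compose[OF filterlim_real_sequentially])
  have "filterlim (\<lambda>m. real (k m) / real (J m) * real (J m)) at_top sequentially"
    by (rule filterlim_tendsto_pos_mult_at_top[OF k t rJ])
  moreover have ev: "eventually (\<lambda>m. J m > 0) sequentially" by (rule filterlim_nat_eventually_pos[OF J])
  hence ev': "eventually (\<lambda>m. real (k m) / real (J m) * real (J m) = real (k m)) sequentially" by eventually_elim auto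
  ultimately have "filterlim (\<lambda>m. real (k m)) at_top sequentially" using filterlim_cong[OF refl refl ev'] by blast
  hence K: "filterlim k at_top sequentially" by (simp add: filterlim_sequentially_iff_filterlim_real)
  have lim: "(\<lambda>m. (Phi (Q (k m)) / real (k m)) * (real (k m) / Phi (Q (J m)))) \<longlonglongrightarrow> 1 * t"
    by (intro tendsto_mult nat_over_Phi_Q[OF J k] filterlim_compose[OF Phi_Q_asymp K])
  have "eventually (\<lambda>m. k m > 0) sequentially" by (rule filterlim_nat_eventually_pos[OF K])
  hence "eventually (\<lambda>m. (Phi (Q (k m)) / real (k m)) * (real (k m) / Phi (Q (J m))) = Phi (Q (k m)) / Phi (Q (J m))) sequentially"
    by eventually_elim auto
  with lim have "(\<lambda>m. Phi (Q (k m)) / Phi (Q (J m))) \<longlonglongrightarrow> t" by (auto intro: Lim_transform_eventually)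
  from Phi_inversion[OF Q_seq_tendsto_0[OF J] Q_pos _ this t] show ?thesis
    using Q_pos Q_le_1 by auto
qed

text \<open>Karamata's relation up to constants: the increment of \<open>Phi\<close> over a doubling
  interval is comparable both with x / g x, by monotonicity of \<open>g\<close>, and with Phi x, by
  regular variation.\<close>

lemma Phi_g_bounds:
  obtains C where "C > 0" "eventually (\<lambda>x. x / g x \<le> C * Phi x \<and> Phi x \<le> C * (x / g x)) (at_right 0)"
proof -
  \<comment> \<open>Strictly between 1 and 2^(-\<alpha>), the limit of Phi (2 x) / Phi x: a fixed
    share of Phi x is then gained between x and 2 x.\<close>
  define q where "q = (1 + 2 powr (-\<alpha>)) / 2"
  have q0: "2 powr (-\<alpha>) < (1::real)" using alpha by (simp add: powr_less_one)
  hence q: "2 powr (-\<alpha>) < q" "q < 1" by (auto simp: q_def)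
  define C where "C = max (1 / (1 - q)) (2 * (2 powr \<alpha> + 1))"
  have "eventually (\<lambda>x. Phi (2 * x) / Phi x < q) (at_right 0)"
    by (rule order_tendstoD(2)[OF Phi_rv q(1)]) simp
  moreover have "eventually (\<lambda>x. Phi ((1/2) * x) / Phi x < 2 powr \<alpha> + 1) (at_right 0)"
    by (rule order_tendstoD(2)[OF Phi_rv]) (auto simp: powr_minus powr_divide)
  moreover have "eventually (\<lambda>x. 0 < x \<and> x < 1 / 2) (at_right (0::real))"
    by (rule eventually_pos_less_at_right_0) simp
  ultimately have "eventually (\<lambda>x. x / g x \<le> C * Phi x \<and> Phi x \<le> C * (x / g x)) (at_right 0)"
  proof eventually_elim
    case (elim x)
    have px: "Phi x > 0" using Phi_less[of x 1] elim by auto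
    have gx: "g x > 0" using g_pos[of x] elim by auto
    have "Phi x - Phi (2 * x) \<le> x / g x" using Phi_diff_bounds(2)[of x "2 * x"] elim by auto
    moreover have "Phi (2 * x) \<le> q * Phi x" using elim px by (auto simp: field_simps)
    ultimately have "(1 - q) * Phi x \<le> x / g x" by (simp add: algebra_simps)
    hence "Phi x \<le> 1 / (1 - q) * (x / g x)" using pos_le_divide_eq[of "1 - q" "Phi x" "x / g x"] q by (simp add: mult.commute)
    also have "\<dots> \<le> C * (x / g x)" using gx elim by (intro mult_right_mono) (auto simp: C_def)
    finally have 1: "Phi x \<le> C * (x / g x)" .
    have "(x / 2) / g x \<le> Phi (x / 2) - Phi x" using Phi_diff_bounds(1)[of "x / 2" x] elim by auto
    also have "\<dots> \<le> (2 powr \<alpha> + 1) * Phi x" using elim px by (auto simp: field_simps)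
    finally have "x / g x \<le> 2 * (2 powr \<alpha> + 1) * Phi x" by (simp add: field_simps)
    also have "\<dots> \<le> C * Phi x" using px by (intro mult_right_mono) (auto simp: C_def)
    finally show ?case using 1 by simp
  qed
  moreover have "C > 0" unfolding C_def using q by (intro less_max_iff_disj[THEN iffD2]) auto
  ultimately show ?thesis using that by blast
qed

text \<open>The Tauberian bounds \<open>w_upper\<close> and \<open>w_lower\<close> show that x / g x
  is the size of \<open>w\<close> at 1 / x; with x = Q j the order j of w (1 / Q j) results.\<close>

lemma g_Q_bounds:
  obtains c C where "c > 0" "C > 0"
    "\<And>j. 1 \<le> j \<Longrightarrow> c * real j \<le> Q j / g (Q j) \<and> Q j / g (Q j) \<le> C * real j"
proof -
  obtain C where C: "C > 0" "eventually (\<lambda>x. x / g x \<le> C * Phi x \<and> Phi x \<le> C * (x / g x)) (at_right 0)"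
    using Phi_g_bounds by blast
  have "filterlim Q (at_right 0) sequentially" using Q_tendsto_0 Q_pos by (auto simp: filterlim_at intro!: always_eventually less_imp_neq[symmetric])
  hence e1: "eventually (\<lambda>j. Q j / g (Q j) \<le> C * Phi (Q j) \<and> Phi (Q j) \<le> C * (Q j / g (Q j))) sequentially"
    by (rule eventually_compose_filterlim[OF C(2)])
  have e2: "eventually (\<lambda>j. Phi (Q j) / real j < 2) sequentially" using Phi_Q_asymp by (rule order_tendstoD) simp
  \<comment> \<open>The index is shifted so that division by j = 0 does not occur. Lower bounds for
    \<open>u\<close> and for 1 / u then extend the eventual estimates to all j >= 1.\<close>
  define u where "u = (\<lambda>j. Q (Suc j) / g (Q (Suc j)) / real (Suc j))"
  have up: "u j > 0" for j using Q_pos Q_le_1 g_pos by (auto simp: u_def)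
  have "eventually (\<lambda>j. 1 / C \<le> u j \<and> u j \<le> 2 * C) sequentially"
  proof -
    have "eventually (\<lambda>j. 1 / C \<le> Q j / g (Q j) / real j \<and> Q j / g (Q j) / real j \<le> 2 * C) sequentially"
      using e1 e2 eventually_gt_at_top[of 0]
    proof eventually_elim
      case (elim j)
      define b where "b = Q j / g (Q j)"
      have "real j \<le> C * b" using elim Phi_Q_lower[of j] unfolding b_def by linarith
      hence 1: "1 / C \<le> Q j / g (Q j) / real j" using elim C(1) unfolding b_def[symmetric] by (simp add: field_simps)
      have "Phi (Q j) \<le> 2 * real j" using elim by (simp add: divide_less_eq)
      hence "C * Phi (Q j) \<le> C * (2 * real j)" using C(1) by (intro mult_left_mono) auto
      hence "b \<le> C * (2 * real j)" using elim unfolding b_def by linarith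
      thus ?case using 1 elim unfolding b_def[symmetric] by (simp add: field_simps)
    qed
    hence "eventually (\<lambda>j. 1 / C \<le> Q (Suc j) / g (Q (Suc j)) / real (Suc j) \<and> Q (Suc j) / g (Q (Suc j)) / real (Suc j) \<le> 2 * C) sequentially"
      by (rule eventually_compose_filterlim[OF _ filterlim_Suc])
    thus ?thesis by (simp only: u_def)
  qed
  hence ev: "eventually (\<lambda>j. 1 / C \<le> u j) sequentially" "eventually (\<lambda>j. 1 / (2 * C) \<le> 1 / u j) sequentially"
    using up C(1) by (auto elim!: eventually_mono simp: field_simps)
  obtain c where c: "c > 0" "\<And>j. c \<le> u j"
    using eventually_ge_imp_bounded_below[OF ev(1)] C(1) up by (metis divide_pos_pos zero_less_one)
  obtain c2 where c2: "c2 > 0" "\<And>j. c2 \<le> 1 / u j"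
    using eventually_ge_imp_bounded_below[OF ev(2)] C(1) up by (metis divide_pos_pos zero_less_one mult_pos_pos zero_less_numeral)
  have "c * real j \<le> Q j / g (Q j) \<and> Q j / g (Q j) \<le> (1 / c2) * real j" if "1 \<le> j" for j
  proof -
    have j: "Suc (j - 1) = j" using that by simp
    have "u (j - 1) \<le> 1 / c2" using c2(2)[of "j - 1"] c2(1) up[of "j - 1"] by (simp add: field_simps)
    moreover define b where "b = Q j / g (Q j)"
    ultimately have "b / real j \<le> 1 / c2" "c \<le> b / real j" using c(2)[of "j - 1"] unfolding u_def j by auto
    thus ?thesis using that unfolding b_def[symmetric] by (simp add: pos_divide_le_eq pos_le_divide_eq)
  qed
  thus ?thesis using that[of c "1 / c2"] c c2 by auto
qed

text \<open>For small c the limit psi \<alpha> 1 c exceeds (1 - e) c, so an exponential parameter of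
  order Q j loses at most the fraction e during j generations. Every Chernoff bound below rests on
  this.\<close>

lemma exp_iter_bound:
  assumes e: "0 < e" "e < 1"
  obtains K where "K > 0"
    "\<And>j. \<exists>\<theta>\<ge>Q j / K. \<theta> > 0 \<and> (\<forall>i\<le>j. (gf \<xi> ^^ i) (exp (- \<theta>)) \<le> exp (- \<theta> * (1 - e)))"
proof -
  have "((\<lambda>c. (1 + c powr \<alpha>) powr (-1/\<alpha>)) \<longlongrightarrow> (1 + 0 powr \<alpha>) powr (-1/\<alpha>)) (at_right 0)"
    using alpha by (intro tendsto_intros) (auto simp: eventually_at_right_less eventually_mono[OF eventually_at_right_less])
  hence "eventually (\<lambda>c. 1 - e < (1 + c powr \<alpha>) powr (-1/\<alpha>)) (at_right 0)"
    by (rule order_tendstoD) (use e alpha in auto)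
  moreover have "eventually (\<lambda>c. 0 < c \<and> c < 1) (at_right (0::real))" by (rule eventually_pos_less_at_right_0) simp
  ultimately have "eventually (\<lambda>c. 1 - e < (1 + c powr \<alpha>) powr (-1/\<alpha>) \<and> 0 < c) (at_right 0)" by eventually_elim auto
  then obtain c where c: "1 - e < (1 + c powr \<alpha>) powr (-1/\<alpha>)" "0 < c" using eventually_happens by fastforce
  have cc: "(1 - e) * c < (1 + c powr (-\<alpha>)) powr (-1/\<alpha>)"
  proof -
    have "1 + c powr (-\<alpha>) = c powr (-\<alpha>) * (1 + c powr \<alpha>)"
      using c by (simp add: algebra_simps powr_minus)
    hence "(1 + c powr (-\<alpha>)) powr (-1/\<alpha>) = c * (1 + c powr \<alpha>) powr (-1/\<alpha>)"
      using c alpha by (simp add: powr_mult powr_powr)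
    thus ?thesis using c by (simp add: mult.commute)
  qed
  define lam where "lam = (\<lambda>m. (1 - exp (- c * Q m)) / Q m)"
  have lam: "lam \<longlonglongrightarrow> c"
  proof -
    have "((\<lambda>x. (1 - exp (- c * x)) / x) \<longlongrightarrow> c) (at_right 0)"
    proof -
      have "((\<lambda>x. 1 - exp (- c * x)) has_real_derivative c) (at 0)"
        by (auto intro!: derivative_eq_intros)
      hence "((\<lambda>x. (1 - exp (- c * x)) / x) \<longlongrightarrow> c) (at 0)"
        by (simp add: has_field_derivative_iff)
      thus ?thesis by (rule tendsto_within_subset) auto
    qed
    thus ?thesis unfolding lam_def by (rule at_right_0_seqD[OF _ Q_tendsto_0 Q_pos])
  qed
  have "(\<lambda>m. (h ^^ m) (Q m * lam m) / Q m) \<longlonglongrightarrow> (1 + c powr (-\<alpha>)) powr (-1/\<alpha>)"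
  proof (rule iter_scaling_pos[OF filterlim_ident _ lam c(2)])
    show "(\<lambda>m. real m / real m) \<longlonglongrightarrow> 1"
      by (rule tendsto_eventually, rule eventually_mono[OF eventually_gt_at_top[of 0]]) auto
  qed simp
  hence "eventually (\<lambda>m. (1 - e) * c < (h ^^ m) (Q m * lam m) / Q m) sequentially"
    using cc by (rule order_tendstoD)
  then obtain j0 where j0: "\<And>m. m \<ge> j0 \<Longrightarrow> (1 - e) * c < (h ^^ m) (Q m * lam m) / Q m"
    by (auto simp: eventually_sequentially)
  \<comment> \<open>Small j use the parameter c * Q j0 of generation j0; this K gives \<theta> >= Q
    j / K in both ranges.\<close>
  define K where "K = 1 / (c * Q j0)"
  have K: "K > 0" using c Q_pos by (simp add: K_def)
  have main: "(gf \<xi> ^^ i) (exp (- (c * Q m))) \<le> exp (- (c * Q m) * (1 - e))" if "m \<ge> j0" "i \<le> m" for m i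
  proof -
    define x where "x = 1 - exp (- (c * Q m))"
    have x: "0 \<le> x" "x \<le> 1" using c Q_pos[of m] by (auto simp: x_def)
    have xe: "x = Q m * lam m" using Q_pos[of m] by (simp add: x_def lam_def)
    have "(1 - e) * (c * Q m) \<le> (h ^^ m) x" using j0[OF that(1)] Q_pos[of m] by (simp add: xe field_simps)
    also have "\<dots> \<le> (h ^^ i) x" using iter_antimono[OF x that(2)] .
    finally have "(gf \<xi> ^^ i) (1 - x) \<le> 1 - (1 - e) * (c * Q m)" using iter_gf[OF x, of i] by simp
    also have "\<dots> \<le> exp (- ((1 - e) * (c * Q m)))" using exp_ge_add_one_self[of "- ((1 - e) * (c * Q m))"] by simp
    finally show ?thesis by (simp add: x_def mult_ac)
  qed
  have "\<exists>\<theta>\<ge>Q j / K. \<theta> > 0 \<and> (\<forall>i\<le>j. (gf \<xi> ^^ i) (exp (- \<theta>)) \<le> exp (- \<theta> * (1 - e)))" for j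
  proof (intro exI conjI allI impI)
    define m where "m = max j j0"
    show "Q j / K \<le> c * Q m"
    proof (cases "j \<ge> j0")
      case True
      have "c * Q j * Q j0 \<le> c * Q j * 1" using Q_le_1 Q_pos[of j] c by (intro mult_left_mono) auto
      thus ?thesis using True by (simp add: K_def m_def max_def mult_ac)
    next
      case False
      have "Q j * (c * Q j0) \<le> 1 * (c * Q j0)" using Q_le_1 Q_pos[of j0] c by (intro mult_right_mono) auto
      thus ?thesis using False by (simp add: K_def m_def max_def mult_ac)
    qed
    show "0 < c * Q m" using c Q_pos by auto
    fix i assume "i \<le> j"
    thus "(gf \<xi> ^^ i) (exp (- (c * Q m))) \<le> exp (- (c * Q m) * (1 - e))" by (intro main) (auto simp: m_def)
  qed
  thus ?thesis using that K by blast
qed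

end

section \<open>First-step analysis of Galton-Watson paths\<close>

lemma integrable_pmf_nonneg_bounded:
  fixes F :: "'b \<Rightarrow> real"
  assumes "\<And>x. 0 \<le> F x" "\<And>x. F x \<le> B"
  shows "integrable (measure_pmf p) F"
  by (rule integrable_pmf_bounded[where B=B]) (use assms in \<open>auto simp: abs_of_nonneg\<close>)

lemma prob_of_bool: "pprob p {x. R x} = pexp p (\<lambda>x. of_bool (R x))"
proof -
  have "pprob p {x. R x} = pexp p (indicator {x. R x})" by simp
  also have "\<dots> = pexp p (\<lambda>x. of_bool (R x))"
    by (rule Bochner_Integration.integral_cong) (auto simp: indicator_def)
  finally show ?thesis .
qed

lemma prob_compl_of_bool: "pprob p {x. R x} = 1 - pprob p {x. \<not> R x}"
proof -
  have "pprob p (space (measure_pmf p) - {x. \<not> R x}) = 1 - pprob p {x. \<not> R x}"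
    by (rule measure_pmf.prob_compl) simp
  moreover have "space (measure_pmf p) - {x. \<not> R x} = {x. R x}" by auto
  ultimately show ?thesis by simp
qed

lemma expectation_pmf_range:
  fixes F :: "'b \<Rightarrow> real"
  assumes "\<And>x. 0 \<le> F x" "\<And>x. F x \<le> B"
  shows "0 \<le> pexp p F" "pexp p F \<le> B"
proof -
  show "0 \<le> pexp p F" by (rule Bochner_Integration.integral_nonneg) (use assms in auto)
  have "pexp p F \<le> pexp p (\<lambda>_. B)"
    by (intro integral_mono integrable_pmf_nonneg_bounded[OF assms]) (use assms in auto)
  thus "pexp p F \<le> B" by simp
qed

text \<open>The tower property is taken from nonnegative integrals, where it holds unconditionally;
  the bound B provides integrability for the return to real expectations.\<close>

lemma expectation_bind_pmf:
  fixes F :: "'b \<Rightarrow> real"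
  assumes "\<And>x. 0 \<le> F x" "\<And>x. F x \<le> B"
  shows "pexp (bind_pmf p f) F = pexp p (\<lambda>x. pexp (f x) F)"
proof -
  have nn: "ennreal (pexp q F) = (\<integral>\<^sup>+ x. ennreal (F x) \<partial>measure_pmf q)" for q
    by (rule nn_integral_eq_integral[symmetric] integrable_pmf_nonneg_bounded[OF assms])+ (use assms in auto)
  have "ennreal (pexp (bind_pmf p f) F)
      = (\<integral>\<^sup>+ x. ennreal (pexp (f x) F) \<partial>measure_pmf p)"
    unfolding nn nn_integral_bind_pmf ..
  also have "\<dots> = ennreal (pexp p (\<lambda>x. pexp (f x) F))"
    by (rule nn_integral_eq_integral, rule integrable_pmf_nonneg_bounded[where B=B])
       (auto intro: expectation_pmf_range[OF assms])
  finally show ?thesis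
    by (subst (asm) ennreal_inj) (auto intro!: Bochner_Integration.integral_nonneg expectation_pmf_range[OF assms])
qed

text \<open>The recursion splits off the first generation and starts from any size z, whereas
  \<open>gw_paths\<close> appends the last generation to a path with one ancestor: the inductions on
  the length of a path condition on the first step.\<close>

fun gw_from :: "nat pmf \<Rightarrow> nat \<Rightarrow> nat \<Rightarrow> nat list pmf" where
  "gw_from p z 0 = return_pmf [z]"
| "gw_from p z (Suc n) = bind_pmf (sum_iid p z) (\<lambda>y. map_pmf ((#) z) (gw_from p y n))"

lemma gw_from_length: "zs \<in> set_pmf (gw_from p z n) \<Longrightarrow> length zs = Suc n \<and> zs ! 0 = z"
  by (induction n arbitrary: z zs) auto

lemma gw_from_nonempty: "zs \<in> set_pmf (gw_from p z n) \<Longrightarrow> zs \<noteq> []"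
  using gw_from_length[of zs p z n] by auto

lemma gw_from_last: "zs \<in> set_pmf (gw_from p z n) \<Longrightarrow> last zs = zs ! n"
  using gw_from_length[of zs p z n] gw_from_nonempty[of zs p z n] by (simp add: last_conv_nth)

lemma gw_from_snoc:
  "gw_from p z (Suc n) = bind_pmf (gw_from p z n) (\<lambda>zs. map_pmf (\<lambda>y. zs @ [y]) (sum_iid p (last zs)))"
proof (induction n arbitrary: z)
  case 0
  show ?case by (simp add: bind_return_pmf map_pmf_def)
next
  case (Suc n)
  have "gw_from p z (Suc (Suc n)) = bind_pmf (sum_iid p z) (\<lambda>y. map_pmf ((#) z) 
      (bind_pmf (gw_from p y n) (\<lambda>zs. map_pmf (\<lambda>y. zs @ [y]) (sum_iid p (last zs)))))"
    by (subst gw_from.simps(2), subst Suc) (rule refl)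
  also have "\<dots> = bind_pmf (sum_iid p z) (\<lambda>y. bind_pmf (map_pmf ((#) z) (gw_from p y n))
      (\<lambda>zs. map_pmf (\<lambda>y. zs @ [y]) (sum_iid p (last zs))))"
    by (intro bind_pmf_cong refl)
       (auto simp: map_bind_pmf bind_map_pmf pmf.map_comp o_def dest: gw_from_nonempty intro!: bind_pmf_cong)
  also have "\<dots> = bind_pmf (gw_from p z (Suc n)) (\<lambda>zs. map_pmf (\<lambda>y. zs @ [y]) (sum_iid p (last zs)))"
    by (simp add: bind_assoc_pmf)
  finally show ?case .
qed

lemma gw_paths_eq: "gw_paths p n = gw_from p 1 n"
  by (induction n) (simp_all add: gw_from_snoc del: gw_from.simps(2))

text \<open>Consistency of the path laws. It permits a common horizon D * J, a multiple of the
  window length, in the limit theorem.\<close>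

lemma gw_from_take: "map_pmf (take (Suc n)) (gw_from p z (n + k)) = gw_from p z n"
proof (induction n arbitrary: z)
  case 0
  have "map_pmf (take (Suc 0)) (gw_from p z k) = map_pmf (\<lambda>_. [z]) (gw_from p z k)"
  proof (rule pmf.map_cong0)
    fix zs assume "zs \<in> set_pmf (gw_from p z k)"
    thus "take (Suc 0) zs = [z]" using gw_from_length[of zs p z k] by (cases zs) auto
  qed
  thus ?case by (simp add: map_pmf_const)
next
  case (Suc n)
  show ?case
    by (simp add: map_bind_pmf pmf.map_comp o_def Suc.IH[symmetric])
qed

lemma gw_from_0: "gw_from p 0 n = return_pmf (replicate (Suc n) 0)"
  by (induction n) (simp_all add: bind_return_pmf)

lemma gw_from_absorbing:
  "zs \<in> set_pmf (gw_from p z n) \<Longrightarrow> k \<le> l \<Longrightarrow> l \<le> n \<Longrightarrow> zs ! k = 0 \<Longrightarrow> zs ! l = 0"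
proof (induction n arbitrary: z zs k l)
  case (Suc n)
  then obtain y ys where y: "y \<in> set_pmf (sum_iid p z)" "ys \<in> set_pmf (gw_from p y n)" "zs = z # ys" by auto
  show ?case
  proof (cases k)
    case 0
    hence "zs \<in> set_pmf (gw_from p 0 (Suc n))" using Suc.prems y by auto
    hence "zs = replicate (Suc (Suc n)) 0" unfolding gw_from_0 by simp
    thus ?thesis using Suc.prems by (simp del: replicate_Suc)
  next
    case (Suc k')
    thus ?thesis using Suc.IH[OF y(2), of k' "l - 1"] Suc.prems y(3) by (auto simp: nth_Cons split: nat.splits)
  qed
qed auto

lemma gw_step:
  fixes F :: "nat list \<Rightarrow> real"
  assumes "\<And>x. 0 \<le> F x" "\<And>x. F x \<le> B"
  shows "pexp (gw_from p z (Suc n)) F =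
    pexp (sum_iid p z) (\<lambda>y. pexp (gw_from p y n) (\<lambda>ys. F (z # ys)))"
  unfolding gw_from.simps by (subst expectation_bind_pmf[OF assms]) simp_all

lemma sum_iid_step:
  fixes F :: "nat \<Rightarrow> real"
  assumes "\<And>x. 0 \<le> F x" "\<And>x. F x \<le> B"
  shows "pexp (sum_iid p (Suc k)) F =
    pexp p (\<lambda>a. pexp (sum_iid p k) (\<lambda>y. F (a + y)))"
  unfolding sum_iid.simps by (subst expectation_bind_pmf[OF assms]) simp_all

lemma power_le_1: "0 \<le> s \<Longrightarrow> s \<le> 1 \<Longrightarrow> 0 \<le> s ^ (n::nat) \<and> s ^ n \<le> (1::real)"
  by (simp add: power_le_one)

lemma sum_iid_gf:
  assumes "0 \<le> s" "s \<le> 1"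
  shows "pexp (sum_iid p k) (\<lambda>y. s ^ y) = gf p s ^ k"
proof (induction k)
  case (Suc k)
  have "pexp (sum_iid p (Suc k)) (\<lambda>y. s ^ y)
     = pexp p (\<lambda>a. pexp (sum_iid p k) (\<lambda>y. s ^ (a + y)))"
    by (rule sum_iid_step[where B=1]) (use power_le_1[OF assms] in auto)
  also have "\<dots> = pexp p (\<lambda>a. s ^ a * gf p s ^ k)"
    by (simp add: power_add Suc)
  also have "\<dots> = gf p s * gf p s ^ k"
    by (simp add: gf_def)
  finally show ?case by simp
qed simp

lemma gf_iter_range: "0 \<le> s \<Longrightarrow> s \<le> 1 \<Longrightarrow> (gf p ^^ n) s \<in> {0..1}"
  by (induction n) (use gf_range in auto)

lemma path_gf:
  assumes "0 \<le> s" "s \<le> 1" "l \<le> n"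
  shows "pexp (gw_from p z n) (\<lambda>zs. s ^ (zs ! l)) = ((gf p ^^ l) s) ^ z"
  using assms(3)
proof (induction l arbitrary: z n)
  case 0
  have "pexp (gw_from p z n) (\<lambda>zs. s ^ (zs ! 0)) = pexp (gw_from p z n) (\<lambda>zs. s ^ z)"
    by (rule integral_cong_AE) (auto simp: AE_measure_pmf_iff gw_from_length)
  thus ?case by simp
next
  case (Suc l)
  then obtain n' where n': "n = Suc n'" "l \<le> n'" by (cases n) auto
  have "pexp (gw_from p z n) (\<lambda>zs. s ^ (zs ! Suc l))
    = pexp (sum_iid p z) (\<lambda>y. pexp (gw_from p y n') (\<lambda>ys. s ^ (ys ! l)))"
    unfolding n' by (subst gw_step[where B=1]) (use power_le_1[OF assms(1,2)] in auto)
  also have "\<dots> = pexp (sum_iid p z) (\<lambda>y. ((gf p ^^ l) s) ^ y)"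
    by (simp add: Suc.IH n')
  also have "\<dots> = gf p ((gf p ^^ l) s) ^ z"
    by (rule sum_iid_gf) (use gf_iter_range[OF assms(1,2)] in auto)
  finally show ?case by simp
qed

lemma sum_iid_mean:
  assumes "(\<integral>\<^sup>+ x. of_nat x \<partial>measure_pmf p) = (1::ennreal)"
  shows "(\<integral>\<^sup>+ x. of_nat x \<partial>measure_pmf (sum_iid p k)) = (of_nat k :: ennreal)"
  by (induction k) (simp_all add: nn_integral_add assms add.commute)

text \<open>In \<open>ennreal\<close> the mean passes through \<open>bind_pmf\<close> with no
  integrability condition; integrability of the generation sizes is then a consequence.\<close>

lemma path_mean:
  assumes "(\<integral>\<^sup>+ x. of_nat x \<partial>measure_pmf p) = (1::ennreal)" "l \<le> n"
  shows "(\<integral>\<^sup>+ zs. of_nat (zs ! l) \<partial>measure_pmf (gw_from p z n)) = (of_nat z :: ennreal)"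
  using assms(2)
proof (induction l arbitrary: z n)
  case 0
  have "(\<integral>\<^sup>+ zs. of_nat (zs ! 0) \<partial>measure_pmf (gw_from p z n)) = (\<integral>\<^sup>+ zs. of_nat z \<partial>measure_pmf (gw_from p z n))"
    by (rule nn_integral_cong_AE) (auto simp: AE_measure_pmf_iff gw_from_length)
  thus ?case by simp
next
  case (Suc l)
  then obtain n' where n': "n = Suc n'" "l \<le> n'" by (cases n) auto
  show ?case by (simp add: n' Suc.IH sum_iid_mean[OF assms(1)])
qed

context critical_gw
begin

lemma nn_mean: "(\<integral>\<^sup>+ x. of_nat x \<partial>measure_pmf \<xi>) = (1::ennreal)"
proof -
  have "(\<integral>\<^sup>+ x. of_nat x \<partial>measure_pmf \<xi>) = (\<integral>\<^sup>+ x. ennreal (real x) \<partial>measure_pmf \<xi>)"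
    by (simp add: ennreal_of_nat_eq_real_of_nat)
  also have "\<dots> = ennreal (pexp \<xi> real)"
    by (rule nn_integral_eq_integral[OF integrable_xi]) auto
  finally show ?thesis using mean by simp
qed

lemma path_integrable: "l \<le> n \<Longrightarrow> integrable (measure_pmf (gw_from \<xi> z n)) (\<lambda>zs. real (zs ! l))"
  using path_mean[OF nn_mean, of l n z]
  by (intro integrableI_nonneg) (auto simp: ennreal_of_nat_eq_real_of_nat)

lemma path_expectation: "l \<le> n \<Longrightarrow> pexp (gw_from \<xi> z n) (\<lambda>zs. real (zs ! l)) = real z"
proof -
  assume l: "l \<le> n"
  have "ennreal (pexp (gw_from \<xi> z n) (\<lambda>zs. real (zs ! l))) = ennreal (real z)"
    using path_mean[OF nn_mean l, of z] nn_integral_eq_integral[OF path_integrable[OF l, of z]]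
    by (simp add: ennreal_of_nat_eq_real_of_nat)
  thus ?thesis by (subst (asm) ennreal_inj) auto
qed

lemma path_extinct: "l \<le> n \<Longrightarrow> pprob (gw_from \<xi> 1 n) {zs. zs ! l > 0} = Q l"
proof -
  assume l: "l \<le> n"
  have "pprob (gw_from \<xi> 1 n) {zs. zs ! l = 0} = pexp (gw_from \<xi> 1 n) (\<lambda>zs. 0 ^ (zs ! l))"
  proof -
    have "pprob (gw_from \<xi> 1 n) {zs. zs ! l = 0} = pexp (gw_from \<xi> 1 n) (indicator {zs. zs ! l = 0})"
      by simp
    also have "\<dots> = pexp (gw_from \<xi> 1 n) (\<lambda>zs. 0 ^ (zs ! l))"
      by (rule Bochner_Integration.integral_cong) (auto simp: indicator_def power_0_left)
    finally show ?thesis .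
  qed
  also have "\<dots> = 1 - Q l"
    using path_gf[of 0 l n \<xi> 1] l iter_gf[of 1 l] by (simp add: Q_def)
  finally have "pprob (gw_from \<xi> 1 n) {zs. zs ! l = 0} = 1 - Q l" .
  moreover have "pprob (gw_from \<xi> 1 n) {zs. zs ! l > 0} = 1 - pprob (gw_from \<xi> 1 n) {zs. zs ! l = 0}"
    by (subst measure_pmf.prob_compl[symmetric]) (auto intro!: arg_cong[where f="measure _"])
  ultimately show ?thesis by simp
qed

end

section \<open>Maxima and logarithmic bounds\<close>

lemma sum_lessThan_add:
  fixes F :: "nat \<Rightarrow> 'b::comm_monoid_add"
  shows "(\<Sum>k<a + n. F k) = (\<Sum>k<a. F k) + (\<Sum>k<n. F (a + k))"
  by (induction n) (simp_all add: ac_simps)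

context critical_gw
begin

definition tail :: "nat \<Rightarrow> real" where "tail k = pprob \<xi> {k<..}"

lemma tail_nonneg: "0 \<le> tail k" by (simp add: tail_def)

lemma tail_0: "1 - tail 0 = pmf \<xi> 0"
proof -
  have "tail 0 = pprob \<xi> (space (measure_pmf \<xi>) - {0})"
    unfolding tail_def by (intro arg_cong[where f="measure _"]) auto
  also have "\<dots> = 1 - pprob \<xi> {0}" by (rule measure_pmf.prob_compl) simp
  finally show ?thesis by (simp add: measure_pmf_single)
qed

lemma tail_Suc: "pmf \<xi> (Suc k) = tail k - tail (Suc k)"
proof -
  have "{k<..} = {Suc k} \<union> {Suc k<..}" by auto
  hence "tail k = pprob \<xi> {Suc k} + tail (Suc k)"
    unfolding tail_def by (simp only:) (rule measure_pmf.finite_measure_Union, auto)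
  thus ?thesis by (simp add: measure_pmf_single)
qed

lemma tail_sum_le: "(\<Sum>k<n. tail k) \<le> 1"
proof -
  have ii: "integrable (measure_pmf \<xi>) (indicator {k<..} :: nat \<Rightarrow> real)" for k
    by (rule integrable_pmf_bounded[where B=1]) (auto simp: indicator_def)
  have "(\<Sum>k<n. tail k) = (\<Sum>k<n. pexp \<xi> (indicator {k<..}))"
    by (simp add: tail_def)
  also have "\<dots> = pexp \<xi> (\<lambda>x. \<Sum>k<n. indicator {k<..} x)"
    by (subst Bochner_Integration.integral_sum) (simp_all add: ii)
  also have "\<dots> \<le> pexp \<xi> real"
  proof (rule integral_mono)
    show "integrable (measure_pmf \<xi>) (\<lambda>x. \<Sum>k<n. indicator {k<..} x :: real)"
      by (intro Bochner_Integration.integrable_sum ii)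
    show "(\<Sum>k<n. indicator {k<..} x :: real) \<le> real x" for x :: nat
    proof -
      have "(\<Sum>k<n. indicator {k<..} x :: real) = real (card ({..<n} \<inter> {..<x}))"
        by (simp add: indicator_def sum.If_cases of_bool_def Int_def)
      also have "card ({..<n} \<inter> {..<x}) \<le> card {..<x}" by (intro card_mono) auto
      finally show ?thesis by simp
    qed
  qed (rule integrable_xi)
  finally show ?thesis by (simp add: mean)
qed

text \<open>The coefficients of 1 / (f(s) - s), in renewal form.\<close>

function w :: "nat \<Rightarrow> real" where
  "w n = (1 + (\<Sum>k<n. tail (n - k) * w k)) / (1 - tail 0)"
  by auto
termination by (relation "Wellfounded.measure id") auto

declare w.simps [simp del]

lemma tail_0_less_1: "0 < 1 - tail 0" using pmf_0_pos tail_0 by simp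

text \<open>If T is the generating function of \<open>tail\<close>, then f(s) - s = (1 - s) (1 -
  T(s)). Comparing coefficients in W(s) (1 - T(s)) = 1 / (1 - s) gives the recursion.\<close>

lemma w_renewal: "(1 - tail 0) * w n = 1 + (\<Sum>k<n. tail (n - k) * w k)"
  using tail_0_less_1 by (subst w.simps) (simp add: field_simps)

lemma w_pos: "0 < w n"
proof (induction n rule: less_induct)
  case (less n)
  have "0 \<le> (\<Sum>k<n. tail (n - k) * w k)"
    by (intro sum_nonneg mult_nonneg_nonneg tail_nonneg) (use less in \<open>auto intro: less_imp_le\<close>)
  hence "0 < (1 - tail 0) * w n" unfolding w_renewal by linarith
  thus ?case using tail_0_less_1 by (simp add: zero_less_mult_iff)
qed

lemma w_Suc_mono: "w n \<le> w (Suc n)"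
proof (induction n rule: less_induct)
  case (less n)
  have "(1 - tail 0) * w n = 1 + (\<Sum>k<n. tail (n - k) * w k)" by (rule w_renewal)
  also have "(\<Sum>k<n. tail (n - k) * w k) \<le> (\<Sum>k<n. tail (n - k) * w (Suc k))"
    by (intro sum_mono mult_left_mono less tail_nonneg) auto
  also have "1 + (\<Sum>k<n. tail (n - k) * w (Suc k)) \<le> 1 + (tail (Suc n) * w 0 + (\<Sum>k<n. tail (n - k) * w (Suc k)))"
    using tail_nonneg[of "Suc n"] w_pos[of 0] by simp
  also have "\<dots> = (1 - tail 0) * w (Suc n)"
    unfolding w_renewal by (subst sum.lessThan_Suc_shift) simp
  finally show ?case using tail_0_less_1 by simp
qed

lemma w_mono: "m \<le> n \<Longrightarrow> w m \<le> w n"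
  by (rule lift_Suc_mono_le[of w]) (rule w_Suc_mono)

text \<open>Induction in the renewal equation: for w (a + n) the terms with index below a are
  bounded by w a, the others by w a + w k. The weights tail 1, tail 2, ... have sum at most 1 - tail
  0 because the offspring mean is 1.\<close>

lemma w_subadd: "w (a + n) \<le> w a + w n"
proof (induction n rule: less_induct)
  case (less n)
  let ?c = "1 - tail 0"
  have "?c * w (a + n) = 1 + (\<Sum>k<a + n. tail (a + n - k) * w k)" by (rule w_renewal)
  also have "(\<Sum>k<a + n. tail (a + n - k) * w k) = (\<Sum>k<a. tail (a + n - k) * w k) + (\<Sum>k<n. tail (n - k) * w (a + k))"
    by (subst sum_lessThan_add) (simp add: add.commute)
  also have "(\<Sum>k<a. tail (a + n - k) * w k) \<le> (\<Sum>k<a. tail (a + n - k) * w a)"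
    by (intro sum_mono mult_left_mono tail_nonneg w_mono) auto
  also have "(\<Sum>k<n. tail (n - k) * w (a + k)) \<le> (\<Sum>k<n. tail (n - k) * (w a + w k))"
    by (intro sum_mono mult_left_mono tail_nonneg less) auto
  also have "1 + ((\<Sum>k<a. tail (a + n - k) * w a) + (\<Sum>k<n. tail (n - k) * (w a + w k)))
     = w a * ((\<Sum>k<a. tail (a + n - k)) + (\<Sum>k<n. tail (n - k))) + ?c * w n"
    unfolding w_renewal by (simp add: algebra_simps sum.distrib sum_distrib_left)
  also have "(\<Sum>k<a. tail (a + n - k)) + (\<Sum>k<n. tail (n - k)) = (\<Sum>k<a + n. tail (a + n - k))"
    by (subst sum_lessThan_add) (simp add: add.commute)
  also have "(\<Sum>k<a + n. tail (a + n - k)) = (\<Sum>k<a + n. tail (Suc k))"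
    by (rule sum.reindex_bij_witness[where i="\<lambda>k. a + n - Suc k" and j="\<lambda>k. a + n - Suc k"]) (auto simp: Suc_diff_Suc)
  also have "(\<Sum>k<a + n. tail (Suc k)) \<le> ?c"
    using tail_sum_le[of "Suc (a + n)"] by (subst (asm) sum.lessThan_Suc_shift) simp
  finally have "?c * w (a + n) \<le> w a * ?c + ?c * w n" using w_pos[of a] by (simp add: mult_left_mono less_imp_le)
  hence "?c * w (a + n) \<le> ?c * (w a + w n)" by (simp add: algebra_simps)
  thus ?case using tail_0_less_1 by simp
qed

text \<open>Read n as the room left below a barrier: a step of size k - 1 changes the room n into n
  + 1 - k, so \<open>w\<close> is harmonic for the walk killed above the barrier. The identity is
  the difference of two consecutive renewal equations.\<close>

lemma w_harmonic: "(\<Sum>k\<le>Suc n. pmf \<xi> k * w (Suc n - k)) = w n"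
proof -
  have "(\<Sum>k\<le>Suc n. pmf \<xi> k * w (Suc n - k)) = pmf \<xi> 0 * w (Suc n) + (\<Sum>k<Suc n. pmf \<xi> (Suc k) * w (n - k))"
    by (subst sum.atMost_Suc_shift) (simp add: lessThan_Suc_atMost)
  also have "(\<Sum>k<Suc n. pmf \<xi> (Suc k) * w (n - k)) = (\<Sum>k<Suc n. pmf \<xi> (Suc (n - k)) * w k)"
    by (rule sum.reindex_bij_witness[where i="\<lambda>k. n - k" and j="\<lambda>k. n - k"]) auto
  also have "\<dots> = (\<Sum>k<Suc n. tail (n - k) * w k) - (\<Sum>k<Suc n. tail (Suc n - k) * w k)"
    unfolding sum_subtractf[symmetric]
    by (intro sum.cong refl) (simp add: tail_Suc Suc_diff_le algebra_simps)
  also have "pmf \<xi> 0 * w (Suc n) = 1 + (\<Sum>k<Suc n. tail (Suc n - k) * w k)"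
    using w_renewal[of "Suc n"] by (simp add: tail_0)
  also have "(\<Sum>k<Suc n. tail (n - k) * w k) = (1 - tail 0) * w n - 1 + tail 0 * w n"
    unfolding w_renewal by simp
  finally show ?thesis by (simp add: algebra_simps)
qed

lemma w_linear: "w n \<le> real (Suc n) * w 1"
proof (induction n)
  case 0 thus ?case using w_Suc_mono[of 0] by simp
next
  case (Suc n) thus ?case using w_subadd[of n 1] by (simp add: algebra_simps)
qed

lemma w_summable:
  assumes "0 \<le> s" "s < 1" shows "summable (\<lambda>n. w n * s ^ n)"
proof (rule summable_comparison_test')
  have "summable (\<lambda>n. real (Suc n) * s ^ n)"
    using geometric_deriv_sums[of s] assms by (auto simp: sums_iff)
  thus "summable (\<lambda>n. w 1 * (real (Suc n) * s ^ n))" by (rule summable_mult)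
  fix n :: nat assume "n \<ge> 0"
  show "norm (w n * s ^ n) \<le> w 1 * (real (Suc n) * s ^ n)"
    using mult_right_mono[OF w_linear[of n], of "s ^ n"] assms w_pos[of n] by (simp add: mult_ac)
qed

text \<open>In the Cauchy product of the series of f and of W, \<open>w_harmonic\<close> identifies
  the coefficients with those of s W(s), except for the constant one, which is 1.\<close>

lemma w_genfun:
  assumes "0 \<le> s" "s < 1" shows "(\<Sum>n. w n * s ^ n) * (gf \<xi> s - s) = 1"
proof -
  define W where "W = (\<Sum>n. w n * s ^ n)"
  have i: "integrable (measure_pmf \<xi>) (\<lambda>k. s ^ k)"
    using power_integrable_pmf[of s \<xi> "\<lambda>k. k"] assms by simp
  hence "integrable (count_space UNIV) (\<lambda>k. pmf \<xi> k * s ^ k)"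
    by (simp add: measure_pmf_eq_density integrable_density)
  hence sp: "summable (\<lambda>k. norm (pmf \<xi> k * s ^ k))"
    by (simp add: integrable_count_space_nat_iff)
  have sw: "summable (\<lambda>k. norm (w k * s ^ k))"
    using w_summable[OF assms] w_pos assms by (simp add: less_imp_le abs_of_nonneg)
  have c: "(\<lambda>k. \<Sum>i\<le>k. (pmf \<xi> i * s ^ i) * (w (k - i) * s ^ (k - i))) sums (gf \<xi> s * W)"
    using Cauchy_product_sums[OF sp sw] gf_eq_suminf[of s \<xi>] assms by (simp add: W_def)
  have c0: "(\<Sum>i\<le>0. (pmf \<xi> i * s ^ i) * (w (0 - i) * s ^ (0 - i))) = 1"
    using w_renewal[of 0] by (simp add: tail_0)
  have cS: "(\<Sum>i\<le>Suc k. (pmf \<xi> i * s ^ i) * (w (Suc k - i) * s ^ (Suc k - i))) = s * (w k * s ^ k)" for k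
  proof -
    have "(\<Sum>i\<le>Suc k. (pmf \<xi> i * s ^ i) * (w (Suc k - i) * s ^ (Suc k - i))) 
        = (\<Sum>i\<le>Suc k. s ^ Suc k * (pmf \<xi> i * w (Suc k - i)))"
    proof (rule sum.cong[OF refl])
      fix i assume "i \<in> {..Suc k}"
      hence "s ^ i * s ^ (Suc k - i) = s ^ Suc k" by (simp add: power_add[symmetric] del: power_Suc)
      thus "(pmf \<xi> i * s ^ i) * (w (Suc k - i) * s ^ (Suc k - i)) = s ^ Suc k * (pmf \<xi> i * w (Suc k - i))"
        by (metis mult.assoc mult.commute mult.left_commute)
    qed
    also have "\<dots> = s ^ Suc k * w k" unfolding sum_distrib_left[symmetric] w_harmonic ..
    finally show ?thesis by simp
  qed
  have "(\<lambda>k. s * (w k * s ^ k)) sums (s * W)"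
    unfolding W_def by (intro sums_mult summable_sums w_summable assms)
  hence "(\<lambda>k. \<Sum>i\<le>k. (pmf \<xi> i * s ^ i) * (w (k - i) * s ^ (k - i))) sums (s * W + 1)"
    using sums_Suc_iff[of "\<lambda>k. \<Sum>i\<le>k. (pmf \<xi> i * s ^ i) * (w (k - i) * s ^ (k - i))"] c0 unfolding cS by simp
  from sums_unique2[OF c this] show ?thesis by (simp add: W_def algebra_simps)
qed

lemma w_genfun_g:
  assumes "0 < x" "x \<le> 1" shows "(\<Sum>n. w n * (1 - x) ^ n) = 1 / g x"
  using w_genfun[of "1 - x"] g_pos[OF assms] assms by (simp add: g_def h_def field_simps)

text \<open>A Tauberian bound from monotonicity: the terms from n on dominate a geometric series
  with factor w n, and the whole series is 1 / g x. The exponential comes from 1 - x >= exp (- 2 x)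
  for x <= 1/2.\<close>

lemma w_upper:
  assumes "0 < x" "x \<le> 1 / 2" shows "w n \<le> x / g x * exp (2 * x * real n)"
proof -
  let ?s = "1 - x"
  have s: "0 \<le> ?s" "?s < 1" "0 < ?s" using assms by auto
  have sm: "summable (\<lambda>k. w (k + n) * ?s ^ (k + n))"
    using w_summable[OF s(1,2)] by (rule summable_ignore_initial_segment)
  have "w n * ?s ^ n * (1 / x) = (\<Sum>k. w n * ?s ^ n * ?s ^ k)"
    using s assms by (simp add: suminf_mult summable_geometric suminf_geometric)
  also have "\<dots> \<le> (\<Sum>k. w (k + n) * ?s ^ (k + n))"
  proof (rule suminf_le[OF _ _ sm])
    show "w n * ?s ^ n * ?s ^ k \<le> w (k + n) * ?s ^ (k + n)" for k
      using w_mono[of n "k + n"] s by (auto simp: power_add mult_ac intro!: mult_right_mono)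
    show "summable (\<lambda>k. w n * ?s ^ n * ?s ^ k)" using s by (intro summable_mult summable_geometric) auto
  qed
  also have "\<dots> \<le> (\<Sum>k. w k * ?s ^ k)"
    using suminf_split_initial_segment[OF w_summable[OF s(1,2)], of n] w_pos s
    by (simp add: sum_nonneg less_imp_le)
  also have "\<dots> = 1 / g x" using assms by (intro w_genfun_g) auto
  finally have 1: "w n * ?s ^ n \<le> x / g x" using assms by (simp add: field_simps)
  have "- (2 * x) \<le> - x - 2 * x\<^sup>2" using assms mult_left_mono[of x "1/2" x] by (simp add: power2_eq_square)
  also have "\<dots> \<le> ln ?s" using assms by (intro ln_one_minus_pos_lower_bound) auto
  finally have "exp (- (2 * x)) \<le> ?s" using s by (simp add: ln_ge_iff)
  hence "exp (- (2 * x)) ^ n \<le> ?s ^ n" by (intro power_mono) auto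
  hence 2: "exp (- (2 * x * real n)) \<le> ?s ^ n" by (simp add: exp_of_nat_mult[symmetric] mult_ac)
  have "w n * exp (- (2 * x * real n)) \<le> w n * ?s ^ n" using 2 w_pos[of n] by (intro mult_left_mono) auto
  hence "w n * exp (- (2 * x * real n)) \<le> x / g x" using 1 by linarith
  thus ?thesis by (simp add: exp_minus field_simps)
qed

lemma w_mult: "w (q * n + r) \<le> real q * w n + w r"
proof (induction q)
  case (Suc q) thus ?case using w_subadd[of n "q * n + r"] by (simp add: algebra_simps)
qed simp

text \<open>A Tauberian bound from subadditivity: w k is at most ((k + 1) / n + 1) w n, and
  summation against (1 - x)^k bounds 1 / g x by w n (1 / (n x^2) + 1 / x). The constant 3 is 2 + 1,
  since 1 / (n x) <= 2.\<close>

lemma w_lower: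
  assumes "0 < x" "x < 1" "1 / 2 \<le> real n * x" shows "x / g x \<le> 3 * w n"
proof -
  let ?s = "1 - x"
  have s: "0 \<le> ?s" "?s < 1" using assms by auto
  have n: "n \<ge> 1" using assms by (cases n) auto
  have wk: "w k \<le> (real (Suc k) / real n + 1) * w n" for k
  proof -
    have "w k \<le> real (k div n) * w n + w (k mod n)" using w_mult[of "k div n" n "k mod n"] by simp
    also have "\<dots> \<le> real (k div n) * w n + w n" using n by (intro add_left_mono w_mono) (simp add: less_imp_le)
    also have "\<dots> = (real (k div n) + 1) * w n" by (simp add: algebra_simps)
    also have "\<dots> \<le> (real (Suc k) / real n + 1) * w n"
    proof (intro mult_right_mono add_right_mono)
      have "real (k div n) \<le> real k / real n" by (rule of_nat_div_le_of_nat)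
      also have "\<dots> \<le> real (Suc k) / real n" by (intro divide_right_mono) auto
      finally show "real (k div n) \<le> real (Suc k) / real n" .
    qed (use w_pos in \<open>auto intro: less_imp_le\<close>)
    finally show ?thesis .
  qed
  have g1: "(\<lambda>k. real (Suc k) * ?s ^ k) sums (1 / x\<^sup>2)" using geometric_deriv_sums[of ?s] s by simp
  have g2: "(\<lambda>k. ?s ^ k) sums (1 / x)" using geometric_sums[of ?s] s by simp
  have g3: "(\<lambda>k. w n / real n * (real (Suc k) * ?s ^ k) + w n * ?s ^ k) sums (w n / real n * (1 / x\<^sup>2) + w n * (1 / x))"
    by (intro sums_add sums_mult g1 g2)
  have "1 / g x = (\<Sum>k. w k * ?s ^ k)" using assms by (subst w_genfun_g) auto
  also have "\<dots> \<le> w n / real n * (1 / x\<^sup>2) + w n * (1 / x)"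
  proof (rule suminf_le_const[OF w_summable[OF s], THEN order_trans[OF _ order_refl]])
    fix N
    have "(\<Sum>k<N. w k * ?s ^ k) \<le> (\<Sum>k<N. w n / real n * (real (Suc k) * ?s ^ k) + w n * ?s ^ k)"
    proof (rule sum_mono)
      fix k
      have "w k * ?s ^ k \<le> ((real (Suc k) / real n + 1) * w n) * ?s ^ k" using s by (intro mult_right_mono wk) auto
      thus "w k * ?s ^ k \<le> w n / real n * (real (Suc k) * ?s ^ k) + w n * ?s ^ k" by (simp add: algebra_simps add_divide_distrib)
    qed
    also have "\<dots> \<le> (\<Sum>k. w n / real n * (real (Suc k) * ?s ^ k) + w n * ?s ^ k)"
    proof (rule sum_le_suminf)
      have "0 \<le> w n" using w_pos[of n] by simp
      thus "0 \<le> w n / real n * (real (Suc k) * ?s ^ k) + w n * ?s ^ k" for k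
        using s by (intro add_nonneg_nonneg mult_nonneg_nonneg divide_nonneg_nonneg) auto
      show "summable (\<lambda>k. w n / real n * (real (Suc k) * ?s ^ k) + w n * ?s ^ k)"
        using g3 by (rule sums_summable)
    qed simp
    also have "\<dots> = w n / real n * (1 / x\<^sup>2) + w n * (1 / x)" using g3 by (simp add: sums_iff)
    finally show "(\<Sum>k<N. w k * ?s ^ k) \<le> w n / real n * (1 / x\<^sup>2) + w n * (1 / x)" .
  qed
  finally have "1 / g x * x \<le> (w n / real n * (1 / x\<^sup>2) + w n * (1 / x)) * x" using assms by (intro mult_right_mono) auto
  also have "\<dots> = w n * (1 / (real n * x)) + w n" using assms n by (simp add: field_simps power2_eq_square)
  also have "\<dots> \<le> w n * 2 + w n"
  proof -
    have "1 / (real n * x) \<le> 2" using assms n by (simp add: field_simps)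
    thus ?thesis using w_pos[of n] by (intro add_right_mono mult_left_mono) auto
  qed
  finally show ?thesis by simp
qed

lemma w_Q_upper:
  assumes "K > 0"
  obtains C where "C > 0" "\<And>j. 1 \<le> j \<Longrightarrow> w (nat \<lceil>K / Q j\<rceil>) \<le> C * real j"
proof -
  obtain c C where C: "c > 0" "C > 0" "\<And>j. 1 \<le> j \<Longrightarrow> c * real j \<le> Q j / g (Q j) \<and> Q j / g (Q j) \<le> C * real j"
    using g_Q_bounds by blast
  define C' where "C' = max (C * exp (2 * (K + 1))) (w (nat \<lceil>2 * K\<rceil>))"
  have "w (nat \<lceil>K / Q j\<rceil>) \<le> C' * real j" if j: "1 \<le> j" for j
  \<comment> \<open>\<open>w_upper\<close> is available for Q j <= 1/2; a larger Q j keeps the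
    argument of \<open>w\<close> below the fixed value 2 K, rounded up.\<close>
  proof (cases "Q j \<le> 1 / 2")
    case True
    have "real (nat \<lceil>K / Q j\<rceil>) \<le> K / Q j + 1" using assms Q_pos[of j] by (simp add: of_nat_nat less_imp_le)
    hence "Q j * real (nat \<lceil>K / Q j\<rceil>) \<le> Q j * (K / Q j + 1)" using Q_pos[of j] by (intro mult_left_mono) auto
    also have "\<dots> \<le> K + 1" using Q_pos[of j] Q_le_1[of j] by (simp add: algebra_simps)
    finally have e: "2 * Q j * real (nat \<lceil>K / Q j\<rceil>) \<le> 2 * (K + 1)" by simp
    have "w (nat \<lceil>K / Q j\<rceil>) \<le> Q j / g (Q j) * exp (2 * Q j * real (nat \<lceil>K / Q j\<rceil>))"
      by (rule w_upper[OF Q_pos True])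
    also have "\<dots> \<le> (C * real j) * exp (2 * (K + 1))"
      using C(2) C(3)[of j] j e by (intro mult_mono) auto
    also have "\<dots> = (C * exp (2 * (K + 1))) * real j" by (simp add: mult_ac)
    also have "\<dots> \<le> C' * real j" by (intro mult_right_mono) (simp_all only: C'_def max.cobounded1 of_nat_0_le_iff)
    finally show ?thesis .
  next
    case False
    have "K / Q j \<le> K / (1 / 2)" using False assms Q_pos[of j] by (intro divide_left_mono) auto
    hence "w (nat \<lceil>K / Q j\<rceil>) \<le> w (nat \<lceil>2 * K\<rceil>)" by (intro w_mono nat_mono ceiling_mono) (simp add: mult.commute)
    also have "\<dots> \<le> C' * 1" by (simp add: C'_def)
    also have "\<dots> \<le> C' * real j" using j w_pos[of "nat \<lceil>2 * K\<rceil>"] by (intro mult_left_mono) (auto simp: C'_def le_max_iff_disj)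
    finally show ?thesis .
  qed
  moreover have "C' > 0" using w_pos[of "nat \<lceil>2 * K\<rceil>"] by (auto simp: C'_def less_max_iff_disj)
  ultimately show ?thesis using that by blast
qed

lemma w_Q_lower:
  obtains c where "c > 0" "\<And>j. 1 \<le> j \<Longrightarrow> c * real j \<le> w (nat \<lfloor>1 / Q j\<rfloor>)"
proof -
  obtain c C where C: "c > 0" "C > 0" "\<And>j. 1 \<le> j \<Longrightarrow> c * real j \<le> Q j / g (Q j) \<and> Q j / g (Q j) \<le> C * real j"
    using g_Q_bounds by blast
  have "c / 3 * real j \<le> w (nat \<lfloor>1 / Q j\<rfloor>)" if j: "1 \<le> j" for j
  proof -
    have Q1: "Q j < 1"
    proof -
      have "Q j \<le> Q 1" using j by (rule Q_antimono)
      also have "Q 1 = 1 - pmf \<xi> 0" by (simp add: Q_def h_def gf_0)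
      finally show ?thesis using pmf_0_pos by simp
    qed
    define v where "v = 1 / Q j"
    have "1 \<le> v" using Q_pos[of j] Q1 by (simp add: v_def)
    moreover have "1 \<le> \<lfloor>v\<rfloor>" using \<open>1 \<le> v\<close> by simp
    ultimately have "v / 2 \<le> real (nat \<lfloor>v\<rfloor>)" by linarith
    hence "1 / Q j / 2 \<le> real (nat \<lfloor>1 / Q j\<rfloor>)" by (simp add: v_def)
    hence "1 / Q j / 2 * Q j \<le> real (nat \<lfloor>1 / Q j\<rfloor>) * Q j" using Q_pos[of j] by (intro mult_right_mono) auto
    hence "1 / 2 \<le> real (nat \<lfloor>1 / Q j\<rfloor>) * Q j" using Q_pos[of j] by simp
    hence "Q j / g (Q j) \<le> 3 * w (nat \<lfloor>1 / Q j\<rfloor>)" by (rule w_lower[OF Q_pos Q1])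
    thus ?thesis using C(3)[OF j] by linarith
  qed
  thus ?thesis using that[of "c / 3"] C by simp
qed

lemma w_at_top: "filterlim w at_top sequentially"
  unfolding filterlim_at_top
proof
  fix Z :: real
  obtain c where c: "c > 0" "\<And>j. 1 \<le> j \<Longrightarrow> c * real j \<le> w (nat \<lfloor>1 / Q j\<rfloor>)" using w_Q_lower by blast
  define j where "j = nat \<lceil>Z / c\<rceil> + 1"
  have "Z / c \<le> real j" unfolding j_def by linarith
  hence "Z \<le> c * real j" using c by (simp add: field_simps)
  also have "\<dots> \<le> w (nat \<lfloor>1 / Q j\<rfloor>)" by (rule c) (simp add: j_def)
  finally have Z: "Z \<le> w (nat \<lfloor>1 / Q j\<rfloor>)" .
  show "eventually (\<lambda>n. Z \<le> w n) sequentially"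
    using eventually_ge_at_top[of "nat \<lfloor>1 / Q j\<rfloor>"] by eventually_elim (use Z w_mono in \<open>meson order_trans\<close>)
qed

text \<open>By subadditivity the increments of \<open>w\<close> are at most w 1, while
  \<open>w\<close> itself tends to infinity.\<close>

lemma w_ratio_tendsto: "(\<lambda>n. 1 - w (n - 1) / w n) \<longlonglongrightarrow> 0"
proof (rule tendsto_sandwich[OF _ _ tendsto_const])
  show "eventually (\<lambda>n. 0 \<le> 1 - w (n - 1) / w n) sequentially"
    using w_mono[of "_ - 1"] w_pos by (intro always_eventually allI) (simp add: divide_le_eq_1)
  show "eventually (\<lambda>n. 1 - w (n - 1) / w n \<le> w 1 / w n) sequentially"
    using eventually_gt_at_top[of 0]
  proof eventually_elim
    case (elim n)
    have "w n \<le> w (n - 1) + w 1" using w_subadd[of "n - 1" 1] elim by simp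
    hence "(w n - w (n - 1)) / w n \<le> w 1 / w n" using w_pos[of n] by (intro divide_right_mono) auto
    thus ?case using w_pos[of n] by (simp add: diff_divide_distrib)
  qed
  show "(\<lambda>n. w 1 / w n) \<longlonglongrightarrow> 0"
    by (rule real_tendsto_divide_at_top[OF tendsto_const w_at_top])
qed

end

section \<open>Upper bounds: the harmonic function and the mean window maximum\<close>

context critical_gw
begin

text \<open>The function \<open>w\<close> of the room left below level N, extended by 0 above N: it
  is harmonic for the walk killed on exceeding N.\<close>

definition wrem :: "nat \<Rightarrow> nat \<Rightarrow> real" where
  "wrem N x = (if x \<le> N then w (N - x) else 0)"

lemma wrem_range: "0 \<le> wrem N x" "wrem N x \<le> w N"
  using w_pos[of "N - x"] w_pos[of N] w_mono[of "N - x" N] by (auto simp: wrem_def)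

lemma wrem_step_eq:
  assumes "Suc x \<le> N"
  shows "pexp \<xi> (\<lambda>a. wrem N (x + a)) = wrem N (Suc x)"
proof -
  define n where "n = N - Suc x"
  have n: "N - x = Suc n" using assms by (simp add: n_def)
  have "pexp \<xi> (\<lambda>a. wrem N (x + a)) = (\<Sum>a\<in>{..N - x}. wrem N (x + a) * pmf \<xi> a)"
    by (rule integral_measure_pmf_real) (use assms in \<open>auto simp: wrem_def split: if_splits\<close>)
  also have "\<dots> = (\<Sum>a\<le>Suc n. pmf \<xi> a * w (Suc n - a))"
  proof (unfold n, rule sum.cong[OF refl])
    fix a assume "a \<in> {..Suc n}"
    hence "x + a \<le> N" "N - (x + a) = Suc n - a" using n by auto
    thus "wrem N (x + a) * pmf \<xi> a = pmf \<xi> a * w (Suc n - a)" by (simp add: wrem_def)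
  qed
  also have "\<dots> = wrem N (Suc x)" unfolding w_harmonic using assms by (simp add: wrem_def n_def)
  finally show ?thesis .
qed

text \<open>Above N only an inequality is left: from N + 1 a childless individual brings the walk
  back to N. Such excursions inside one generation are invisible in the generation sizes.\<close>

lemma wrem_step: "wrem N (Suc x) \<le> pexp \<xi> (\<lambda>a. wrem N (x + a))"
proof (cases "Suc x \<le> N")
  case False
  hence "wrem N (Suc x) = 0" by (simp add: wrem_def)
  thus ?thesis by (simp add: wrem_range Bochner_Integration.integral_nonneg)
qed (simp add: wrem_step_eq)

text \<open>The parents reproduce one at a time: \<open>c\<close> counts the children already born,
  \<open>k\<close> the parents still waiting, and each reproduction is one step of the walk.\<close>

lemma wrem_sum_iid: "wrem N (c + k) \<le> pexp (sum_iid \<xi> k) (\<lambda>y. wrem N (c + y))"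
proof (induction k arbitrary: c)
  case (Suc k)
  have "wrem N (c + Suc k) \<le> pexp \<xi> (\<lambda>a. wrem N (c + k + a))" using wrem_step[of N "c + k"] by simp
  also have "\<dots> = pexp \<xi> (\<lambda>a. wrem N ((c + a) + k))" by (simp add: ac_simps)
  also have "\<dots> \<le> pexp \<xi> (\<lambda>a. pexp (sum_iid \<xi> k) (\<lambda>y. wrem N ((c + a) + y)))"
    by (intro integral_mono Suc integrable_pmf_nonneg_bounded[where B="w N"] wrem_range expectation_pmf_range[where B="w N"])
  also have "\<dots> = pexp (sum_iid \<xi> (Suc k)) (\<lambda>y. wrem N (c + y))"
    by (subst sum_iid_step[where B="w N"]) (simp_all add: wrem_range add.assoc)
  finally show ?case .
qed simp

text \<open>Along the generations \<open>wrem\<close> is a submartingale. It vanishes above N and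
  never exceeds w N, so its initial value is at most w N times the probability of staying at or
  below N.\<close>

lemma max_le_prob:
  "wrem N z \<le> w N * pexp (gw_from \<xi> z n) (\<lambda>zs. of_bool (\<forall>y\<in>set zs. y \<le> N))"
proof (induction n arbitrary: z)
  case 0 thus ?case using w_mono[of "N - z" N] by (simp add: wrem_def)
next
  case (Suc n)
  show ?case
  proof (cases "z \<le> N")
    case False
    have "0 \<le> w N * pexp (gw_from \<xi> z (Suc n)) (\<lambda>zs. of_bool (\<forall>y\<in>set zs. y \<le> N))"
      using w_pos[of N] by (intro mult_nonneg_nonneg Bochner_Integration.integral_nonneg) auto
    thus ?thesis using False by (simp add: wrem_def)
  next
    case True
    have "wrem N z \<le> pexp (sum_iid \<xi> z) (\<lambda>y. wrem N y)"
      using wrem_sum_iid[of N 0 z] by simp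
    also have "\<dots> \<le> pexp (sum_iid \<xi> z) (\<lambda>y. w N * pexp (gw_from \<xi> y n) (\<lambda>zs. of_bool (\<forall>y\<in>set zs. y \<le> N)))"
      using w_pos[of N]
      by (intro integral_mono Suc integrable_pmf_nonneg_bounded[where B="w N"] wrem_range
           mult_nonneg_nonneg mult_left_le expectation_pmf_range) auto
    also have "\<dots> = w N * pexp (gw_from \<xi> z (Suc n)) (\<lambda>zs. of_bool (\<forall>y\<in>set zs. y \<le> N))"
      by (subst gw_step[where B=1]) (use True in auto)
    finally show ?thesis .
  qed
qed

lemma max_tail_upper:
  assumes "1 \<le> t"
  shows "pprob (gw_from \<xi> 1 n) {zs. \<exists>y\<in>set zs. t < y} \<le> 1 - w (t - 1) / w t"
proof -
  have "pprob (gw_from \<xi> 1 n) {zs. \<exists>y\<in>set zs. t < y} = 1 - pprob (gw_from \<xi> 1 n) {zs. \<forall>y\<in>set zs. y \<le> t}"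
    by (subst prob_compl_of_bool) (simp add: not_less)
  also have "\<dots> \<le> 1 - w (t - 1) / w t"
    using max_le_prob[of t 1 n] assms w_pos[of t] unfolding prob_of_bool by (simp add: wrem_def field_simps)
  finally show ?thesis .
qed

lemma chernoff_path:
  assumes "\<theta> > 0" "l \<le> n" "(gf \<xi> ^^ l) (exp (- \<theta>)) \<le> exp (- \<theta> * (1 - e))"
  shows "pprob (gw_from \<xi> z n) {zs. real (zs ! l) \<le> a} \<le> exp (\<theta> * a - \<theta> * (1 - e) * real z)"
proof -
  have s: "0 \<le> exp (- \<theta>)" "exp (- \<theta>) \<le> 1" using assms by auto
  have "pprob (gw_from \<xi> z n) {zs. real (zs ! l) \<le> a}
     \<le> pexp (gw_from \<xi> z n) (\<lambda>zs. exp (\<theta> * a) * exp (- \<theta>) ^ (zs ! l))"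
    unfolding prob_of_bool
  proof (rule integral_mono)
    show "integrable (measure_pmf (gw_from \<xi> z n)) (\<lambda>zs. of_bool (real (zs ! l) \<le> a) :: real)"
      by (rule integrable_pmf_nonneg_bounded[where B=1]) auto
    show "integrable (measure_pmf (gw_from \<xi> z n)) (\<lambda>zs. exp (\<theta> * a) * exp (- \<theta>) ^ (zs ! l))"
      by (intro integrable_mult_right power_integrable_pmf s)
    fix zs :: "nat list"
    have "exp (\<theta> * a) * exp (- \<theta>) ^ (zs ! l) = exp (\<theta> * (a - real (zs ! l)))"
      by (simp add: exp_of_nat_mult[symmetric] exp_add[symmetric] algebra_simps)
    moreover have "real (zs ! l) \<le> a \<Longrightarrow> 1 \<le> exp (\<theta> * (a - real (zs ! l)))" using assms(1) by simp
    ultimately show "of_bool (real (zs ! l) \<le> a) \<le> exp (\<theta> * a) * exp (- \<theta>) ^ (zs ! l)" by auto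
  qed
  also have "\<dots> = exp (\<theta> * a) * ((gf \<xi> ^^ l) (exp (- \<theta>))) ^ z"
    using path_gf[OF s assms(2), where p=\<xi> and z=z] by simp
  also have "\<dots> \<le> exp (\<theta> * a) * (exp (- \<theta> * (1 - e))) ^ z"
    using gf_iter_range[OF s, where p=\<xi> and n=l] by (intro mult_left_mono power_mono assms) auto
  also have "\<dots> = exp (\<theta> * a - \<theta> * (1 - e) * real z)"
    by (simp add: exp_of_nat_mult[symmetric] exp_add[symmetric] algebra_simps)
  finally show ?thesis .
qed

text \<open>An Ottaviani-type inequality: a population above K / Q m is unlikely to halve within m generations.\<close>

lemma ottaviani:
  obtains K where "K > 0"
    "\<And>m n z y. n \<le> m \<Longrightarrow> K / Q m \<le> y \<Longrightarrow>
       pprob (gw_from \<xi> z n) {zs. \<exists>u\<in>set zs. y < real u} \<le> 2 * pprob (gw_from \<xi> z n) {zs. y < 2 * real (last zs)}"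
proof -
  obtain K0 where K0: "K0 > 0"
    "\<And>j. \<exists>\<theta>\<ge>Q j / K0. \<theta> > 0 \<and> (\<forall>i\<le>j. (gf \<xi> ^^ i) (exp (- \<theta>)) \<le> exp (- \<theta> * (1 - 1/4)))"
    using exp_iter_bound[of "1/4"] by auto
  \<comment> \<open>For z > y >= K / Q m this gives \<theta> z >= 4. The Chernoff exponent for
    falling to z / 2 is then \<theta> z (1/2 - 3/4) <= -1, and exp (-1) <= 1/2.\<close>
  define K where "K = 4 * K0"
  have "pprob (gw_from \<xi> z n) {zs. \<exists>u\<in>set zs. y < real u} \<le> 2 * pprob (gw_from \<xi> z n) {zs. y < 2 * real (last zs)}"
    if "n \<le> m" and y: "K / Q m \<le> y" for m n z y
  proof -
    obtain \<theta> where \<theta>: "\<theta> \<ge> Q m / K0" "\<theta> > 0" "\<And>i. i \<le> m \<Longrightarrow> (gf \<xi> ^^ i) (exp (- \<theta>)) \<le> exp (- \<theta> * (1 - 1/4))"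
      using K0(2)[of m] by blast
    have big: "1 \<le> 2 * pprob (gw_from \<xi> z n) {zs. y < 2 * real (last zs)}" if "y < real z" "n \<le> m" for z n
    proof -
      have "Q m / K0 * (K / Q m) \<le> \<theta> * real z" using \<theta> that y K0 Q_pos[of m]
        by (intro mult_mono) (auto simp: K_def less_imp_le)
      hence z4: "4 \<le> \<theta> * real z" using K0 Q_pos[of m] by (simp add: K_def)
      have "pprob (gw_from \<xi> z n) {zs. real (zs ! n) \<le> real z / 2} \<le> exp (\<theta> * (real z / 2) - \<theta> * (1 - 1/4) * real z)"
        by (rule chernoff_path[OF \<theta>(2) _ \<theta>(3)]) (use that in auto)
      also have "\<dots> \<le> exp (- 1)" using z4 by simp
      also have "exp (- 1) \<le> (1 / 2 :: real)"
        using exp_ge_add_one_self[of 1] by (simp add: exp_minus field_simps)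
      finally have 1: "pprob (gw_from \<xi> z n) {zs. real (zs ! n) \<le> real z / 2} \<le> 1 / 2" .
      have "1 - pprob (gw_from \<xi> z n) {zs. y < 2 * real (last zs)} = pprob (gw_from \<xi> z n) {zs. \<not> y < 2 * real (last zs)}"
        by (subst (2) prob_compl_of_bool) simp
      also have "\<dots> \<le> pprob (gw_from \<xi> z n) {zs. real (zs ! n) \<le> real z / 2}"
        by (rule measure_pmf.finite_measure_mono_AE) (use that in \<open>auto simp: AE_measure_pmf_iff gw_from_last\<close>)
      also note 1
      finally show ?thesis by simp
    qed
    \<comment> \<open>The induction runs up to the first generation above y; from there
      \<open>big\<close> says that the last generation exceeds y / 2 with probability at least
      1/2.\<close>
    show ?thesis using \<open>n \<le> m\<close>
    proof (induction n arbitrary: z)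
      case 0
      show ?case
      proof (cases "y < real z")
        case True thus ?thesis using big[OF True, of 0] by (simp add: measure_return_pmf indicator_def)
      next
        case False thus ?thesis by (simp add: measure_return_pmf indicator_def)
      qed
    next
      case (Suc n)
      show ?case
      proof (cases "y < real z")
        case True
        have "pprob (gw_from \<xi> z (Suc n)) {zs. \<exists>u\<in>set zs. y < real u} \<le> 1" by simp
        also have "1 \<le> 2 * pprob (gw_from \<xi> z (Suc n)) {zs. y < 2 * real (last zs)}"
          by (rule big[OF True Suc.prems])
        finally show ?thesis .
      next
        case False
        have "pprob (gw_from \<xi> z (Suc n)) {zs. \<exists>u\<in>set zs. y < real u}
          = pexp (sum_iid \<xi> z) (\<lambda>x. pexp (gw_from \<xi> x n) (\<lambda>ys. of_bool (\<exists>u\<in>set ys. y < real u)))"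
          unfolding prob_of_bool by (subst gw_step[where B=1]) (use False in auto)
        also have "\<dots> \<le> pexp (sum_iid \<xi> z) (\<lambda>x. 2 * pexp (gw_from \<xi> x n) (\<lambda>ys. of_bool (y < 2 * real (last ys))))"
        proof (rule integral_mono)
          show "integrable (measure_pmf (sum_iid \<xi> z)) (\<lambda>x. pexp (gw_from \<xi> x n) (\<lambda>ys. of_bool (\<exists>u\<in>set ys. y < real u)) :: real)"
            by (intro integrable_pmf_nonneg_bounded[where B=1] expectation_pmf_range) auto
          show "integrable (measure_pmf (sum_iid \<xi> z)) (\<lambda>x. 2 * pexp (gw_from \<xi> x n) (\<lambda>ys. of_bool (y < 2 * real (last ys))) :: real)"
            by (intro integrable_mult_right integrable_pmf_nonneg_bounded[where B=1] expectation_pmf_range) auto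
          fix x
          have "n \<le> m" using Suc.prems by simp
          from Suc.IH[OF this, of x]
          show "(pexp (gw_from \<xi> x n) (\<lambda>ys. of_bool (\<exists>u\<in>set ys. y < real u)) :: real) \<le> 2 * pexp (gw_from \<xi> x n) (\<lambda>ys. of_bool (y < 2 * real (last ys)))"
            unfolding prob_of_bool .
        qed
        also have "\<dots> = 2 * pexp (gw_from \<xi> z (Suc n)) (\<lambda>zs. of_bool (y < 2 * real (last zs)))"
        proof -
          have "pexp (gw_from \<xi> x n) (\<lambda>ys. of_bool (y < 2 * real (last (z # ys))))
             = (pexp (gw_from \<xi> x n) (\<lambda>ys. of_bool (y < 2 * real (last ys))) :: real)" for x
            by (rule integral_cong_AE) (auto simp: AE_measure_pmf_iff dest: gw_from_nonempty)
          thus ?thesis by (subst gw_step[where B=1]) auto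
        qed
        finally show ?thesis unfolding prob_of_bool .
      qed
    qed
  qed
  thus ?thesis using that[of K] K0 by (auto simp: K_def)
qed

text \<open>1 - a <= - ln a for each quotient a of consecutive values of \<open>w\<close>, and the
  logarithms telescope.\<close>

lemma sum_ratio_upper:
  assumes "1 \<le> y" "y \<le> x"
  shows "(\<Sum>t\<in>{y..<x}. 1 - w (t - 1) / w t) \<le> ln (w (x - 1) / w (y - 1))"
  using assms(2)
proof (induction rule: dec_induct)
  case (step x)
  have "1 - w (x - 1) / w x \<le> - ln (w (x - 1) / w x)"
    using ln_le_minus_one[of "w (x - 1) / w x"] w_pos by simp
  also have "\<dots> = ln (w x) - ln (w (x - 1))" using w_pos[of x] w_pos[of "x - 1"] by (simp add: ln_div)
  finally have "1 - w (x - 1) / w x \<le> ln (w x) - ln (w (x - 1))" .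
  moreover have "ln (w (x - 1) / w (y - 1)) + (ln (w x) - ln (w (x - 1))) = ln (w (Suc x - 1) / w (y - 1))"
    using w_pos[of x] w_pos[of "x - 1"] w_pos[of "y - 1"] by (simp add: ln_div)
  ultimately show ?case using step by simp
qed (use w_pos in \<open>simp add: less_imp_neq[symmetric]\<close>)

text \<open>Generations before j are charged to the first window, whose mean is exactly j. What
  remains is the maximum from generation j on, and this is 0 unless Z_j > 0.\<close>

lemma M_max_le:
  assumes "1 \<le> j" "j \<le> m" "length zs = Suc m"
  shows "M_max zs m j \<le> (\<Sum>l<j. zs ! l) + j * Max (set (drop j zs))"
  unfolding M_max_def
proof (rule Max.boundedI)
  fix a assume "a \<in> (\<lambda>k. S_win zs k j) ` {0..m - j}"
  then obtain k where k: "k \<le> m - j" "a = S_win zs k j" by auto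
  let ?X = "Max (set (drop j zs))"
  have X: "zs ! l \<le> ?X" if "j \<le> l" "l \<le> m" for l
  proof (rule Max_ge)
    have "drop j zs ! (l - j) \<in> set (drop j zs)" using that assms by (intro nth_mem) auto
    thus "zs ! l \<in> set (drop j zs)" using that assms by simp
  qed simp
  have "a = (\<Sum>l\<in>{k..<k+j} \<inter> {..<j}. zs ! l) + (\<Sum>l\<in>{k..<k+j} - {..<j}. zs ! l)"
    unfolding k(2) S_win_def by (rule sum.Int_Diff) simp
  also have "(\<Sum>l\<in>{k..<k+j} \<inter> {..<j}. zs ! l) \<le> (\<Sum>l<j. zs ! l)"
    by (rule sum_mono2) auto
  also have "(\<Sum>l\<in>{k..<k+j} - {..<j}. zs ! l) \<le> of_nat (card ({k..<k+j} - {..<j})) * ?X"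
    using k assms by (intro sum_bounded_above X) auto
  also have "\<dots> \<le> j * ?X"
  proof -
    have "card ({k..<k+j} - {..<j}) \<le> card {k..<k+j}" by (intro card_mono) auto
    thus ?thesis by simp
  qed
  finally show "a \<le> (\<Sum>l<j. zs ! l) + j * ?X" by simp
qed auto

text \<open>The tails of the maximum after generation j are summed over three ranges of levels. Up
  to about 1 / Q j they are at most P(Z_j > 0) = Q j; in the middle the harmonic bound produces the
  logarithm; above K / Q m the maximal inequality reduces them to tails of 2 Z_m, whose mean is
  2.\<close>

lemma EM_upper:
  obtains C where "\<And>m j. 1 \<le> j \<Longrightarrow> j \<le> m \<Longrightarrow> EM \<xi> m j \<le> real j * (ln (real m / real j) + C)"
    "\<And>m j. 1 \<le> j \<Longrightarrow> j \<le> m \<Longrightarrow> integrable (measure_pmf (gw_from \<xi> 1 m)) (\<lambda>zs. real (M_max zs m j))"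
proof -
  obtain K where K: "K > 0" "\<And>m n z y. n \<le> m \<Longrightarrow> K / Q m \<le> y \<Longrightarrow>
       pprob (gw_from \<xi> z n) {zs. \<exists>u\<in>set zs. y < real u} \<le> 2 * pprob (gw_from \<xi> z n) {zs. y < 2 * real (last zs)}"
    using ottaviani by blast
  obtain Cu where Cu: "Cu > 0" "\<And>j. 1 \<le> j \<Longrightarrow> w (nat \<lceil>K / Q j\<rceil>) \<le> Cu * real j" using w_Q_upper[OF K(1)] by blast
  obtain cl where cl: "cl > 0" "\<And>j. 1 \<le> j \<Longrightarrow> cl * real j \<le> w (nat \<lfloor>1 / Q j\<rfloor>)" using w_Q_lower by blast
  let ?r = "\<lambda>t. 1 - w (t - 1) / w t"
  define D where "D = max 1 (Cu / cl)"
  \<comment> \<open>7 = 2 + 4 + 1: the levels below \<open>y\<close>, the levels above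
    \<open>x\<close>, and the first window. \<open>ln D\<close> pays for the constants in w (x - 1)
    / w (y - 1).\<close>
  define C where "C = 7 + ln D"
  have main: "(\<integral>\<^sup>+ zs. ennreal (real (M_max zs m j)) \<partial>measure_pmf (gw_from \<xi> 1 m)) \<le> ennreal (real j * (ln (real m / real j) + C))"
    and pos: "0 \<le> real j * (ln (real m / real j) + C)"
    if j: "1 \<le> j" "j \<le> m" for m j
  proof -
    let ?p = "gw_from \<xi> 1 m"
    define X where "X = (\<lambda>zs :: nat list. Max (set (drop j zs)))"
    define y where "y = nat \<lfloor>1 / Q j\<rfloor> + 1"
    \<comment> \<open>If K / Q m does not reach beyond \<open>y\<close>, then x = y and the middle
      range is empty.\<close>
    define x where "x = max y (nat \<lceil>K / Q m\<rceil>)"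
    define S where "S = (\<Sum>t\<in>{y..<x}. ?r t)"
    have Xgt: "\<exists>l\<ge>j. l \<le> m \<and> t < zs ! l" if "zs \<in> set_pmf ?p" "t < X zs" for zs t
    proof -
      have len: "length zs = Suc m" using gw_from_length that by blast
      have "X zs \<in> set (drop j zs)" unfolding X_def using len j by (intro Max_in) auto
      then obtain i where "i < length (drop j zs)" "drop j zs ! i = X zs" by (auto simp: in_set_conv_nth)
      thus ?thesis using len that by (intro exI[of _ "j + i"]) auto
    qed
    have tail: "emeasure ?p {zs. t < X zs} \<le> emeasure ?p {zs. R zs}"
      if R: "\<And>zs l. zs \<in> set_pmf ?p \<Longrightarrow> j \<le> l \<Longrightarrow> l \<le> m \<Longrightarrow> t < zs ! l \<Longrightarrow> R zs" for t R
      by (rule emeasure_mono_AE) (use Xgt R in \<open>auto simp: AE_measure_pmf_iff\<close>)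
    have mem: "zs ! l \<in> set zs" if "zs \<in> set_pmf ?p" "l \<le> m" for zs l
      using gw_from_length[OF that(1)] that(2) by (intro nth_mem) simp
    have D0: "D \<ge> 1" by (simp add: D_def)
    have mj: "0 \<le> ln (real m / real j)" using j by simp
    show pos: "0 \<le> real j * (ln (real m / real j) + C)" using mj D0 by (simp add: C_def)
    have t0: "0 \<le> ?r t" for t
      using w_mono[of "t - 1" t] w_pos[of t] by simp
    have bound: "emeasure ?p {zs. t < X zs} \<le> ennreal (Q j * indicator {..<y} t) + ennreal ((?r t) * indicator {y..<x} t)
        + 2 * emeasure ?p {zs. t < 2 * zs ! m}" for t
    proof -
      consider "t < y" | "y \<le> t" "t < x" | "x \<le> t" by linarith
      thus ?thesis
      proof cases
        case 1
        have "emeasure ?p {zs. t < X zs} \<le> emeasure ?p {zs. zs ! j > 0}"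
          by (rule tail) (use gw_from_absorbing in fastforce)
        also have "\<dots> = ennreal (Q j * indicator {..<y} t)"
          using path_extinct[OF j(2)] 1 by (simp add: measure_pmf.emeasure_eq_measure)
        also have "\<dots> \<le> ennreal (Q j * indicator {..<y} t) + (ennreal ((?r t) * indicator {y..<x} t)
        + 2 * emeasure ?p {zs. t < 2 * zs ! m})" by (rule add_increasing2[OF zero_le order_refl])
        finally show ?thesis by (simp add: add.assoc)
      next
        case 2
        have t1: "1 \<le> t" using 2 by (auto simp: y_def)
        have "emeasure ?p {zs. t < X zs} \<le> emeasure ?p {zs. \<exists>u\<in>set zs. t < u}"
          by (rule tail) (use mem in blast)
        also have "\<dots> \<le> ennreal (?r t)"
          unfolding measure_pmf.emeasure_eq_measure using max_tail_upper[OF t1, of m] by (intro ennreal_leI) simp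
        also have "\<dots> = ennreal ((?r t) * indicator {y..<x} t)" using 2 by simp
        also have "\<dots> \<le> ennreal ((?r t) * indicator {y..<x} t) + (ennreal (Q j * indicator {..<y} t)
        + 2 * emeasure ?p {zs. t < 2 * zs ! m})" by (rule add_increasing2[OF zero_le order_refl])
        finally show ?thesis by (simp add: ac_simps)
      next
        case 3
        have Kt: "K / Q m \<le> real t" using 3 by (simp add: x_def)
        have "emeasure ?p {zs. t < X zs} \<le> emeasure ?p {zs. \<exists>u\<in>set zs. real t < real u}"
          by (rule tail) (use mem in force)
        also have "\<dots> \<le> ennreal (2 * pprob ?p {zs. real t < 2 * real (last zs)})"
          unfolding measure_pmf.emeasure_eq_measure by (intro ennreal_leI K(2)[OF order_refl Kt])
        also have "\<dots> = 2 * emeasure ?p {zs. real t < 2 * real (last zs)}"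
          by (simp add: measure_pmf.emeasure_eq_measure ennreal_mult)
        also have "emeasure ?p {zs. real t < 2 * real (last zs)} = emeasure ?p {zs. t < 2 * zs ! m}"
        proof (rule emeasure_eq_AE)
          have "(real t < 2 * real (last zs)) = (t < 2 * zs ! m)" if "zs \<in> set_pmf ?p" for zs
            unfolding gw_from_last[OF that] by linarith
          thus "AE zs in measure_pmf ?p. (zs \<in> {zs. real t < 2 * real (last zs)}) = (zs \<in> {zs. t < 2 * zs ! m})"
            by (simp add: AE_measure_pmf_iff)
        qed auto
        also have "2 * emeasure ?p {zs. t < 2 * zs ! m} \<le> 2 * emeasure ?p {zs. t < 2 * zs ! m} + (ennreal (Q j * indicator {..<y} t) + ennreal ((?r t) * indicator {y..<x} t))"
          by (rule add_increasing2[OF zero_le order_refl])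
        finally show ?thesis by (simp add: ac_simps)
      qed
    qed
    have "(\<integral>\<^sup>+ zs. of_nat (X zs) \<partial>measure_pmf ?p) = (\<Sum>t. emeasure ?p {zs. t < X zs})"
      by (subst nn_integral_nat_function) simp_all
    also have "\<dots> \<le> (\<Sum>t. ennreal (Q j * indicator {..<y} t) + ennreal ((?r t) * indicator {y..<x} t)
        + 2 * emeasure ?p {zs. t < 2 * zs ! m})"
      by (intro suminf_le bound summableI)
    also have "\<dots> = (\<Sum>t. ennreal (Q j * indicator {..<y} t)) + (\<Sum>t. ennreal ((?r t) * indicator {y..<x} t))
        + 2 * (\<Sum>t. emeasure ?p {zs. t < 2 * zs ! m})"
      by (simp add: suminf_add[symmetric] summableI)
    also have "(\<Sum>t. ennreal (Q j * indicator {..<y} t)) = (\<Sum>t<y. ennreal (Q j))"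
      by (subst suminf_finite[of "{..<y}"]) (auto intro!: sum.cong)
    also have "\<dots> = ennreal (real y * Q j)" using Q_pos[of j] by (simp add: ennreal_mult ennreal_of_nat_eq_real_of_nat)
    also have "(\<Sum>t. ennreal ((?r t) * indicator {y..<x} t)) = (\<Sum>t\<in>{y..<x}. ennreal (?r t))"
      by (subst suminf_finite[of "{y..<x}"]) (auto intro!: sum.cong)
    also have "\<dots> = ennreal S" unfolding S_def by (rule sum_ennreal) (rule t0)
    also have "(\<Sum>t. emeasure ?p {zs. t < 2 * zs ! m}) = (\<integral>\<^sup>+ zs. of_nat (2 * zs ! m) \<partial>measure_pmf ?p)"
      by (subst nn_integral_nat_function) simp_all
    also have "\<dots> = 2"
      using path_mean[OF nn_mean, of m m 1] by (simp add: nn_integral_cmult)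
    also have "ennreal (real y * Q j) + ennreal S + 2 * 2 = ennreal (real y * Q j + S + 4)"
    proof -
      have "S \<ge> 0" unfolding S_def by (rule sum_nonneg) (rule t0)
      thus ?thesis using Q_pos[of j] by (simp add: ennreal_plus)
    qed
    also have "\<dots> \<le> ennreal (ln (real m / real j) + C - 1)"
    proof (rule ennreal_leI)
      have "real y \<le> 1 / Q j + 1" using Q_pos[of j] by (simp add: y_def)
      hence "real y * Q j \<le> (1 / Q j + 1) * Q j" using Q_pos[of j] by (intro mult_right_mono) auto
      also have "\<dots> \<le> 2" using Q_pos[of j] Q_le_1[of j] by (simp add: algebra_simps)
      finally have 1: "real y * Q j \<le> 2" .
      have "S \<le> ln (w (x - 1) / w (y - 1))" unfolding S_def by (rule sum_ratio_upper) (auto simp: y_def x_def)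
      also have "\<dots> \<le> ln (D * (real m / real j))"
      proof -
        have wy: "cl * real j \<le> w (y - 1)" using cl(2)[OF j(1)] by (simp add: y_def)
        have "w (x - 1) / w (y - 1) \<le> D * (real m / real j)"
        proof (cases "x = y")
          case True
          have "1 * 1 \<le> D * (real m / real j)" using D0 j by (intro mult_mono) auto
          thus ?thesis using True w_pos[of "y - 1"] by simp
        next
          case False
          have "w (x - 1) \<le> w (nat \<lceil>K / Q m\<rceil>)" using False by (intro w_mono) (auto simp: x_def max_def split: if_splits)
          also have "\<dots> \<le> Cu * real m" using Cu(2)[of m] j by simp
          finally have "w (x - 1) / w (y - 1) \<le> (Cu * real m) / (cl * real j)"
            using wy cl j w_pos[of "x - 1"] by (intro frac_le) auto
          also have "\<dots> = (Cu / cl) * (real m / real j)" by simp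
          also have "\<dots> \<le> D * (real m / real j)" by (intro mult_right_mono) (auto simp: D_def)
          finally show ?thesis .
        qed
        thus ?thesis by (subst ln_le_cancel_iff) (use w_pos D0 j in auto)
      qed
      also have "\<dots> = ln D + ln (real m / real j)" using D0 j by (subst ln_mult) auto
      finally show "real y * Q j + S + 4 \<le> ln (real m / real j) + C - 1" using 1 by (simp add: C_def)
    qed
    finally have EX: "(\<integral>\<^sup>+ zs. of_nat (X zs) \<partial>measure_pmf ?p) \<le> ennreal (ln (real m / real j) + C - 1)" .
    have "(\<integral>\<^sup>+ zs. ennreal (real (M_max zs m j)) \<partial>measure_pmf ?p) \<le> (\<integral>\<^sup>+ zs. (\<Sum>l<j. of_nat (zs ! l)) + of_nat j * of_nat (X zs) \<partial>measure_pmf ?p)"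
    proof (rule nn_integral_mono_AE, unfold AE_measure_pmf_iff, intro ballI)
      fix zs assume "zs \<in> set_pmf ?p"
      hence "M_max zs m j \<le> (\<Sum>l<j. zs ! l) + j * X zs" unfolding X_def using j gw_from_length by (intro M_max_le) auto
      hence "(of_nat (M_max zs m j) :: ennreal) \<le> of_nat ((\<Sum>l<j. zs ! l) + j * X zs)" by (simp only: of_nat_le_iff)
      thus "ennreal (real (M_max zs m j)) \<le> (\<Sum>l<j. of_nat (zs ! l)) + of_nat j * of_nat (X zs)"
        by (simp add: ennreal_of_nat_eq_real_of_nat[symmetric])
    qed
    also have "\<dots> = (\<Sum>l<j. \<integral>\<^sup>+ zs. of_nat (zs ! l) \<partial>measure_pmf ?p) + of_nat j * (\<integral>\<^sup>+ zs. of_nat (X zs) \<partial>measure_pmf ?p)"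
      by (simp add: nn_integral_add nn_integral_sum nn_integral_cmult)
    also have "(\<Sum>l<j. \<integral>\<^sup>+ zs. of_nat (zs ! l) \<partial>measure_pmf ?p) = (\<Sum>l<j. 1 :: ennreal)"
      using path_mean[OF nn_mean, of _ m 1] j by (intro sum.cong) auto
    also have "(\<Sum>l<j. 1 :: ennreal) + of_nat j * (\<integral>\<^sup>+ zs. of_nat (X zs) \<partial>measure_pmf ?p) \<le> of_nat j + of_nat j * ennreal (ln (real m / real j) + C - 1)"
      using EX by (intro add_mono mult_left_mono) auto
    also have "\<dots> = ennreal (real j + real j * (ln (real m / real j) + C - 1))"
      using mj D0 by (simp add: ennreal_plus ennreal_mult ennreal_of_nat_eq_real_of_nat C_def)
    also have "real j + real j * (ln (real m / real j) + C - 1) = real j * (ln (real m / real j) + C)" by (simp add: algebra_simps)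
    finally show "(\<integral>\<^sup>+ zs. ennreal (real (M_max zs m j)) \<partial>measure_pmf ?p) \<le> ennreal (real j * (ln (real m / real j) + C))" .
  qed
  have int: "integrable (measure_pmf (gw_from \<xi> 1 m)) (\<lambda>zs. real (M_max zs m j))" if "1 \<le> j" "j \<le> m" for m j
    using main[OF that] by (intro integrableI_nonneg) (auto intro: le_less_trans)
  have "EM \<xi> m j \<le> real j * (ln (real m / real j) + C)" if j: "1 \<le> j" "j \<le> m" for m j
  proof -
    have "ennreal (EM \<xi> m j) = (\<integral>\<^sup>+ zs. ennreal (real (M_max zs m j)) \<partial>measure_pmf (gw_from \<xi> 1 m))"
      unfolding EM_def gw_paths_eq by (rule nn_integral_eq_integral[symmetric, OF int[OF j]]) auto
    also note main[OF j]
    finally show ?thesis using pos[OF j] by (simp add: ennreal_le_iff)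
  qed
  thus ?thesis using that int by blast
qed

end

section \<open>Lower bounds and the small-window asymptotics\<close>

context critical_gw
begin

text \<open>If the walk passes (1 + \<delta>) N inside a generation, that generation still ends
  above N with probability at least 1 - d. This bridges the gap between the walk and the generation
  sizes in the lower bound.\<close>

lemma sum_iid_lower_tail:
  assumes "0 < \<delta>" "\<delta> < 1" "0 < d"
  obtains N0 where "N0 > 0"
    "\<And>N r c. N0 \<le> N \<Longrightarrow> real r \<le> N \<Longrightarrow> (1 + \<delta>) * N < real (c + r) \<Longrightarrow>
       pprob (sum_iid \<xi> r) {y. real (c + y) \<le> N} \<le> d"
proof -
  obtain K where "K > 0"
    "\<And>j. \<exists>\<theta>\<ge>Q j / K. \<theta> > 0 \<and> (\<forall>i\<le>j. (gf \<xi> ^^ i) (exp (- \<theta>)) \<le> exp (- \<theta> * (1 - \<delta> / 2)))"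
    using exp_iter_bound[of "\<delta> / 2"] assms by auto
  then obtain \<theta> where \<theta>: "\<theta> > 0" "\<And>i. i \<le> 1 \<Longrightarrow> (gf \<xi> ^^ i) (exp (- \<theta>)) \<le> exp (- \<theta> * (1 - \<delta> / 2))" by meson
  have g1: "gf \<xi> (exp (- \<theta>)) \<le> exp (- \<theta> * (1 - \<delta> / 2))" using \<theta>(2)[of 1] by simp
  have s: "0 \<le> exp (- \<theta>)" "exp (- \<theta>) \<le> 1" using \<theta> by auto
  \<comment> \<open>For r <= N the Chernoff bound with loss \<delta> / 2 is exp (- \<theta> \<delta>
    N / 2); from N0 on it is at most d.\<close>
  define N0 where "N0 = max 1 (- ln d * 2 / (\<theta> * \<delta>))"
  have "pprob (sum_iid \<xi> r) {y. real (c + y) \<le> N} \<le> d"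
    if N: "N0 \<le> N" and r: "real r \<le> N" and c: "(1 + \<delta>) * N < real (c + r)" for N r c
  proof -
    have "pprob (sum_iid \<xi> r) {y. real (c + y) \<le> N}
       \<le> pexp (sum_iid \<xi> r) (\<lambda>y. exp (\<theta> * (N - real c)) * exp (- \<theta>) ^ y)"
      unfolding prob_of_bool
    proof (rule integral_mono)
      show "integrable (measure_pmf (sum_iid \<xi> r)) (\<lambda>y. of_bool (real (c + y) \<le> N) :: real)"
        by (rule integrable_pmf_nonneg_bounded[where B=1]) auto
      show "integrable (measure_pmf (sum_iid \<xi> r)) (\<lambda>y. exp (\<theta> * (N - real c)) * exp (- \<theta>) ^ y)"
        using power_integrable_pmf[OF s, of _ "\<lambda>y. y"] by (intro integrable_mult_right) simp
      fix y :: nat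
      have "exp (\<theta> * (N - real c)) * exp (- \<theta>) ^ y = exp (\<theta> * (N - real (c + y)))"
        by (simp add: exp_of_nat_mult[symmetric] exp_add[symmetric] algebra_simps)
      moreover have "real (c + y) \<le> N \<Longrightarrow> 1 \<le> exp (\<theta> * (N - real (c + y)))" using \<theta>(1) by simp
      ultimately show "of_bool (real (c + y) \<le> N) \<le> exp (\<theta> * (N - real c)) * exp (- \<theta>) ^ y" by auto
    qed
    also have "\<dots> = exp (\<theta> * (N - real c)) * gf \<xi> (exp (- \<theta>)) ^ r"
      using sum_iid_gf[OF s, of \<xi> r] by simp
    also have "\<dots> \<le> exp (\<theta> * (N - real c)) * (exp (- \<theta> * (1 - \<delta> / 2))) ^ r"
      using gf_range[OF s, of \<xi>] by (intro mult_left_mono power_mono g1) auto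
    also have "\<dots> = exp (\<theta> * (N - real c - (1 - \<delta> / 2) * real r))"
      by (simp add: exp_of_nat_mult[symmetric] exp_add[symmetric] algebra_simps)
    also have "\<dots> \<le> exp (\<theta> * (- (\<delta> / 2 * N)))"
    proof -
      have "\<delta> / 2 * real r \<le> \<delta> / 2 * N" using r assms by (intro mult_left_mono) auto
      hence "N - real c - (1 - \<delta> / 2) * real r \<le> - (\<delta> / 2 * N)" using c by (simp add: algebra_simps)
      hence "\<theta> * (N - real c - (1 - \<delta> / 2) * real r) \<le> \<theta> * (- (\<delta> / 2 * N))" using \<theta>(1) by (intro mult_left_mono) auto
      thus ?thesis by (simp only: exp_le_cancel_iff)
    qed
    also have "\<dots> \<le> exp (ln d)"
    proof -
      have "- ln d * 2 / (\<theta> * \<delta>) \<le> N" using N by (simp add: N0_def)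
      hence "- ln d \<le> \<theta> * (\<delta> / 2 * N)" using \<theta>(1) assms by (simp add: field_simps)
      thus ?thesis by simp
    qed
    finally show ?thesis using assms by simp
  qed
  moreover have "N0 > 0" by (simp add: N0_def less_max_iff_disj)
  ultimately show ?thesis using that by blast
qed

text \<open>The probability that the walk from x exceeds n before reaching 0: harmonic in between, 0
  at x = 0 and 1 above n.\<close>

definition hit :: "nat \<Rightarrow> nat \<Rightarrow> real" where "hit n x = 1 - wrem n x / w n"

lemma hit_range: "0 \<le> hit n x" "hit n x \<le> 1"
  using wrem_range[of n x] w_pos[of n] by (auto simp: hit_def divide_le_eq_1)

lemma hit_step:
  assumes "Suc x \<le> n"
  shows "hit n (Suc x) = pexp \<xi> (\<lambda>a. hit n (x + a))"
proof -
  have "integrable (measure_pmf \<xi>) (\<lambda>a. wrem n (x + a))"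
    by (rule integrable_pmf_nonneg_bounded[where B="w n"]) (rule wrem_range)+
  thus ?thesis unfolding hit_def using wrem_step_eq[OF assms] by simp
qed

text \<open>The parents again reproduce one at a time. As long as the walk stays at or below n,
  harmonicity carries the estimate on; once it exceeds n, \<open>tl\<close> lets the generation end
  above N with probability at least 1 - d. There q = 1, so the factor 1 - d is paid only
  once.\<close>

lemma hit_sum_iid:
  fixes q :: "nat \<Rightarrow> real"
  assumes q: "\<And>y. 0 \<le> q y" "\<And>y. q y \<le> 1" and qH: "\<And>y. real y \<le> N \<Longrightarrow> (1 - d) * hit n y \<le> q y"
    and q1: "\<And>y. N < real y \<Longrightarrow> q y = 1" and d: "0 \<le> d" "d \<le> 1"
    and tl: "\<And>r c. real r \<le> N \<Longrightarrow> n < c + r \<Longrightarrow> pprob (sum_iid \<xi> r) {y. real (c + y) \<le> N} \<le> d"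
  shows "real r \<le> N \<Longrightarrow> (1 - d) * hit n (c + r) \<le> pexp (sum_iid \<xi> r) (\<lambda>y. q (c + y))"
proof (induction r arbitrary: c)
  case 0
  show ?case
  proof (cases "real c \<le> N")
    case True thus ?thesis using qH by simp
  next
    case False
    have "(1 - d) * hit n c \<le> 1 * 1" using d hit_range[of n c] by (intro mult_mono) auto
    thus ?thesis using False q1 by simp
  qed
next
  case (Suc r)
  show ?case
  proof (cases "n < c + Suc r")
    case True
    have "(1 - d) * hit n (c + Suc r) \<le> (1 - d) * 1" using d hit_range(2) by (intro mult_left_mono) auto
    also have "\<dots> \<le> 1 - pprob (sum_iid \<xi> (Suc r)) {y. real (c + y) \<le> N}"
      using tl[OF Suc.prems True] by simp
    also have "\<dots> = pprob (sum_iid \<xi> (Suc r)) {y. \<not> real (c + y) \<le> N}"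
      by (subst (2) prob_compl_of_bool) simp
    also have "\<dots> \<le> pexp (sum_iid \<xi> (Suc r)) (\<lambda>y. q (c + y))"
      unfolding prob_of_bool
      by (intro integral_mono integrable_pmf_nonneg_bounded[where B=1] q) (use q q1 in \<open>auto simp del: sum_iid.simps\<close>)
    finally show ?thesis .
  next
    case False
    have "(1 - d) * hit n (c + Suc r) = (1 - d) * pexp \<xi> (\<lambda>a. hit n (c + r + a))"
      using False by (simp add: hit_step)
    also have "\<dots> = pexp \<xi> (\<lambda>a. (1 - d) * hit n ((c + a) + r))"
      by (simp add: ac_simps)
    also have "\<dots> \<le> pexp \<xi> (\<lambda>a. pexp (sum_iid \<xi> r) (\<lambda>y. q ((c + a) + y)))"
    proof (rule integral_mono)
      show "integrable (measure_pmf \<xi>) (\<lambda>a. (1 - d) * hit n ((c + a) + r))"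
        by (intro integrable_mult_right integrable_pmf_nonneg_bounded[where B=1] hit_range)
      show "integrable (measure_pmf \<xi>) (\<lambda>a. pexp (sum_iid \<xi> r) (\<lambda>y. q ((c + a) + y)))"
        by (intro integrable_pmf_nonneg_bounded[where B=1] expectation_pmf_range[where B=1] q)
      show "(1 - d) * hit n ((c + a) + r) \<le> pexp (sum_iid \<xi> r) (\<lambda>y. q ((c + a) + y))" for a
        by (rule Suc.IH) (use Suc.prems in auto)
    qed
    also have "\<dots> = pexp (sum_iid \<xi> (Suc r)) (\<lambda>y. q (c + y))"
      by (subst sum_iid_step[where B=1]) (simp_all add: q add.assoc)
    finally show ?thesis .
  qed
qed

text \<open>\<open>hit\<close> is the probability that the walk leaves through the top. Passing n
  yields a generation above N up to the factor 1 - d; the other loss is that neither exit has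
  occurred by generation k, which forces Z_k > 0.\<close>

lemma max_tail_lower:
  assumes d: "0 \<le> d" "d \<le> 1" and N: "0 \<le> N" and n: "1 \<le> n"
    and tl: "\<And>r c. real r \<le> N \<Longrightarrow> n < c + r \<Longrightarrow> pprob (sum_iid \<xi> r) {y. real (c + y) \<le> N} \<le> d"
  shows "(1 - d) * (1 - w (n - 1) / w n) - Q k \<le> pprob (gw_from \<xi> 1 k) {zs. \<exists>u\<in>set zs. N < real u}"
proof -
  \<comment> \<open>Survival to the horizon counts as success, which makes the induction start at k
    = 0; its probability Q k is subtracted at the end.\<close>
  let ?b = "\<lambda>zs :: nat list. of_bool ((\<exists>u\<in>set zs. N < real u) \<or> 0 < last zs) :: real"
  have q: "(1 - d) * hit n z \<le> pexp (gw_from \<xi> z k) ?b" for z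
  proof (induction k arbitrary: z)
    case 0
    show ?case
    proof (cases "z = 0")
      case True thus ?thesis using N w_pos[of n] by (simp add: hit_def wrem_def)
    next
      case False
      have "(1 - d) * hit n z \<le> 1 * 1" using d hit_range[of n z] by (intro mult_mono) auto
      thus ?thesis using False by simp
    qed
  next
    case (Suc k)
    show ?case
    proof (cases "N < real z")
      case True
      have "(1 - d) * hit n z \<le> 1 * 1" using d hit_range[of n z] by (intro mult_mono) auto
      also have "1 * 1 = pexp (gw_from \<xi> z (Suc k)) (\<lambda>zs. 1 :: real)" by simp
      also have "\<dots> = pexp (gw_from \<xi> z (Suc k)) ?b"
        by (rule integral_cong_AE) (use True in \<open>auto simp: AE_measure_pmf_iff\<close>)
      finally show ?thesis .
    next
      case False
      let ?q = "\<lambda>y. pexp (gw_from \<xi> y k) ?b :: real"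
      have q1: "?q y = 1" if "N < real y" for y
      proof -
        have "\<exists>u\<in>set zs. N < real u" if zs: "zs \<in> set_pmf (gw_from \<xi> y k)" for zs
        proof -
          have "zs ! 0 = y" "zs ! 0 \<in> set zs" using gw_from_length[OF zs] by (auto intro!: nth_mem)
          thus ?thesis using \<open>N < real y\<close> by auto
        qed
        hence "?q y = pexp (gw_from \<xi> y k) (\<lambda>zs. 1 :: real)"
          by (intro integral_cong_AE) (auto simp: AE_measure_pmf_iff)
        thus ?thesis by simp
      qed
      have "(1 - d) * hit n (0 + z) \<le> pexp (sum_iid \<xi> z) (\<lambda>y. ?q (0 + y))"
        by (rule hit_sum_iid[where N=N]) (use False Suc.IH q1 d tl in \<open>auto intro!: expectation_pmf_range\<close>)
      also have "\<dots> = pexp (gw_from \<xi> z (Suc k)) ?b"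
      proof -
        have "?q y = pexp (gw_from \<xi> y k) (\<lambda>ys. of_bool ((\<exists>u\<in>set (z # ys). N < real u) \<or> 0 < last (z # ys)))" for y
          by (rule integral_cong_AE) (use False in \<open>auto simp: AE_measure_pmf_iff dest: gw_from_nonempty\<close>)
        thus ?thesis by (subst gw_step[where B=1]) auto
      qed
      finally show ?thesis by simp
    qed
  qed
  have "(1 - d) * (1 - w (n - 1) / w n) = (1 - d) * hit n 1" using n by (simp add: hit_def wrem_def)
  also note q[of 1]
  also have "pexp (gw_from \<xi> 1 k) ?b
     \<le> pexp (gw_from \<xi> 1 k) (\<lambda>zs. of_bool (\<exists>u\<in>set zs. N < real u) + (of_bool (0 < last zs) :: real))"
  proof -
    have i: "integrable (measure_pmf (gw_from \<xi> 1 k)) (\<lambda>zs. of_bool (R zs) :: real)" for R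
      by (rule integrable_pmf_nonneg_bounded[where B=1]) auto
    show ?thesis by (intro integral_mono Bochner_Integration.integrable_add i) auto
  qed
  also have "\<dots> = pprob (gw_from \<xi> 1 k) {zs. \<exists>u\<in>set zs. N < real u} + pprob (gw_from \<xi> 1 k) {zs. 0 < last zs}"
    unfolding prob_of_bool
    by (intro Bochner_Integration.integral_add integrable_pmf_nonneg_bounded[where B=1]) auto
  also have "pprob (gw_from \<xi> 1 k) {zs. 0 < last zs} = pprob (gw_from \<xi> 1 k) {zs. zs ! k > 0}"
    by (rule measure_pmf.finite_measure_eq_AE)
       (auto simp: AE_measure_pmf_iff gw_from_last)
  also have "\<dots> = Q k" by (rule path_extinct) simp
  finally show ?thesis by simp
qed

lemma exp_mean_le:
  fixes a :: "nat \<Rightarrow> real"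
  assumes "j \<ge> 1"
  shows "exp ((\<Sum>l<j. a l) / real j) \<le> (\<Sum>l<j. exp (a l)) / real j"
proof -
  have "exp (\<Sum>l<j. (1 / real j) *\<^sub>R a l) \<le> (\<Sum>l<j. (1 / real j) * exp (a l))"
    by (rule convex_on_sum[OF _ _ exp_convex]) (use assms in \<open>auto simp: lessThan_empty_iff\<close>)
  thus ?thesis by (simp add: sum_divide_distrib)
qed

text \<open>Start at the first generation above (1 + \<delta>) N. By Jensen the exponential of the
  average over the next j generations is at most the average of the exponentials, and
  \<open>exp_iter_bound\<close> controls the mean of each. The j additional generations make room
  for the window.\<close>

lemma window_lower:
  assumes "0 < \<delta>" "\<delta> < 1" "0 < d" "d < 1"
  obtains K where "K > 0"
    "\<And>N j n z. 1 \<le> j \<Longrightarrow> K / Q j \<le> N \<Longrightarrow>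
       (1 - d) * pprob (gw_from \<xi> z n) {zs. \<exists>u\<in>set zs. (1 + \<delta>) * N < real u}
         \<le> pprob (gw_from \<xi> z (n + j)) {zs. \<exists>k\<le>n. real j * N \<le> real (S_win zs k j)}"
proof -
  \<comment> \<open>Chosen for (1 - e) (1 + \<delta>) = 1 + \<delta> / 2: the exponent keeps a
    surplus \<theta> N \<delta> / 2, and K below makes this at least - ln d.\<close>
  define e where "e = \<delta> / (2 * (1 + \<delta>))"
  have e: "0 < e" "e < 1" using assms by (auto simp: e_def field_simps)
  have ed: "(1 - e) * (1 + \<delta>) = 1 + \<delta> / 2" using assms by (simp add: e_def field_simps)
  obtain K0 where K0: "K0 > 0"
    "\<And>j. \<exists>\<theta>\<ge>Q j / K0. \<theta> > 0 \<and> (\<forall>i\<le>j. (gf \<xi> ^^ i) (exp (- \<theta>)) \<le> exp (- \<theta> * (1 - e)))"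
    using exp_iter_bound[OF e] by auto
  define K where "K = K0 * (1 + 2 / \<delta> * (- ln d))"
  have lnd: "- ln d > 0" using assms by simp
  have Kpos: "K > 0" using K0 assms lnd unfolding K_def by (intro mult_pos_pos add_pos_pos) auto
  have "(1 - d) * pprob (gw_from \<xi> z n) {zs. \<exists>u\<in>set zs. (1 + \<delta>) * N < real u}
         \<le> pprob (gw_from \<xi> z (n + j)) {zs. \<exists>k\<le>n. real j * N \<le> real (S_win zs k j)}"
    if j: "1 \<le> j" and N: "K / Q j \<le> N" for N j n z
  proof -
    obtain \<theta> where \<theta>: "\<theta> \<ge> Q j / K0" "\<theta> > 0" "\<And>i. i \<le> j \<Longrightarrow> (gf \<xi> ^^ i) (exp (- \<theta>)) \<le> exp (- \<theta> * (1 - e))"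
      using K0(2)[of j] by blast
    have N0: "N > 0" using N Kpos Q_pos[of j] by (smt (verit) divide_pos_pos)
    have s: "0 \<le> exp (- \<theta>)" "exp (- \<theta>) \<le> 1" using \<theta> by auto
    have \<theta>N: "- ln d \<le> \<theta> * N * \<delta> / 2"
    proof -
      have "Q j / K0 * (K / Q j) \<le> \<theta> * N" using \<theta> N Kpos Q_pos[of j] K0
        by (intro mult_mono) (auto simp: less_imp_le)
      hence "1 + 2 / \<delta> * (- ln d) \<le> \<theta> * N" using K0 Q_pos[of j] by (simp add: K_def)
      hence "(2 / \<delta> * (- ln d)) * (\<delta> / 2) \<le> (\<theta> * N) * (\<delta> / 2)" using assms by (intro mult_right_mono) auto
      thus ?thesis using assms by simp
    qed
    have base: "1 - d \<le> pprob (gw_from \<xi> z (n + j)) {zs. real j * N \<le> real (S_win zs 0 j)}"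
      if z: "(1 + \<delta>) * N < real z" for z n
    proof -
      have "pprob (gw_from \<xi> z (n + j)) {zs. \<not> real j * N \<le> real (S_win zs 0 j)}
        \<le> pexp (gw_from \<xi> z (n + j)) (\<lambda>zs. exp (\<theta> * N) * ((\<Sum>l<j. exp (- \<theta>) ^ (zs ! l)) / real j))"
        unfolding prob_of_bool
      proof (rule integral_mono)
        show "integrable (measure_pmf (gw_from \<xi> z (n + j))) (\<lambda>zs. of_bool (\<not> real j * N \<le> real (S_win zs 0 j)) :: real)"
          by (rule integrable_pmf_nonneg_bounded[where B=1]) auto
        show "integrable (measure_pmf (gw_from \<xi> z (n + j))) (\<lambda>zs. exp (\<theta> * N) * ((\<Sum>l<j. exp (- \<theta>) ^ (zs ! l)) / real j))"
          by (intro integrable_mult_right integrable_divide Bochner_Integration.integrable_sum power_integrable_pmf s)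
        fix zs :: "nat list"
        have "exp ((\<Sum>l<j. - \<theta> * real (zs ! l)) / real j) \<le> (\<Sum>l<j. exp (- \<theta> * real (zs ! l))) / real j"
          by (rule exp_mean_le[OF j])
        also have "\<dots> = (\<Sum>l<j. exp (- \<theta>) ^ (zs ! l)) / real j"
          by (simp add: exp_of_nat_mult[symmetric] mult.commute)
        finally have 1: "exp (\<theta> * N) * exp ((\<Sum>l<j. - \<theta> * real (zs ! l)) / real j) \<le> exp (\<theta> * N) * ((\<Sum>l<j. exp (- \<theta>) ^ (zs ! l)) / real j)"
          by (intro mult_left_mono) auto
        have S: "(\<Sum>l<j. - \<theta> * real (zs ! l)) = - \<theta> * real (S_win zs 0 j)"
          by (simp add: S_win_def sum_distrib_left lessThan_atLeast0)
        have "1 \<le> exp (\<theta> * N) * exp ((\<Sum>l<j. - \<theta> * real (zs ! l)) / real j)" if "\<not> real j * N \<le> real (S_win zs 0 j)"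
        proof -
          have "real (S_win zs 0 j) / real j \<le> N" using that j by (simp add: field_simps)
          hence "\<theta> * (real (S_win zs 0 j) / real j) \<le> \<theta> * N" using \<theta>(2) by (intro mult_left_mono) auto
          thus ?thesis unfolding S exp_add[symmetric] by simp
        qed
        moreover have "0 \<le> exp (\<theta> * N) * exp ((\<Sum>l<j. - \<theta> * real (zs ! l)) / real j)" by simp
        ultimately have "of_bool (\<not> real j * N \<le> real (S_win zs 0 j)) \<le> exp (\<theta> * N) * exp ((\<Sum>l<j. - \<theta> * real (zs ! l)) / real j)"
          by (cases "real j * N \<le> real (S_win zs 0 j)") (simp_all only: of_bool_eq not_True_eq_False not_False_eq_True simp_thms)
        thus "of_bool (\<not> real j * N \<le> real (S_win zs 0 j)) \<le> exp (\<theta> * N) * ((\<Sum>l<j. exp (- \<theta>) ^ (zs ! l)) / real j)"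
          using 1 by linarith
      qed
      also have "\<dots> = exp (\<theta> * N) * ((\<Sum>l<j. pexp (gw_from \<xi> z (n + j)) (\<lambda>zs. exp (- \<theta>) ^ (zs ! l))) / real j)"
        by (simp add: Bochner_Integration.integral_sum power_integrable_pmf[OF s])
      also have "\<dots> \<le> exp (\<theta> * N) * ((\<Sum>l<j. exp (- \<theta> * (1 - e)) ^ z) / real j)"
      proof (intro mult_left_mono divide_right_mono sum_mono)
        fix l assume l: "l \<in> {..<j}"
        have "pexp (gw_from \<xi> z (n + j)) (\<lambda>zs. exp (- \<theta>) ^ (zs ! l)) = ((gf \<xi> ^^ l) (exp (- \<theta>))) ^ z"
          by (rule path_gf[OF s]) (use l in auto)
        also have "\<dots> \<le> exp (- \<theta> * (1 - e)) ^ z"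
          using gf_iter_range[OF s, where p=\<xi> and n=l] l by (intro power_mono \<theta>) auto
        finally show "pexp (gw_from \<xi> z (n + j)) (\<lambda>zs. exp (- \<theta>) ^ (zs ! l)) \<le> exp (- \<theta> * (1 - e)) ^ z" .
      qed auto
      also have "\<dots> = exp (\<theta> * N - \<theta> * (1 - e) * real z)"
        using j by (simp add: exp_of_nat_mult[symmetric] exp_add[symmetric] algebra_simps)
      also have "\<dots> \<le> exp (ln d)"
      proof -
        have "\<theta> * (1 - e) * ((1 + \<delta>) * N) \<le> \<theta> * (1 - e) * real z" using z e \<theta> by (intro mult_left_mono) auto
        moreover have "\<theta> * (1 - e) * ((1 + \<delta>) * N) = \<theta> * N * ((1 - e) * (1 + \<delta>))" by (simp add: mult_ac)
        hence "\<theta> * (1 - e) * ((1 + \<delta>) * N) = \<theta> * N + \<theta> * N * \<delta> / 2" unfolding ed by (simp add: algebra_simps)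
        ultimately show ?thesis using \<theta>N by simp
      qed
      finally show ?thesis using assms by (subst prob_compl_of_bool) simp
    qed
    show ?thesis
    proof (induction n arbitrary: z)
      case 0
      show ?case
      proof (cases "(1 + \<delta>) * N < real z")
        case True thus ?thesis using base[OF True, of 0] by (simp add: measure_return_pmf indicator_def)
      next
        case False thus ?thesis by (simp add: measure_return_pmf indicator_def)
      qed
    next
      case (Suc n)
      show ?case
      proof (cases "(1 + \<delta>) * N < real z")
        case True
        have "(1 - d) * pprob (gw_from \<xi> z (Suc n)) {zs. \<exists>u\<in>set zs. (1 + \<delta>) * N < real u} \<le> (1 - d) * 1"
          using assms by (intro mult_left_mono) auto
        also have "\<dots> \<le> pprob (gw_from \<xi> z (Suc n + j)) {zs. real j * N \<le> real (S_win zs 0 j)}"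
          using base[OF True, of "Suc n"] by simp
        also have "\<dots> \<le> pprob (gw_from \<xi> z (Suc n + j)) {zs. \<exists>k\<le>Suc n. real j * N \<le> real (S_win zs k j)}"
          by (rule measure_pmf.finite_measure_mono) auto
        finally show ?thesis .
      next
        case False
        have S: "S_win (z # ys) (Suc k) j = S_win ys k j" for ys k
          unfolding S_win_def by (rule sum.reindex_bij_witness[where i=Suc and j="\<lambda>l. l - 1"]) auto
        have "(1 - d) * pprob (gw_from \<xi> z (Suc n)) {zs. \<exists>u\<in>set zs. (1 + \<delta>) * N < real u}
          = pexp (sum_iid \<xi> z) (\<lambda>x. (1 - d) * pexp (gw_from \<xi> x n) (\<lambda>ys. of_bool (\<exists>u\<in>set ys. (1 + \<delta>) * N < real u)))"
          unfolding prob_of_bool by (subst gw_step[where B=1]) (use False in auto)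
        also have "\<dots> \<le> pexp (sum_iid \<xi> z) (\<lambda>x. pexp (gw_from \<xi> x (n + j)) (\<lambda>ys. of_bool (\<exists>k\<le>Suc n. real j * N \<le> real (S_win (z # ys) k j))))"
        proof (rule integral_mono)
          show "integrable (measure_pmf (sum_iid \<xi> z)) (\<lambda>x. (1 - d) * pexp (gw_from \<xi> x n) (\<lambda>ys. of_bool (\<exists>u\<in>set ys. (1 + \<delta>) * N < real u)) :: real)"
            by (intro integrable_mult_right integrable_pmf_nonneg_bounded[where B=1] expectation_pmf_range) auto
          show "integrable (measure_pmf (sum_iid \<xi> z)) (\<lambda>x. pexp (gw_from \<xi> x (n + j)) (\<lambda>ys. of_bool (\<exists>k\<le>Suc n. real j * N \<le> real (S_win (z # ys) k j))) :: real)"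
            by (intro integrable_pmf_nonneg_bounded[where B=1] expectation_pmf_range) auto
          fix x
          have "(1 - d) * pexp (gw_from \<xi> x n) (\<lambda>ys. of_bool (\<exists>u\<in>set ys. (1 + \<delta>) * N < real u))
            \<le> pprob (gw_from \<xi> x (n + j)) {zs. \<exists>k\<le>n. real j * N \<le> real (S_win zs k j)}"
            using Suc.IH[of x] unfolding prob_of_bool .
          also have "\<dots> \<le> pprob (gw_from \<xi> x (n + j)) {ys. \<exists>k\<le>Suc n. real j * N \<le> real (S_win (z # ys) k j)}"
          proof (rule measure_pmf.finite_measure_mono)
            show "{zs. \<exists>k\<le>n. real j * N \<le> real (S_win zs k j)} \<subseteq> {ys. \<exists>k\<le>Suc n. real j * N \<le> real (S_win (z # ys) k j)}"
            proof safe
              fix zs k assume "k \<le> n" "real j * N \<le> real (S_win zs k j)"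
              thus "\<exists>k\<le>Suc n. real j * N \<le> real (S_win (z # zs) k j)" by (intro exI[of _ "Suc k"]) (simp add: S)
            qed
          qed simp
          finally show "(1 - d) * pexp (gw_from \<xi> x n) (\<lambda>ys. of_bool (\<exists>u\<in>set ys. (1 + \<delta>) * N < real u))
            \<le> (pexp (gw_from \<xi> x (n + j)) (\<lambda>ys. of_bool (\<exists>k\<le>Suc n. real j * N \<le> real (S_win (z # ys) k j))) :: real)"
            unfolding prob_of_bool .
        qed
        also have "\<dots> = pprob (gw_from \<xi> z (Suc n + j)) {zs. \<exists>k\<le>Suc n. real j * N \<le> real (S_win zs k j)}"
          unfolding prob_of_bool add_Suc by (subst gw_step[where B=1]) auto
        finally show ?thesis .
      qed
    qed
  qed
  thus ?thesis using that Kpos by blast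
qed

text \<open>For a quotient a >= 1 - d of consecutive values of \<open>w\<close>, ln (1 / a) <= 1 / a
  - 1 gives (1 - d) ln (1 / a) <= a (1 / a - 1) = 1 - a; the logarithms telescope.\<close>

lemma sum_ratio_lower:
  assumes "1 \<le> y" "\<And>t. y \<le> t \<Longrightarrow> 1 - w (t - 1) / w t \<le> d" "0 < d" "d < 1"
  shows "(1 - d) * ln (w (x - 1) / w (y - 1)) \<le> (\<Sum>t\<in>{y..<x}. 1 - w (t - 1) / w t)"
proof (cases "y \<le> x")
  case False
  hence "w (x - 1) / w (y - 1) \<le> 1" using w_mono[of "x - 1" "y - 1"] w_pos[of "y - 1"] by simp
  hence "ln (w (x - 1) / w (y - 1)) \<le> 0" using w_pos by simp
  hence "(1 - d) * ln (w (x - 1) / w (y - 1)) \<le> 0" using assms by (intro mult_nonneg_nonpos) auto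
  thus ?thesis using False by simp
next
  case True
  thus ?thesis
  proof (induction rule: dec_induct)
    case base
    show ?case using w_pos[of "y - 1"] by simp
  next
    case (step x)
    define a where "a = w (x - 1) / w x"
    have a: "0 < a" "1 - a \<le> d" using w_pos assms(2)[of x] step by (auto simp: a_def)
    have "(1 - d) * ln (1 / a) \<le> 1 - a"
    proof -
      have a1: "a \<le> 1" using w_mono[of "x - 1" x] w_pos[of x] by (simp add: a_def)
      have "ln (1 / a) \<le> 1 / a - 1" using a by (intro ln_le_minus_one) auto
      hence "(1 - d) * ln (1 / a) \<le> a * (1 / a - 1)"
        using a a1 assms by (intro mult_mono) auto
      also have "\<dots> = 1 - a" using a by (simp add: field_simps)
      finally show ?thesis .
    qed
    moreover have "ln (1 / a) = ln (w x) - ln (w (x - 1))" using w_pos[of x] w_pos[of "x - 1"] by (simp add: a_def ln_div)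
    moreover have eq: "ln (w (Suc x - 1) / w (y - 1)) = ln (w (x - 1) / w (y - 1)) + (ln (w x) - ln (w (x - 1)))"
      using w_pos[of x] w_pos[of "x - 1"] w_pos[of "y - 1"] by (simp add: ln_div)
    ultimately have "(1 - d) * ln (w (Suc x - 1) / w (y - 1)) \<le> (1 - d) * ln (w (x - 1) / w (y - 1)) + (1 - a)"
      unfolding eq distrib_left by simp
    thus ?case using step by (simp add: a_def)
  qed
qed


lemma sum_of_bool_le:
  assumes "0 \<le> v" "1 \<le> y"
  shows "(\<Sum>t\<in>{y..<x}. of_bool (real t \<le> v)) \<le> (v :: real)"
proof -
  have "(\<Sum>t\<in>{y..<x}. of_bool (real t \<le> v)) = real (card ({y..<x} \<inter> {t. real t \<le> v}))"
    by (simp add: of_bool_def sum.If_cases)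
  also have "card ({y..<x} \<inter> {t. real t \<le> v}) \<le> card {1..nat \<lfloor>v\<rfloor>}"
    using assms by (intro card_mono) (auto simp: le_nat_floor)
  also have "real (card {1..nat \<lfloor>v\<rfloor>}) \<le> v" using assms by simp
  finally show ?thesis by simp
qed

lemma M_max_integrable:
  "1 \<le> j \<Longrightarrow> j \<le> m \<Longrightarrow> integrable (measure_pmf (gw_from \<xi> 1 m)) (\<lambda>zs. real (M_max zs m j))"
  by (rule EM_upper) blast

text \<open>The levels between K3 / Q j and 1 / Q m' are summed. The loss Q m' from
  \<open>max_tail_lower\<close> occurs for at most 1 / Q m' levels and therefore costs only a
  constant.\<close>

lemma EM_lower:
  assumes eps: "0 < \<epsilon>" "\<epsilon> < 1"
  obtains C where "C \<ge> 0" "\<And>m j. 1 \<le> j \<Longrightarrow> 2 * j \<le> m \<Longrightarrow> real j * ((1 - \<epsilon>) * ln (real m / real j) - C) \<le> EM \<xi> m j"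
proof -
  \<comment> \<open>The losses multiply to (1 - \<delta>)^3 / (1 + \<delta>)^2, which is at least (1
    - \<delta>)^5 and hence at least 1 - 5 \<delta>.\<close>
  define \<delta> where "\<delta> = \<epsilon> / 5"
  have \<delta>: "0 < \<delta>" "\<delta> < 1" using eps by (auto simp: \<delta>_def)
  \<comment> \<open>One factor 1 + \<delta> is lost between the walk and the generation sizes, the
    other between a generation size and the average over a window.\<close>
  define D where "D = (1 + \<delta>)\<^sup>2"
  have D: "1 \<le> D" "D \<le> 4" "0 < D" using \<delta> power_mono[of "1 + \<delta>" 2 2] by (auto simp: D_def)
  obtain N0 where N0: "N0 > 0" "\<And>N r c. N0 \<le> N \<Longrightarrow> real r \<le> N \<Longrightarrow> (1 + \<delta>) * N < real (c + r) \<Longrightarrow>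
       pprob (sum_iid \<xi> r) {y. real (c + y) \<le> N} \<le> \<delta>"
    using sum_iid_lower_tail[OF \<delta> \<delta>(1)] by blast
  obtain K where K: "K > 0" "\<And>N j n z. 1 \<le> j \<Longrightarrow> K / Q j \<le> N \<Longrightarrow>
       (1 - \<delta>) * pprob (gw_from \<xi> z n) {zs. \<exists>u\<in>set zs. (1 + \<delta>) * N < real u}
         \<le> pprob (gw_from \<xi> z (n + j)) {zs. \<exists>k\<le>n. real j * N \<le> real (S_win zs k j)}"
    using window_lower[OF \<delta> \<delta>] by blast
  obtain n1 where n1: "\<And>n. n \<ge> n1 \<Longrightarrow> 1 - w (n - 1) / w n < \<delta>"
    using order_tendstoD(2)[OF w_ratio_tendsto \<delta>(1)] by (auto simp: eventually_sequentially)
  \<comment> \<open>4 K because D <= 4, 2 N0 because 1 + \<delta> <= 2, and n1 so that the quotients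
    of \<open>w\<close> are within \<delta> of 1.\<close>
  define K3 where "K3 = Max {4 * K, 2 * N0, real n1, 1}"
  have K3: "4 * K \<le> K3" "2 * N0 \<le> K3" "real n1 \<le> K3" "1 \<le> K3" by (auto simp: K3_def)
  obtain Cu where Cu: "Cu > 0" "\<And>j. 1 \<le> j \<Longrightarrow> w (nat \<lceil>K3 / Q j\<rceil>) \<le> Cu * real j" by (rule w_Q_upper[of K3]) (use K3 in auto)
  obtain cl where cl: "cl > 0" "\<And>j. 1 \<le> j \<Longrightarrow> cl * real j \<le> w (nat \<lfloor>1 / Q j\<rfloor>)" using w_Q_lower by blast
  define C where "C = \<bar>ln (cl / (2 * Cu))\<bar> + 1"
  have "real j * ((1 - \<epsilon>) * ln (real m / real j) - C) \<le> EM \<xi> m j" if j: "1 \<le> j" "2 * j \<le> m" for m j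
  proof -
    let ?p = "gw_from \<xi> 1 m"
    \<comment> \<open>The last j generations are reserved for the window; 2 j <= m keeps m' of the
      order of m.\<close>
    define m' where "m' = m - j"
    have m': "m' + j = m" "1 \<le> m'" "real m / 2 \<le> real m'" using j by (auto simp: m'_def)
    define y where "y = nat \<lceil>K3 / Q j\<rceil>"
    define x where "x = nat \<lfloor>1 / Q m'\<rfloor> + 1"
    have yK: "K3 / Q j \<le> real y" unfolding y_def by (rule real_nat_ceiling_ge)
    have yK3: "K3 \<le> real y"
    proof -
      have "K3 / 1 \<le> K3 / Q j" using K3 Q_pos[of j] Q_le_1[of j] by (intro divide_left_mono) auto
      thus ?thesis using yK by simp
    qed
    have y1: "1 \<le> y" using yK3 K3 by simp
    have obt: "integrable (measure_pmf ?p) (\<lambda>zs. real (M_max zs m j))"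
      using j by (intro M_max_integrable) auto
    have Pt: "(1 - \<delta>)\<^sup>2 * (1 - w (t - 1) / w t) - Q m' \<le> pprob ?p {zs. real j * (real t / D) \<le> real (M_max zs m j)}"
      if t: "y \<le> t" for t
    proof -
      have tt: "K3 / Q j \<le> real t" "K3 \<le> real t" using t yK yK3 by auto
      have N2: "(1 + \<delta>) * (real t / D) = real t / (1 + \<delta>)" using \<delta> by (simp add: D_def power2_eq_square)
      have "real t / 2 \<le> real t / (1 + \<delta>)" using \<delta> by (intro divide_left_mono) auto
      hence N2': "N0 \<le> real t / (1 + \<delta>)" using tt K3 by linarith
      have N1: "K / Q j \<le> real t / D"
      proof -
        have "K / Q j \<le> (K3 / 4) / Q j" using K3 Q_pos[of j] by (intro divide_right_mono) auto
        also have "\<dots> \<le> real t / 4" using tt by simp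
        also have "\<dots> \<le> real t / D" using D by (intro divide_left_mono) auto
        finally show ?thesis .
      qed
      have "(1 - \<delta>) * (1 - w (t - 1) / w t) - Q m' \<le> pprob (gw_from \<xi> 1 m') {zs. \<exists>u\<in>set zs. real t / (1 + \<delta>) < real u}"
      proof (rule max_tail_lower)
        fix r c assume r: "real r \<le> real t / (1 + \<delta>)" "t < c + r"
        have "(1 + \<delta>) * (real t / (1 + \<delta>)) = real t" using \<delta> by simp
        thus "pprob (sum_iid \<xi> r) {y. real (c + y) \<le> real t / (1 + \<delta>)} \<le> \<delta>"
          using r by (intro N0(2)[OF N2']) auto
      qed (use \<delta> y1 t in auto)
      hence "(1 - \<delta>) * ((1 - \<delta>) * (1 - w (t - 1) / w t) - Q m') \<le> (1 - \<delta>) * pprob (gw_from \<xi> 1 m') {zs. \<exists>u\<in>set zs. real t / (1 + \<delta>) < real u}"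
        using \<delta> by (intro mult_left_mono) auto
      also have "\<dots> \<le> pprob (gw_from \<xi> 1 (m' + j)) {zs. \<exists>k\<le>m'. real j * (real t / D) \<le> real (S_win zs k j)}"
        using K(2)[OF j(1) N1, of 1 m'] unfolding N2 .
      also have "\<dots> \<le> pprob ?p {zs. real j * (real t / D) \<le> real (M_max zs m j)}"
        unfolding m'(1)
      proof (rule measure_pmf.finite_measure_mono)
        show "{zs. \<exists>k\<le>m'. real j * (real t / D) \<le> real (S_win zs k j)} \<subseteq> {zs. real j * (real t / D) \<le> real (M_max zs m j)}"
        proof safe
          fix zs k assume k: "k \<le> m'" "real j * (real t / D) \<le> real (S_win zs k j)"
          have "S_win zs k j \<le> M_max zs m j" unfolding M_max_def using k(1) by (intro Max_ge) (auto simp: m'_def)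
          thus "real j * (real t / D) \<le> real (M_max zs m j)" using k(2) by linarith
        qed
      qed simp
      finally have "(1 - \<delta>) * ((1 - \<delta>) * (1 - w (t - 1) / w t) - Q m') \<le> pprob ?p {zs. real j * (real t / D) \<le> real (M_max zs m j)}" .
      moreover have "(1 - \<delta>) * Q m' \<le> 1 * Q m'" using \<delta> Q_pos[of m'] by (intro mult_right_mono) auto
      moreover have "(1 - \<delta>) * ((1 - \<delta>) * b - q) = (1 - \<delta>)\<^sup>2 * b - (1 - \<delta>) * q" for b q
        by (simp add: algebra_simps power2_eq_square)
      ultimately show ?thesis by simp
    qed
    have S1: "(1 - \<delta>) ^ 3 * ln (w (x - 1) / w (y - 1)) - 1 \<le> (\<Sum>t\<in>{y..<x}. (1 - \<delta>)\<^sup>2 * (1 - w (t - 1) / w t) - Q m')"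
    proof -
      have "(1 - \<delta>) * ln (w (x - 1) / w (y - 1)) \<le> (\<Sum>t\<in>{y..<x}. 1 - w (t - 1) / w t)"
      proof (rule sum_ratio_lower)
        fix t assume "y \<le> t"
        hence "n1 \<le> t" using yK3 K3(3) by linarith
        thus "1 - w (t - 1) / w t \<le> \<delta>" using n1[of t] by simp
      qed (use y1 \<delta> in auto)
      hence "(1 - \<delta>)\<^sup>2 * ((1 - \<delta>) * ln (w (x - 1) / w (y - 1))) \<le> (1 - \<delta>)\<^sup>2 * (\<Sum>t\<in>{y..<x}. 1 - w (t - 1) / w t)"
        by (intro mult_left_mono) auto
      moreover have "(1 - \<delta>)\<^sup>2 * ((1 - \<delta>) * ln (w (x - 1) / w (y - 1))) = (1 - \<delta>) ^ 3 * ln (w (x - 1) / w (y - 1))"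
        by (simp add: power2_eq_square power3_eq_cube)
      moreover have "real (x - y) * Q m' \<le> 1"
      proof -
        have "real (x - y) \<le> real (nat \<lfloor>1 / Q m'\<rfloor>)" using y1 by (simp add: x_def)
        also have "\<dots> \<le> 1 / Q m'" using Q_pos[of m'] by simp
        finally show ?thesis using Q_pos[of m'] by (simp add: field_simps)
      qed
      moreover have "(\<Sum>t\<in>{y..<x}. (1 - \<delta>)\<^sup>2 * (1 - w (t - 1) / w t) - Q m') = (1 - \<delta>)\<^sup>2 * (\<Sum>t\<in>{y..<x}. 1 - w (t - 1) / w t) - real (x - y) * Q m'"
        by (subst sum_subtractf) (simp only: sum_distrib_left sum_constant card_atLeastLessThan)
      ultimately show ?thesis by linarith
    qed
    have lnw: "ln (real m / real j) - (C - 1) \<le> ln (w (x - 1) / w (y - 1))"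
    proof -
      have 1: "cl * (real m / 2) \<le> w (x - 1)"
      proof -
        have "cl * (real m / 2) \<le> cl * real m'" using m'(3) cl(1) by (intro mult_left_mono) auto
        also have "\<dots> \<le> w (x - 1)" using cl(2)[OF m'(2)] by (simp add: x_def)
        finally show ?thesis .
      qed
      have 2: "w (y - 1) \<le> Cu * real j" using w_mono[of "y - 1" y] Cu(2)[OF j(1)] by (simp add: y_def)
      have "(cl * (real m / 2)) / (Cu * real j) \<le> w (x - 1) / w (y - 1)"
        using 1 2 w_pos cl j by (intro frac_le) (auto intro: less_imp_le)
      moreover have "(cl * (real m / 2)) / (Cu * real j) = cl / (2 * Cu) * (real m / real j)" by simp
      ultimately have "ln (cl / (2 * Cu) * (real m / real j)) \<le> ln (w (x - 1) / w (y - 1))"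
        using cl Cu j by (intro ln_mono) auto
      moreover have "ln (cl / (2 * Cu) * (real m / real j)) = ln (cl / (2 * Cu)) + ln (real m / real j)"
        using cl Cu j by (intro ln_mult_pos) auto
      ultimately show ?thesis by (simp add: C_def)
    qed
    have ln0: "0 \<le> ln (real m / real j)" using j by simp
    have C1: "C \<ge> 1" by (simp add: C_def)
    have "(1 - \<delta>) ^ 3 * ln (real m / real j) - C \<le> (1 - \<delta>) ^ 3 * ln (w (x - 1) / w (y - 1)) - 1"
    proof -
      have "(1 - \<delta>) ^ 3 * (ln (real m / real j) - (C - 1)) \<le> (1 - \<delta>) ^ 3 * ln (w (x - 1) / w (y - 1))"
        using \<delta> by (intro mult_left_mono lnw) auto
      moreover have "(1 - \<delta>) ^ 3 * (C - 1) \<le> 1 * (C - 1)" using \<delta> C1 by (intro mult_right_mono power_le_one) auto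
      ultimately show ?thesis by (simp add: algebra_simps)
    qed
    also note S1
    also have "(\<Sum>t\<in>{y..<x}. (1 - \<delta>)\<^sup>2 * (1 - w (t - 1) / w t) - Q m') \<le> (\<Sum>t\<in>{y..<x}. pprob ?p {zs. real j * (real t / D) \<le> real (M_max zs m j)})"
      by (intro sum_mono Pt) auto
    also have "\<dots> = pexp ?p (\<lambda>zs. \<Sum>t\<in>{y..<x}. of_bool (real j * (real t / D) \<le> real (M_max zs m j)))"
      unfolding prob_of_bool
      by (rule Bochner_Integration.integral_sum[symmetric]) (auto intro!: integrable_pmf_nonneg_bounded[where B=1])
    also have "\<dots> \<le> pexp ?p (\<lambda>zs. D / real j * real (M_max zs m j))"
    proof (rule integral_mono)
      show "integrable (measure_pmf ?p) (\<lambda>zs. \<Sum>t\<in>{y..<x}. of_bool (real j * (real t / D) \<le> real (M_max zs m j)) :: real)"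
        by (intro Bochner_Integration.integrable_sum integrable_pmf_nonneg_bounded[where B=1]) auto
      show "integrable (measure_pmf ?p) (\<lambda>zs. D / real j * real (M_max zs m j))"
        using obt by simp
      fix zs
      have "(real j * (real t / D) \<le> real (M_max zs m j)) = (real t \<le> D / real j * real (M_max zs m j))" for t
        using j D by (simp add: field_simps)
      thus "(\<Sum>t\<in>{y..<x}. of_bool (real j * (real t / D) \<le> real (M_max zs m j))) \<le> D / real j * real (M_max zs m j)"
        using D y1 by (simp only:) (rule sum_of_bool_le, auto)
    qed
    also have "\<dots> = D / real j * EM \<xi> m j" by (simp add: EM_def gw_paths_eq)
    finally have "((1 - \<delta>) ^ 3 * ln (real m / real j) - C) * (real j / D) \<le> (D / real j * EM \<xi> m j) * (real j / D)"
      using j D by (intro mult_right_mono) auto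
    also have "\<dots> = EM \<xi> m j" using j D by simp
    finally have main: "real j * (((1 - \<delta>) ^ 3 * ln (real m / real j) - C) / D) \<le> EM \<xi> m j" by (simp add: mult_ac)
    have "(1 - \<epsilon>) * D \<le> (1 - \<delta>) ^ 3"
    proof -
      have "1 - \<epsilon> \<le> (1 - \<delta>) ^ 5" using Bernoulli_inequality[of "- \<delta>" 5] \<delta> by (simp add: \<delta>_def)
      hence "(1 - \<epsilon>) * D \<le> (1 - \<delta>) ^ 5 * D" using D by (intro mult_right_mono) auto
      also have "\<dots> = (1 - \<delta>) ^ 3 * ((1 - \<delta>) * (1 + \<delta>))\<^sup>2" by (simp add: D_def power_mult_distrib power_add[symmetric] flip: mult.assoc)
      also have "\<dots> \<le> (1 - \<delta>) ^ 3 * 1\<^sup>2"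
        using \<delta> mult_mono[of \<delta> 1 \<delta> 1] by (intro mult_left_mono power_mono) (auto simp: algebra_simps)
      finally show ?thesis by simp
    qed
    hence "(1 - \<epsilon>) * D * ln (real m / real j) \<le> (1 - \<delta>) ^ 3 * ln (real m / real j)" using ln0 by (intro mult_right_mono)
    moreover have "C * 1 \<le> C * D" using C1 D by (intro mult_left_mono) auto
    ultimately have "((1 - \<epsilon>) * ln (real m / real j) - C) * D \<le> (1 - \<delta>) ^ 3 * ln (real m / real j) - C"
      by (simp add: algebra_simps)
    hence "(1 - \<epsilon>) * ln (real m / real j) - C \<le> ((1 - \<delta>) ^ 3 * ln (real m / real j) - C) / D"
      using D by (simp add: pos_le_divide_eq)
    hence "real j * ((1 - \<epsilon>) * ln (real m / real j) - C) \<le> real j * (((1 - \<delta>) ^ 3 * ln (real m / real j) - C) / D)"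
      by (intro mult_left_mono) auto
    thus ?thesis using main by linarith
  qed
  moreover have "C \<ge> 0" by (simp add: C_def)
  ultimately show ?thesis using that by blast
qed

lemma EM_nonneg: "0 \<le> EM \<xi> m j"
  unfolding EM_def by (rule Bochner_Integration.integral_nonneg) simp

lemma EM_log_bounds:
  assumes eps: "0 < \<epsilon>" "\<epsilon> < 1"
  obtains C where "C \<ge> 0" "\<And>m j. 1 \<le> j \<Longrightarrow> j \<le> m \<Longrightarrow> \<bar>EM \<xi> m j / real j - ln (real m / real j)\<bar> \<le> \<epsilon> * ln (real m / real j) + C"
proof -
  obtain C1 where C1: "\<And>m j. 1 \<le> j \<Longrightarrow> j \<le> m \<Longrightarrow> EM \<xi> m j \<le> real j * (ln (real m / real j) + C1)"
    using EM_upper by metis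
  obtain C2 where C2: "C2 \<ge> 0" "\<And>m j. 1 \<le> j \<Longrightarrow> 2 * j \<le> m \<Longrightarrow> real j * ((1 - \<epsilon>) * ln (real m / real j) - C2) \<le> EM \<xi> m j"
    using EM_lower[OF eps] by blast
  define C where "C = \<bar>C1\<bar> + C2 + ln 2"
  have "\<bar>EM \<xi> m j / real j - ln (real m / real j)\<bar> \<le> \<epsilon> * ln (real m / real j) + C" if j: "1 \<le> j" "j \<le> m" for m j
  proof -
    define l where "l = ln (real m / real j)"
    define a where "a = EM \<xi> m j / real j"
    have l0: "0 \<le> \<epsilon> * l" "0 \<le> l" using j eps by (auto simp: l_def)
    have a0: "0 \<le> a" using EM_nonneg by (simp add: a_def)
    have 1: "a \<le> l + C1" using C1[OF j] j by (simp add: a_def l_def field_simps)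
    have 2: "(1 - \<epsilon>) * l - C2 - ln 2 \<le> a"
    \<comment> \<open>For m < 2 j the logarithm is at most ln 2, so nonnegativity of the mean is
      enough.\<close>
    proof (cases "2 * j \<le> m")
      case True
      have "(1 - \<epsilon>) * l - C2 \<le> a" using C2(2)[OF j(1) True] j by (simp add: a_def l_def pos_le_divide_eq mult.commute)
      thus ?thesis using ln_ge_zero[of "2::real"] by linarith
    next
      case False
      have "l \<le> ln 2" unfolding l_def using False j by (intro ln_mono) (auto simp: field_simps)
      moreover have "(1 - \<epsilon>) * l = l - \<epsilon> * l" by (simp add: algebra_simps)
      ultimately show ?thesis using a0 l0 C2(1) by linarith
    qed
    have "(1 - \<epsilon>) * l = l - \<epsilon> * l" by (simp add: algebra_simps)
    hence "\<bar>a - l\<bar> \<le> \<epsilon> * l + C" using 1 2 l0 C2(1) ln_ge_zero[of "2::real"] unfolding C_def by linarith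
    thus ?thesis by (simp add: a_def l_def)
  qed
  moreover have "C \<ge> 0" using C2(1) by (simp add: C_def)
  ultimately show ?thesis using that by blast
qed

lemma EM_small_window:
  assumes j: "\<And>m. m \<ge> 1 \<Longrightarrow> 1 \<le> j m \<and> j m \<le> m" and lim: "(\<lambda>m. real (j m) / real m) \<longlonglongrightarrow> 0"
  shows "(\<lambda>m. EM \<xi> m (j m)) \<sim>[at_top] (\<lambda>m. real (j m) * ln (real m / real (j m)))"
proof -
  define l where "l = (\<lambda>m. ln (real m / real (j m)))"
  have l: "filterlim l at_top sequentially"
  proof -
    have "filterlim (\<lambda>m. real (j m) / real m) (at_right 0) sequentially"
      unfolding filterlim_at
    proof (intro conjI lim)
      show "eventually (\<lambda>m. real (j m) / real m \<in> {0<..} \<and> real (j m) / real m \<noteq> 0) sequentially"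
        using eventually_ge_at_top[of 1]
      proof eventually_elim
        case (elim m) thus ?case using j[of m] by auto
      qed
    qed
    hence "filterlim (\<lambda>m. inverse (real (j m) / real m)) at_top sequentially"
      by (rule filterlim_compose[OF filterlim_inverse_at_top_right])
    hence "filterlim (\<lambda>m. ln (inverse (real (j m) / real m))) at_top sequentially"
      by (rule filterlim_compose[OF ln_at_top])
    thus ?thesis by (simp add: l_def)
  qed
  have "(\<lambda>m. EM \<xi> m (j m) / real (j m) / l m) \<longlonglongrightarrow> 1"
  proof (rule ratio_tendsto_1[OF l])
    fix e :: real assume e: "0 < e" "e < 1"
    obtain C where C: "\<And>m j. 1 \<le> j \<Longrightarrow> j \<le> m \<Longrightarrow> \<bar>EM \<xi> m j / real j - ln (real m / real j)\<bar> \<le> e * ln (real m / real j) + C"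
      using EM_log_bounds[OF e] by blast
    show "\<exists>C. eventually (\<lambda>m. \<bar>EM \<xi> m (j m) / real (j m) - l m\<bar> \<le> e * l m + C) sequentially"
      unfolding l_def using j C by (intro exI[of _ C] eventually_sequentiallyI[of 1]) auto
  qed
  hence "(\<lambda>m. EM \<xi> m (j m) / (real (j m) * l m)) \<longlonglongrightarrow> 1" by simp
  thus ?thesis unfolding l_def by (rule asymp_equivI')
qed

end

section \<open>Limits given survival\<close>

text \<open>Joint generating function of the values at the times in the list: E_z of the product of c ^ Z_k is
  its z-th power, s being the current time.\<close>

fun dval :: "nat pmf \<Rightarrow> nat \<Rightarrow> (nat \<times> real) list \<Rightarrow> real" where
  "dval p s [] = 1"
| "dval p s ((k, c) # r) = (gf p ^^ (k - s)) (c * dval p k r)"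

lemma dval_range:
  "\<forall>x\<in>set L. 0 \<le> snd x \<and> snd x \<le> 1 \<Longrightarrow> dval p s L \<in> {0..1}"
proof (induction L arbitrary: s)
  case (Cons x L)
  obtain k c where x: "x = (k, c)" by force
  have "dval p k L \<in> {0..1}" "0 \<le> c" "c \<le> 1" using Cons x by auto
  hence "0 \<le> c * dval p k L" "c * dval p k L \<le> 1" by (auto intro: mult_le_one)
  thus ?case using gf_iter_range[of "c * dval p k L", where p=p and n="k - s"] by (simp add: x)
qed auto

lemma prod_list_01:
  "\<forall>x\<in>set (L::'b list). 0 \<le> F x \<and> F x \<le> 1 \<Longrightarrow> 0 \<le> prod_list (map F L) \<and> prod_list (map F L) \<le> (1::real)"
  by (induction L) (auto intro: mult_le_one)

text \<open>Induction on the horizon. \<open>s\<close> is the absolute time of the current head, so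
  time k is read at position k - s. Inside, \<open>B\<close> treats lists whose times all lie after
  s; a factor at time s is the constant c ^ z.\<close>

lemma path_list_gf:
  assumes "\<forall>x\<in>set L. s \<le> fst x \<and> fst x \<le> s + n \<and> 0 \<le> snd x \<and> snd x \<le> 1" "sorted_wrt (<) (map fst L)"
  shows "pexp (gw_from p z n) (\<lambda>zs. prod_list (map (\<lambda>(k, c). c ^ (zs ! (k - s))) L)) = dval p s L ^ z"
  using assms
proof (induction n arbitrary: s z L)
  case 0
  show ?case
  proof (cases L)
    case (Cons x r)
    obtain k c where x: "x = (k, c)" by force
    have k: "k = s" using 0 Cons x by auto
    have "r = []"
    proof (rule ccontr)
      assume "r \<noteq> []"
      then obtain y r' where y: "r = y # r'" by (cases r) auto
      hence "fst x < fst y" "fst y \<le> s" using 0 Cons by auto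
      thus False using k x by auto
    qed
    thus ?thesis by (simp add: Cons x k)
  qed auto
next
  case (Suc n)
  have B: "pexp (gw_from p z (Suc n)) (\<lambda>zs. prod_list (map (\<lambda>(k, c). c ^ (zs ! (k - s))) L)) = dval p s L ^ z"
    if L: "\<forall>x\<in>set L. s < fst x \<and> fst x \<le> s + Suc n \<and> 0 \<le> snd x \<and> snd x \<le> 1" "sorted_wrt (<) (map fst L)" for L
  proof -
    have "pexp (gw_from p z (Suc n)) (\<lambda>zs. prod_list (map (\<lambda>(k, c). c ^ (zs ! (k - s))) L))
      = pexp (sum_iid p z) (\<lambda>y. pexp (gw_from p y n) (\<lambda>ys. prod_list (map (\<lambda>(k, c). c ^ ((z # ys) ! (k - s))) L)))"
    proof (rule gw_step[where B=1])
      fix zs :: "nat list"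
      have "\<forall>x\<in>set L. 0 \<le> (\<lambda>(k, c). c ^ (zs ! (k - s))) x \<and> (\<lambda>(k, c). c ^ (zs ! (k - s))) x \<le> 1"
        using L by (auto simp: power_le_one)
      from prod_list_01[OF this] show "0 \<le> prod_list (map (\<lambda>(k, c). c ^ (zs ! (k - s))) L)" "prod_list (map (\<lambda>(k, c). c ^ (zs ! (k - s))) L) \<le> 1" by auto
    qed
    also have "(\<lambda>y. pexp (gw_from p y n) (\<lambda>ys. prod_list (map (\<lambda>(k, c). c ^ ((z # ys) ! (k - s))) L)))
      = (\<lambda>y. pexp (gw_from p y n) (\<lambda>ys. prod_list (map (\<lambda>(k, c). c ^ (ys ! (k - Suc s))) L)))"
    proof (intro ext arg_cong[where f="pexp _"] arg_cong[where f=prod_list] map_cong refl)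
      fix ys x assume x: "x \<in> set L"
      obtain k c where kc: "x = (k, c)" by force
      have "k - s = Suc (k - Suc s)" using L x kc by auto
      thus "(case x of (k, c) \<Rightarrow> c ^ ((z # ys) ! (k - s))) = (case x of (k, c) \<Rightarrow> c ^ (ys ! (k - Suc s)))"
        by (simp add: kc)
    qed
    also have "\<dots> = (\<lambda>y. dval p (Suc s) L ^ y)"
      by (intro ext Suc.IH) (use L in auto)
    also have "pexp (sum_iid p z) (\<lambda>y. dval p (Suc s) L ^ y) = gf p (dval p (Suc s) L) ^ z"
      by (rule sum_iid_gf) (use dval_range[of L p "Suc s"] L in auto)
    also have "gf p (dval p (Suc s) L) = dval p s L"
    proof (cases L)
      case Nil thus ?thesis by (simp add: gf_1)
    next
      case (Cons x r)
      obtain k c where x: "x = (k, c)" by force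
      have "s < k" using L Cons x by auto
      hence ks: "k - s = Suc (k - Suc s)" by simp
      show ?thesis unfolding Cons x dval.simps ks by simp
    qed
    finally show ?thesis .
  qed
  show ?case
  proof (cases "\<exists>c r. L = (s, c) # r")
    case True
    then obtain c r where L: "L = (s, c) # r" by blast
    have "pexp (gw_from p z (Suc n)) (\<lambda>zs. prod_list (map (\<lambda>(k, c). c ^ (zs ! (k - s))) L))
      = pexp (gw_from p z (Suc n)) (\<lambda>zs. c ^ z * prod_list (map (\<lambda>(k, c). c ^ (zs ! (k - s))) r))"
      by (rule integral_cong_AE) (auto simp: AE_measure_pmf_iff L gw_from_length simp del: gw_from.simps)
    also have "\<dots> = c ^ z * dval p s r ^ z"
      using B[of r] Suc.prems unfolding L by (auto simp: less_imp_le simp del: gw_from.simps)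
    also have "\<dots> = dval p s L ^ z" by (simp add: L power_mult_distrib)
    finally show ?thesis .
  next
    case False
    have "s < fst x" if "x \<in> set L" for x
    proof (cases L)
      case (Cons y r)
      have "fst y \<noteq> s" using False Cons by (metis prod.collapse)
      hence "s < fst y" using Suc.prems Cons by fastforce
      moreover have "fst y \<le> fst x" using that Suc.prems Cons by auto
      ultimately show ?thesis by simp
    qed (use that in auto)
    thus ?thesis using Suc.prems by (intro B) auto
  qed
qed

text \<open>Scaling limits of 1 - dval. For Ulim nothing is imposed at time 1; Blim carries the indicator
  of extinction at time 1, i.e. an infinite argument there. Their difference is therefore the limit given survival.\<close>

fun Ulim :: "real \<Rightarrow> real \<Rightarrow> (real \<times> real) list \<Rightarrow> real" where
  "Ulim \<alpha> s [] = 0"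
| "Ulim \<alpha> s ((t, \<theta>) # r) = psi \<alpha> (t - s) (\<theta> + Ulim \<alpha> t r)"

fun Blim :: "real \<Rightarrow> real \<Rightarrow> (real \<times> real) list \<Rightarrow> real" where
  "Blim \<alpha> s [] = (1 - s) powr (-1/\<alpha>)"
| "Blim \<alpha> s ((t, \<theta>) # r) = (if t < 1 then psi \<alpha> (t - s) (\<theta> + Blim \<alpha> t r) else (1 - s) powr (-1/\<alpha>))"

lemma psi_nonneg: "0 \<le> psi \<alpha> t l" by (simp add: psi_def)

lemma Ulim_nonneg: "0 \<le> Ulim \<alpha> s L"
  by (cases L) (auto simp: psi_nonneg)

lemma Blim_nonneg: "0 \<le> Blim \<alpha> s L"
  by (cases L) (auto simp: psi_nonneg)

definition tf :: "nat \<Rightarrow> real \<Rightarrow> nat" where "tf J t = nat \<lfloor>t * real J\<rfloor>"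

lemma tf_0 [simp]: "tf J 0 = 0" by (simp add: tf_def)
lemma tf_1 [simp]: "tf J 1 = J" by (simp add: tf_def)
lemma tf_mono: "s \<le> t \<Longrightarrow> tf J s \<le> tf J t"
  unfolding tf_def by (intro nat_mono floor_mono mult_right_mono) auto

lemma tf_le: "t \<le> real D \<Longrightarrow> tf J t \<le> D * J"
proof -
  assume "t \<le> real D"
  hence "tf J t \<le> tf J (real D)" by (rule tf_mono)
  also have "tf J (real D) = D * J" unfolding tf_def of_nat_mult[symmetric] by (simp only: floor_of_nat nat_int)
  finally show ?thesis .
qed

lemma tf_diff_lim:
  assumes J: "filterlim J at_top sequentially" and s: "0 \<le> s" "s \<le> t"
  shows "(\<lambda>m. real (tf (J m) t - tf (J m) s) / real (J m)) \<longlonglongrightarrow> t - s"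
proof -
  have c: "(\<lambda>m. real (tf (J m) u) / real (J m)) \<longlonglongrightarrow> u" if "0 \<le> u" for u
  proof -
    have "(\<lambda>m. u - 1 / real (J m)) \<longlonglongrightarrow> u - 0"
      by (intro tendsto_intros tendsto_divide_0[OF tendsto_const] filterlim_at_top_imp_at_infinity
          filterlim_compose[OF filterlim_real_sequentially J])
    hence l: "(\<lambda>m. u - 1 / real (J m)) \<longlonglongrightarrow> u" by simp
    have b: "eventually (\<lambda>m. u - 1 / real (J m) \<le> real (tf (J m) u) / real (J m) \<and> real (tf (J m) u) / real (J m) \<le> u) sequentially"
      using filterlim_nat_eventually_pos[OF J]
    proof eventually_elim
      case (elim m)
      have "0 \<le> u * real (J m)" using that by simp
      hence "u * real (J m) - 1 \<le> real (tf (J m) u)" "real (tf (J m) u) \<le> u * real (J m)"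
        unfolding tf_def by linarith+
      hence "(u * real (J m) - 1) / real (J m) \<le> real (tf (J m) u) / real (J m)"
        "real (tf (J m) u) / real (J m) \<le> u * real (J m) / real (J m)"
        by (intro divide_right_mono; simp)+
      thus ?case using elim by (simp add: diff_divide_distrib)
    qed
    show ?thesis
      by (rule tendsto_sandwich[OF _ _ l tendsto_const[of u]]) (use b in \<open>auto elim: eventually_mono\<close>)
  qed
  have "(\<lambda>m. real (tf (J m) t) / real (J m) - real (tf (J m) s) / real (J m)) \<longlonglongrightarrow> t - s"
    using s by (intro tendsto_diff c) auto
  moreover have "real (tf (J m) t) / real (J m) - real (tf (J m) s) / real (J m) = real (tf (J m) t - tf (J m) s) / real (J m)" for m
    using tf_mono[OF s(2), of "J m"] by (simp add: of_nat_diff diff_divide_distrib)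
  ultimately show ?thesis by simp
qed

lemma tf_strict:
  assumes J: "filterlim J at_top sequentially" and s: "0 \<le> s" "s < t"
  shows "eventually (\<lambda>m. tf (J m) s < tf (J m) t) sequentially"
proof -
  have "eventually (\<lambda>m. 0 < real (tf (J m) t - tf (J m) s) / real (J m)) sequentially"
    by (rule order_tendstoD(1)[OF tf_diff_lim[OF J]]) (use s in auto)
  thus ?thesis by eventually_elim (auto simp: zero_less_divide_iff)
qed

context critical_gw
begin

definition dl :: "nat \<Rightarrow> (real \<times> real) list \<Rightarrow> (nat \<times> real) list" where
  "dl J tL = map (\<lambda>(t, \<theta>). (tf J t, exp (- \<theta> * Q J))) tL"

text \<open>The base 0 at time 1 yields 0 ^ Z_J, the indicator of extinction by generation J. On
  that event Z_J = 0, so the exponential factor belonging to time 1 equals 1.\<close>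

definition dk :: "nat \<Rightarrow> (real \<times> real) list \<Rightarrow> (nat \<times> real) list" where
  "dk J tL = map (\<lambda>(t, \<theta>). (tf J t, if t = 1 then 0 else exp (- \<theta> * Q J))) tL"

lemma dl_Cons: "dl J ((t, \<theta>) # r) = (tf J t, exp (- \<theta> * Q J)) # dl J r"
  and dk_Cons: "dk J ((t, \<theta>) # r) = (tf J t, if t = 1 then 0 else exp (- \<theta> * Q J)) # dk J r"
  by (simp_all add: dl_def dk_def)

lemma dl_range: "\<forall>x\<in>set tL. 0 \<le> snd x \<Longrightarrow> \<forall>x\<in>set (dl J tL). 0 \<le> snd x \<and> snd x \<le> 1"
  and dk_range: "\<forall>x\<in>set tL. 0 \<le> snd x \<Longrightarrow> \<forall>x\<in>set (dk J tL). 0 \<le> snd x \<and> snd x \<le> 1"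
  using Q_pos[of J] by (auto simp: dl_def dk_def less_imp_le)

text \<open>Both factors differ from 1 by a multiple of Q J. The defect of their product is
  (\<theta> + U) Q J to first order, and \<open>iter_scaling\<close> transports it through the
  generations between the two times.\<close>

lemma dval_step:
  assumes J: "filterlim J at_top sequentially" and t: "0 \<le> s" "s \<le> t" and \<theta>: "0 \<le> \<theta>"
    and v: "\<And>m. v m \<in> {0..1}" "(\<lambda>m. (1 - v m) / Q (J m)) \<longlonglongrightarrow> U"
  shows "(\<lambda>m. (1 - (gf \<xi> ^^ (tf (J m) t - tf (J m) s)) (exp (- \<theta> * Q (J m)) * v m)) / Q (J m)) \<longlonglongrightarrow> psi \<alpha> (t - s) (\<theta> + U)"
proof -
  define c where "c = (\<lambda>m. exp (- \<theta> * Q (J m)))"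
  have c: "0 \<le> c m" "c m \<le> 1" for m using \<theta> Q_pos[of "J m"] by (auto simp: c_def)
  define lam where "lam = (\<lambda>m. (1 - c m * v m) / Q (J m))"
  have x: "0 \<le> 1 - c m * v m" "1 - c m * v m \<le> 1" for m
    using c[of m] v(1)[of m] by (auto intro: mult_le_one)
  have Q0: "(\<lambda>m. Q (J m)) \<longlonglongrightarrow> 0" by (rule Q_seq_tendsto_0[OF J])
  have l1: "(\<lambda>m. (1 - c m) / Q (J m)) \<longlonglongrightarrow> \<theta>"
  proof -
    have "((\<lambda>x. 1 - exp (- \<theta> * x)) has_real_derivative \<theta>) (at 0)"
      by (auto intro!: derivative_eq_intros)
    hence "((\<lambda>x. (1 - exp (- \<theta> * x)) / x) \<longlongrightarrow> \<theta>) (at 0)"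
      by (simp add: has_field_derivative_iff)
    hence "((\<lambda>x. (1 - exp (- \<theta> * x)) / x) \<longlongrightarrow> \<theta>) (at_right 0)" by (rule tendsto_within_subset) auto
    thus ?thesis unfolding c_def by (rule at_right_0_seqD[OF _ Q0 Q_pos])
  qed
  have c1: "c \<longlonglongrightarrow> 1"
  proof -
    have "(\<lambda>m. exp (- \<theta> * Q (J m))) \<longlonglongrightarrow> exp (- \<theta> * 0)" by (intro tendsto_intros Q0)
    thus ?thesis by (simp add: c_def)
  qed
  have "(\<lambda>m. (1 - c m) / Q (J m) + c m * ((1 - v m) / Q (J m))) \<longlonglongrightarrow> \<theta> + 1 * U"
    by (intro tendsto_intros l1 c1 v(2))
  moreover have "(\<lambda>m. (1 - c m) / Q (J m) + c m * ((1 - v m) / Q (J m))) = lam"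
    by (simp add: lam_def add_divide_distrib[symmetric] algebra_simps)
  ultimately have lam: "lam \<longlonglongrightarrow> \<theta> + U" by simp
  have "(\<lambda>m. (h ^^ (tf (J m) t - tf (J m) s)) (Q (J m) * lam m) / Q (J m)) \<longlonglongrightarrow> psi \<alpha> (t - s) (\<theta> + U)"
  proof (rule iter_scaling[OF J tf_diff_lim[OF J t] lam])
    show "0 \<le> lam m" for m using x[of m] Q_pos[of "J m"] by (simp add: lam_def)
  qed (use t in auto)
  moreover have "(h ^^ k) (Q (J m) * lam m) = 1 - (gf \<xi> ^^ k) (c m * v m)" for k m
    using iter_gf[OF x, of k m] Q_pos[of "J m"] by (simp add: lam_def)
  ultimately show ?thesis by (simp add: c_def)
qed

lemma dval_dl_lim:
  assumes J: "filterlim J at_top sequentially"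
  shows "0 \<le> s \<Longrightarrow> \<forall>x\<in>set tL. s < fst x \<and> 0 \<le> snd x \<Longrightarrow> sorted_wrt (<) (map fst tL) \<Longrightarrow>
    (\<lambda>m. (1 - dval \<xi> (tf (J m) s) (dl (J m) tL)) / Q (J m)) \<longlonglongrightarrow> Ulim \<alpha> s tL"
proof (induction tL arbitrary: s)
  case Nil thus ?case by (simp add: dl_def)
next
  case (Cons x r)
  obtain t \<theta> where x: "x = (t, \<theta>)" by force
  have IH: "(\<lambda>m. (1 - dval \<xi> (tf (J m) t) (dl (J m) r)) / Q (J m)) \<longlonglongrightarrow> Ulim \<alpha> t r"
    by (rule Cons.IH) (use Cons.prems x in auto)
  show ?case unfolding x dl_Cons dval.simps Ulim.simps
    by (rule dval_step[OF J _ _ _ _ IH]) (use Cons.prems x dval_range[OF dl_range] in auto)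
qed

text \<open>The factor 0 at time 1 cuts off everything later: the iteration starts from 0 there, and
  its defect is the survival probability over the remaining time, treated by
  \<open>Q_ratio\<close>.\<close>

lemma dval_dk_lim:
  assumes J: "filterlim J at_top sequentially"
  shows "0 \<le> s \<Longrightarrow> s < 1 \<Longrightarrow> \<forall>x\<in>set tL. s < fst x \<and> 0 \<le> snd x \<Longrightarrow> sorted_wrt (<) (map fst tL) \<Longrightarrow> 1 \<in> fst ` set tL \<Longrightarrow>
    (\<lambda>m. (1 - dval \<xi> (tf (J m) s) (dk (J m) tL)) / Q (J m)) \<longlonglongrightarrow> Blim \<alpha> s tL"
proof (induction tL arbitrary: s)
  case Nil thus ?case by simp
next
  case (Cons x r)
  obtain t \<theta> where x: "x = (t, \<theta>)" by force
  show ?case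
  proof (cases "t < 1")
    case True
    have IH: "(\<lambda>m. (1 - dval \<xi> (tf (J m) t) (dk (J m) r)) / Q (J m)) \<longlonglongrightarrow> Blim \<alpha> t r"
      by (rule Cons.IH) (use Cons.prems x True in auto)
    have "(\<lambda>m. (1 - (gf \<xi> ^^ (tf (J m) t - tf (J m) s)) (exp (- \<theta> * Q (J m)) * dval \<xi> (tf (J m) t) (dk (J m) r))) / Q (J m)) \<longlonglongrightarrow> psi \<alpha> (t - s) (\<theta> + Blim \<alpha> t r)"
      by (rule dval_step[OF J _ _ _ _ IH]) (use Cons.prems x dval_range[OF dk_range] in auto)
    thus ?thesis using True by (simp add: x dk_Cons)
  next
    case False
    have t1: "t = 1"
    proof (rule ccontr)
      assume "t \<noteq> 1"
      hence "1 < t" using False by simp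
      moreover obtain y where "1 = fst y" "y \<in> set (x # r)" using Cons.prems(5) by (rule imageE)
      ultimately show False using Cons.prems(4) x by auto
    qed
    have "(\<lambda>m. Q (tf (J m) 1 - tf (J m) s) / Q (J m)) \<longlonglongrightarrow> (1 - s) powr (-1/\<alpha>)"
      by (rule Q_ratio[OF J tf_diff_lim[OF J]]) (use Cons.prems in auto)
    moreover have "1 - dval \<xi> (tf (J m) s) (dk (J m) (x # r)) = Q (tf (J m) 1 - tf (J m) s)" for m
      using iter_gf[of 1 "tf (J m) 1 - tf (J m) s"] by (simp add: x t1 dk_Cons Q_def)
    ultimately show ?thesis by (simp add: x t1)
  qed
qed

text \<open>The law of the path up to generation D * J given Z_J > 0. Lists of naturals form a
  countable discrete space, so every functional of the path is measurable.\<close>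

definition nu :: "nat \<Rightarrow> nat \<Rightarrow> nat list measure" where
  "nu D J = uniform_measure (measure_pmf (gw_from \<xi> 1 (D * J))) {zs. 0 < zs ! J}"

lemma surv_emeasure:
  assumes "1 \<le> D"
  shows "emeasure (measure_pmf (gw_from \<xi> 1 (D * J))) {zs. 0 < zs ! J} = ennreal (Q J)"
proof -
  have "J \<le> D * J" using assms by (cases D) auto
  thus ?thesis using path_extinct[of J "D * J"] by (simp add: measure_pmf.emeasure_eq_measure)
qed

lemma nu_prob: "1 \<le> D \<Longrightarrow> prob_space (nu D J)"
  unfolding nu_def by (rule prob_space_uniform_measure) (use surv_emeasure[of D J] Q_pos[of J] in auto)

lemma sets_nu [measurable_cong, simp]: "sets (nu D J) = sets (count_space UNIV)"
  and space_nu [simp]: "space (nu D J) = UNIV"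
  by (simp_all add: nu_def)

lemma nu_density:
  assumes "1 \<le> D"
  shows "nu D J = density (measure_pmf (gw_from \<xi> 1 (D * J))) (\<lambda>zs. ennreal (of_bool (0 < zs ! J) / Q J))"
proof -
  have "indicator {zs. 0 < zs ! J} zs / ennreal (Q J) = ennreal (of_bool (0 < zs ! J) / Q J)" for zs :: "nat list"
    using Q_pos[of J] by (auto simp: indicator_def divide_ennreal[symmetric] less_imp_le)
  thus ?thesis unfolding nu_def uniform_measure_def surv_emeasure[OF assms] by simp
qed

lemma nu_integral:
  fixes F :: "nat list \<Rightarrow> real"
  assumes "1 \<le> D"
  shows "(\<integral>zs. F zs \<partial>nu D J) = pexp (gw_from \<xi> 1 (D * J)) (\<lambda>zs. of_bool (0 < zs ! J) * F zs) / Q J"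
  unfolding nu_density[OF assms] using Q_pos[of J]
  by (subst integral_density) (auto simp: less_imp_le divide_simps mult_ac)

lemma nu_integrable:
  fixes F :: "nat list \<Rightarrow> real"
  assumes "1 \<le> D" "integrable (measure_pmf (gw_from \<xi> 1 (D * J))) F"
  shows "integrable (nu D J) F"
  unfolding nu_density[OF assms(1)] using Q_pos[of J]
proof (subst integrable_density)
  have "integrable (measure_pmf (gw_from \<xi> 1 (D * J))) (\<lambda>zs. F zs / Q J)" using assms by simp
  thus "integrable (measure_pmf (gw_from \<xi> 1 (D * J))) (\<lambda>zs. (of_bool (0 < zs ! J) / Q J) *\<^sub>R F zs)"
    by (rule Bochner_Integration.integrable_bound) (use Q_pos[of J] in \<open>auto simp: abs_mult less_imp_le\<close>)
qed (auto simp: less_imp_le)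

definition Y :: "nat \<Rightarrow> real \<Rightarrow> nat list \<Rightarrow> real" where
  "Y J t zs = Q J * real (zs ! tf J t)"

lemma Y_nonneg: "0 \<le> Y J t zs" using Q_pos[of J] by (simp add: Y_def less_imp_le)

lemma Y_integrable_pmf: "t \<le> real D \<Longrightarrow> integrable (measure_pmf (gw_from \<xi> 1 (D * J))) (Y J t)"
  unfolding Y_def by (intro integrable_mult_right path_integrable tf_le)

lemma Y_integrable: "1 \<le> D \<Longrightarrow> t \<le> real D \<Longrightarrow> integrable (nu D J) (Y J t)"
  by (intro nu_integrable Y_integrable_pmf)

text \<open>Given survival the transform is the full one minus the one on extinction, divided by Q
  J. Expressing both through their distance to 1 turns it into a difference of two convergent
  quotients. Time 1 must be in the list to carry the extinction indicator; its weight may be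
  0.\<close>

lemma Y_fdd_lim:
  assumes J: "filterlim J at_top sequentially" and D: "1 \<le> D"
    and tL: "\<forall>x\<in>set tL. 0 < fst x \<and> fst x \<le> real D \<and> 0 \<le> snd x" "sorted_wrt (<) (map fst tL)" "1 \<in> fst ` set tL"
  shows "(\<lambda>m. \<integral>zs. exp (- (\<Sum>x\<leftarrow>tL. snd x * Y (J m) (fst x) zs)) \<partial>nu D (J m)) \<longlonglongrightarrow> Blim \<alpha> 0 tL - Ulim \<alpha> 0 tL"
    and "(\<lambda>m. (1 - pexp (gw_from \<xi> 1 (D * J m)) (\<lambda>zs. of_bool (zs ! J m = 0) * exp (- (\<Sum>x\<leftarrow>tL. snd x * Y (J m) (fst x) zs)))) / Q (J m)) \<longlonglongrightarrow> Blim \<alpha> 0 tL"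
proof -
  let ?p = "\<lambda>m. gw_from \<xi> 1 (D * J m)"
  let ?E = "\<lambda>m zs. exp (- (\<Sum>x\<leftarrow>tL. snd x * Y (J m) (fst x) zs))"
  have lU: "(\<lambda>m. (1 - dval \<xi> (tf (J m) 0) (dl (J m) tL)) / Q (J m)) \<longlonglongrightarrow> Ulim \<alpha> 0 tL"
    by (rule dval_dl_lim[OF J]) (use tL in auto)
  have lB: "(\<lambda>m. (1 - dval \<xi> (tf (J m) 0) (dk (J m) tL)) / Q (J m)) \<longlonglongrightarrow> Blim \<alpha> 0 tL"
    by (rule dval_dk_lim[OF J]) (use tL in auto)
  \<comment> \<open>For small J distinct times can fall into the same generation; their integer
    parts are strictly increasing only eventually.\<close>
  have evs: "eventually (\<lambda>m. sorted_wrt (<) (map (tf (J m)) (map fst tL))) sequentially"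
    using tL(1,2)
  proof (induction tL)
    case (Cons x r)
    have "eventually (\<lambda>m. \<forall>y\<in>set r. tf (J m) (fst x) < tf (J m) (fst y)) sequentially"
      using Cons.prems by (intro eventually_ball_finite ballI tf_strict[OF J]) auto
    moreover have "eventually (\<lambda>m. sorted_wrt (<) (map (tf (J m)) (map fst r))) sequentially"
      using Cons by auto
    ultimately show ?case by eventually_elim auto
  qed auto
  have e1: "?E m zs = prod_list (map (\<lambda>(k, c). c ^ (zs ! (k - 0))) (dl (J m) tL))" for m zs
    by (induction tL) (auto simp: dl_def Y_def exp_add exp_minus exp_diff exp_of_nat_mult[symmetric] mult_ac divide_inverse simp flip: exp_minus)
  have e2: "prod_list (map (\<lambda>(k, c). c ^ (zs ! (k - 0))) (dk (J m) tL)) = of_bool (zs ! J m = 0) * ?E m zs" for m zs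
  proof (cases "zs ! J m = 0")
    case True
    have "prod_list (map (\<lambda>(k, c). c ^ (zs ! (k - 0))) (dk (J m) tL)) = prod_list (map (\<lambda>(k, c). c ^ (zs ! (k - 0))) (dl (J m) tL))"
      using True by (auto simp: dk_def dl_def intro!: arg_cong[where f=prod_list])
    thus ?thesis using True e1 by simp
  next
    case False
    have "0 \<in> set (map (\<lambda>(k, c). c ^ (zs ! (k - 0))) (dk (J m) tL))"
      using tL(3) False by (force simp: dk_def image_iff)
    thus ?thesis using False by (simp add: prod_list_zero_iff)
  qed
  have v: "eventually (\<lambda>m. pexp (?p m) (?E m) = dval \<xi> 0 (dl (J m) tL)
      \<and> pexp (?p m) (\<lambda>zs. of_bool (zs ! J m = 0) * ?E m zs) = dval \<xi> 0 (dk (J m) tL)) sequentially"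
    using evs
  proof eventually_elim
    case (elim m)
    have s1: "sorted_wrt (<) (map fst (dl (J m) tL))" "sorted_wrt (<) (map fst (dk (J m) tL))"
      using elim by (auto simp: dl_def dk_def case_prod_unfold o_def)
    have r: "\<forall>x\<in>set (dl (J m) tL). 0 \<le> fst x \<and> fst x \<le> 0 + D * J m \<and> 0 \<le> snd x \<and> snd x \<le> 1"
      "\<forall>x\<in>set (dk (J m) tL). 0 \<le> fst x \<and> fst x \<le> 0 + D * J m \<and> 0 \<le> snd x \<and> snd x \<le> 1"
      using tL(1) dl_range[of tL "J m"] dk_range[of tL "J m"] tf_le[of _ D "J m"] by (auto simp: dl_def dk_def)
    show ?case
      using path_list_gf[OF r(1) s1(1), of \<xi> 1] path_list_gf[OF r(2) s1(2), of \<xi> 1]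
      unfolding e1[symmetric] e2 by simp
  qed
  have Ei: "integrable (measure_pmf (?p m)) (\<lambda>zs. ?E m zs)" for m
    by (rule integrable_pmf_nonneg_bounded[where B=1])
       (use tL in \<open>auto intro!: sum_list_nonneg mult_nonneg_nonneg Y_nonneg\<close>)
  have Ei0: "integrable (measure_pmf (?p m)) (\<lambda>zs. of_bool (zs ! J m = 0) * ?E m zs)" for m
    by (rule Bochner_Integration.integrable_bound[OF Ei[of m]]) auto
  have "eventually (\<lambda>m. (\<integral>zs. ?E m zs \<partial>nu D (J m)) = (1 - dval \<xi> 0 (dk (J m) tL)) / Q (J m) - (1 - dval \<xi> 0 (dl (J m) tL)) / Q (J m)) sequentially"
    using v
  proof eventually_elim
    case (elim m)
    have "pexp (?p m) (\<lambda>zs. of_bool (0 < zs ! J m) * ?E m zs)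
      = pexp (?p m) (\<lambda>zs. ?E m zs - of_bool (zs ! J m = 0) * ?E m zs)"
      by (rule Bochner_Integration.integral_cong) auto
    also have "\<dots> = dval \<xi> 0 (dl (J m) tL) - dval \<xi> 0 (dk (J m) tL)"
      using elim Ei Ei0 by (subst Bochner_Integration.integral_diff) auto
    finally show ?case unfolding nu_integral[OF D] by (simp add: diff_divide_distrib[symmetric])
  qed
  moreover have "(\<lambda>m. (1 - dval \<xi> 0 (dk (J m) tL)) / Q (J m) - (1 - dval \<xi> 0 (dl (J m) tL)) / Q (J m)) \<longlonglongrightarrow> Blim \<alpha> 0 tL - Ulim \<alpha> 0 tL"
    using tendsto_diff[OF lB lU] by simp
  ultimately show "(\<lambda>m. \<integral>zs. ?E m zs \<partial>nu D (J m)) \<longlonglongrightarrow> Blim \<alpha> 0 tL - Ulim \<alpha> 0 tL"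
    by (simp add: tendsto_cong)
  have "eventually (\<lambda>m. (1 - pexp (?p m) (\<lambda>zs. of_bool (zs ! J m = 0) * ?E m zs)) / Q (J m) = (1 - dval \<xi> 0 (dk (J m) tL)) / Q (J m)) sequentially"
    using v by eventually_elim simp
  note cong = tendsto_cong[OF this]
  show "(\<lambda>m. (1 - pexp (?p m) (\<lambda>zs. of_bool (zs ! J m = 0) * ?E m zs)) / Q (J m)) \<longlonglongrightarrow> Blim \<alpha> 0 tL"
    using lB unfolding cong by simp
qed

end

text \<open>The mean of X* at time u.\<close>

definition mulim :: "real \<Rightarrow> real \<Rightarrow> real" where
  "mulim \<alpha> u = (if u < 1 then 1 - (1 - u) powr (1 + 1 / \<alpha>) else 1)"

lemma psi_pos_eq: "0 < l \<Longrightarrow> psi \<alpha> t l = (t + l powr (-\<alpha>)) powr (-1/\<alpha>)"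
  by (simp add: psi_def)

lemma psi_0 [simp]: "psi \<alpha> t 0 = 0" by (simp add: psi_def)

lemma psi_semigroup:
  assumes "0 < \<alpha>" "0 \<le> s" "0 \<le> t" "0 \<le> l"
  shows "psi \<alpha> s (psi \<alpha> t l) = psi \<alpha> (s + t) l"
proof (cases "l = 0")
  case False
  hence l: "0 < l" using assms by simp
  have b: "0 < t + l powr (-\<alpha>)" using assms l by (intro add_nonneg_pos) auto
  hence "0 < psi \<alpha> t l" using l by (simp add: psi_pos_eq)
  moreover have "psi \<alpha> t l powr (-\<alpha>) = t + l powr (-\<alpha>)"
    using l b assms by (simp add: psi_pos_eq powr_powr)
  ultimately show ?thesis using l by (simp add: psi_pos_eq add.assoc)
qed simp

lemma psi_over_id:
  assumes "0 < \<alpha>" "0 \<le> t" shows "((\<lambda>e. psi \<alpha> t e / e) \<longlongrightarrow> 1) (at_right 0)"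
proof -
  have "((\<lambda>c. (t * c powr \<alpha> + 1) powr (-1/\<alpha>)) \<longlongrightarrow> (t * 0 powr \<alpha> + 1) powr (-1/\<alpha>)) (at_right 0)"
    using assms by (intro tendsto_intros) (auto simp: eventually_at_right_less eventually_mono[OF eventually_at_right_less])
  moreover have "eventually (\<lambda>c. (t * c powr \<alpha> + 1) powr (-1/\<alpha>) = psi \<alpha> t c / c) (at_right 0)"
    using eventually_at_right_less[of 0]
  proof eventually_elim
    case (elim c)
    have "t + c powr (-\<alpha>) = c powr (-\<alpha>) * (t * c powr \<alpha> + 1)"
      using elim by (simp add: algebra_simps powr_minus)
    hence "psi \<alpha> t c = c * (t * c powr \<alpha> + 1) powr (-1/\<alpha>)"
      using elim assms by (simp add: psi_pos_eq powr_mult powr_powr)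
    thus ?case using elim by simp
  qed
  ultimately show ?thesis using assms by (auto intro: Lim_transform_eventually)
qed

text \<open>psi \<alpha> u equals 1 at l = (1 - u)^(-1/\<alpha>), so this is a difference quotient
  at l. The derivative there is (psi / l)^(1 + \<alpha>) = l^(-1 - \<alpha>). It is the limit of the
  mean of Z_{uJ} on extinction.\<close>

lemma psi_deriv_at_surv:
  assumes a: "0 < \<alpha>" and u: "0 \<le> u" "u < 1"
  shows "((\<lambda>e. (psi \<alpha> u (e + (1 - u) powr (-1/\<alpha>)) - 1) / e) \<longlongrightarrow> (1 - u) powr (1 + 1 / \<alpha>)) (at_right 0)"
proof -
  define l where "l = (1 - u) powr (-1/\<alpha>)"
  have l: "0 < l" using u by (simp add: l_def)
  have la: "l powr (-\<alpha>) = 1 - u" using a u by (simp add: l_def powr_powr)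
  have lb: "l powr (-\<alpha> - 1) = (1 - u) powr (1 + 1 / \<alpha>)"
  proof -
    have "(-1/\<alpha>) * (-\<alpha> - 1) = 1 + 1 / \<alpha>" using a by (simp add: field_simps)
    thus ?thesis unfolding l_def powr_powr by simp
  qed
  have "((\<lambda>x. (u + x powr (-\<alpha>)) powr (-1/\<alpha>)) has_real_derivative (-1/\<alpha>) * (u + l powr (-\<alpha>)) powr (-1/\<alpha> - 1) * (0 + (-\<alpha>) * l powr (-\<alpha> - 1))) (at l)"
    by (rule DERIV_fun_powr[where r="-1/\<alpha>", THEN DERIV_cong] derivative_intros has_real_derivative_powr l)+ (use la l in auto)
  hence "((\<lambda>x. (u + x powr (-\<alpha>)) powr (-1/\<alpha>)) has_real_derivative (1 - u) powr (1 + 1 / \<alpha>)) (at l)"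
    using a by (simp add: la lb)
  hence "((\<lambda>e. ((u + (l + e) powr (-\<alpha>)) powr (-1/\<alpha>) - (u + l powr (-\<alpha>)) powr (-1/\<alpha>)) / e) \<longlongrightarrow> (1 - u) powr (1 + 1 / \<alpha>)) (at 0)"
    by (simp add: DERIV_def)
  hence "((\<lambda>e. ((u + (l + e) powr (-\<alpha>)) powr (-1/\<alpha>) - (u + l powr (-\<alpha>)) powr (-1/\<alpha>)) / e) \<longlongrightarrow> (1 - u) powr (1 + 1 / \<alpha>)) (at_right 0)"
    by (rule tendsto_within_subset) auto
  moreover have "eventually (\<lambda>e. ((u + (l + e) powr (-\<alpha>)) powr (-1/\<alpha>) - (u + l powr (-\<alpha>)) powr (-1/\<alpha>)) / e = (psi \<alpha> u (e + l) - 1) / e) (at_right 0)"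
    using eventually_at_right_less[of 0]
  proof eventually_elim
    case (elim e)
    thus ?case using l by (simp add: psi_pos_eq la add.commute)
  qed
  ultimately show ?thesis unfolding l_def[symmetric] by (auto intro: Lim_transform_eventually)
qed

text \<open>The difference in the numerator is \<open>Blim\<close> minus \<open>Ulim\<close> for the
  times u and 1 with weights e and 0, that is the Laplace transform of the limit process at time u;
  the quotient therefore tends to the mean.\<close>

lemma surv_diff_lim:
  assumes a: "0 < \<alpha>" and u: "0 \<le> u" "u < 1"
  shows "((\<lambda>e. (1 - (psi \<alpha> u (e + (1 - u) powr (-1/\<alpha>)) - psi \<alpha> u e)) / e) \<longlongrightarrow> mulim \<alpha> u) (at_right 0)"
proof -
  have "((\<lambda>e. psi \<alpha> u e / e - (psi \<alpha> u (e + (1 - u) powr (-1/\<alpha>)) - 1) / e) \<longlongrightarrow> 1 - (1 - u) powr (1 + 1 / \<alpha>)) (at_right 0)"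
    by (intro tendsto_diff psi_over_id psi_deriv_at_surv a u)
  moreover have "psi \<alpha> u e / e - (psi \<alpha> u (e + (1 - u) powr (-1/\<alpha>)) - 1) / e = (1 - (psi \<alpha> u (e + (1 - u) powr (-1/\<alpha>)) - psi \<alpha> u e)) / e" for e
    unfolding diff_divide_distrib[symmetric] by simp
  ultimately show ?thesis using u by (simp add: mulim_def)
qed

lemma mulim_range: "0 < \<alpha> \<Longrightarrow> 0 \<le> u \<Longrightarrow> mulim \<alpha> u \<in> {0..1}"
  by (auto simp: mulim_def powr_le1)

section \<open>Means given survival\<close>

context critical_gw
begin

lemma nu_mean_eq:
  assumes "1 \<le> D"
  shows "(\<integral>zs. Y J t zs \<partial>nu D J) = pexp (gw_from \<xi> 1 (D * J)) (\<lambda>zs. of_bool (0 < zs ! J) * real (zs ! tf J t))"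
proof -
  have "pexp (gw_from \<xi> 1 (D * J)) (\<lambda>zs. of_bool (0 < zs ! J) * Y J t zs)
     = pexp (gw_from \<xi> 1 (D * J)) (\<lambda>zs. Q J * (of_bool (0 < zs ! J) * real (zs ! tf J t)))"
    by (simp add: Y_def mult_ac)
  thus ?thesis unfolding nu_integral[OF assms] using Q_pos[of J] by simp
qed

text \<open>The unconditioned mean is 1 by criticality, so the mean on extinction and the mean given
  survival determine each other.\<close>

lemma nu_mean_compl:
  assumes "1 \<le> D" "t \<le> real D"
  shows "pexp (gw_from \<xi> 1 (D * J)) (\<lambda>zs. of_bool (zs ! J = 0) * real (zs ! tf J t)) = 1 - (\<integral>zs. Y J t zs \<partial>nu D J)"
proof -
  let ?p = "gw_from \<xi> 1 (D * J)"
  have i: "integrable (measure_pmf ?p) (\<lambda>zs. real (zs ! tf J t))" by (intro path_integrable tf_le assms)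
  have i2: "integrable (measure_pmf ?p) (\<lambda>zs. of_bool (R zs) * real (zs ! tf J t))" for R
    by (rule Bochner_Integration.integrable_bound[OF i]) auto
  have "pexp ?p (\<lambda>zs. of_bool (zs ! J = 0) * real (zs ! tf J t)) + pexp ?p (\<lambda>zs. of_bool (0 < zs ! J) * real (zs ! tf J t))
     = pexp ?p (\<lambda>zs. real (zs ! tf J t))"
    unfolding Bochner_Integration.integral_add[OF i2 i2, symmetric]
    by (rule Bochner_Integration.integral_cong) auto
  also have "\<dots> = 1" using path_expectation[OF tf_le[OF assms(2), of J], of 1] by simp
  finally show ?thesis unfolding nu_mean_eq[OF assms(1)] by simp
qed

lemma nu_mean_range:
  assumes "1 \<le> D" "t \<le> real D"
  shows "0 \<le> (\<integral>zs. Y J t zs \<partial>nu D J)" "(\<integral>zs. Y J t zs \<partial>nu D J) \<le> 1"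
proof -
  show "0 \<le> (\<integral>zs. Y J t zs \<partial>nu D J)" by (intro Bochner_Integration.integral_nonneg Y_nonneg)
  have "0 \<le> pexp (gw_from \<xi> 1 (D * J)) (\<lambda>zs. of_bool (zs ! J = 0) * real (zs ! tf J t))"
    by (intro Bochner_Integration.integral_nonneg) auto
  thus "(\<integral>zs. Y J t zs \<partial>nu D J) \<le> 1" unfolding nu_mean_compl[OF assms] by simp
qed

text \<open>From 1 - exp (- x) <= x the transform given survival bounds the mean from below. The
  same inequality on extinction bounds the complementary mean from below, hence the first one from
  above. Both bounds converge, and as e tends to 0 their limits meet; no uniform integrability is
  presupposed. For u >= 1 absorption makes the complementary mean 0.\<close>

lemma nu_mean_lim:
  assumes J: "filterlim J at_top sequentially" and D: "1 \<le> D" and u: "0 < u" "u \<le> real D"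
  shows "(\<lambda>m. \<integral>zs. Y (J m) u zs \<partial>nu D (J m)) \<longlonglongrightarrow> mulim \<alpha> u"
proof (cases "u < 1")
  case False
  have "(\<integral>zs. Y (J m) u zs \<partial>nu D (J m)) = 1" for m
  proof -
    let ?p = "gw_from \<xi> 1 (D * J m)"
    have JJ: "J m \<le> tf (J m) u" using tf_mono[of 1 u "J m"] False by simp
    have "pexp ?p (\<lambda>zs. of_bool (zs ! J m = 0) * real (zs ! tf (J m) u)) = pexp ?p (\<lambda>zs. 0)"
    proof (rule integral_cong_AE)
      show "AE zs in measure_pmf ?p. of_bool (zs ! J m = 0) * real (zs ! tf (J m) u) = 0"
      proof (unfold AE_measure_pmf_iff, intro ballI)
        fix zs assume "zs \<in> set_pmf ?p"
        from gw_from_absorbing[OF this JJ tf_le[OF u(2)]]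
        show "of_bool (zs ! J m = 0) * real (zs ! tf (J m) u) = 0" by (cases "zs ! J m = 0") auto
      qed
    qed auto
    thus ?thesis using nu_mean_compl[OF D u(2), of "J m"] by simp
  qed
  thus ?thesis using False by (simp add: mulim_def)
next
  case True
  define l where "l = (1 - u) powr (-1/\<alpha>)"
  define b1 where "b1 = (1 - u) powr (1 + 1 / \<alpha>)"
  define a where "a = (\<lambda>m. \<integral>zs. Y (J m) u zs \<partial>nu D (J m))"
  let ?E = "\<lambda>e m. \<integral>zs. exp (- (e * Y (J m) u zs)) \<partial>nu D (J m)"
  let ?B = "\<lambda>e m. pexp (gw_from \<xi> 1 (D * J m)) (\<lambda>zs. of_bool (zs ! J m = 0) * exp (- (e * Y (J m) u zs)))"
  have ml: "mulim \<alpha> u = 1 - b1" using True by (simp add: mulim_def b1_def)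
  have fdd: "(\<lambda>m. ?E e m) \<longlonglongrightarrow> psi \<alpha> u (e + l) - psi \<alpha> u e"
    and fddB: "(\<lambda>m. (1 - ?B e m) / Q (J m)) \<longlonglongrightarrow> psi \<alpha> u (e + l)"
    if e: "0 < e" for e
    using Y_fdd_lim[OF J D, of "[(u, e), (1, 0)]"] u True e D by (auto simp: l_def)
  have x1: "1 - exp (- (e * y)) \<le> e * y" for e y :: real
    using exp_ge_add_one_self[of "- (e * y)"] by simp
  have la: "(1 - ?E e m) / e \<le> a m" if e: "0 < e" for e m
  proof -
    interpret prob_space "nu D (J m)" by (rule nu_prob[OF D])
    have ie: "integrable (nu D (J m)) (\<lambda>zs. exp (- (e * Y (J m) u zs)))"
      by (rule integrable_const_bound[where B=1]) (use e Y_nonneg in auto)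
    have "1 - ?E e m = (\<integral>zs. 1 - exp (- (e * Y (J m) u zs)) \<partial>nu D (J m))"
      using ie by (subst Bochner_Integration.integral_diff) (auto simp: prob_space[unfolded space_nu])
    also have "\<dots> \<le> (\<integral>zs. e * Y (J m) u zs \<partial>nu D (J m))"
      by (intro integral_mono x1) (use ie Y_integrable[OF D u(2)] in auto)
    also have "\<dots> = e * a m" by (simp add: a_def)
    finally show ?thesis using e by (simp add: field_simps)
  qed
  \<comment> \<open>Survival itself contributes Q (J m) to 1 - ?B, hence the subtracted 1 after
    division by Q (J m).\<close>
  have lb: "((1 - ?B e m) / Q (J m) - 1) / e \<le> 1 - a m"
    if e: "0 < e" for e m
  proof -
    let ?p = "gw_from \<xi> 1 (D * J m)"
    have i0: "integrable (measure_pmf ?p) (\<lambda>zs. of_bool (zs ! J m = 0) :: real)"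
      by (rule integrable_pmf_nonneg_bounded[where B=1]) auto
    have i1: "integrable (measure_pmf ?p) (\<lambda>zs. of_bool (zs ! J m = 0) * exp (- (e * Y (J m) u zs)))"
      by (rule integrable_pmf_nonneg_bounded[where B=1]) (use e Y_nonneg in auto)
    have i2: "integrable (measure_pmf ?p) (\<lambda>zs. of_bool (zs ! J m = 0) * real (zs ! tf (J m) u))"
      by (rule Bochner_Integration.integrable_bound[OF path_integrable[OF tf_le[OF u(2)]]]) auto
    have JD: "J m \<le> D * J m" using D by (cases D) auto
    have pz: "pexp ?p (\<lambda>zs. of_bool (zs ! J m = 0)) = 1 - Q (J m)"
    proof -
      have "pexp ?p (\<lambda>zs. of_bool (zs ! J m = 0)) = pprob ?p {zs. zs ! J m = 0}"
        unfolding prob_of_bool ..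
      also have "\<dots> = 1 - pprob ?p {zs. 0 < zs ! J m}"
        by (subst prob_compl_of_bool) simp
      finally show ?thesis using path_extinct[OF JD] by simp
    qed
    have "1 - Q (J m) - ?B e m
      = pexp ?p (\<lambda>zs. of_bool (zs ! J m = 0) - of_bool (zs ! J m = 0) * exp (- (e * Y (J m) u zs)))"
      unfolding pz[symmetric] using i0 i1 by simp
    also have "\<dots> \<le> pexp ?p (\<lambda>zs. (e * Q (J m)) * (of_bool (zs ! J m = 0) * real (zs ! tf (J m) u)))"
    proof (rule integral_mono)
      show "of_bool (zs ! J m = 0) - of_bool (zs ! J m = 0) * exp (- (e * Y (J m) u zs)) \<le> (e * Q (J m)) * (of_bool (zs ! J m = 0) * real (zs ! tf (J m) u))" for zs
        using x1[of e "Y (J m) u zs"] by (cases "zs ! J m = 0") (auto simp: Y_def mult_ac)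
    qed (use i0 i1 i2 in auto)
    also have "\<dots> = e * Q (J m) * (1 - a m)"
      using nu_mean_compl[OF D u(2), of "J m"] by (simp add: a_def)
    finally have le: "1 - Q (J m) - ?B e m \<le> e * Q (J m) * (1 - a m)" .
    define b where "b = ?B e m"
    have "(1 - b) / Q (J m) - 1 = (1 - Q (J m) - b) / Q (J m)" using Q_pos[of "J m"] by (simp add: field_simps)
    also have "\<dots> \<le> (e * Q (J m) * (1 - a m)) / Q (J m)"
      using le Q_pos[of "J m"] unfolding b_def by (intro divide_right_mono) auto
    also have "\<dots> = e * (1 - a m)" using Q_pos[of "J m"] by simp
    finally have "((1 - b) / Q (J m) - 1) / e \<le> e * (1 - a m) / e" using e by (intro divide_right_mono) auto
    thus ?thesis using e by (simp add: b_def)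
  qed
  show ?thesis unfolding a_def[symmetric]
  proof (rule order_tendstoI)
    fix y assume "y < mulim \<alpha> u"
    hence "eventually (\<lambda>e. y < (1 - (psi \<alpha> u (e + l) - psi \<alpha> u e)) / e) (at_right 0)"
      unfolding l_def by (intro order_tendstoD(1)[OF surv_diff_lim]) (use alpha u True in auto)
    moreover have "eventually (\<lambda>e. 0 < e) (at_right (0::real))" by (rule eventually_at_right_less)
    ultimately have "eventually (\<lambda>e. y < (1 - (psi \<alpha> u (e + l) - psi \<alpha> u e)) / e \<and> 0 < e) (at_right 0)" by eventually_elim auto
    then obtain e where e: "y < (1 - (psi \<alpha> u (e + l) - psi \<alpha> u e)) / e" "0 < e" using eventually_happens by fastforce
    have "(\<lambda>m. (1 - ?E e m) / e) \<longlonglongrightarrow> (1 - (psi \<alpha> u (e + l) - psi \<alpha> u e)) / e"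
      by (intro tendsto_intros fdd e) (use e in auto)
    hence "eventually (\<lambda>m. y < (1 - ?E e m) / e) sequentially"
      using e(1) by (rule order_tendstoD)
    thus "eventually (\<lambda>m. y < a m) sequentially"
      by eventually_elim (rule less_le_trans[OF _ la[OF e(2)]])
  next
    fix y assume "mulim \<alpha> u < y"
    hence "1 - y < b1" by (simp add: ml)
    hence "eventually (\<lambda>e. 1 - y < (psi \<alpha> u (e + l) - 1) / e) (at_right 0)"
      unfolding l_def b1_def by (intro order_tendstoD(1)[OF psi_deriv_at_surv]) (use alpha u True in auto)
    moreover have "eventually (\<lambda>e. 0 < e) (at_right (0::real))" by (rule eventually_at_right_less)
    ultimately have "eventually (\<lambda>e. 1 - y < (psi \<alpha> u (e + l) - 1) / e \<and> 0 < e) (at_right 0)" by eventually_elim auto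
    then obtain e where e: "1 - y < (psi \<alpha> u (e + l) - 1) / e" "0 < e" using eventually_happens by fastforce
    have "(\<lambda>m. ((1 - ?B e m) / Q (J m) - 1) / e)
       \<longlonglongrightarrow> (psi \<alpha> u (e + l) - 1) / e"
      by (intro tendsto_divide tendsto_diff tendsto_const fddB e) (use e in auto)
    hence "eventually (\<lambda>m. 1 - y < ((1 - ?B e m) / Q (J m) - 1) / e) sequentially"
      using e(1) by (rule order_tendstoD)
    thus "eventually (\<lambda>m. a m < y) sequentially"
    proof eventually_elim
      case (elim m)
      thus ?case using lb[OF e(2), of m] by linarith
    qed
  qed
qed

end

text \<open>Monotone-class device: both sides of the finite-dimensional formula have these properties in each
  single test function, so they agree for all nonnegative measurable ones as soon as they agree for indicators.\<close>

definition nnlin :: "((real \<Rightarrow> ennreal) \<Rightarrow> ennreal) \<Rightarrow> bool" where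
  "nnlin F \<longleftrightarrow>
     (\<forall>c. \<forall>g\<in>borel_measurable borel. F (\<lambda>x. c * g x) = c * F g) \<and>
     (\<forall>f\<in>borel_measurable borel. \<forall>g\<in>borel_measurable borel. F (\<lambda>x. f x + g x) = F f + F g) \<and>
     (\<forall>U::nat \<Rightarrow> real \<Rightarrow> ennreal. (\<forall>i. U i \<in> borel_measurable borel) \<longrightarrow> incseq U \<longrightarrow> F (\<lambda>x. SUP i. U i x) = (SUP i. F (U i)))"

lemma nnlin_mult: "nnlin F \<Longrightarrow> g \<in> borel_measurable borel \<Longrightarrow> F (\<lambda>x. c * g x) = c * F g"
  and nnlin_add: "nnlin F \<Longrightarrow> f \<in> borel_measurable borel \<Longrightarrow> g \<in> borel_measurable borel \<Longrightarrow> F (\<lambda>x. f x + g x) = F f + F g"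
  and nnlin_SUP: "nnlin F \<Longrightarrow> (\<And>i. U i \<in> borel_measurable borel) \<Longrightarrow> incseq U \<Longrightarrow> F (\<lambda>x. SUP i. U i x) = (SUP i. F (U (i::nat)))"
  by (auto simp: nnlin_def)

lemma nnlin_mono:
  assumes "nnlin F" "f \<in> borel_measurable borel" "g \<in> borel_measurable borel" "f \<le> g"
  shows "F f \<le> F g"
proof -
  define U where "U = (\<lambda>i::nat. if i = 0 then f else g)"
  have inc: "incseq U" using assms(4) by (auto simp: U_def incseq_def)
  have "(SUP i. U i x) = g x" for x
  proof (rule antisym)
    show "(SUP i. U i x) \<le> g x" using assms(4) by (intro SUP_least) (auto simp: U_def le_fun_def)
    show "g x \<le> (SUP i. U i x)" by (rule SUP_upper2[of 1]) (auto simp: U_def)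
  qed
  hence "F g = (SUP i. F (U i))" using nnlin_SUP[OF assms(1), of U] assms(2,3) inc by (simp add: U_def)
  moreover have "F (U 0) \<le> (SUP i. F (U i))" by (rule SUP_upper) simp
  ultimately show ?thesis by (simp add: U_def)
qed

lemma nnlin_eq:
  assumes F: "nnlin F" and G: "nnlin G" and ind: "\<And>A. A \<in> sets borel \<Longrightarrow> F (indicator A) = G (indicator A)"
    and g: "g \<in> borel_measurable borel"
  shows "F g = G g"
  using g
proof (induction rule: borel_measurable_induct)
  case (cong f g)
  hence "f = g" by auto
  thus ?case using cong by simp
next
  case (set A) thus ?case by (rule ind)
next
  case (mult u c) thus ?case by (simp add: nnlin_mult[OF F] nnlin_mult[OF G])
next
  case (add u v) thus ?case by (simp add: nnlin_add[OF F] nnlin_add[OF G])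
next
  case (seq U)
  have "(\<Squnion> range U) = (\<lambda>x. SUP i. U i x)" by (auto simp: fun_eq_iff image_comp)
  thus ?case using seq nnlin_SUP[OF F, of U] nnlin_SUP[OF G, of U] by simp
qed

text \<open>Carries the property through nested kernel integrals: \<open>F\<close> integrates over
  the current state and \<open>H\<close> over the later ones.\<close>

lemma nnlin_comp:
  assumes F: "nnlin F" and H: "\<And>y. nnlin (\<lambda>g. H g y)" and m: "\<And>g. g \<in> borel_measurable borel \<Longrightarrow> H g \<in> borel_measurable borel"
    and c: "c \<in> borel_measurable borel"
  shows "nnlin (\<lambda>g. F (\<lambda>y. c y * H g y))"
  unfolding nnlin_def
proof (intro conjI allI ballI impI)
  fix a and g :: "real \<Rightarrow> ennreal" assume g: "g \<in> borel_measurable borel"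
  have "(\<lambda>y. c y * H (\<lambda>x. a * g x) y) = (\<lambda>y. a * (c y * H g y))"
    using nnlin_mult[OF H g] by (simp add: mult_ac)
  thus "F (\<lambda>y. c y * H (\<lambda>x. a * g x) y) = a * F (\<lambda>y. c y * H g y)"
    using nnlin_mult[OF F, of "\<lambda>y. c y * H g y"] c m[OF g] by simp
next
  fix f g :: "real \<Rightarrow> ennreal" assume fg: "f \<in> borel_measurable borel" "g \<in> borel_measurable borel"
  have "(\<lambda>y. c y * H (\<lambda>x. f x + g x) y) = (\<lambda>y. c y * H f y + c y * H g y)"
    using nnlin_add[OF H fg] by (simp add: distrib_left)
  thus "F (\<lambda>y. c y * H (\<lambda>x. f x + g x) y) = F (\<lambda>y. c y * H f y) + F (\<lambda>y. c y * H g y)"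
    using nnlin_add[OF F, of "\<lambda>y. c y * H f y" "\<lambda>y. c y * H g y"] c m[OF fg(1)] m[OF fg(2)] by simp
next
  fix U :: "nat \<Rightarrow> real \<Rightarrow> ennreal" assume U: "\<forall>i. U i \<in> borel_measurable borel" "incseq U"
  have "(\<lambda>y. c y * H (\<lambda>x. SUP i. U i x) y) = (\<lambda>y. SUP i. c y * H (U i) y)"
    using nnlin_SUP[OF H, of U] U by (simp add: SUP_mult_left_ennreal)
  moreover have "incseq (\<lambda>i y. c y * H (U i) y)"
    unfolding incseq_def le_fun_def
  proof (intro allI impI mult_left_mono)
    fix m n :: nat and y assume "m \<le> n"
    thus "H (U m) y \<le> H (U n) y" using nnlin_mono[OF H, of "U m" "U n"] U by (auto simp: incseq_def)
  qed simp
  moreover have "(\<lambda>y. c y * H (U i) y) \<in> borel_measurable borel" for i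
    using c m[of "U i"] U by simp
  ultimately show "F (\<lambda>y. c y * H (\<lambda>x. SUP i. U i x) y) = (SUP i. F (\<lambda>y. c y * H (U i) y))"
    using nnlin_SUP[OF F, of "\<lambda>i y. c y * H (U i) y"] by simp
qed

lemma nnlin_eval: "nnlin (\<lambda>g. g a)" by (simp add: nnlin_def)

lemma nnlin_nn:
  assumes [measurable_cong]: "sets \<mu> = sets borel" shows "nnlin (\<lambda>g. \<integral>\<^sup>+ y. g y \<partial>\<mu>)"
  unfolding nnlin_def
proof (intro conjI allI ballI impI)
  fix c and g :: "real \<Rightarrow> ennreal" assume [measurable]: "g \<in> borel_measurable borel"
  show "(\<integral>\<^sup>+ y. c * g y \<partial>\<mu>) = c * (\<integral>\<^sup>+ y. g y \<partial>\<mu>)" by (rule nn_integral_cmult) measurable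
next
  fix f g :: "real \<Rightarrow> ennreal" assume [measurable]: "f \<in> borel_measurable borel" "g \<in> borel_measurable borel"
  show "(\<integral>\<^sup>+ y. f y + g y \<partial>\<mu>) = (\<integral>\<^sup>+ y. f y \<partial>\<mu>) + (\<integral>\<^sup>+ y. g y \<partial>\<mu>)" by (rule nn_integral_add) measurable
next
  fix U :: "nat \<Rightarrow> real \<Rightarrow> ennreal" assume U: "\<forall>i. U i \<in> borel_measurable borel" "incseq U"
  have [measurable]: "U i \<in> borel_measurable borel" for i using U by simp
  show "(\<integral>\<^sup>+ y. (SUP i. U i y) \<partial>\<mu>) = (SUP i. \<integral>\<^sup>+ y. U i y \<partial>\<mu>)"
    by (rule nn_integral_monotone_convergence_SUP[OF U(2)]) measurable
qed

lemma nnlin_nn_mult: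
  assumes s: "sets \<mu> = sets borel" and c: "c \<in> borel_measurable borel" shows "nnlin (\<lambda>g. \<integral>\<^sup>+ y. c y * g y \<partial>\<mu>)"
  using nnlin_comp[OF nnlin_nn[OF s] nnlin_eval _ c] by simp

lemma nnlin_factor: "nnlin F \<Longrightarrow> c \<in> borel_measurable borel \<Longrightarrow> nnlin (\<lambda>g. F (\<lambda>y. g y * c y))"
  using nnlin_comp[of F "\<lambda>g. g" c] nnlin_eval by (simp add: mult.commute)

text \<open>Test functions take the place of the sets of \<open>fdd_from\<close>, so that
  exponentials can be inserted and the nested integrals evaluated.\<close>

fun fddg_from :: "(real \<Rightarrow> real \<Rightarrow> real measure) \<Rightarrow> real \<Rightarrow> real \<Rightarrow> (real \<times> (real \<Rightarrow> ennreal)) list \<Rightarrow> ennreal" where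
  "fddg_from P s x [] = 1"
| "fddg_from P s x ((t, g) # rest) = kint P s t x (\<lambda>y. g y * fddg_from P t y rest)"

fun fddg :: "(real \<Rightarrow> real \<Rightarrow> real measure) \<Rightarrow> real measure \<Rightarrow> real \<Rightarrow> (real \<times> (real \<Rightarrow> ennreal)) list \<Rightarrow> ennreal" where
  "fddg P ch \<alpha> [] = 1"
| "fddg P ch \<alpha> ((t, g) # rest) = mu_int P ch \<alpha> t (\<lambda>y. g y * fddg_from P t y rest)"

lemma fddg_from_indicator: "fddg_from P s x (map (\<lambda>(t, A). (t, indicator A)) tas) = fdd_from P s x tas"
  by (induction tas arbitrary: s x) auto

lemma fddg_indicator: "fddg P ch \<alpha> (map (\<lambda>(t, A). (t, indicator A)) tas) = fdd P ch \<alpha> tas"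
  by (cases tas) (auto simp: fddg_from_indicator)

section \<open>The limit process\<close>

locale csbp =
  fixes P :: "real \<Rightarrow> real \<Rightarrow> real measure" and \<alpha> :: real
  assumes alpha: "0 < \<alpha>" "\<alpha> \<le> 1" and P_csbp: "csbp_kernel P \<alpha>"
begin

lemma P_prob: "0 \<le> t \<Longrightarrow> prob_space (P t x)"
  and P_sets: "0 \<le> t \<Longrightarrow> sets (P t x) = sets borel"
  and P_nonneg: "0 \<le> t \<Longrightarrow> 0 \<le> x \<Longrightarrow> AE y in P t x. 0 \<le> y"
  and P_laplace: "0 \<le> t \<Longrightarrow> 0 \<le> x \<Longrightarrow> 0 < l \<Longrightarrow> (\<integral>y. exp (- l * y) \<partial>P t x) = exp (- x * psi \<alpha> t l)"
  using P_csbp by (auto simp: csbp_kernel_def psi_def)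

lemma P_meas: "0 \<le> t \<Longrightarrow> P t \<in> borel \<rightarrow>\<^sub>M subprob_algebra borel"
proof (rule measurable_subprob_algebra)
  fix A :: "real set" assume "0 \<le> t" "A \<in> sets borel"
  thus "(\<lambda>a. emeasure (P t a) A) \<in> borel_measurable borel" using P_csbp by (auto simp: csbp_kernel_def)
qed (auto simp: P_sets prob_space_imp_subprob_space P_prob)

lemma surv_meas [measurable]: "0 \<le> r \<Longrightarrow> surv P r \<in> borel_measurable borel"
proof -
  assume "0 \<le> r"
  hence [measurable]: "(\<lambda>y. emeasure (P r y) {z. z > 0}) \<in> borel_measurable borel"
    using P_csbp by (auto simp: csbp_kernel_def)
  show ?thesis unfolding surv_def[abs_def] measure_def by measurable
qed

lemma P_nn_meas:
  assumes "0 \<le> t" "(\<lambda>(x, y). f x y) \<in> borel_measurable (borel \<Otimes>\<^sub>M borel)"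
  shows "(\<lambda>x. \<integral>\<^sup>+ y. f x y \<partial>P t x) \<in> borel_measurable borel"
  using nn_integral_measurable_subprob_algebra2[OF assms(2) P_meas[OF assms(1)]] .

lemma kint_meas:
  assumes s: "0 \<le> s" "s < t" and [measurable]: "g \<in> borel_measurable borel"
  shows "(\<lambda>x. kint P s t x g) \<in> borel_measurable borel"
proof -
  consider "t \<le> 1" | "\<not> t \<le> 1" "1 \<le> s" | "\<not> t \<le> 1" "\<not> 1 \<le> s" by blast
  thus ?thesis
  proof cases
    case 1
    hence [measurable]: "surv P (1 - t) \<in> borel_measurable borel" "surv P (1 - s) \<in> borel_measurable borel" using s by auto
    show ?thesis unfolding kint_def using 1 by (simp, intro P_nn_meas) (use s in auto)
  next
    case 2
    show ?thesis unfolding kint_def using 2 by (simp, intro P_nn_meas) (use s in auto)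
  next
    case 3
    hence [measurable]: "surv P 0 \<in> borel_measurable borel" "surv P (1 - s) \<in> borel_measurable borel" using s by auto
    have [measurable]: "(\<lambda>z. \<integral>\<^sup>+ y. g y \<partial>P (t - 1) z) \<in> borel_measurable borel"
      by (rule P_nn_meas) (use 3 in auto)
    show ?thesis unfolding kint_def using 3 by (simp, intro P_nn_meas) (use s in auto)
  qed
qed

lemma kint_nnlin:
  assumes s: "0 \<le> s" "s < t" shows "nnlin (kint P s t x)"
proof -
  consider "t \<le> 1" | "\<not> t \<le> 1" "1 \<le> s" | "\<not> t \<le> 1" "\<not> 1 \<le> s" by blast
  thus ?thesis
  proof cases
    case 1
    hence [measurable]: "surv P (1 - t) \<in> borel_measurable borel" using s by auto
    have "nnlin (\<lambda>g. \<integral>\<^sup>+ y. ennreal (surv P (1 - t) y / surv P (1 - s) x) * g y \<partial>P (t - s) x)"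
      by (rule nnlin_nn_mult) (use s P_sets in auto)
    thus ?thesis unfolding kint_def[abs_def] using 1 by simp
  next
    case 2
    thus ?thesis unfolding kint_def[abs_def] using nnlin_nn[OF P_sets, of "t - s" x] s by simp
  next
    case 3
    hence [measurable]: "surv P 0 \<in> borel_measurable borel" by auto
    have "nnlin (\<lambda>g. \<integral>\<^sup>+ z. ennreal (surv P 0 z / surv P (1 - s) x) * (\<integral>\<^sup>+ y. g y \<partial>P (t - 1) z) \<partial>P (1 - s) x)"
      by (rule nnlin_comp[where H="\<lambda>g z. \<integral>\<^sup>+ y. g y \<partial>P (t - 1) z", OF nnlin_nn nnlin_nn])
         (use 3 P_sets in \<open>auto intro!: P_nn_meas\<close>)
    thus ?thesis unfolding kint_def[abs_def] using 3 by simp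
  qed
qed

lemma mu_int_nnlin:
  assumes t: "0 < t" and ch: "sets ch = sets borel" shows "nnlin (mu_int P ch \<alpha> t)"
proof (cases "t \<le> 1")
  case True
  hence [measurable]: "surv P (1 - t) \<in> borel_measurable borel" by auto
  have "nnlin (\<lambda>g. \<integral>\<^sup>+ c. ennreal (t powr (-1/\<alpha>) * surv P (1 - t) (t powr (1/\<alpha>) * c)) * g (t powr (1/\<alpha>) * c) \<partial>ch)"
    by (rule nnlin_comp[where H="\<lambda>g c. g (t powr (1/\<alpha>) * c)", OF nnlin_nn[OF ch] nnlin_eval]) auto
  thus ?thesis unfolding mu_int_def[abs_def] using True by simp
next
  case False
  hence [measurable]: "surv P 0 \<in> borel_measurable borel" by auto
  have "nnlin (\<lambda>g. \<integral>\<^sup>+ c. ennreal (surv P 0 c) * (\<integral>\<^sup>+ y. g y \<partial>P (t - 1) c) \<partial>ch)"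
    by (rule nnlin_comp[where H="\<lambda>g z. \<integral>\<^sup>+ y. g y \<partial>P (t - 1) z", OF nnlin_nn[OF ch] nnlin_nn])
       (use False P_sets in \<open>auto intro!: P_nn_meas\<close>)
  thus ?thesis unfolding mu_int_def[abs_def] using False by simp
qed

lemma fddg_from_meas:
  "0 \<le> s \<Longrightarrow> \<forall>p\<in>set ts. s < fst p \<and> snd p \<in> borel_measurable borel \<Longrightarrow> sorted_wrt (<) (map fst ts) \<Longrightarrow>
    (\<lambda>x. fddg_from P s x ts) \<in> borel_measurable borel"
proof (induction ts arbitrary: s)
  case (Cons p r)
  obtain t g where p: "p = (t, g)" by force
  have [measurable]: "(\<lambda>x. fddg_from P t x r) \<in> borel_measurable borel"
    by (rule Cons.IH) (use Cons.prems p in auto)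
  have [measurable]: "g \<in> borel_measurable borel" using Cons.prems p by simp
  show ?case unfolding p fddg_from.simps by (rule kint_meas) (use Cons.prems p in auto)
qed simp

lemma fddg_from_nnlin:
  assumes t: "\<forall>p\<in>set l2. snd p \<in> borel_measurable borel"
  shows "0 \<le> s \<Longrightarrow> \<forall>p\<in>set l1. snd p \<in> borel_measurable borel \<Longrightarrow> \<forall>u\<in>set (map fst l1 @ t # map fst l2). s < u \<Longrightarrow>
     sorted_wrt (<) (map fst l1 @ t # map fst l2) \<Longrightarrow> nnlin (\<lambda>g. fddg_from P s x (l1 @ (t, g) # l2))"
proof (induction l1 arbitrary: s x)
  case Nil
  have "(\<lambda>y. fddg_from P t y l2) \<in> borel_measurable borel"
    by (rule fddg_from_meas) (use Nil assms in auto)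
  thus ?case using nnlin_factor[OF kint_nnlin[of s t x]] Nil by simp
next
  case (Cons p r)
  obtain u g0 where p: "p = (u, g0)" by force
  have u: "s < u" "0 \<le> u" using Cons.prems p by auto
  have IH: "nnlin (\<lambda>g. fddg_from P u y (r @ (t, g) # l2))" for y
    by (rule Cons.IH) (use Cons.prems p in auto)
  have "nnlin (\<lambda>g. kint P s u x (\<lambda>y. g0 y * fddg_from P u y (r @ (t, g) # l2)))"
  proof (rule nnlin_comp[where H="\<lambda>g y. fddg_from P u y (r @ (t, g) # l2)", OF kint_nnlin IH])
    fix g :: "real \<Rightarrow> ennreal" assume "g \<in> borel_measurable borel"
    thus "(\<lambda>y. fddg_from P u y (r @ (t, g) # l2)) \<in> borel_measurable borel"
      using Cons.prems p assms by (intro fddg_from_meas) (auto simp: sorted_wrt_append)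
  qed (use Cons.prems p u in auto)
  thus ?case by (simp add: p)
qed

lemma fddg_nnlin:
  assumes ch: "sets ch = sets borel" and m: "\<forall>p\<in>set l1. snd p \<in> borel_measurable borel" "\<forall>p\<in>set l2. snd p \<in> borel_measurable borel"
    and pos: "\<forall>u\<in>set (map fst l1 @ t # map fst l2). 0 < u" and so: "sorted_wrt (<) (map fst l1 @ t # map fst l2)"
  shows "nnlin (\<lambda>g. fddg P ch \<alpha> (l1 @ (t, g) # l2))"
proof (cases l1)
  case Nil
  have "(\<lambda>y. fddg_from P t y l2) \<in> borel_measurable borel"
    by (rule fddg_from_meas) (use Nil assms in auto)
  thus ?thesis using nnlin_factor[OF mu_int_nnlin[OF _ ch, of t]] Nil pos by simp
next
  case (Cons p r)
  obtain u g0 where p: "p = (u, g0)" by force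
  have u: "0 < u" using Cons pos p by auto
  have IH: "nnlin (\<lambda>g. fddg_from P u y (r @ (t, g) # l2))" for y
    by (rule fddg_from_nnlin) (use assms Cons p in auto)
  have "nnlin (\<lambda>g. mu_int P ch \<alpha> u (\<lambda>y. g0 y * fddg_from P u y (r @ (t, g) # l2)))"
  proof (rule nnlin_comp[where H="\<lambda>g y. fddg_from P u y (r @ (t, g) # l2)", OF mu_int_nnlin[OF u ch] IH])
    fix g :: "real \<Rightarrow> ennreal" assume "g \<in> borel_measurable borel"
    thus "(\<lambda>y. fddg_from P u y (r @ (t, g) # l2)) \<in> borel_measurable borel"
      using assms Cons p by (intro fddg_from_meas) (auto simp: sorted_wrt_append)
  qed (use assms Cons p in auto)
  thus ?thesis by (simp add: Cons p)
qed

end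

locale xstar = csbp P \<alpha> for P :: "real \<Rightarrow> real \<Rightarrow> real measure" and \<alpha> :: real +
  fixes ch :: "real measure" and M :: "'a measure" and Xs :: "real \<Rightarrow> 'a \<Rightarrow> real"
  assumes chi: "chi_law ch \<alpha>" and Xstar: "is_Xstar P ch \<alpha> M Xs"
begin

sublocale prob_space M using Xstar by (simp add: is_Xstar_def)

lemma Xs_meas [measurable]: "Xs t \<in> borel_measurable M"
  and Xs_0: "\<omega> \<in> space M \<Longrightarrow> Xs 0 \<omega> = 0"
  and Xs_nonneg: "\<omega> \<in> space M \<Longrightarrow> 0 \<le> t \<Longrightarrow> 0 \<le> Xs t \<omega>"
  and Xs_cadlag: "\<omega> \<in> space M \<Longrightarrow> cadlag_on_nonneg (\<lambda>t. Xs t \<omega>)"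
  using Xstar by (auto simp: is_Xstar_def)

lemma ch_sets: "sets ch = sets borel"
  using chi by (simp add: chi_law_def)

lemma fdd_eq:
  "sorted_wrt (<) (map fst tas) \<Longrightarrow> \<forall>p\<in>set tas. fst p > 0 \<and> snd p \<in> sets borel \<Longrightarrow>
    emeasure M {\<omega>\<in>space M. \<forall>p\<in>set tas. Xs (fst p) \<omega> \<in> snd p} = fdd P ch \<alpha> tas"
  using Xstar by (simp add: is_Xstar_def)

lemma prod_list_indicator:
  "prod_list (map (\<lambda>(t, g). g (Xs t \<omega>)) (map (\<lambda>(t, A). (t, indicator A)) tas)) = (indicator {\<omega>. \<forall>p\<in>set tas. Xs (fst p) \<omega> \<in> snd p} \<omega> :: ennreal)"
  by (induction tas) (auto simp: indicator_def)

lemma prod_list_meas: "\<forall>p\<in>set ts. snd p \<in> borel_measurable borel \<Longrightarrow> (\<lambda>\<omega>. prod_list (map (\<lambda>(t, g). g (Xs t \<omega>)) ts) :: ennreal) \<in> borel_measurable M"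
proof (induction ts)
  case (Cons p r)
  obtain t g where p: "p = (t, g)" by force
  hence [measurable]: "g \<in> borel_measurable borel" "(\<lambda>\<omega>. prod_list (map (\<lambda>(t, g). g (Xs t \<omega>)) r) :: ennreal) \<in> borel_measurable M"
    using Cons by auto
  show ?case by (simp add: p)
qed simp

text \<open>Test functions occupy a prefix and sets the rest. By \<open>nnlin_eq\<close> the last
  test function may be taken to be an indicator; it then joins the sets, and the induction
  hypothesis applies to the shorter prefix.\<close>

lemma fdd_general_aux:
  "\<forall>p\<in>set gs. fst p > 0 \<and> snd p \<in> borel_measurable borel \<Longrightarrow> \<forall>p\<in>set tas. fst p > 0 \<and> snd p \<in> sets borel \<Longrightarrow>
   sorted_wrt (<) (map fst gs @ map fst tas) \<Longrightarrow>
   (\<integral>\<^sup>+ \<omega>. prod_list (map (\<lambda>(t, g). g (Xs t \<omega>)) (gs @ map (\<lambda>(t, A). (t, indicator A)) tas)) \<partial>M)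
     = fddg P ch \<alpha> (gs @ map (\<lambda>(t, A). (t, indicator A)) tas)"
proof (induction gs arbitrary: tas rule: rev_induct)
  case Nil
  have [measurable]: "{\<omega> \<in> space M. \<forall>p\<in>set tas. Xs (fst p) \<omega> \<in> snd p} \<in> sets M"
  proof (rule sets.sets_Collect_finite_All)
    fix p assume "p \<in> set tas"
    hence [measurable]: "snd p \<in> sets borel" using Nil by auto
    show "{\<omega> \<in> space M. Xs (fst p) \<omega> \<in> snd p} \<in> sets M" by measurable
  qed simp
  have "(\<integral>\<^sup>+ \<omega>. prod_list (map (\<lambda>(t, g). g (Xs t \<omega>)) (map (\<lambda>(t, A). (t, indicator A)) tas)) \<partial>M)
    = (\<integral>\<^sup>+ \<omega>. indicator {\<omega>\<in>space M. \<forall>p\<in>set tas. Xs (fst p) \<omega> \<in> snd p} \<omega> \<partial>M)"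
    unfolding prod_list_indicator by (intro nn_integral_cong) (auto simp: indicator_def)
  also have "\<dots> = emeasure M {\<omega>\<in>space M. \<forall>p\<in>set tas. Xs (fst p) \<omega> \<in> snd p}" by (rule nn_integral_indicator) measurable
  also have "\<dots> = fdd P ch \<alpha> tas" by (rule fdd_eq) (use Nil in auto)
  finally show ?case by (simp only: append_Nil fddg_indicator)
next
  case (snoc q gs)
  obtain t g where q: "q = (t, g)" by force
  let ?l2 = "map (\<lambda>(t, A). (t, indicator A :: real \<Rightarrow> ennreal)) tas"
  let ?prod = "\<lambda>ts \<omega>. prod_list (map (\<lambda>(t, g). g (Xs t \<omega>)) ts) :: ennreal"
  have f2: "map fst ?l2 = map fst tas" by (auto simp: case_prod_unfold)
  have m1: "\<forall>p\<in>set gs. snd p \<in> borel_measurable borel" using snoc.prems by auto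
  have m2: "\<forall>p\<in>set ?l2. snd p \<in> borel_measurable borel" using snoc.prems by auto
  have so: "sorted_wrt (<) (map fst gs @ t # map fst ?l2)" unfolding f2 using snoc.prems(3) q by simp
  have pos: "\<forall>u\<in>set (map fst gs @ t # map fst ?l2). 0 < u" unfolding f2 using snoc.prems q by auto
  have L: "nnlin (\<lambda>g. fddg P ch \<alpha> (gs @ (t, g) # ?l2))"
    by (rule fddg_nnlin[OF ch_sets m1 m2 pos so])
  have R: "nnlin (\<lambda>g. \<integral>\<^sup>+ \<omega>. ?prod (gs @ (t, g) # ?l2) \<omega> \<partial>M)"
  proof -
    have [measurable]: "?prod gs \<in> borel_measurable M" "?prod ?l2 \<in> borel_measurable M"
      using m1 m2 by (intro prod_list_meas; simp)+
    show ?thesis unfolding nnlin_def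
    proof (intro conjI allI ballI impI)
      fix c and g :: "real \<Rightarrow> ennreal" assume [measurable]: "g \<in> borel_measurable borel"
      have "(\<integral>\<^sup>+ \<omega>. ?prod (gs @ (t, \<lambda>x. c * g x) # ?l2) \<omega> \<partial>M) = (\<integral>\<^sup>+ \<omega>. c * (?prod gs \<omega> * (g (Xs t \<omega>) * ?prod ?l2 \<omega>)) \<partial>M)"
        by (simp add: mult_ac)
      also have "\<dots> = c * (\<integral>\<^sup>+ \<omega>. ?prod gs \<omega> * (g (Xs t \<omega>) * ?prod ?l2 \<omega>) \<partial>M)" by (rule nn_integral_cmult) measurable
      finally show "(\<integral>\<^sup>+ \<omega>. ?prod (gs @ (t, \<lambda>x. c * g x) # ?l2) \<omega> \<partial>M) = c * (\<integral>\<^sup>+ \<omega>. ?prod (gs @ (t, g) # ?l2) \<omega> \<partial>M)" by simp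
    next
      fix f g :: "real \<Rightarrow> ennreal" assume [measurable]: "f \<in> borel_measurable borel" "g \<in> borel_measurable borel"
      have "(\<integral>\<^sup>+ \<omega>. ?prod (gs @ (t, \<lambda>x. f x + g x) # ?l2) \<omega> \<partial>M) = (\<integral>\<^sup>+ \<omega>. ?prod gs \<omega> * (f (Xs t \<omega>) * ?prod ?l2 \<omega>) + ?prod gs \<omega> * (g (Xs t \<omega>) * ?prod ?l2 \<omega>) \<partial>M)"
        by (simp add: distrib_left distrib_right)
      also have "\<dots> = (\<integral>\<^sup>+ \<omega>. ?prod gs \<omega> * (f (Xs t \<omega>) * ?prod ?l2 \<omega>) \<partial>M) + (\<integral>\<^sup>+ \<omega>. ?prod gs \<omega> * (g (Xs t \<omega>) * ?prod ?l2 \<omega>) \<partial>M)"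
        by (rule nn_integral_add) measurable
      finally show "(\<integral>\<^sup>+ \<omega>. ?prod (gs @ (t, \<lambda>x. f x + g x) # ?l2) \<omega> \<partial>M) = (\<integral>\<^sup>+ \<omega>. ?prod (gs @ (t, f) # ?l2) \<omega> \<partial>M) + (\<integral>\<^sup>+ \<omega>. ?prod (gs @ (t, g) # ?l2) \<omega> \<partial>M)" by simp
    next
      fix U :: "nat \<Rightarrow> real \<Rightarrow> ennreal" assume U: "\<forall>i. U i \<in> borel_measurable borel" "incseq U"
      have [measurable]: "U i \<in> borel_measurable borel" for i using U by simp
      have "(\<integral>\<^sup>+ \<omega>. ?prod (gs @ (t, \<lambda>x. SUP i. U i x) # ?l2) \<omega> \<partial>M) = (\<integral>\<^sup>+ \<omega>. (SUP i. (?prod gs \<omega> * ?prod ?l2 \<omega>) * U i (Xs t \<omega>)) \<partial>M)"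
        by (simp only: SUP_mult_left_ennreal[symmetric]) (simp add: mult_ac)
      also have "\<dots> = (SUP i. \<integral>\<^sup>+ \<omega>. (?prod gs \<omega> * ?prod ?l2 \<omega>) * U i (Xs t \<omega>) \<partial>M)"
      proof (rule nn_integral_monotone_convergence_SUP)
        show "incseq (\<lambda>i \<omega>. (?prod gs \<omega> * ?prod ?l2 \<omega>) * U i (Xs t \<omega>))"
          using U(2) unfolding incseq_def le_fun_def by (auto intro!: mult_left_mono)
      qed measurable
      finally show "(\<integral>\<^sup>+ \<omega>. ?prod (gs @ (t, \<lambda>x. SUP i. U i x) # ?l2) \<omega> \<partial>M) = (SUP i. \<integral>\<^sup>+ \<omega>. ?prod (gs @ (t, U i) # ?l2) \<omega> \<partial>M)"
        by (simp add: mult_ac)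
    qed
  qed
  have "(\<integral>\<^sup>+ \<omega>. ?prod (gs @ (t, g) # ?l2) \<omega> \<partial>M) = fddg P ch \<alpha> (gs @ (t, g) # ?l2)"
  proof (rule nnlin_eq[OF R L])
    fix A :: "real set" assume "A \<in> sets borel"
    thus "(\<integral>\<^sup>+ \<omega>. ?prod (gs @ (t, indicator A) # ?l2) \<omega> \<partial>M) = fddg P ch \<alpha> (gs @ (t, indicator A) # ?l2)"
      using snoc.IH[of "(t, A) # tas"] snoc.prems q by (simp add: sorted_wrt_append)
  qed (use snoc.prems q in auto)
  thus ?case by (simp add: q)
qed

lemma fdd_general:
  assumes "\<forall>p\<in>set gs. fst p > 0 \<and> snd p \<in> borel_measurable borel" "sorted_wrt (<) (map fst gs)"
  shows "(\<integral>\<^sup>+ \<omega>. prod_list (map (\<lambda>(t, g). g (Xs t \<omega>)) gs) \<partial>M) = fddg P ch \<alpha> gs"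
  using fdd_general_aux[of gs "[]"] assms by simp

end

section \<open>Laplace transforms and means of the limit process\<close>

lemma ennreal_mult3: "0 \<le> a \<Longrightarrow> 0 \<le> b \<Longrightarrow> 0 \<le> c \<Longrightarrow> ennreal a * (ennreal b * ennreal c) = ennreal (a * (b * c))"
  by (simp add: ennreal_mult)

lemma psi_mono:
  assumes "0 < \<alpha>" "0 \<le> t" "0 \<le> a" "a \<le> b" shows "psi \<alpha> t a \<le> psi \<alpha> t b"
proof (cases "a = 0")
  case False
  hence a: "0 < a" "0 < b" using assms by auto
  have "b powr (-\<alpha>) \<le> a powr (-\<alpha>)" using a assms by (intro powr_mono2') auto
  thus ?thesis using a assms by (simp add: psi_pos_eq powr_mono2' add_nonneg_pos)
qed (simp add: psi_nonneg)

lemma psi_le: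
  assumes "0 < \<alpha>" "0 < t" shows "psi \<alpha> t a \<le> t powr (-1/\<alpha>)"
  using assms by (auto simp: psi_def intro!: powr_mono2')

text \<open>An infinite argument at time 1 dominates every finite one, by \<open>psi_le\<close>, and
  monotonicity of \<open>psi\<close> propagates this to earlier times. The differences of
  exponentials below are thereby nonnegative, as their conversion to \<open>ennreal\<close>
  requires.\<close>

lemma Ulim_le_Blim:
  assumes a: "0 < \<alpha>"
  shows "0 \<le> s \<Longrightarrow> s < 1 \<Longrightarrow> \<forall>x\<in>set ts. s < fst x \<and> 0 \<le> snd x \<Longrightarrow> sorted_wrt (<) (map fst ts) \<Longrightarrow> 1 \<in> fst ` set ts \<Longrightarrow>
    Ulim \<alpha> s ts \<le> Blim \<alpha> s ts"
proof (induction ts arbitrary: s)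
  case (Cons x r)
  obtain t \<theta> where x: "x = (t, \<theta>)" by force
  show ?case
  proof (cases "t < 1")
    case True
    have "Ulim \<alpha> t r \<le> Blim \<alpha> t r" by (rule Cons.IH) (use Cons.prems x True in auto)
    thus ?thesis using True Cons.prems x a Ulim_nonneg[of \<alpha> t r] by (auto intro!: psi_mono)
  next
    case False
    have "psi \<alpha> (t - s) (\<theta> + Ulim \<alpha> t r) \<le> (t - s) powr (-1/\<alpha>)" using a Cons.prems x by (intro psi_le) auto
    also have "\<dots> \<le> (1 - s) powr (-1/\<alpha>)" using False Cons.prems a by (intro powr_mono2') auto
    finally show ?thesis using False by (simp add: x)
  qed
qed auto

lemma psi_tendsto_at_top:
  assumes a: "0 < \<alpha>" and r: "0 < r"
  shows "(\<lambda>n. psi \<alpha> r (real (Suc n))) \<longlonglongrightarrow> r powr (-1/\<alpha>)"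
proof -
  have "(\<lambda>n. real (Suc n) powr (-\<alpha>)) \<longlonglongrightarrow> 0"
    using a by (intro tendsto_neg_powr filterlim_compose[OF filterlim_real_sequentially filterlim_Suc]) auto
  hence "(\<lambda>n. (r + real (Suc n) powr (-\<alpha>)) powr (-1/\<alpha>)) \<longlonglongrightarrow> (r + 0) powr (-1/\<alpha>)"
    using r by (intro tendsto_intros) auto
  thus ?thesis by (simp add: psi_def)
qed

lemma psi_t0: "0 < \<alpha> \<Longrightarrow> 0 \<le> l \<Longrightarrow> psi \<alpha> 0 l = l"
  by (auto simp: psi_def powr_powr)

text \<open>Self-similarity of the branching mechanism. It turns the transform of chi rescaled by
  t^(1/\<alpha>) and weighted by t^(-1/\<alpha>) into an expression in psi at time t.\<close>

lemma psi_scale: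
  assumes a: "0 < \<alpha>" and t: "0 < t" and l: "0 \<le> l"
  shows "t powr (-1/\<alpha>) * psi \<alpha> 1 (t powr (1/\<alpha>) * l) = psi \<alpha> t l"
proof (cases "l = 0")
  case False
  hence l: "0 < l" using l by simp
  have "(t powr (1/\<alpha>) * l) powr (-\<alpha>) = l powr (-\<alpha>) / t"
    using a t l by (simp add: powr_mult powr_powr powr_minus field_simps)
  moreover have "t powr (-1/\<alpha>) * (1 + l powr (-\<alpha>) / t) powr (-1/\<alpha>) = (t * (1 + l powr (-\<alpha>) / t)) powr (-1/\<alpha>)"
    using t by (subst powr_mult) (auto intro!: add_nonneg_nonneg)
  moreover have "t * (1 + l powr (-\<alpha>) / t) = t + l powr (-\<alpha>)" using t by (simp add: field_simps)
  ultimately show ?thesis using t l by (simp add: psi_pos_eq)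
qed simp

lemma exp_neg_Suc_lim: "0 < (y::real) \<Longrightarrow> (\<lambda>n. exp (- real (Suc n) * y)) \<longlonglongrightarrow> 0"
proof -
  assume y: "0 < y"
  have "filterlim (\<lambda>n. y * real (Suc n)) at_top sequentially"
    by (intro filterlim_tendsto_pos_mult_at_top[OF tendsto_const y] filterlim_compose[OF filterlim_real_sequentially filterlim_Suc])
  hence "filterlim (\<lambda>n. - (y * real (Suc n))) at_bot sequentially" by (simp add: filterlim_uminus_at_top)
  hence "(\<lambda>n. exp (- (y * real (Suc n)))) \<longlonglongrightarrow> 0" by (rule filterlim_compose[OF exp_at_bot])
  thus ?thesis by (simp add: mult.commute del: of_nat_Suc)
qed

text \<open>On y >= 0 the functions exp (- l y) tend to the indicator of y = 0 as l grows, so the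
  mass at 0 is the Laplace transform at infinity.\<close>

lemma laplace_atom_lim:
  assumes p: "prob_space \<mu>" and s: "sets \<mu> = sets borel" and nn: "AE y in \<mu>. (0::real) \<le> y"
  shows "(\<lambda>n. \<integral>y. exp (- real (Suc n) * y) \<partial>\<mu>) \<longlonglongrightarrow> (\<integral>y. of_bool (y = 0) \<partial>\<mu>)"
proof (rule integral_dominated_convergence[where w="\<lambda>_. 1"])
  interpret prob_space \<mu> by (rule p)
  show "AE y in \<mu>. (\<lambda>n. exp (- real (Suc n) * y)) \<longlonglongrightarrow> of_bool (y = 0)"
    using nn
  proof eventually_elim
    case (elim y)
    show ?case
    proof (cases "y = 0")
      case False
      hence "0 < y" using elim by simp
      thus ?thesis using exp_neg_Suc_lim[of y] False by simp
    qed simp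
  qed
  show "AE y in \<mu>. norm (exp (- real (Suc n) * y)) \<le> 1" for n
    using nn by eventually_elim (simp del: of_nat_Suc)
  show "integrable \<mu> (\<lambda>_. 1 :: real)" by simp
qed (use s in \<open>auto intro!: borel_measurable_continuous_onI continuous_intros simp: measurable_cong_sets[OF s refl]\<close>)

context csbp
begin

lemma exp_integrable: "0 \<le> t \<Longrightarrow> 0 \<le> x \<Longrightarrow> 0 \<le> l \<Longrightarrow> integrable (P t x) (\<lambda>y. exp (- l * y))"
proof -
  assume a: "0 \<le> t" "0 \<le> x" "0 \<le> l"
  interpret prob_space "P t x" by (rule P_prob[OF a(1)])
  show ?thesis
  proof (rule integrable_const_bound[where B=1])
    show "AE y in P t x. norm (exp (- l * y)) \<le> 1"
      using P_nonneg[OF a(1,2)] by eventually_elim (use a in auto)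
  qed (simp add: measurable_cong_sets[OF P_sets[OF a(1)] refl])
qed

lemma P_laplace0: "0 \<le> t \<Longrightarrow> 0 \<le> x \<Longrightarrow> 0 \<le> l \<Longrightarrow> (\<integral>y. exp (- l * y) \<partial>P t x) = exp (- x * psi \<alpha> t l)"
proof (cases "l = 0")
  case True
  assume "0 \<le> t"
  then interpret prob_space "P t x" by (rule P_prob)
  show ?thesis using True by (simp add: prob_space)
qed (use P_laplace[of t x l] in auto)

lemma P_atom: "0 < r \<Longrightarrow> 0 \<le> x \<Longrightarrow> (\<integral>y. of_bool (y = 0) \<partial>P r x) = exp (- x * r powr (-1/\<alpha>))"
  and P0_atom: "0 \<le> x \<Longrightarrow> (\<integral>y. of_bool (y = 0) \<partial>P 0 x) = (of_bool (x = 0) :: real)"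
proof -
  have lim: "(\<lambda>n. exp (- x * psi \<alpha> r (real (Suc n)))) \<longlonglongrightarrow> (\<integral>y. of_bool (y = 0) \<partial>P r x)" if "0 \<le> r" "0 \<le> x" for r x
    using laplace_atom_lim[OF P_prob[of r x] P_sets[of r x] P_nonneg[of r x]] that P_laplace[of r x "real (Suc _)"] by simp
  show "(\<integral>y. of_bool (y = 0) \<partial>P r x) = exp (- x * r powr (-1/\<alpha>))" if "0 < r" "0 \<le> x"
  proof (rule LIMSEQ_unique[OF lim])
    show "(\<lambda>n. exp (- x * psi \<alpha> r (real (Suc n)))) \<longlonglongrightarrow> exp (- x * r powr (-1/\<alpha>))"
      by (intro tendsto_intros psi_tendsto_at_top alpha that)
  qed (use that in auto)
  show "(\<integral>y. of_bool (y = 0) \<partial>P 0 x) = (of_bool (x = 0) :: real)" if x: "0 \<le> x"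
  proof (rule LIMSEQ_unique[OF lim[OF order_refl x]])
    show "(\<lambda>n. exp (- x * psi \<alpha> 0 (real (Suc n)))) \<longlonglongrightarrow> of_bool (x = 0)"
    proof (cases "x = 0")
      case False
      hence "0 < x" using x by simp
      thus ?thesis using exp_neg_Suc_lim[of x] False by (simp add: psi_t0[OF alpha(1)] mult.commute del: of_nat_Suc)
    qed simp
  qed
qed

lemma atom_integrable: "0 \<le> t \<Longrightarrow> integrable (P t x) (\<lambda>y. of_bool (y = 0) :: real)"
proof -
  assume a: "0 \<le> t"
  interpret prob_space "P t x" by (rule P_prob[OF a(1)])
  show ?thesis
    by (rule integrable_const_bound[where B=1]) (auto simp: measurable_cong_sets[OF P_sets[OF a] refl])
qed

lemma surv_eq_atom:
  assumes "0 \<le> r" "0 \<le> x" shows "surv P r x = 1 - (\<integral>y. of_bool (y = 0) \<partial>P r x)"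
proof -
  interpret prob_space "P r x" by (rule P_prob[OF assms(1)])
  have m: "{z. 0 < z} \<in> sets (P r x)" using P_sets[OF assms(1)] by simp
  have "surv P r x = (\<integral>y. indicator {z. 0 < z} y \<partial>P r x)"
    unfolding surv_def using m by simp
  also have "\<dots> = (\<integral>y. 1 - of_bool (y = 0) \<partial>P r x)"
  proof (rule integral_cong_AE)
    show "AE y in P r x. indicator {z. 0 < z} y = 1 - (of_bool (y = 0) :: real)"
      using P_nonneg[OF assms] by eventually_elim (auto simp: indicator_def)
  qed (auto simp: measurable_cong_sets[OF P_sets[OF assms(1)] refl])
  also have "\<dots> = 1 - (\<integral>y. of_bool (y = 0) \<partial>P r x)"
    using atom_integrable[OF assms(1), of x] prob_space by simp
  finally show ?thesis .
qed

lemma surv_pos_time: "0 < r \<Longrightarrow> 0 \<le> x \<Longrightarrow> surv P r x = 1 - exp (- x * r powr (-1/\<alpha>))"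
  and surv_0: "0 \<le> x \<Longrightarrow> surv P 0 x = of_bool (0 < x)"
  using surv_eq_atom[of r x] surv_eq_atom[of 0 x] P_atom[of r x] P0_atom[of x] by auto

lemma surv_nonneg: "0 \<le> surv P r x" by (simp add: surv_def)

lemma surv_gt_0: "0 \<le> r \<Longrightarrow> 0 < x \<Longrightarrow> 0 < surv P r x"
  using surv_pos_time[of r x] surv_0[of x] by (cases "r = 0") auto

lemma surv_at_0: "0 \<le> r \<Longrightarrow> surv P r 0 = 0"
  using surv_pos_time[of r 0] surv_0[of 0] by (cases "r = 0") auto

lemma laplace_diff_nn:
  assumes "0 \<le> t" "0 \<le> x" "0 \<le> a" "a \<le> b" "0 \<le> K"
  shows "(\<integral>\<^sup>+ y. ennreal (K * (exp (- a * y) - exp (- b * y))) \<partial>P t x) = ennreal (K * (exp (- x * psi \<alpha> t a) - exp (- x * psi \<alpha> t b)))"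
proof -
  have i: "integrable (P t x) (\<lambda>y. exp (- a * y))" "integrable (P t x) (\<lambda>y. exp (- b * y))"
    using exp_integrable[of t x a] exp_integrable[of t x b] assms by auto
  have "(\<integral>\<^sup>+ y. ennreal (K * (exp (- a * y) - exp (- b * y))) \<partial>P t x) = ennreal (\<integral>y. K * (exp (- a * y) - exp (- b * y)) \<partial>P t x)"
  proof (rule nn_integral_eq_integral)
    show "AE y in P t x. 0 \<le> K * (exp (- a * y) - exp (- b * y))"
      using P_nonneg[OF assms(1,2)]
    proof eventually_elim
      case (elim y)
      have "a * y \<le> b * y" using elim assms by (intro mult_right_mono) auto
      thus ?case using assms by (intro mult_nonneg_nonneg) auto
    qed
  qed (use i in auto)
  also have "(\<integral>y. K * (exp (- a * y) - exp (- b * y)) \<partial>P t x) = K * (exp (- x * psi \<alpha> t a) - exp (- x * psi \<alpha> t b))"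
    using i P_laplace0[of t x a] P_laplace0[of t x b] assms by simp
  finally show ?thesis .
qed

lemma laplace_atom_nn:
  assumes "0 \<le> t" "0 \<le> x" "0 \<le> a" "0 \<le> K"
  shows "(\<integral>\<^sup>+ y. ennreal (K * (exp (- a * y) - of_bool (y = 0))) \<partial>P t x) = ennreal (K * (exp (- x * psi \<alpha> t a) - (\<integral>y. of_bool (y = 0) \<partial>P t x)))"
proof -
  have i: "integrable (P t x) (\<lambda>y. exp (- a * y))" "integrable (P t x) (\<lambda>y. of_bool (y = 0) :: real)"
    using exp_integrable[of t x a] atom_integrable[of t x] assms by auto
  have "(\<integral>\<^sup>+ y. ennreal (K * (exp (- a * y) - of_bool (y = 0))) \<partial>P t x) = ennreal (\<integral>y. K * (exp (- a * y) - of_bool (y = 0)) \<partial>P t x)"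
  proof (rule nn_integral_eq_integral)
    show "AE y in P t x. 0 \<le> K * (exp (- a * y) - of_bool (y = 0))"
      using assms by (intro AE_I2) auto
  qed (use i in auto)
  also have "(\<integral>y. K * (exp (- a * y) - of_bool (y = 0)) \<partial>P t x) = K * (exp (- x * psi \<alpha> t a) - (\<integral>y. of_bool (y = 0) \<partial>P t x))"
    using i P_laplace0[of t x a] assms by simp
  finally show ?thesis .
qed

definition exp_fns :: "(real \<times> real) list \<Rightarrow> (real \<times> (real \<Rightarrow> ennreal)) list" where
  "exp_fns ts = map (\<lambda>(t, \<theta>). (t, \<lambda>y. ennreal (exp (- \<theta> * y)))) ts"

lemma exp_fns_Cons: "exp_fns ((t, \<theta>) # r) = (t, \<lambda>y. ennreal (exp (- \<theta> * y))) # exp_fns r"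
  and exp_fns_Nil: "exp_fns [] = []"
  by (simp_all add: exp_fns_def)

text \<open>From time 1 on the kernel is the unconditioned one, and the branching property composes
  the exponents exactly as in the recursion of \<open>Ulim\<close>.\<close>

lemma fddg_exp_after:
  "1 \<le> s \<Longrightarrow> \<forall>x\<in>set ts. s < fst x \<and> 0 \<le> snd x \<Longrightarrow> sorted_wrt (<) (map fst ts) \<Longrightarrow> 0 \<le> x \<Longrightarrow>
    fddg_from P s x (exp_fns ts) = ennreal (exp (- x * Ulim \<alpha> s ts))"
proof (induction ts arbitrary: s x)
  case Nil thus ?case by (simp add: exp_fns_Nil)
next
  case (Cons p r)
  obtain t \<theta> where p: "p = (t, \<theta>)" by force
  have ts: "s < t" "0 \<le> t - s" "0 \<le> \<theta>" using Cons.prems p by auto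
  have IH: "fddg_from P t y (exp_fns r) = ennreal (exp (- y * Ulim \<alpha> t r))" if "0 \<le> y" for y
    by (rule Cons.IH) (use Cons.prems p that in auto)
  have "fddg_from P s x (exp_fns (p # r)) = (\<integral>\<^sup>+ y. ennreal (exp (- \<theta> * y)) * fddg_from P t y (exp_fns r) \<partial>P (t - s) x)"
    using Cons.prems p by (simp add: exp_fns_Cons kint_def)
  also have "\<dots> = (\<integral>\<^sup>+ y. ennreal (exp (- (\<theta> + Ulim \<alpha> t r) * y)) \<partial>P (t - s) x)"
  proof (rule nn_integral_cong_AE)
    show "AE y in P (t - s) x. ennreal (exp (- \<theta> * y)) * fddg_from P t y (exp_fns r) = ennreal (exp (- (\<theta> + Ulim \<alpha> t r) * y))"
      using P_nonneg[OF ts(2) Cons.prems(4)]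
    proof eventually_elim
      case (elim y)
      show ?case unfolding IH[OF elim] by (simp add: ennreal_mult[symmetric] exp_add[symmetric] algebra_simps)
    qed
  qed
  also have "\<dots> = ennreal (\<integral>y. exp (- (\<theta> + Ulim \<alpha> t r) * y) \<partial>P (t - s) x)"
    by (rule nn_integral_eq_integral[OF exp_integrable]) (use ts Cons.prems Ulim_nonneg in auto)
  also have "\<dots> = ennreal (exp (- x * Ulim \<alpha> s (p # r)))"
    using P_laplace0[of "t - s" x "\<theta> + Ulim \<alpha> t r"] ts Cons.prems Ulim_nonneg[of \<alpha> t r] by (simp add: p)
  finally show ?case .
qed

text \<open>The conditioning telescopes: the weight surv (1 - t) y of the kernel cancels the
  denominator left by the later times, and only 1 / surv (1 - s) x survives. At t = 1 the weight is
  the indicator of y > 0, and the removed atom at 0 produces the exponential with exponent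
  \<open>Blim\<close>.\<close>

lemma fddg_exp_before:
  "0 \<le> s \<Longrightarrow> s < 1 \<Longrightarrow> \<forall>x\<in>set ts. s < fst x \<and> 0 \<le> snd x \<Longrightarrow> sorted_wrt (<) (map fst ts) \<Longrightarrow> 1 \<in> fst ` set ts \<Longrightarrow> 0 \<le> x \<Longrightarrow>
    fddg_from P s x (exp_fns ts) = ennreal ((exp (- x * Ulim \<alpha> s ts) - exp (- x * Blim \<alpha> s ts)) / surv P (1 - s) x)"
proof (induction ts arbitrary: s x)
  case Nil thus ?case by simp
next
  case (Cons p r)
  obtain t \<theta> where p: "p = (t, \<theta>)" by force
  have ts: "s < t" "0 \<le> t - s" "0 \<le> \<theta>" using Cons.prems p by auto
  have t1: "t \<le> 1"
  proof (rule ccontr)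
    assume "\<not> t \<le> 1"
    moreover obtain y where "1 = fst y" "y \<in> set (p # r)" using Cons.prems(5) by (rule imageE)
    ultimately show False using Cons.prems(4) p by auto
  qed
  define K where "K = 1 / surv P (1 - s) x"
  have K: "0 \<le> K" by (simp add: K_def surv_nonneg)
  have k: "fddg_from P s x (exp_fns (p # r)) = (\<integral>\<^sup>+ y. ennreal (surv P (1 - t) y / surv P (1 - s) x) * (ennreal (exp (- \<theta> * y)) * fddg_from P t y (exp_fns r)) \<partial>P (t - s) x)"
    using t1 by (simp add: p exp_fns_Cons kint_def)
  show ?case
  proof (cases "t < 1")
    case True
    let ?A = "Ulim \<alpha> t r" and ?B = "Blim \<alpha> t r"
    have AB: "?A \<le> ?B" by (rule Ulim_le_Blim[OF alpha(1)]) (use Cons.prems p True in auto)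
    have IH: "fddg_from P t y (exp_fns r) = ennreal ((exp (- y * ?A) - exp (- y * ?B)) / surv P (1 - t) y)" if "0 \<le> y" for y
      by (rule Cons.IH) (use Cons.prems p that True in auto)
    have "fddg_from P s x (exp_fns (p # r)) = (\<integral>\<^sup>+ y. ennreal (K * (exp (- (\<theta> + ?A) * y) - exp (- (\<theta> + ?B) * y))) \<partial>P (t - s) x)"
      unfolding k
    proof (rule nn_integral_cong_AE)
      show "AE y in P (t - s) x. ennreal (surv P (1 - t) y / surv P (1 - s) x) * (ennreal (exp (- \<theta> * y)) * fddg_from P t y (exp_fns r))
         = ennreal (K * (exp (- (\<theta> + ?A) * y) - exp (- (\<theta> + ?B) * y)))"
        using P_nonneg[OF ts(2) Cons.prems(6)]
      proof eventually_elim
        case (elim y)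
        show ?case
        \<comment> \<open>Cancellation needs a positive weight. At y = 0 both sides are 0: the
          weight vanishes, and so does the difference of the two exponentials.\<close>
        proof (cases "y = 0")
          case True
          have "surv P (1 - t) y = 0" using surv_at_0[of "1 - t"] t1 True by simp
          thus ?thesis using True by simp
        next
          case False
          hence sp: "0 < surv P (1 - t) y" using elim t1 by (intro surv_gt_0) auto
          have d: "0 \<le> exp (- y * ?A) - exp (- y * ?B)" using AB elim by (simp add: mult_left_mono)
          have "ennreal (surv P (1 - t) y / surv P (1 - s) x) * (ennreal (exp (- \<theta> * y)) * fddg_from P t y (exp_fns r))
            = ennreal (surv P (1 - t) y / surv P (1 - s) x * (exp (- \<theta> * y) * ((exp (- y * ?A) - exp (- y * ?B)) / surv P (1 - t) y)))"
            unfolding IH[OF elim] by (rule ennreal_mult3) (use d sp surv_nonneg in auto)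
          also have "surv P (1 - t) y / surv P (1 - s) x * (exp (- \<theta> * y) * ((exp (- y * ?A) - exp (- y * ?B)) / surv P (1 - t) y))
            = K * (exp (- \<theta> * y) * (exp (- y * ?A) - exp (- y * ?B)))"
            using sp by (simp add: K_def)
          also have "exp (- \<theta> * y) * (exp (- y * ?A) - exp (- y * ?B)) = exp (- (\<theta> + ?A) * y) - exp (- (\<theta> + ?B) * y)"
            by (simp add: right_diff_distrib exp_add[symmetric] algebra_simps)
          finally show ?thesis .
        qed
      qed
    qed
    also have "\<dots> = ennreal (K * (exp (- x * psi \<alpha> (t - s) (\<theta> + ?A)) - exp (- x * psi \<alpha> (t - s) (\<theta> + ?B))))"
      by (rule laplace_diff_nn) (use ts Cons.prems K AB Ulim_nonneg[of \<alpha> t r] in auto)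
    also have "\<dots> = ennreal ((exp (- x * Ulim \<alpha> s (p # r)) - exp (- x * Blim \<alpha> s (p # r))) / surv P (1 - s) x)"
      using True by (simp add: p K_def)
    finally show ?thesis .
  next
    case False
    hence t: "t = 1" using t1 by simp
    let ?A = "Ulim \<alpha> t r"
    have IH: "fddg_from P t y (exp_fns r) = ennreal (exp (- y * ?A))" if "0 \<le> y" for y
      by (rule fddg_exp_after) (use Cons.prems p that t in auto)
    have "fddg_from P s x (exp_fns (p # r)) = (\<integral>\<^sup>+ y. ennreal (K * (exp (- (\<theta> + ?A) * y) - of_bool (y = 0))) \<partial>P (t - s) x)"
      unfolding k
    proof (rule nn_integral_cong_AE)
      show "AE y in P (t - s) x. ennreal (surv P (1 - t) y / surv P (1 - s) x) * (ennreal (exp (- \<theta> * y)) * fddg_from P t y (exp_fns r))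
         = ennreal (K * (exp (- (\<theta> + ?A) * y) - of_bool (y = 0)))"
        using P_nonneg[OF ts(2) Cons.prems(6)]
      proof eventually_elim
        case (elim y)
        have "ennreal (surv P (1 - t) y / surv P (1 - s) x) = ennreal (K * of_bool (0 < y))"
          using surv_0[OF elim] by (simp add: t K_def)
        hence "ennreal (surv P (1 - t) y / surv P (1 - s) x) * (ennreal (exp (- \<theta> * y)) * fddg_from P t y (exp_fns r))
          = ennreal (K * of_bool (0 < y) * (exp (- \<theta> * y) * exp (- y * ?A)))"
          unfolding IH[OF elim] using K by (simp add: ennreal_mult)
        also have "exp (- \<theta> * y) * exp (- y * ?A) = exp (- (\<theta> + ?A) * y)" by (simp add: exp_add[symmetric] algebra_simps)
        also have "K * of_bool (0 < y) * exp (- (\<theta> + ?A) * y) = K * (exp (- (\<theta> + ?A) * y) - of_bool (y = 0))"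
          using elim by auto
        finally show ?case .
      qed
    qed
    also have "\<dots> = ennreal (K * (exp (- x * psi \<alpha> (t - s) (\<theta> + ?A)) - exp (- x * (t - s) powr (-1/\<alpha>))))"
      using P_atom[of "t - s" x] ts Cons.prems K Ulim_nonneg[of \<alpha> t r] by (subst laplace_atom_nn) auto
    also have "\<dots> = ennreal ((exp (- x * Ulim \<alpha> s (p # r)) - exp (- x * Blim \<alpha> s (p # r))) / surv P (1 - s) x)"
      by (simp add: p K_def t)
    finally show ?thesis .
  qed
qed

end

context xstar
begin

lemma ch_prob: "prob_space ch" and ch_nonneg: "AE c in ch. 0 \<le> c"
  and ch_laplace1: "0 < l \<Longrightarrow> (\<integral>c. exp (- l * c) \<partial>ch) = 1 - psi \<alpha> 1 l"
  using chi by (auto simp: chi_law_def psi_def)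

lemma ch_laplace: "0 \<le> l \<Longrightarrow> (\<integral>c. exp (- l * c) \<partial>ch) = 1 - psi \<alpha> 1 l"
proof (cases "l = 0")
  case True
  interpret c: prob_space ch by (rule ch_prob)
  show ?thesis using True by (simp add: c.prob_space)
qed (use ch_laplace1[of l] in auto)

lemma ch_integrable: "0 \<le> l \<Longrightarrow> integrable ch (\<lambda>c. exp (- l * c))"
proof -
  assume a: "0 \<le> l"
  interpret c: prob_space ch by (rule ch_prob)
  show ?thesis
  proof (rule c.integrable_const_bound[where B=1])
    show "AE y in ch. norm (exp (- l * y)) \<le> 1"
      using ch_nonneg by eventually_elim (use a in auto)
  qed (simp add: measurable_cong_sets[OF ch_sets refl])
qed

text \<open>The transform 1 - psi \<alpha> 1 l tends to 0 as l grows, so there is no mass at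
  0.\<close>

lemma ch_pos: "AE c in ch. 0 < c"
proof -
  interpret c: prob_space ch by (rule ch_prob)
  have "(\<lambda>n. \<integral>c. exp (- real (Suc n) * c) \<partial>ch) \<longlonglongrightarrow> (\<integral>c. of_bool (c = 0) \<partial>ch)"
    by (rule laplace_atom_lim[OF ch_prob ch_sets ch_nonneg])
  moreover have "(\<lambda>n. \<integral>c. exp (- real (Suc n) * c) \<partial>ch) \<longlonglongrightarrow> 1 - 1 powr (-1/\<alpha>)"
    unfolding ch_laplace1[OF of_nat_0_less_iff[THEN iffD2, OF zero_less_Suc]]
    by (intro tendsto_intros psi_tendsto_at_top alpha) simp
  ultimately have z: "(\<integral>c. of_bool (c = 0) \<partial>ch) = (0::real)" by (auto dest: LIMSEQ_unique)
  have "integrable ch (\<lambda>c. of_bool (c = 0) :: real)"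
    by (rule c.integrable_const_bound[where B=1]) (auto simp: measurable_cong_sets[OF ch_sets refl])
  from integral_nonneg_eq_0_iff_AE[OF this] z have "AE c in ch. of_bool (c = 0) = (0::real)" by auto
  with ch_nonneg show ?thesis by eventually_elim auto
qed

text \<open>The same cancellation, with the entrance law in place of a kernel. In the difference of
  two transforms of chi the constants 1 cancel, and \<open>psi_scale\<close> rewrites the rest at
  time t.\<close>

lemma fddg_exp:
  assumes L: "\<forall>x\<in>set ts. 0 < fst x \<and> 0 \<le> snd x" "sorted_wrt (<) (map fst ts)" "1 \<in> fst ` set ts"
  shows "fddg P ch \<alpha> (exp_fns ts) = ennreal (Blim \<alpha> 0 ts - Ulim \<alpha> 0 ts)"
proof (cases ts)
  case Nil thus ?thesis using L by simp
next
  case (Cons p r)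
  obtain t \<theta> where p: "p = (t, \<theta>)" by force
  have tt: "0 < t" "0 \<le> \<theta>" using L Cons p by auto
  have t1: "t \<le> 1"
  proof (rule ccontr)
    assume "\<not> t \<le> 1"
    moreover obtain y where "1 = fst y" "y \<in> set ts" using L(3) by (rule imageE)
    ultimately show False using L(2) p Cons by auto
  qed
  define k where "k = t powr (1/\<alpha>)"
  have k: "0 < k" using tt by (simp add: k_def)
  define K where "K = t powr (-1/\<alpha>)"
  have K: "0 \<le> K" by (simp add: K_def)
  have m: "fddg P ch \<alpha> (exp_fns ts) = (\<integral>\<^sup>+ c. ennreal (K * surv P (1 - t) (k * c)) * (ennreal (exp (- \<theta> * (k * c))) * fddg_from P t (k * c) (exp_fns r)) \<partial>ch)"
    using t1 by (simp add: Cons p exp_fns_Cons mu_int_def k_def K_def)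
  show ?thesis
  proof (cases "t < 1")
    case True
    let ?A = "Ulim \<alpha> t r" and ?B = "Blim \<alpha> t r"
    have AB: "?A \<le> ?B" by (rule Ulim_le_Blim[OF alpha(1)]) (use L Cons p True in auto)
    have IH: "fddg_from P t y (exp_fns r) = ennreal ((exp (- y * ?A) - exp (- y * ?B)) / surv P (1 - t) y)" if "0 \<le> y" for y
      by (rule fddg_exp_before) (use L Cons p that True in auto)
    have i: "integrable ch (\<lambda>c. exp (- (k * (\<theta> + ?A)) * c))" "integrable ch (\<lambda>c. exp (- (k * (\<theta> + ?B)) * c))"
      using ch_integrable[of "k * (\<theta> + ?A)"] ch_integrable[of "k * (\<theta> + ?B)"] k tt Ulim_nonneg[of \<alpha> t r] Blim_nonneg[of \<alpha> t r] by auto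
    have "fddg P ch \<alpha> (exp_fns ts) = (\<integral>\<^sup>+ c. ennreal (K * (exp (- (k * (\<theta> + ?A)) * c) - exp (- (k * (\<theta> + ?B)) * c))) \<partial>ch)"
      unfolding m
    proof (rule nn_integral_cong_AE)
      show "AE c in ch. ennreal (K * surv P (1 - t) (k * c)) * (ennreal (exp (- \<theta> * (k * c))) * fddg_from P t (k * c) (exp_fns r))
         = ennreal (K * (exp (- (k * (\<theta> + ?A)) * c) - exp (- (k * (\<theta> + ?B)) * c)))"
        using ch_pos
      proof eventually_elim
        case (elim c)
        define y where "y = k * c"
        have y: "0 < y" using elim k by (simp add: y_def)
        have sp: "0 < surv P (1 - t) y" using y t1 by (intro surv_gt_0) auto
        have d: "0 \<le> exp (- y * ?A) - exp (- y * ?B)" using AB y by (simp add: mult_left_mono)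
        have "ennreal (K * surv P (1 - t) y) * (ennreal (exp (- \<theta> * y)) * fddg_from P t y (exp_fns r))
            = ennreal (K * surv P (1 - t) y * (exp (- \<theta> * y) * ((exp (- y * ?A) - exp (- y * ?B)) / surv P (1 - t) y)))"
          unfolding IH[OF less_imp_le[OF y]] by (rule ennreal_mult3) (use d sp K in auto)
        also have "K * surv P (1 - t) y * (exp (- \<theta> * y) * ((exp (- y * ?A) - exp (- y * ?B)) / surv P (1 - t) y))
            = K * (exp (- \<theta> * y) * (exp (- y * ?A) - exp (- y * ?B)))"
          using sp by simp
        also have "exp (- \<theta> * y) * (exp (- y * ?A) - exp (- y * ?B)) = exp (- (k * (\<theta> + ?A)) * c) - exp (- (k * (\<theta> + ?B)) * c)"
          by (simp add: right_diff_distrib exp_add[symmetric] y_def algebra_simps)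
        finally show ?case by (simp only: y_def)
      qed
    qed
    also have "\<dots> = ennreal (\<integral>c. K * (exp (- (k * (\<theta> + ?A)) * c) - exp (- (k * (\<theta> + ?B)) * c)) \<partial>ch)"
    proof (rule nn_integral_eq_integral)
      show "AE c in ch. 0 \<le> K * (exp (- (k * (\<theta> + ?A)) * c) - exp (- (k * (\<theta> + ?B)) * c))"
        using ch_nonneg
      proof eventually_elim
        case (elim c)
        have "k * (\<theta> + ?A) * c \<le> k * (\<theta> + ?B) * c" using AB k elim by (intro mult_right_mono mult_left_mono) auto
        thus ?case using K by auto
      qed
    qed (use i in auto)
    also have "(\<integral>c. K * (exp (- (k * (\<theta> + ?A)) * c) - exp (- (k * (\<theta> + ?B)) * c)) \<partial>ch)
      = K * ((1 - psi \<alpha> 1 (k * (\<theta> + ?A))) - (1 - psi \<alpha> 1 (k * (\<theta> + ?B))))"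
      using i ch_laplace[of "k * (\<theta> + ?A)"] ch_laplace[of "k * (\<theta> + ?B)"] k tt Ulim_nonneg[of \<alpha> t r] Blim_nonneg[of \<alpha> t r] by simp
    also have "\<dots> = psi \<alpha> t (\<theta> + ?B) - psi \<alpha> t (\<theta> + ?A)"
      using psi_scale[OF alpha(1) tt(1), of "\<theta> + ?A"] psi_scale[OF alpha(1) tt(1), of "\<theta> + ?B"] tt Ulim_nonneg[of \<alpha> t r] Blim_nonneg[of \<alpha> t r]
      by (simp add: K_def k_def algebra_simps)
    finally show ?thesis using True by (simp add: Cons p)
  next
    case False
    hence t: "t = 1" using t1 by simp
    let ?A = "Ulim \<alpha> t r"
    have IH: "fddg_from P t y (exp_fns r) = ennreal (exp (- y * ?A))" if "0 \<le> y" for y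
      by (rule fddg_exp_after) (use L Cons p that t in auto)
    have "fddg P ch \<alpha> (exp_fns ts) = (\<integral>\<^sup>+ c. ennreal (exp (- (\<theta> + ?A) * c)) \<partial>ch)"
      unfolding m
    proof (rule nn_integral_cong_AE)
      show "AE c in ch. ennreal (K * surv P (1 - t) (k * c)) * (ennreal (exp (- \<theta> * (k * c))) * fddg_from P t (k * c) (exp_fns r)) = ennreal (exp (- (\<theta> + ?A) * c))"
        using ch_pos
      proof eventually_elim
        case (elim c)
        have "k = 1" "K = 1" by (simp_all add: k_def K_def t)
        thus ?case using IH[of c] elim surv_0[of c] by (simp add: t ennreal_mult[symmetric] exp_add[symmetric] algebra_simps)
      qed
    qed
    also have "\<dots> = ennreal (\<integral>c. exp (- (\<theta> + ?A) * c) \<partial>ch)"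
      by (rule nn_integral_eq_integral[OF ch_integrable]) (use tt Ulim_nonneg[of \<alpha> t r] in auto)
    also have "\<dots> = ennreal (1 - psi \<alpha> 1 (\<theta> + ?A))" using ch_laplace[of "\<theta> + ?A"] tt Ulim_nonneg[of \<alpha> t r] by simp
    finally show ?thesis by (simp add: Cons p t)
  qed
qed

text \<open>The value is the limit found in \<open>Y_fdd_lim\<close>; this is what identifies the
  limit of the rescaled process given survival.\<close>

lemma Xs_laplace:
  assumes L: "\<forall>x\<in>set ts. 0 < fst x \<and> 0 \<le> snd x" "sorted_wrt (<) (map fst ts)" "1 \<in> fst ` set ts"
  shows "(\<integral>\<omega>. exp (- (\<Sum>x\<leftarrow>ts. snd x * Xs (fst x) \<omega>)) \<partial>M) = Blim \<alpha> 0 ts - Ulim \<alpha> 0 ts"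
proof -
  have e: "prod_list (map (\<lambda>(t, g). g (Xs t \<omega>)) (exp_fns ts)) = ennreal (exp (- (\<Sum>x\<leftarrow>ts. snd x * Xs (fst x) \<omega>)))" for \<omega>
  proof (induction ts)
    case (Cons p r)
    obtain t \<theta> where p: "p = (t, \<theta>)" by force
    show ?case using Cons by (simp add: p exp_fns_Cons ennreal_mult[symmetric] exp_add[symmetric])
  qed (simp add: exp_fns_Nil)
  have f: "map fst (exp_fns ts) = map fst ts" by (auto simp: exp_fns_def case_prod_unfold)
  have "(\<integral>\<^sup>+ \<omega>. ennreal (exp (- (\<Sum>x\<leftarrow>ts. snd x * Xs (fst x) \<omega>))) \<partial>M) = fddg P ch \<alpha> (exp_fns ts)"
    unfolding e[symmetric]
  proof (rule fdd_general)
    show "\<forall>p\<in>set (exp_fns ts). 0 < fst p \<and> snd p \<in> borel_measurable borel" using L(1) by (auto simp: exp_fns_def)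
    show "sorted_wrt (<) (map fst (exp_fns ts))" unfolding f by (rule L(2))
  qed
  also have "\<dots> = ennreal (Blim \<alpha> 0 ts - Ulim \<alpha> 0 ts)" by (rule fddg_exp[OF L])
  finally have "(\<integral>\<^sup>+ \<omega>. ennreal (exp (- (\<Sum>x\<leftarrow>ts. snd x * Xs (fst x) \<omega>))) \<partial>M) = ennreal (Blim \<alpha> 0 ts - Ulim \<alpha> 0 ts)" .
  moreover have "Ulim \<alpha> 0 ts \<le> Blim \<alpha> 0 ts" by (rule Ulim_le_Blim[OF alpha(1)]) (use L in auto)
  moreover have "(\<lambda>\<omega>. \<Sum>x\<leftarrow>ts. snd x * Xs (fst x) \<omega>) \<in> borel_measurable M"
    by (induction ts) simp_all
  ultimately show ?thesis
    by (subst integral_eq_nn_integral) auto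
qed

text \<open>Integrability of the limit process has to be extracted from its transforms. The variable
  (1 - exp (- c X)) / c lies below X and tends to X as c tends to 0, so its mean gives a lower
  bound, and Fatou's lemma gives the upper one.\<close>

lemma Xs_mean_nn:
  assumes u: "0 < u" shows "(\<integral>\<^sup>+ \<omega>. ennreal (Xs u \<omega>) \<partial>M) = ennreal (mulim \<alpha> u)"
proof -
  define e where "e = (\<lambda>n. 1 / real (Suc n))"
  have e0: "0 < e n" for n by (simp add: e_def)
  have eR: "filterlim e (at_right 0) sequentially"
  proof -
    have "e \<longlonglongrightarrow> 0" unfolding e_def by (rule LIMSEQ_Suc[OF lim_inverse_n'])
    thus ?thesis using e0 by (auto simp: filterlim_at intro!: always_eventually less_imp_neq[symmetric])
  qed
  define E where "E = (\<lambda>c. \<integral>\<omega>. exp (- (c * Xs u \<omega>)) \<partial>M)"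
  have int: "integrable M (\<lambda>\<omega>. exp (- (c * Xs u \<omega>)))" if "0 < c" for c
    by (rule integrable_const_bound[where B=1]) (use that u Xs_nonneg in \<open>auto intro!: AE_I2\<close>)
  have EL: "((\<lambda>c. (1 - E c) / c) \<longlongrightarrow> mulim \<alpha> u) (at_right 0)"
  proof (cases "u < 1")
    case True
    have "E c = psi \<alpha> u (c + (1 - u) powr (-1/\<alpha>)) - psi \<alpha> u c" if "0 < c" for c
      using Xs_laplace[of "[(u, c), (1, 0)]"] u True that by (simp add: E_def)
    hence "eventually (\<lambda>c. (1 - (psi \<alpha> u (c + (1 - u) powr (-1/\<alpha>)) - psi \<alpha> u c)) / c = (1 - E c) / c) (at_right 0)"
      using eventually_at_right_less[of 0] by (auto elim: eventually_mono)
    thus ?thesis using surv_diff_lim[OF alpha(1), of u] u True by (auto intro: Lim_transform_eventually)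
  next
    case False
    have "E c = 1 - psi \<alpha> u c" if c: "0 < c" for c
    proof (cases "u = 1")
      case True
      thus ?thesis using Xs_laplace[of "[(1, c)]"] c by (simp add: E_def)
    next
      case u1: False
      have "E c = 1 - psi \<alpha> 1 (psi \<alpha> (u - 1) c)"
        using Xs_laplace[of "[(1, 0), (u, c)]"] c u1 False by (simp add: E_def)
      thus ?thesis using psi_semigroup[OF alpha(1), of 1 "u - 1" c] c False by simp
    qed
    hence "eventually (\<lambda>c. psi \<alpha> u c / c = (1 - E c) / c) (at_right 0)"
      using eventually_at_right_less[of 0] by (auto elim: eventually_mono)
    thus ?thesis using psi_over_id[OF alpha(1), of u] u False by (auto simp: mulim_def intro: Lim_transform_eventually)
  qed
  have lim: "(\<lambda>n. (1 - E (e n)) / e n) \<longlonglongrightarrow> mulim \<alpha> u" by (rule filterlim_compose[OF EL eR])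
  define F where "F = (\<lambda>n \<omega>. (1 - exp (- (e n * Xs u \<omega>))) / e n)"
  have Fnn: "0 \<le> F n \<omega>" if "\<omega> \<in> space M" for n \<omega>
    using Xs_nonneg[OF that, of u] u e0[of n] by (simp add: F_def)
  have FE: "(\<integral>\<^sup>+ \<omega>. ennreal (F n \<omega>) \<partial>M) = ennreal ((1 - E (e n)) / e n)" for n
  proof -
    have i: "integrable M (F n)" unfolding F_def using int[OF e0[of n]] by auto
    have "(\<integral>\<^sup>+ \<omega>. ennreal (F n \<omega>) \<partial>M) = ennreal (\<integral>\<omega>. F n \<omega> \<partial>M)"
      by (rule nn_integral_eq_integral[OF i]) (use Fnn in auto)
    also have "(\<integral>\<omega>. F n \<omega> \<partial>M) = (1 - E (e n)) / e n"
      unfolding F_def E_def using int[OF e0[of n]] by (simp add: prob_space)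
    finally show ?thesis .
  qed
  have Fle: "F n \<omega> \<le> Xs u \<omega>" for n \<omega>
    using exp_ge_add_one_self[of "- (e n * Xs u \<omega>)"] e0[of n] by (simp add: F_def field_simps)
  have Flim: "(\<lambda>n. F n \<omega>) \<longlonglongrightarrow> Xs u \<omega>" for \<omega>
  proof -
    have "((\<lambda>x. 1 - exp (- (x * Xs u \<omega>))) has_real_derivative Xs u \<omega>) (at 0)"
      by (auto intro!: derivative_eq_intros)
    hence "((\<lambda>x. (1 - exp (- (x * Xs u \<omega>))) / x) \<longlongrightarrow> Xs u \<omega>) (at 0)"
      by (simp add: has_field_derivative_iff)
    hence "((\<lambda>x. (1 - exp (- (x * Xs u \<omega>))) / x) \<longlongrightarrow> Xs u \<omega>) (at_right 0)" by (rule tendsto_within_subset) auto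
    thus ?thesis unfolding F_def by (rule filterlim_compose[OF _ eR])
  qed
  have 1: "ennreal (mulim \<alpha> u) \<le> (\<integral>\<^sup>+ \<omega>. ennreal (Xs u \<omega>) \<partial>M)"
  proof (rule LIMSEQ_le_const2[OF tendsto_ennrealI[OF lim]], intro exI allI impI)
    fix n
    show "ennreal ((1 - E (e n)) / e n) \<le> (\<integral>\<^sup>+ \<omega>. ennreal (Xs u \<omega>) \<partial>M)"
      unfolding FE[symmetric] by (intro nn_integral_mono ennreal_leI Fle)
  qed
  have "(\<integral>\<^sup>+ \<omega>. ennreal (Xs u \<omega>) \<partial>M) = (\<integral>\<^sup>+ \<omega>. liminf (\<lambda>n. ennreal (F n \<omega>)) \<partial>M)"
  proof (rule nn_integral_cong)
    fix \<omega> assume "\<omega> \<in> space M"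
    have "(\<lambda>n. ennreal (F n \<omega>)) \<longlonglongrightarrow> ennreal (Xs u \<omega>)" by (rule tendsto_ennrealI[OF Flim])
    thus "ennreal (Xs u \<omega>) = liminf (\<lambda>n. ennreal (F n \<omega>))" by (simp add: lim_imp_Liminf)
  qed
  also have "\<dots> \<le> liminf (\<lambda>n. \<integral>\<^sup>+ \<omega>. ennreal (F n \<omega>) \<partial>M)"
    by (rule nn_integral_liminf) (simp add: F_def)
  also have "\<dots> = ennreal (mulim \<alpha> u)"
    unfolding FE using tendsto_ennrealI[OF lim] by (simp add: lim_imp_Liminf)
  finally have 2: "(\<integral>\<^sup>+ \<omega>. ennreal (Xs u \<omega>) \<partial>M) \<le> ennreal (mulim \<alpha> u)" .
  from 2 1 show ?thesis by (rule antisym)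
qed

lemma Xs_integrable: "0 < u \<Longrightarrow> integrable M (Xs u)"
  and Xs_mean: "0 < u \<Longrightarrow> (\<integral>\<omega>. Xs u \<omega> \<partial>M) = mulim \<alpha> u"
proof -
  assume u: "0 < u"
  have nn: "AE \<omega> in M. 0 \<le> Xs u \<omega>" using Xs_nonneg u by (intro AE_I2) auto
  show "integrable M (Xs u)"
    using Xs_mean_nn[OF u] nn by (intro integrableI_nonneg) auto
  show "(\<integral>\<omega>. Xs u \<omega> \<partial>M) = mulim \<alpha> u"
    using Xs_mean_nn[OF u] nn mulim_range[OF alpha(1), of u] u by (subst integral_eq_nn_integral) auto
qed

end

section \<open>Convergence of Lipschitz functionals\<close>

text \<open>A polynomial is a list of coefficients with exponent vectors. Evaluated at exp (- Z i),
  a monomial becomes the exponential of minus a combination of the Z i with natural coefficients,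
  whose mean is a Laplace transform.\<close>

definition pol :: "nat \<Rightarrow> (real \<times> (nat \<Rightarrow> nat)) list \<Rightarrow> (nat \<Rightarrow> real) \<Rightarrow> real" where
  "pol n l x = (\<Sum>(c, e)\<leftarrow>l. c * (\<Prod>i<n. x i ^ e i))"

lemma pol_Nil [simp]: "pol n [] x = 0"
  and pol_Cons: "pol n ((c, e) # l) x = c * (\<Prod>i<n. x i ^ e i) + pol n l x"
  and pol_append: "pol n (l1 @ l2) x = pol n l1 x + pol n l2 x"
  by (simp_all add: pol_def)

lemma pol_mult1: "c * (\<Prod>i<n. x i ^ e i) * pol n l x = pol n (map (\<lambda>(c', e'). (c * c', \<lambda>i. e i + e' i)) l) x"
proof (induction l)
  case (Cons p l)
  obtain c' e' where p: "p = (c', e')" by force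
  show ?case using Cons by (simp add: p pol_Cons power_add prod.distrib algebra_simps)
qed simp

lemma pol_mult: "\<exists>l. \<forall>x. pol n l1 x * pol n l2 x = pol n l x"
proof (induction l1)
  case Nil show ?case by (rule exI[of _ "[]"]) simp
next
  case (Cons p l1)
  obtain c e where p: "p = (c, e)" by force
  obtain l where l: "\<And>x. pol n l1 x * pol n l2 x = pol n l x" using Cons by blast
  show ?case
    by (rule exI[of _ "map (\<lambda>(c', e'). (c * c', \<lambda>i. e i + e' i)) l2 @ l"])
       (simp add: p pol_Cons pol_append distrib_right l pol_mult1)
qed

lemma pol_continuous: "continuous_on S (pol n l)"
proof (induction l)
  case Nil
  have "pol n [] = (\<lambda>x. 0)" by auto
  thus ?case by simp
next
  case (Cons p l)
  obtain c e where p: "p = (c, e)" by force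
  have "continuous_on S (\<lambda>x::nat \<Rightarrow> real. x i)" for i
    by (rule continuous_on_subset[OF continuous_on_product_coordinates]) simp
  hence "continuous_on S (\<lambda>x. c * (\<Prod>i<n. x i ^ e i) + pol n l x)"
    by (intro continuous_intros Cons)
  moreover have "pol n (p # l) = (\<lambda>x. c * (\<Prod>i<n. x i ^ e i) + pol n l x)" by (auto simp: p pol_Cons)
  ultimately show ?case by simp
qed

text \<open>Coordinates from n on are pinned to 0. This keeps the cube compact in the product
  topology on \<open>nat \<Rightarrow> real\<close> and lets polynomials in the first n coordinates
  separate its points.\<close>

definition unit_cube :: "nat \<Rightarrow> (nat \<Rightarrow> real) set" where
  "unit_cube n = {x. \<forall>i. x i \<in> (if i < n then {0..1} else {0})}"

lemma compact_unit_cube: "compact (unit_cube n)"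
proof -
  have "unit_cube n = PiE UNIV (\<lambda>i. if i < n then {0..1} else {0})"
    by (auto simp: unit_cube_def PiE_def Pi_iff split: if_splits)
  moreover have "compactin (product_topology (\<lambda>i. euclidean) UNIV) (PiE UNIV (\<lambda>i::nat. if i < n then {0..1::real} else {0}))"
    unfolding compactin_PiE by auto
  ultimately show ?thesis by (simp add: euclidean_product_topology)
qed

lemma pol_dense:
  fixes F :: "(nat \<Rightarrow> real) \<Rightarrow> real"
  assumes F: "continuous_on (unit_cube n) F" and e: "0 < e"
  obtains l where "\<And>x. x \<in> unit_cube n \<Longrightarrow> \<bar>F x - pol n l x\<bar> < e"
proof -
  interpret function_ring_on "range (pol n)" "unit_cube n"
  proof
    show "compact (unit_cube n)" by (rule compact_unit_cube)
    show "continuous_on (unit_cube n) f" if "f \<in> range (pol n)" for f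
      using that pol_continuous by auto
    show "(\<lambda>x. f x + g x) \<in> range (pol n)" if fg: "f \<in> range (pol n)" "g \<in> range (pol n)" for f g
    proof -
      obtain l1 l2 where "f = pol n l1" "g = pol n l2" using fg by auto
      hence "(\<lambda>x. f x + g x) = pol n (l1 @ l2)" by (auto simp: pol_append)
      thus ?thesis by simp
    qed
    show "(\<lambda>x. f x * g x) \<in> range (pol n)" if fg: "f \<in> range (pol n)" "g \<in> range (pol n)" for f g
    proof -
      obtain l1 l2 where "f = pol n l1" "g = pol n l2" using fg by auto
      moreover obtain l where "\<And>x. pol n l1 x * pol n l2 x = pol n l x" using pol_mult by blast
      ultimately have "(\<lambda>x. f x * g x) = pol n l" by auto
      thus ?thesis by simp
    qed
    show "(\<lambda>_. c) \<in> range (pol n)" for c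
    proof -
      have "(\<lambda>_. c) = pol n [(c, \<lambda>_. 0)]" by (auto simp: pol_Cons)
      thus ?thesis by simp
    qed
    show "\<exists>f\<in>range (pol n). f x \<noteq> f y" if xy: "x \<in> unit_cube n" "y \<in> unit_cube n" "x \<noteq> y" for x y
    proof -
      obtain i where i: "x i \<noteq> y i" using xy(3) by auto
      have "i < n"
      proof (rule ccontr)
        assume "\<not> i < n"
        hence "x i = 0" "y i = 0" using xy by (auto simp: unit_cube_def dest: spec[of _ i])
        thus False using i by simp
      qed
      have "pol n [(1, \<lambda>k. if k = i then 1 else 0)] z = z i" for z
      proof -
        have "(\<Prod>k<n. z k ^ (if k = i then 1 else 0)) = (\<Prod>k<n. if k = i then z i else 1)"
          by (rule prod.cong) auto
        also have "\<dots> = z i" using \<open>i < n\<close> by (simp add: prod.delta)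
        finally show ?thesis by (simp add: pol_Cons)
      qed
      thus ?thesis using i by (intro bexI[of _ "pol n [(1, \<lambda>k. if k = i then 1 else 0)]"]) auto
    qed
  qed
  obtain g where "g \<in> range (pol n)" "\<forall>x\<in>unit_cube n. \<bar>F x - g x\<bar> < e"
    using Stone_Weierstrass_basic[OF F e] by blast
  thus ?thesis using that by auto
qed

definition expv :: "nat \<Rightarrow> (nat \<Rightarrow> 'b \<Rightarrow> real) \<Rightarrow> 'b \<Rightarrow> nat \<Rightarrow> real" where
  "expv n Z \<omega> i = (if i < n then exp (- Z i \<omega>) else 0)"

lemma expv_cube: "(\<And>i. i < n \<Longrightarrow> 0 \<le> Z i \<omega>) \<Longrightarrow> expv n Z \<omega> \<in> unit_cube n"
  by (auto simp: expv_def unit_cube_def)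

lemma pol_expv_integral:
  assumes "prob_space \<mu>" "\<And>i. i < n \<Longrightarrow> Z i \<in> borel_measurable \<mu>" "\<And>i \<omega>. i < n \<Longrightarrow> \<omega> \<in> space \<mu> \<Longrightarrow> 0 \<le> Z i \<omega>"
  shows "integrable \<mu> (\<lambda>\<omega>. pol n l (expv n Z \<omega>)) \<and>
    (\<integral>\<omega>. pol n l (expv n Z \<omega>) \<partial>\<mu>) = (\<Sum>(c, e)\<leftarrow>l. c * (\<integral>\<omega>. exp (- (\<Sum>i<n. real (e i) * Z i \<omega>)) \<partial>\<mu>))"
proof (induction l)
  case (Cons p l)
  obtain c e where p: "p = (c, e)" by force
  interpret prob_space \<mu> by fact
  have eq: "(\<Prod>i<n. expv n Z \<omega> i ^ e i) = exp (- (\<Sum>i<n. real (e i) * Z i \<omega>))" for \<omega>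
  proof -
    have "(\<Prod>i<n. expv n Z \<omega> i ^ e i) = (\<Prod>i<n. exp (- (real (e i) * Z i \<omega>)))"
      by (rule prod.cong) (auto simp: expv_def exp_of_nat_mult[symmetric])
    also have "\<dots> = exp (\<Sum>i<n. - (real (e i) * Z i \<omega>))" by (simp add: exp_sum)
    finally show ?thesis by (simp add: sum_negf)
  qed
  have i: "integrable \<mu> (\<lambda>\<omega>. exp (- (\<Sum>i<n. real (e i) * Z i \<omega>)))"
  proof (rule integrable_const_bound[where B=1])
    show "AE \<omega> in \<mu>. norm (exp (- (\<Sum>i<n. real (e i) * Z i \<omega>))) \<le> 1"
      using assms(3) by (intro AE_I2) (auto intro!: sum_nonneg)
    have "(\<lambda>\<omega>. \<Sum>i<n. real (e i) * Z i \<omega>) \<in> borel_measurable \<mu>"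
      using assms(2) by (intro borel_measurable_sum borel_measurable_times) auto
    thus "(\<lambda>\<omega>. exp (- (\<Sum>i<n. real (e i) * Z i \<omega>))) \<in> borel_measurable \<mu>" by simp
  qed
  show ?case using Cons i by (simp add: p pol_Cons eq)
qed simp

lemma pol_close:
  fixes F :: "(nat \<Rightarrow> real) \<Rightarrow> real"
  assumes l: "\<And>x. x \<in> unit_cube n \<Longrightarrow> \<bar>F x - pol n l x\<bar> < d"
    and \<mu>: "prob_space \<mu>" "\<And>i. i < n \<Longrightarrow> Z i \<in> borel_measurable \<mu>" "\<And>i \<omega>. i < n \<Longrightarrow> \<omega> \<in> space \<mu> \<Longrightarrow> 0 \<le> Z i \<omega>"
    and Fm: "(\<lambda>\<omega>. F (expv n Z \<omega>)) \<in> borel_measurable \<mu>"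
  shows "\<bar>(\<integral>\<omega>. F (expv n Z \<omega>) \<partial>\<mu>) - (\<integral>\<omega>. pol n l (expv n Z \<omega>) \<partial>\<mu>)\<bar> \<le> d"
proof -
  interpret prob_space \<mu> by fact
  have i1: "integrable \<mu> (\<lambda>\<omega>. pol n l (expv n Z \<omega>))" by (rule conjunct1[OF pol_expv_integral]) (use \<mu> in auto)
  have m2: "(\<lambda>\<omega>. F (expv n Z \<omega>) - pol n l (expv n Z \<omega>)) \<in> borel_measurable \<mu>" using Fm i1 by auto
  have d: "\<bar>F (expv n Z \<omega>) - pol n l (expv n Z \<omega>)\<bar> \<le> d" if "\<omega> \<in> space \<mu>" for \<omega>
    by (rule less_imp_le[OF l[OF expv_cube]]) (rule \<mu>(3)[OF _ that])
  have i3: "integrable \<mu> (\<lambda>\<omega>. F (expv n Z \<omega>) - pol n l (expv n Z \<omega>))"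
    by (rule integrable_const_bound[OF _ m2, where B=d]) (use d in \<open>auto intro!: AE_I2\<close>)
  have i2: "integrable \<mu> (\<lambda>\<omega>. F (expv n Z \<omega>))" using Bochner_Integration.integrable_add[OF i3 i1] by simp
  have "(\<integral>\<omega>. F (expv n Z \<omega>) \<partial>\<mu>) - (\<integral>\<omega>. pol n l (expv n Z \<omega>) \<partial>\<mu>) = (\<integral>\<omega>. F (expv n Z \<omega>) - pol n l (expv n Z \<omega>) \<partial>\<mu>)"
    using i1 i2 by simp
  also have "\<bar>\<dots>\<bar> \<le> (\<integral>\<omega>. \<bar>F (expv n Z \<omega>) - pol n l (expv n Z \<omega>)\<bar> \<partial>\<mu>)" by (rule integral_abs_bound)
  also have "\<dots> \<le> (\<integral>\<omega>. d \<partial>\<mu>)" by (rule integral_mono) (use i3 d in auto)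
  finally show ?thesis by (simp add: prob_space)
qed

lemma weak_conv_cube:
  fixes N :: "nat \<Rightarrow> 'b measure" and M :: "'a measure" and F :: "(nat \<Rightarrow> real) \<Rightarrow> real"
  assumes N: "\<And>m. prob_space (N m)" "\<And>m i. i < n \<Longrightarrow> Y m i \<in> borel_measurable (N m)" "\<And>m i \<omega>. i < n \<Longrightarrow> \<omega> \<in> space (N m) \<Longrightarrow> 0 \<le> Y m i \<omega>"
    and M: "prob_space M" "\<And>i. i < n \<Longrightarrow> X i \<in> borel_measurable M" "\<And>i \<omega>. i < n \<Longrightarrow> \<omega> \<in> space M \<Longrightarrow> 0 \<le> X i \<omega>"
    and lap: "\<And>e::nat \<Rightarrow> nat. (\<lambda>m. \<integral>\<omega>. exp (- (\<Sum>i<n. real (e i) * Y m i \<omega>)) \<partial>N m) \<longlonglongrightarrow> (\<integral>\<omega>. exp (- (\<Sum>i<n. real (e i) * X i \<omega>)) \<partial>M)"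
    and F: "continuous_on (unit_cube n) F"
    and Fm: "\<And>m. (\<lambda>\<omega>. F (expv n (Y m) \<omega>)) \<in> borel_measurable (N m)" "(\<lambda>\<omega>. F (expv n X \<omega>)) \<in> borel_measurable M"
  shows "(\<lambda>m. \<integral>\<omega>. F (expv n (Y m) \<omega>) \<partial>N m) \<longlonglongrightarrow> (\<integral>\<omega>. F (expv n X \<omega>) \<partial>M)"
proof (rule LIMSEQ_I)
  fix r :: real assume r: "0 < r"
  obtain l where l: "\<And>x. x \<in> unit_cube n \<Longrightarrow> \<bar>F x - pol n l x\<bar> < r / 3" using pol_dense[OF F, of "r / 3"] r by auto
  have "(\<lambda>m. \<Sum>(c, e)\<leftarrow>l. c * (\<integral>\<omega>. exp (- (\<Sum>i<n. real (e i) * Y m i \<omega>)) \<partial>N m)) \<longlonglongrightarrow> (\<Sum>(c, e)\<leftarrow>l. c * (\<integral>\<omega>. exp (- (\<Sum>i<n. real (e i) * X i \<omega>)) \<partial>M))" for l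
  proof (induction l)
    case (Cons p l)
    obtain c e where p: "p = (c, e)" by force
    show ?case using Cons by (simp add: p) (intro tendsto_intros lap)
  qed simp
  moreover have "(\<integral>\<omega>. pol n l (expv n (Y m) \<omega>) \<partial>N m) = (\<Sum>(c, e)\<leftarrow>l. c * (\<integral>\<omega>. exp (- (\<Sum>i<n. real (e i) * Y m i \<omega>)) \<partial>N m))" for m
    by (rule pol_expv_integral[THEN conjunct2]) (use N in auto)
  moreover have "(\<integral>\<omega>. pol n l (expv n X \<omega>) \<partial>M) = (\<Sum>(c, e)\<leftarrow>l. c * (\<integral>\<omega>. exp (- (\<Sum>i<n. real (e i) * X i \<omega>)) \<partial>M))"
    by (rule pol_expv_integral[THEN conjunct2]) (use M in auto)
  ultimately have "(\<lambda>m. \<integral>\<omega>. pol n l (expv n (Y m) \<omega>) \<partial>N m) \<longlonglongrightarrow> (\<integral>\<omega>. pol n l (expv n X \<omega>) \<partial>M)" by simp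
  moreover have "0 < r / 3" using r by simp
  ultimately have "eventually (\<lambda>m. dist (\<integral>\<omega>. pol n l (expv n (Y m) \<omega>) \<partial>N m) (\<integral>\<omega>. pol n l (expv n X \<omega>) \<partial>M) < r / 3) sequentially"
    by (rule tendstoD)
  hence "eventually (\<lambda>m. norm ((\<integral>\<omega>. F (expv n (Y m) \<omega>) \<partial>N m) - (\<integral>\<omega>. F (expv n X \<omega>) \<partial>M)) < r) sequentially"
  proof eventually_elim
    case (elim m)
    have "\<bar>(\<integral>\<omega>. F (expv n (Y m) \<omega>) \<partial>N m) - (\<integral>\<omega>. pol n l (expv n (Y m) \<omega>) \<partial>N m)\<bar> \<le> r / 3"
      by (rule pol_close[OF l]) (use N Fm in auto)
    moreover have "\<bar>(\<integral>\<omega>. F (expv n X \<omega>) \<partial>M) - (\<integral>\<omega>. pol n l (expv n X \<omega>) \<partial>M)\<bar> \<le> r / 3"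
      by (rule pol_close[OF l]) (use M Fm in auto)
    ultimately show ?case using elim unfolding real_norm_def dist_real_def by linarith
  qed
  thus "\<exists>no. \<forall>m\<ge>no. norm ((\<integral>\<omega>. F (expv n (Y m) \<omega>) \<partial>N m) - (\<integral>\<omega>. F (expv n X \<omega>) \<partial>M)) < r"
    by (simp add: eventually_sequentially)
qed

lemma coord_lipschitz_continuous:
  fixes \<Psi> :: "(nat \<Rightarrow> real) \<Rightarrow> real"
  assumes lip: "\<And>x y. \<bar>\<Psi> x - \<Psi> y\<bar> \<le> C * (\<Sum>i<n. \<bar>x i - y i\<bar>)"
  shows "continuous_on UNIV \<Psi>"
  unfolding continuous_on_def
proof
  fix x :: "nat \<Rightarrow> real"
  have c: "((\<lambda>y::nat \<Rightarrow> real. y i) \<longlongrightarrow> x i) (at x within UNIV)" for i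
    using continuous_on_product_coordinates[of i] unfolding continuous_on_def by blast
  have "((\<lambda>y. C * (\<Sum>i<n. \<bar>y i - x i\<bar>)) \<longlongrightarrow> C * (\<Sum>i<n. \<bar>x i - x i\<bar>)) (at x within UNIV)"
    by (intro tendsto_intros c)
  hence "((\<lambda>y. C * (\<Sum>i<n. \<bar>y i - x i\<bar>)) \<longlongrightarrow> 0) (at x within UNIV)" by simp
  hence "((\<lambda>y. \<Psi> y - \<Psi> x) \<longlongrightarrow> 0) (at x within UNIV)"
    by (rule Lim_null_comparison[rotated]) (use lip in auto)
  thus "(\<Psi> \<longlongrightarrow> \<Psi> x) (at x within UNIV)" by (simp add: LIM_zero_iff)
qed

lemma coord_lipschitz_measurable:
  fixes \<Psi> :: "(nat \<Rightarrow> real) \<Rightarrow> real"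
  assumes lip: "\<And>x y. \<bar>\<Psi> x - \<Psi> y\<bar> \<le> C * (\<Sum>i<n. \<bar>x i - y i\<bar>)" and Z: "\<And>i. i < n \<Longrightarrow> Z i \<in> borel_measurable \<mu>"
  shows "(\<lambda>\<omega>. \<Psi> (\<lambda>i. Z i \<omega>)) \<in> borel_measurable \<mu>"
proof -
  \<comment> \<open>By the Lipschitz bound \<open>\<Psi>\<close> depends on the first n coordinates
    only; measurability is known for these alone, so the others are set to 0.\<close>
  have e: "\<Psi> x = \<Psi> (\<lambda>i. if i < n then x i else 0)" for x
  proof -
    have "\<bar>\<Psi> x - \<Psi> (\<lambda>i. if i < n then x i else 0)\<bar> \<le> C * (\<Sum>i<n. \<bar>x i - (if i < n then x i else 0)\<bar>)" by (rule lip)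
    also have "\<dots> = 0" by simp
    finally show ?thesis by simp
  qed
  have "(\<lambda>\<omega> i. if i < n then Z i \<omega> else 0) \<in> borel_measurable \<mu>"
  proof (rule measurable_coordinatewise_then_product)
    fix i
    show "(\<lambda>\<omega>. if i < n then Z i \<omega> else 0) \<in> borel_measurable \<mu>"
      by (cases "i < n") (use Z in auto)
  qed
  hence "(\<lambda>\<omega>. \<Psi> (\<lambda>i. if i < n then Z i \<omega> else 0)) \<in> borel_measurable \<mu>"
    by (rule measurable_compose) (rule borel_measurable_continuous_onI[OF coord_lipschitz_continuous[OF lip]])
  thus ?thesis by (simp add: e[of "\<lambda>i. Z i _"])
qed

lemma coord_lipschitz_integrable:
  fixes \<Psi> :: "(nat \<Rightarrow> real) \<Rightarrow> real"
  assumes lip: "\<And>x y. \<bar>\<Psi> x - \<Psi> y\<bar> \<le> C * (\<Sum>i<n. \<bar>x i - y i\<bar>)" and p: "prob_space \<mu>" and Z: "\<And>i. i < n \<Longrightarrow> integrable \<mu> (Z i)"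
  shows "integrable \<mu> (\<lambda>\<omega>. \<Psi> (\<lambda>i. Z i \<omega>))"
proof (rule Bochner_Integration.integrable_bound)
  interpret prob_space \<mu> by (rule p)
  show "integrable \<mu> (\<lambda>\<omega>. \<bar>\<Psi> (\<lambda>_. 0)\<bar> + C * (\<Sum>i<n. \<bar>Z i \<omega>\<bar>))"
    by (intro Bochner_Integration.integrable_add integrable_mult_right Bochner_Integration.integrable_sum integrable_abs Z) auto
  show "(\<lambda>\<omega>. \<Psi> (\<lambda>i. Z i \<omega>)) \<in> borel_measurable \<mu>" by (rule coord_lipschitz_measurable[OF lip]) (use Z in auto)
  show "AE \<omega> in \<mu>. norm (\<Psi> (\<lambda>i. Z i \<omega>)) \<le> norm (\<bar>\<Psi> (\<lambda>_. 0)\<bar> + C * (\<Sum>i<n. \<bar>Z i \<omega>\<bar>))"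
  proof (rule AE_I2)
    fix \<omega>
    have "\<bar>\<Psi> (\<lambda>i. Z i \<omega>) - \<Psi> (\<lambda>_. 0)\<bar> \<le> C * (\<Sum>i<n. \<bar>Z i \<omega>\<bar>)" using lip[of "\<lambda>i. Z i \<omega>" "\<lambda>_. 0"] by simp
    thus "norm (\<Psi> (\<lambda>i. Z i \<omega>)) \<le> norm (\<bar>\<Psi> (\<lambda>_. 0)\<bar> + C * (\<Sum>i<n. \<bar>Z i \<omega>\<bar>))" unfolding real_norm_def by linarith
  qed
qed

text \<open>\<open>\<Psi>\<close> with coordinates truncated at R, read as a function of y i = exp
  (- z i). The maximum with exp (- R) keeps the logarithm continuous on the whole cube, also where y
  i = 0.\<close>

definition clamp :: "nat \<Rightarrow> real \<Rightarrow> ((nat \<Rightarrow> real) \<Rightarrow> real) \<Rightarrow> (nat \<Rightarrow> real) \<Rightarrow> real" where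
  "clamp n R \<Psi> y = \<Psi> (\<lambda>i. if i < n then - ln (max (y i) (exp (- R))) else 0)"

lemma clamp_expv:
  assumes "\<And>i. i < n \<Longrightarrow> 0 \<le> Z i \<omega>"
  shows "clamp n R \<Psi> (expv n Z \<omega>) = \<Psi> (\<lambda>i. if i < n then min (Z i \<omega>) R else 0)"
proof -
  have "max (exp (- z)) (exp (- R)) = exp (- min z R)" for z by (auto simp: max_def min_def)
  thus ?thesis by (auto simp: clamp_def expv_def intro!: arg_cong[where f=\<Psi>])
qed

lemma clamp_continuous:
  fixes \<Psi> :: "(nat \<Rightarrow> real) \<Rightarrow> real"
  assumes "continuous_on UNIV \<Psi>" shows "continuous_on S (clamp n R \<Psi>)"
  unfolding clamp_def[abs_def]
proof (rule continuous_on_compose2[OF assms])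
  have c: "continuous_on S (\<lambda>x::nat \<Rightarrow> real. x i)" for i
    by (rule continuous_on_subset[OF continuous_on_product_coordinates]) simp
  show "continuous_on S (\<lambda>y i. if i < n then - ln (max (y i) (exp (- R))) else 0)"
  proof (rule continuous_on_coordinatewise_then_product)
    fix i
    have "0 < max (y i) (exp (- R))" for y :: "nat \<Rightarrow> real" by (simp add: less_max_iff_disj)
    hence "max (y i) (exp (- R)) \<noteq> 0" for y :: "nat \<Rightarrow> real" by (simp add: less_imp_neq[symmetric])
    thus "continuous_on S (\<lambda>y. if i < n then - ln (max (y i) (exp (- R))) else 0)"
      by (cases "i < n") (auto intro!: continuous_intros c)
  qed
qed simp

lemma truncated_mean_lim:
  assumes "integrable \<mu> Z"
  shows "(\<lambda>R::nat. \<integral>\<omega>. min (Z \<omega>) (real R) \<partial>\<mu>) \<longlonglongrightarrow> (\<integral>\<omega>. Z \<omega> \<partial>\<mu>)"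
proof (rule integral_dominated_convergence[where w="\<lambda>\<omega>. \<bar>Z \<omega>\<bar>"])
  show "AE \<omega> in \<mu>. (\<lambda>R. min (Z \<omega>) (real R)) \<longlonglongrightarrow> Z \<omega>"
  proof (rule AE_I2)
    fix \<omega>
    have "eventually (\<lambda>R. min (Z \<omega>) (real R) = Z \<omega>) sequentially"
      using eventually_ge_at_top[of "nat \<lceil>Z \<omega>\<rceil>"]
      by eventually_elim (auto simp: min_def dest: order_trans[OF real_nat_ceiling_ge])
    thus "(\<lambda>R. min (Z \<omega>) (real R)) \<longlonglongrightarrow> Z \<omega>" by (rule tendsto_eventually)
  qed
  show "AE \<omega> in \<mu>. norm (min (Z \<omega>) (real R)) \<le> \<bar>Z \<omega>\<bar>" for R by (rule AE_I2) auto
qed (use assms in auto)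

lemma truncation_error:
  fixes \<Psi> :: "(nat \<Rightarrow> real) \<Rightarrow> real"
  assumes lip: "\<And>x y. \<bar>\<Psi> x - \<Psi> y\<bar> \<le> C * (\<Sum>i<n. \<bar>x i - y i\<bar>)" and p: "prob_space \<mu>" and Z: "\<And>i. i < n \<Longrightarrow> integrable \<mu> (Z i)"
    and nn: "\<And>i \<omega>. i < n \<Longrightarrow> \<omega> \<in> space \<mu> \<Longrightarrow> 0 \<le> Z i \<omega>"
  shows "\<bar>(\<integral>\<omega>. \<Psi> (\<lambda>i. Z i \<omega>) \<partial>\<mu>) - (\<integral>\<omega>. clamp n (real R) \<Psi> (expv n Z \<omega>) \<partial>\<mu>)\<bar>
     \<le> C * (\<Sum>i<n. (\<integral>\<omega>. Z i \<omega> \<partial>\<mu>) - (\<integral>\<omega>. min (Z i \<omega>) (real R) \<partial>\<mu>))"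
proof -
  interpret prob_space \<mu> by (rule p)
  define W where "W = (\<lambda>i \<omega>. if i < n then min (Z i \<omega>) (real R) else 0)"
  have im: "integrable \<mu> (\<lambda>\<omega>. min (Z i \<omega>) (real R))" if "i < n" for i
    using Z[OF that] by (intro integrable_min) auto
  have iW: "integrable \<mu> (W i)" if "i < n" for i using im[OF that] that by (simp add: W_def)
  have i1: "integrable \<mu> (\<lambda>\<omega>. \<Psi> (\<lambda>i. Z i \<omega>))" by (rule coord_lipschitz_integrable[OF lip p Z])
  have i2: "integrable \<mu> (\<lambda>\<omega>. \<Psi> (\<lambda>i. W i \<omega>))" by (rule coord_lipschitz_integrable[OF lip p iW])
  have "(\<integral>\<omega>. clamp n (real R) \<Psi> (expv n Z \<omega>) \<partial>\<mu>) = (\<integral>\<omega>. \<Psi> (\<lambda>i. W i \<omega>) \<partial>\<mu>)"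
    by (rule Bochner_Integration.integral_cong[OF refl]) (use nn in \<open>simp add: clamp_expv W_def\<close>)
  hence "(\<integral>\<omega>. \<Psi> (\<lambda>i. Z i \<omega>) \<partial>\<mu>) - (\<integral>\<omega>. clamp n (real R) \<Psi> (expv n Z \<omega>) \<partial>\<mu>) = (\<integral>\<omega>. \<Psi> (\<lambda>i. Z i \<omega>) - \<Psi> (\<lambda>i. W i \<omega>) \<partial>\<mu>)"
    using i1 i2 by simp
  also have "\<bar>\<dots>\<bar> \<le> (\<integral>\<omega>. \<bar>\<Psi> (\<lambda>i. Z i \<omega>) - \<Psi> (\<lambda>i. W i \<omega>)\<bar> \<partial>\<mu>)" by (rule integral_abs_bound)
  also have "\<dots> \<le> (\<integral>\<omega>. C * (\<Sum>i<n. Z i \<omega> - min (Z i \<omega>) (real R)) \<partial>\<mu>)"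
  proof (rule integral_mono)
    fix \<omega>
    have "\<bar>\<Psi> (\<lambda>i. Z i \<omega>) - \<Psi> (\<lambda>i. W i \<omega>)\<bar> \<le> C * (\<Sum>i<n. \<bar>Z i \<omega> - W i \<omega>\<bar>)" by (rule lip)
    also have "(\<Sum>i<n. \<bar>Z i \<omega> - W i \<omega>\<bar>) = (\<Sum>i<n. Z i \<omega> - min (Z i \<omega>) (real R))"
      by (rule sum.cong) (auto simp: W_def)
    finally show "\<bar>\<Psi> (\<lambda>i. Z i \<omega>) - \<Psi> (\<lambda>i. W i \<omega>)\<bar> \<le> C * (\<Sum>i<n. Z i \<omega> - min (Z i \<omega>) (real R))" .
  qed (use i1 i2 Z im in auto)
  also have "\<dots> = C * (\<Sum>i<n. (\<integral>\<omega>. Z i \<omega> \<partial>\<mu>) - (\<integral>\<omega>. min (Z i \<omega>) (real R) \<partial>\<mu>))"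
    using Z im by (simp add: Bochner_Integration.integral_sum)
  finally show ?thesis .
qed

text \<open>Laplace transforms at integer points determine the limit by Stone-Weierstrass; convergence of the
  means supplies the uniform integrability needed for unbounded Lipschitz functions.\<close>

lemma weak_conv_lipschitz:
  fixes N :: "nat \<Rightarrow> 'b measure" and M :: "'a measure" and \<Psi> :: "(nat \<Rightarrow> real) \<Rightarrow> real"
  assumes N: "\<And>m. prob_space (N m)" "\<And>m i. i < n \<Longrightarrow> integrable (N m) (Y m i)" "\<And>m i \<omega>. i < n \<Longrightarrow> \<omega> \<in> space (N m) \<Longrightarrow> 0 \<le> Y m i \<omega>"
    and M: "prob_space M" "\<And>i. i < n \<Longrightarrow> integrable M (X i)" "\<And>i \<omega>. i < n \<Longrightarrow> \<omega> \<in> space M \<Longrightarrow> 0 \<le> X i \<omega>"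
    and lap: "\<And>e::nat \<Rightarrow> nat. (\<lambda>m. \<integral>\<omega>. exp (- (\<Sum>i<n. real (e i) * Y m i \<omega>)) \<partial>N m) \<longlonglongrightarrow> (\<integral>\<omega>. exp (- (\<Sum>i<n. real (e i) * X i \<omega>)) \<partial>M)"
    and mean: "\<And>i. i < n \<Longrightarrow> (\<lambda>m. \<integral>\<omega>. Y m i \<omega> \<partial>N m) \<longlonglongrightarrow> (\<integral>\<omega>. X i \<omega> \<partial>M)"
    and lip: "\<And>x y. \<bar>\<Psi> x - \<Psi> y\<bar> \<le> C * (\<Sum>i<n. \<bar>x i - y i\<bar>)"
  shows "(\<lambda>m. \<integral>\<omega>. \<Psi> (\<lambda>i. Y m i \<omega>) \<partial>N m) \<longlonglongrightarrow> (\<integral>\<omega>. \<Psi> (\<lambda>i. X i \<omega>) \<partial>M)"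
proof -
  have cl: "(\<lambda>m. \<integral>\<omega>. clamp n (real R) \<Phi> (expv n (Y m) \<omega>) \<partial>N m) \<longlonglongrightarrow> (\<integral>\<omega>. clamp n (real R) \<Phi> (expv n X \<omega>) \<partial>M)"
    if lp: "\<And>x y. \<bar>\<Phi> x - \<Phi> y\<bar> \<le> C * (\<Sum>i<n. \<bar>x i - y i\<bar>)" for \<Phi> C and R :: nat
  proof (rule weak_conv_cube)
    show "continuous_on (unit_cube n) (clamp n (real R) \<Phi>)"
      by (rule clamp_continuous[OF coord_lipschitz_continuous[OF lp]])
    show "(\<lambda>\<omega>. clamp n (real R) \<Phi> (expv n (Y m) \<omega>)) \<in> borel_measurable (N m)" for m
      unfolding clamp_def expv_def
      by (rule coord_lipschitz_measurable[OF lp, where Z="\<lambda>i \<omega>. if i < n then - ln (max (if i < n then exp (- Y m i \<omega>) else 0) (exp (- real R))) else 0"])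
         (use N(2)[of _ m] in auto)
    show "(\<lambda>\<omega>. clamp n (real R) \<Phi> (expv n X \<omega>)) \<in> borel_measurable M"
      unfolding clamp_def expv_def
      by (rule coord_lipschitz_measurable[OF lp, where Z="\<lambda>i \<omega>. if i < n then - ln (max (if i < n then exp (- X i \<omega>) else 0) (exp (- real R))) else 0"])
         (use M(2) in auto)
  qed (use N M lap in auto)
  \<comment> \<open>Coordinate projections are themselves Lipschitz, so the truncated means converge
    as well.\<close>
  have mc: "(\<lambda>m. \<integral>\<omega>. min (Y m i \<omega>) (real R) \<partial>N m) \<longlonglongrightarrow> (\<integral>\<omega>. min (X i \<omega>) (real R) \<partial>M)" if i: "i < n" for i and R :: nat
  proof -
    have "\<bar>x i - y i\<bar> \<le> 1 * (\<Sum>k<n. \<bar>x k - y k\<bar>)" for x y :: "nat \<Rightarrow> real"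
      using member_le_sum[of i "{..<n}" "\<lambda>k. \<bar>x k - y k\<bar>"] i by simp
    from cl[OF this, of R] have "(\<lambda>m. \<integral>\<omega>. clamp n (real R) (\<lambda>x. x i) (expv n (Y m) \<omega>) \<partial>N m) \<longlonglongrightarrow> (\<integral>\<omega>. clamp n (real R) (\<lambda>x. x i) (expv n X \<omega>) \<partial>M)" .
    moreover have "(\<integral>\<omega>. clamp n (real R) (\<lambda>x. x i) (expv n (Y m) \<omega>) \<partial>N m) = (\<integral>\<omega>. min (Y m i \<omega>) (real R) \<partial>N m)" for m
      by (rule Bochner_Integration.integral_cong[OF refl]) (use N(3) i in \<open>simp add: clamp_expv\<close>)
    moreover have "(\<integral>\<omega>. clamp n (real R) (\<lambda>x. x i) (expv n X \<omega>) \<partial>M) = (\<integral>\<omega>. min (X i \<omega>) (real R) \<partial>M)"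
      by (rule Bochner_Integration.integral_cong[OF refl]) (use M(3) i in \<open>simp add: clamp_expv\<close>)
    ultimately show ?thesis by simp
  qed
  define dX where "dX = (\<lambda>R::nat. C * (\<Sum>i<n. (\<integral>\<omega>. X i \<omega> \<partial>M) - (\<integral>\<omega>. min (X i \<omega>) (real R) \<partial>M)))"
  have dX0: "dX \<longlonglongrightarrow> 0"
  proof -
    have "dX \<longlonglongrightarrow> C * (\<Sum>i<n. (\<integral>\<omega>. X i \<omega> \<partial>M) - (\<integral>\<omega>. X i \<omega> \<partial>M))"
      unfolding dX_def by (intro tendsto_intros truncated_mean_lim M) auto
    thus ?thesis by simp
  qed
  show ?thesis
  proof (rule LIMSEQ_I)
    fix r :: real assume r: "0 < r"
    have "eventually (\<lambda>R. dX R < r / 4) sequentially" using dX0 by (rule order_tendstoD) (use r in auto)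
    \<comment> \<open>R is chosen from the limit alone. Convergence of the full and of the truncated
      means then makes the truncation error before the limit small too.\<close>
    then obtain R where R: "dX R < r / 4" by (meson eventually_happens trivial_limit_sequentially)
    have "(\<lambda>m. C * (\<Sum>i<n. (\<integral>\<omega>. Y m i \<omega> \<partial>N m) - (\<integral>\<omega>. min (Y m i \<omega>) (real R) \<partial>N m))) \<longlonglongrightarrow> dX R"
      unfolding dX_def by (intro tendsto_intros mean mc) auto
    hence e1: "eventually (\<lambda>m. C * (\<Sum>i<n. (\<integral>\<omega>. Y m i \<omega> \<partial>N m) - (\<integral>\<omega>. min (Y m i \<omega>) (real R) \<partial>N m)) < r / 4) sequentially"
      using R by (rule order_tendstoD)
    have e2: "eventually (\<lambda>m. dist (\<integral>\<omega>. clamp n (real R) \<Psi> (expv n (Y m) \<omega>) \<partial>N m) (\<integral>\<omega>. clamp n (real R) \<Psi> (expv n X \<omega>) \<partial>M) < r / 4) sequentially"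
      by (rule tendstoD[OF cl[OF lip]]) (use r in auto)
    have "eventually (\<lambda>m. norm ((\<integral>\<omega>. \<Psi> (\<lambda>i. Y m i \<omega>) \<partial>N m) - (\<integral>\<omega>. \<Psi> (\<lambda>i. X i \<omega>) \<partial>M)) < r) sequentially"
      using e1 e2
    proof eventually_elim
      case (elim m)
      have "\<bar>(\<integral>\<omega>. \<Psi> (\<lambda>i. Y m i \<omega>) \<partial>N m) - (\<integral>\<omega>. clamp n (real R) \<Psi> (expv n (Y m) \<omega>) \<partial>N m)\<bar>
          \<le> C * (\<Sum>i<n. (\<integral>\<omega>. Y m i \<omega> \<partial>N m) - (\<integral>\<omega>. min (Y m i \<omega>) (real R) \<partial>N m))"
        by (rule truncation_error[OF lip]) (use N in auto)
      moreover have "\<bar>(\<integral>\<omega>. \<Psi> (\<lambda>i. X i \<omega>) \<partial>M) - (\<integral>\<omega>. clamp n (real R) \<Psi> (expv n X \<omega>) \<partial>M)\<bar> \<le> dX R"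
        unfolding dX_def by (rule truncation_error[OF lip]) (use M in auto)
      ultimately show ?case using elim R r unfolding real_norm_def dist_real_def by linarith
    qed
    thus "\<exists>no. \<forall>m\<ge>no. norm ((\<integral>\<omega>. \<Psi> (\<lambda>i. Y m i \<omega>) \<partial>N m) - (\<integral>\<omega>. \<Psi> (\<lambda>i. X i \<omega>) \<partial>M)) < r"
      by (simp add: eventually_sequentially)
  qed
qed

text \<open>The grid point to the right of u; never 0, so that the process is only evaluated at positive times,
  where its marginals are known.\<close>

definition gup :: "nat \<Rightarrow> real \<Rightarrow> real" where
  "gup N u = real (max 1 (nat \<lceil>u * real N\<rceil>)) / real N"

lemma gup_meas [measurable]: "gup N \<in> borel_measurable borel"
  unfolding gup_def[abs_def] by measurable

lemma gup_ge: "1 \<le> N \<Longrightarrow> u \<le> gup N u"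
proof -
  assume N: "1 \<le> N"
  have "u * real N \<le> real (nat \<lceil>u * real N\<rceil>)" by (rule real_nat_ceiling_ge)
  also have "\<dots> \<le> real (max 1 (nat \<lceil>u * real N\<rceil>))" by simp
  finally show ?thesis using N by (simp add: gup_def pos_le_divide_eq)
qed

lemma gup_pos: "1 \<le> N \<Longrightarrow> 0 < gup N u"
  by (auto simp: gup_def)

lemma gup_le_add: "1 \<le> N \<Longrightarrow> 0 \<le> u \<Longrightarrow> gup N u \<le> u + 1 / real N"
proof -
  assume N: "1 \<le> N" and u: "0 \<le> u"
  have "0 \<le> u * real N" using u by simp
  hence "real (max 1 (nat \<lceil>u * real N\<rceil>)) \<le> u * real N + 1"
    by (simp add: max_def)
  hence "gup N u \<le> (u * real N + 1) / real N" unfolding gup_def by (intro divide_right_mono) auto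
  thus ?thesis using N by (simp add: add_divide_distrib)
qed

lemma gup_grid:
  assumes "1 \<le> N" "1 \<le> D" "u \<le> real D"
  obtains k where "1 \<le> k" "k \<le> N * D" "gup N u = real k / real N"
proof
  show "1 \<le> max 1 (nat \<lceil>u * real N\<rceil>)" by simp
  have "u * real N \<le> real D * real N" using assms by (intro mult_right_mono) auto
  hence "\<lceil>u * real N\<rceil> \<le> \<lceil>real D * real N\<rceil>" by (rule ceiling_mono)
  also have "\<lceil>real D * real N\<rceil> = int (N * D)" by (metis ceiling_of_nat mult.commute of_nat_mult)
  finally have "nat \<lceil>u * real N\<rceil> \<le> N * D" by (rule nat_le_iff[THEN iffD2])
  moreover have "1 \<le> N * D" using assms by simp
  ultimately show "max 1 (nat \<lceil>u * real N\<rceil>) \<le> N * D" by simp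
qed (simp add: gup_def)

lemma grid_le_bound: "1 \<le> N \<Longrightarrow> k \<le> N * D \<Longrightarrow> real k / real N \<le> real D"
proof -
  assume a: "1 \<le> N" "k \<le> N * D"
  have "real k \<le> real N * real D" using a(2) by (metis of_nat_le_iff of_nat_mult)
  thus ?thesis using a(1) by (simp add: divide_le_eq mult.commute)
qed

lemma gup_le: "1 \<le> N \<Longrightarrow> 1 \<le> D \<Longrightarrow> u \<le> real D \<Longrightarrow> gup N u \<le> real D"
proof -
  assume a: "1 \<le> N" "1 \<le> D" "u \<le> real D"
  obtain k where "k \<le> N * D" "gup N u = real k / real N" using gup_grid[OF a] by metis
  thus ?thesis using grid_le_bound a(1) by simp
qed

lemma gup_cell:
  assumes "1 \<le> N" "real k / real N < u" "u < real (Suc k) / real N"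
  shows "gup N u = real (Suc k) / real N"
proof -
  have "real k < u * real N" "u * real N < real (Suc k)" using assms by (auto simp: divide_less_eq less_divide_eq)
  hence "\<lceil>u * real N\<rceil> = int (Suc k)" by (intro ceiling_unique) auto
  thus ?thesis by (simp add: gup_def)
qed

lemma gup_tendsto: "0 \<le> u \<Longrightarrow> (\<lambda>N. gup N u) \<longlonglongrightarrow> u"
proof -
  assume u: "0 \<le> u"
  have l: "(\<lambda>N. u + 1 / real N) \<longlonglongrightarrow> u + 0" by (intro tendsto_intros lim_const_over_n)
  show ?thesis
  proof (rule tendsto_sandwich[OF _ _ tendsto_const])
    show "eventually (\<lambda>N. u \<le> gup N u) sequentially" using eventually_ge_at_top[of 1] by eventually_elim (rule gup_ge)
    show "eventually (\<lambda>N. gup N u \<le> u + 1 / real N) sequentially"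
      using eventually_ge_at_top[of 1] by eventually_elim (rule gup_le_add[OF _ u])
    show "(\<lambda>N. u + 1 / real N) \<longlonglongrightarrow> u" using l by simp
  qed
qed

lemma floor_grid:
  assumes "0 \<le> x" "1 \<le> N"
  shows "real (nat \<lfloor>x * real N\<rfloor>) / real N \<le> x" "x < real (nat \<lfloor>x * real N\<rfloor>) / real N + 1 / real N"
proof -
  have 0: "0 \<le> x * real N" using assms by simp
  have i: "real (nat \<lfloor>x * real N\<rfloor>) \<le> x * real N" "x * real N < real (nat \<lfloor>x * real N\<rfloor>) + 1" using 0 by linarith+
  show "real (nat \<lfloor>x * real N\<rfloor>) / real N \<le> x" using i(1) assms(2) by (simp add: divide_le_eq)
  have "x < (real (nat \<lfloor>x * real N\<rfloor>) + 1) / real N" using i(2) assms(2) by (simp only: pos_less_divide_eq of_nat_0_less_iff)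
  thus "x < real (nat \<lfloor>x * real N\<rfloor>) / real N + 1 / real N" by (simp add: add_divide_distrib)
qed

text \<open>Values are prescribed on the open cells only; the finitely many grid points do not
  change the integral.\<close>

lemma step_integral:
  fixes f :: "real \<Rightarrow> real"
  assumes "1 \<le> N" "a \<le> b" "\<And>k u. a \<le> k \<Longrightarrow> k < b \<Longrightarrow> real k / real N < u \<Longrightarrow> u < real (Suc k) / real N \<Longrightarrow> f u = c k"
  shows "(f has_integral (\<Sum>k\<in>{a..<b}. c k) / real N) {real a / real N..real b / real N}"
  using assms(2,3)
proof (induction rule: dec_induct)
  case base
  show ?case by (simp add: has_integral_refl)
next
  case (step b)
  have le: "real a / real N \<le> real b / real N" "real b / real N \<le> real (Suc b) / real N" using step by (auto intro!: divide_right_mono)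
  have c1: "((\<lambda>_. c b) has_integral (real (Suc b) / real N - real b / real N) *\<^sub>R c b) (cbox (real b / real N) (real (Suc b) / real N))"
    using has_integral_const_real[of "c b" "real b / real N" "real (Suc b) / real N"] le by simp
  have "(f has_integral (real (Suc b) / real N - real b / real N) *\<^sub>R c b) (cbox (real b / real N) (real (Suc b) / real N))"
    by (rule has_integral_spike_interior[OF c1]) (use step in auto)
  moreover have "(real (Suc b) / real N - real b / real N) *\<^sub>R c b = c b / real N"
    by (simp add: diff_divide_distrib[symmetric])
  ultimately have "(f has_integral c b / real N) {real b / real N..real (Suc b) / real N}" by simp
  moreover have "(f has_integral (\<Sum>k\<in>{a..<b}. c k) / real N) {real a / real N..real b / real N}"
    by (rule step.IH) (use step.prems in auto)
  ultimately have "(f has_integral (\<Sum>k\<in>{a..<b}. c k) / real N + c b / real N) {real a / real N..real (Suc b) / real N}"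
    by (intro has_integral_combine[OF le])
  moreover have "(\<Sum>k\<in>{a..<b}. c k) / real N + c b / real N = (\<Sum>k\<in>{a..<Suc b}. c k) / real N"
    using step by (simp add: add_divide_distrib)
  ultimately show ?case by simp
qed

lemma bounded_integrable:
  fixes f :: "real \<Rightarrow> real"
  assumes [measurable]: "f \<in> borel_measurable borel" and "\<And>u. a \<le> u \<Longrightarrow> u \<le> b \<Longrightarrow> \<bar>f u\<bar> \<le> B"
  shows "set_integrable lborel {a..b} f" "f integrable_on {a..b}"
proof -
  show s: "set_integrable lborel {a..b} f"
    unfolding set_integrable_def
    by (rule integrableI_bounded_set_indicator[where B=B]) (use assms(2) in \<open>auto simp: emeasure_lborel_Icc_eq\<close>)
  show "f integrable_on {a..b}" by (rule set_borel_integral_eq_integral(1)[OF s])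
qed

section \<open>Windows of a path compared with sums over a grid\<close>

definition wint :: "(real \<Rightarrow> real) \<Rightarrow> real \<Rightarrow> real" where "wint y s = integral {s..s+1} y"
definition rsum :: "nat \<Rightarrow> (real \<Rightarrow> real) \<Rightarrow> nat \<Rightarrow> real" where
  "rsum N y i = (\<Sum>k\<in>{i..<i + N}. y (real (Suc k) / real N)) / real N"
definition osc :: "nat \<Rightarrow> nat \<Rightarrow> (real \<Rightarrow> real) \<Rightarrow> real" where
  "osc D N y = integral {0..real D} (\<lambda>u. \<bar>y u - y (gup N u)\<bar>)"
text \<open>The largest grid value times the mesh 1 / N: an upper bound for the integral over a
  single cell of the path frozen at its grid values.\<close>

definition gmax :: "nat \<Rightarrow> nat \<Rightarrow> (real \<Rightarrow> real) \<Rightarrow> real" where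
  "gmax D N y = Max ((\<lambda>k. y (real (Suc k) / real N)) ` {..<N * D}) / real N"

locale nn_path =
  fixes y :: "real \<Rightarrow> real" and D N :: nat and B :: real
  assumes y_meas [measurable]: "y \<in> borel_measurable borel" and y_nn: "\<And>u. 0 \<le> y u"
    and y_le: "\<And>u. 0 \<le> u \<Longrightarrow> u \<le> real D \<Longrightarrow> y u \<le> B" and N: "1 \<le> N" and D: "1 \<le> D"
begin

lemma y_int: "0 \<le> a \<Longrightarrow> b \<le> real D \<Longrightarrow> y integrable_on {a..b}"
  by (rule bounded_integrable(2)[where B=B]) (use y_nn y_le in auto)

lemma yg_range: "0 \<le> u \<Longrightarrow> u \<le> real D \<Longrightarrow> 0 \<le> y (gup N u) \<and> y (gup N u) \<le> B"
  using y_nn y_le[of "gup N u"] gup_pos[OF N, of u] gup_le[OF N D, of u] by (auto simp: less_imp_le)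

lemma yg_int: "0 \<le> a \<Longrightarrow> b \<le> real D \<Longrightarrow> (\<lambda>u. y (gup N u)) integrable_on {a..b}"
  by (rule bounded_integrable(2)[where B=B]) (use yg_range in auto)

lemma osc_int: "0 \<le> a \<Longrightarrow> b \<le> real D \<Longrightarrow> (\<lambda>u. \<bar>y u - y (gup N u)\<bar>) integrable_on {a..b}"
proof (rule bounded_integrable(2)[where B="2 * B"])
  fix u assume a: "0 \<le> a" "b \<le> real D" "a \<le> u" "u \<le> b"
  hence u: "0 \<le> u" "u \<le> real D" by auto
  show "\<bar>\<bar>y u - y (gup N u)\<bar>\<bar> \<le> 2 * B"
    using y_nn[of u] y_le[OF u] yg_range[OF u] by linarith
qed measurable

lemma osc_bound: "0 \<le> a \<Longrightarrow> b \<le> real D \<Longrightarrow> \<bar>integral {a..b} y - integral {a..b} (\<lambda>u. y (gup N u))\<bar> \<le> osc D N y"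
proof -
  assume a: "0 \<le> a" "b \<le> real D"
  have "integral {a..b} y - integral {a..b} (\<lambda>u. y (gup N u)) = integral {a..b} (\<lambda>u. y u - y (gup N u))"
    by (rule integral_diff[symmetric, OF y_int[OF a] yg_int[OF a]])
  also have "\<bar>\<dots>\<bar> \<le> integral {a..b} (\<lambda>u. \<bar>y u - y (gup N u)\<bar>)"
    using integral_norm_bound_integral[of "\<lambda>u. y u - y (gup N u)" "{a..b}" "\<lambda>u. \<bar>y u - y (gup N u)\<bar>"]
      integrable_diff[OF y_int[OF a] yg_int[OF a]] osc_int[OF a] by simp
  also have "\<dots> \<le> osc D N y"
    unfolding osc_def by (rule integral_subset_le) (use a osc_int in auto)
  finally show ?thesis .
qed

lemma gmax_ge: "k < N * D \<Longrightarrow> y (real (Suc k) / real N) \<le> real N * gmax D N y"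
  unfolding gmax_def using N by (simp add: Max_ge)

lemma gmax_nonneg: "0 \<le> gmax D N y"
proof -
  have "0 \<le> y (real (Suc 0) / real N)" by (rule y_nn)
  also have "\<dots> \<le> real N * gmax D N y" by (rule gmax_ge) (use N D in auto)
  finally show ?thesis using N by (simp add: zero_le_mult_iff)
qed

lemma osc_nonneg: "0 \<le> osc D N y"
  unfolding osc_def by (rule integral_nonneg) (use osc_int in auto)

lemma yg_gmax: "u \<le> real D \<Longrightarrow> y (gup N u) \<le> real N * gmax D N y"
proof -
  assume "u \<le> real D"
  then obtain k where "1 \<le> k" "k \<le> N * D" "gup N u = real k / real N" using gup_grid[OF N D] by metis
  thus ?thesis using gmax_ge[of "k - 1"] by simp
qed

lemma small_window:
  assumes "0 \<le> a" "a \<le> b" "b \<le> real D" "b - a \<le> 2 / real N"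
  shows "0 \<le> integral {a..b} y" "integral {a..b} y \<le> osc D N y + 2 * gmax D N y"
proof -
  show "0 \<le> integral {a..b} y" using assms y_nn by (intro integral_nonneg y_int) auto
  have "integral {a..b} (\<lambda>u. y (gup N u)) \<le> integral {a..b} (\<lambda>_. real N * gmax D N y)"
    by (rule integral_le) (use assms yg_int yg_gmax in auto)
  also have "\<dots> = (b - a) * (real N * gmax D N y)" using assms by simp
  also have "\<dots> \<le> 2 / real N * (real N * gmax D N y)"
    using assms gmax_nonneg N by (intro mult_right_mono) auto
  also have "\<dots> = 2 * gmax D N y" using N by simp
  finally show "integral {a..b} y \<le> osc D N y + 2 * gmax D N y"
    using osc_bound[of a b] assms by linarith
qed

lemma rsum_eq:
  assumes "i + N \<le> N * D" shows "integral {real i / real N..real i / real N + 1} (\<lambda>u. y (gup N u)) = rsum N y i"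
proof -
  have "((\<lambda>u. y (gup N u)) has_integral (\<Sum>k\<in>{i..<i + N}. y (real (Suc k) / real N)) / real N) {real i / real N..real (i + N) / real N}"
    by (rule step_integral[OF N]) (use gup_cell[OF N] in auto)
  moreover have "real (i + N) / real N = real i / real N + 1" using N by (simp add: add_divide_distrib)
  ultimately show ?thesis unfolding rsum_def by (simp add: integral_unique)
qed

lemma grid_le: "i + N \<le> N * D \<Longrightarrow> real i / real N + 1 \<le> real D"
proof -
  assume "i + N \<le> N * D"
  hence "real i + real N \<le> real N * real D" by (metis of_nat_add of_nat_le_iff of_nat_mult)
  hence "(real i + real N) / real N \<le> real D" using N by (simp add: divide_le_eq mult.commute)
  thus ?thesis using N by (simp add: add_divide_distrib)
qed

text \<open>Shifting a window exchanges two nonnegative end pieces of length at most 2 / N, so only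
  the larger of them counts.\<close>

lemma wint_shift:
  assumes "0 \<le> s" "s \<le> t" "t + 1 \<le> real D" "t - s \<le> 2 / real N"
  shows "\<bar>wint y t - wint y s\<bar> \<le> osc D N y + 2 * gmax D N y"
proof -
  have c1: "integral {s..t} y + integral {t..t+1} y = integral {s..t+1} y"
    by (rule Henstock_Kurzweil_Integration.integral_combine) (use assms y_int in auto)
  have c2: "integral {s..s+1} y + integral {s+1..t+1} y = integral {s..t+1} y"
    by (rule Henstock_Kurzweil_Integration.integral_combine) (use assms y_int in auto)
  have "wint y t - wint y s = integral {s+1..t+1} y - integral {s..t} y"
    unfolding wint_def using c1 c2 by linarith
  moreover have "0 \<le> integral {s+1..t+1} y" "integral {s+1..t+1} y \<le> osc D N y + 2 * gmax D N y"
    "0 \<le> integral {s..t} y" "integral {s..t} y \<le> osc D N y + 2 * gmax D N y"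
    using small_window[of "s+1" "t+1"] small_window[of s t] assms by auto
  ultimately show ?thesis by linarith
qed

lemma wint_rsum:
  assumes "i + N \<le> N * D" "0 \<le> s" "s + 1 \<le> real D" "\<bar>s - real i / real N\<bar> \<le> 2 / real N"
  shows "\<bar>wint y s - rsum N y i\<bar> \<le> 2 * osc D N y + 2 * gmax D N y"
proof -
  have i0: "0 \<le> real i / real N" by simp
  have "\<bar>wint y s - wint y (real i / real N)\<bar> \<le> osc D N y + 2 * gmax D N y"
    using wint_shift[of s "real i / real N"] wint_shift[of "real i / real N" s] assms grid_le[OF assms(1)] i0
    by (cases "s \<le> real i / real N") (auto simp: abs_minus_commute)
  moreover have "\<bar>wint y (real i / real N) - rsum N y i\<bar> \<le> osc D N y"
    unfolding wint_def rsum_eq[OF assms(1), symmetric] by (rule osc_bound) (use grid_le[OF assms(1)] in auto)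
  ultimately show ?thesis by linarith
qed

lemma wint_bdd: "0 \<le> s \<Longrightarrow> s + 1 \<le> real D \<Longrightarrow> wint y s \<le> integral {0..real D} y"
  unfolding wint_def by (rule integral_subset_le) (use y_int y_nn in auto)

text \<open>The two sets of starting points lie within 2 / N of each other in both directions.
  \<open>A\<close> is left general: it will be an interval for the limit process and the multiples
  of 1 / J for the rescaled one.\<close>

lemma sup_window_close:
  assumes A: "A \<noteq> {}" "\<And>s. s \<in> A \<Longrightarrow> 0 \<le> s \<and> s + 1 \<le> real D"
    and G: "finite G" "G \<noteq> {}" "\<And>i. i \<in> G \<Longrightarrow> i + N \<le> N * D"
    and AG: "\<And>s. s \<in> A \<Longrightarrow> \<exists>i\<in>G. \<bar>s - real i / real N\<bar> \<le> 2 / real N"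
    and GA: "\<And>i. i \<in> G \<Longrightarrow> \<exists>s\<in>A. \<bar>s - real i / real N\<bar> \<le> 2 / real N"
  shows "\<bar>(SUP s\<in>A. wint y s) - Max (rsum N y ` G)\<bar> \<le> 2 * osc D N y + 2 * gmax D N y"
proof -
  let ?e = "2 * osc D N y + 2 * gmax D N y"
  have bdd: "bdd_above (wint y ` A)"
    by (rule bdd_aboveI2[of _ _ "integral {0..real D} y"]) (use A wint_bdd in auto)
  have "(SUP s\<in>A. wint y s) \<le> Max (rsum N y ` G) + ?e"
  proof (rule cSUP_least[OF A(1)])
    fix s assume s: "s \<in> A"
    obtain i where i: "i \<in> G" "\<bar>s - real i / real N\<bar> \<le> 2 / real N" using AG[OF s] by blast
    have "wint y s \<le> rsum N y i + ?e" using wint_rsum[OF G(3)[OF i(1)] _ _ i(2)] A(2)[OF s] by force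
    moreover have "rsum N y i \<le> Max (rsum N y ` G)" using G i by simp
    ultimately show "wint y s \<le> Max (rsum N y ` G) + ?e" by linarith
  qed
  moreover have "Max (rsum N y ` G) \<le> (SUP s\<in>A. wint y s) + ?e"
  proof (rule Max.boundedI)
    fix r assume "r \<in> rsum N y ` G"
    then obtain i where i: "i \<in> G" "r = rsum N y i" by auto
    obtain s where s: "s \<in> A" "\<bar>s - real i / real N\<bar> \<le> 2 / real N" using GA[OF i(1)] by blast
    have "rsum N y i \<le> wint y s + ?e" using wint_rsum[OF G(3)[OF i(1)] _ _ s(2)] A(2)[OF s(1)] by force
    moreover have "wint y s \<le> (SUP s\<in>A. wint y s)" by (rule cSUP_upper[OF s(1) bdd])
    ultimately show "r \<le> (SUP s\<in>A. wint y s) + ?e" using i by linarith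
  qed (use G in auto)
  ultimately show ?thesis by linarith
qed

lemma gmax_le_osc: "gmax D N y \<le> osc D N y + integral {0..real D} y"
proof -
  have ne: "(\<lambda>k. y (real (Suc k) / real N)) ` {..<N * D} \<noteq> {}" using N D by (auto simp: lessThan_empty_iff)
  have "Max ((\<lambda>k. y (real (Suc k) / real N)) ` {..<N * D}) \<in> (\<lambda>k. y (real (Suc k) / real N)) ` {..<N * D}"
    by (rule Max_in) (use ne in auto)
  then obtain k where k: "k < N * D" "Max ((\<lambda>k. y (real (Suc k) / real N)) ` {..<N * D}) = y (real (Suc k) / real N)" by auto
  have "((\<lambda>u. y (gup N u)) has_integral (\<Sum>k\<in>{0..<N * D}. y (real (Suc k) / real N)) / real N) {real 0 / real N..real (N * D) / real N}"
    by (rule step_integral[OF N]) (use gup_cell[OF N] in auto)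
  hence "integral {0..real D} (\<lambda>u. y (gup N u)) = (\<Sum>k\<in>{0..<N * D}. y (real (Suc k) / real N)) / real N"
    using N by (simp add: integral_unique)
  moreover have "y (real (Suc k) / real N) \<le> (\<Sum>k\<in>{0..<N * D}. y (real (Suc k) / real N))"
    by (rule member_le_sum) (use k y_nn in auto)
  ultimately have "gmax D N y \<le> integral {0..real D} (\<lambda>u. y (gup N u))"
    unfolding gmax_def k(2) by (simp add: divide_right_mono)
  thus ?thesis using osc_bound[of 0 "real D"] by linarith
qed

lemma gmax_le_B: "gmax D N y \<le> B / real N"
  unfolding gmax_def
proof (intro divide_right_mono Max.boundedI)
  show "(\<lambda>k. y (real (Suc k) / real N)) ` {..<N * D} \<noteq> {}" using N D by (auto simp: lessThan_empty_iff)
  fix a assume "a \<in> (\<lambda>k. y (real (Suc k) / real N)) ` {..<N * D}"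
  then obtain k where k0: "k < N * D" and k: "a = y (real (Suc k) / real N)" by auto
  have "real (Suc k) / real N \<le> real D" by (rule grid_le_bound[OF N]) (use k0 in simp)
  thus "a \<le> B" unfolding k by (intro y_le) auto
qed auto

end

lemma Max_image_close:
  fixes f g :: "'i \<Rightarrow> real"
  assumes "finite S" "S \<noteq> {}" "\<And>i. i \<in> S \<Longrightarrow> \<bar>f i - g i\<bar> \<le> e"
  shows "\<bar>Max (f ` S) - Max (g ` S)\<bar> \<le> e"
proof -
  have "Max (f ` S) \<le> Max (g ` S) + e" if "\<And>i. i \<in> S \<Longrightarrow> \<bar>f i - g i\<bar> \<le> e" for f g :: "'i \<Rightarrow> real"
  proof (rule Max.boundedI)
    fix a assume "a \<in> f ` S"
    then obtain i where i: "i \<in> S" "a = f i" by auto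
    have "g i \<le> Max (g ` S)" using assms(1) i by simp
    thus "a \<le> Max (g ` S) + e" using that[OF i(1)] i by linarith
  qed (use assms in auto)
  from this[of f g] this[of g f] show ?thesis using assms(3) by (force simp: abs_minus_commute)
qed

definition winmax :: "nat \<Rightarrow> nat set \<Rightarrow> (nat \<Rightarrow> real) \<Rightarrow> real" where
  "winmax N G x = Max ((\<lambda>i. (\<Sum>k\<in>{i..<i + N}. x k) / real N) ` G)"
definition ptmax :: "nat \<Rightarrow> nat \<Rightarrow> (nat \<Rightarrow> real) \<Rightarrow> real" where
  "ptmax D N x = Max (x ` {..<N * D}) / real N"

lemma winmax_rsum: "Max (rsum N y ` G) = winmax N G (\<lambda>k. y (real (Suc k) / real N))"
  by (simp add: winmax_def rsum_def[abs_def])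

lemma ptmax_gmax: "gmax D N y = ptmax D N (\<lambda>k. y (real (Suc k) / real N))"
  by (simp add: ptmax_def gmax_def)

lemma winmax_lipschitz:
  assumes N: "1 \<le> N" and G: "finite G" "G \<noteq> {}" "\<And>i. i \<in> G \<Longrightarrow> i + N \<le> n"
  shows "\<bar>winmax N G x - winmax N G y\<bar> \<le> 1 * (\<Sum>i<n. \<bar>x i - y i\<bar>)"
  unfolding winmax_def
proof (rule Max_image_close[OF G(1,2)])
  fix i assume i: "i \<in> G"
  have "\<bar>(\<Sum>k\<in>{i..<i + N}. x k) / real N - (\<Sum>k\<in>{i..<i + N}. y k) / real N\<bar> = \<bar>\<Sum>k\<in>{i..<i + N}. x k - y k\<bar> / real N"
    by (simp add: diff_divide_distrib[symmetric] sum_subtractf[symmetric] abs_divide)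
  also have "\<dots> \<le> (\<Sum>k\<in>{i..<i + N}. \<bar>x k - y k\<bar>) / real N" by (intro divide_right_mono sum_abs) auto
  also have "\<dots> \<le> (\<Sum>k\<in>{i..<i + N}. \<bar>x k - y k\<bar>) / 1" using N by (intro divide_left_mono sum_nonneg) auto
  also have "\<dots> \<le> 1 * (\<Sum>i<n. \<bar>x i - y i\<bar>)" using G(3)[OF i] by (simp, intro sum_mono2) auto
  finally show "\<bar>(\<Sum>k\<in>{i..<i + N}. x k) / real N - (\<Sum>k\<in>{i..<i + N}. y k) / real N\<bar> \<le> 1 * (\<Sum>i<n. \<bar>x i - y i\<bar>)" .
qed

lemma ptmax_lipschitz:
  assumes N: "1 \<le> N" "1 \<le> D"
  shows "\<bar>ptmax D N x - ptmax D N y\<bar> \<le> 1 * (\<Sum>i<N * D. \<bar>x i - y i\<bar>)"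
proof -
  have "\<bar>Max (x ` {..<N * D}) - Max (y ` {..<N * D})\<bar> \<le> (\<Sum>i<N * D. \<bar>x i - y i\<bar>)"
  proof (rule Max_image_close)
    show "{..<N * D} \<noteq> {}" using N by (auto simp: lessThan_empty_iff)
    show "\<bar>x i - y i\<bar> \<le> (\<Sum>i<N * D. \<bar>x i - y i\<bar>)" if "i \<in> {..<N * D}" for i
      using member_le_sum[of i "{..<N * D}" "\<lambda>i. \<bar>x i - y i\<bar>"] that by simp
  qed simp
  hence "\<bar>Max (x ` {..<N * D}) - Max (y ` {..<N * D})\<bar> / real N \<le> (\<Sum>i<N * D. \<bar>x i - y i\<bar>) / real N"
    by (rule divide_right_mono) simp
  also have "\<dots> \<le> (\<Sum>i<N * D. \<bar>x i - y i\<bar>) / 1" using N by (intro divide_left_mono sum_nonneg) auto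
  finally show ?thesis using N by (simp add: ptmax_def diff_divide_distrib[symmetric] abs_divide)
qed

section \<open>Random paths: window suprema in mean\<close>

locale nn_process = prob_space \<mu> for \<mu> :: "'b measure" +
  fixes Z :: "real \<Rightarrow> 'b \<Rightarrow> real" and D :: nat
  assumes Z_joint: "(\<lambda>(\<omega>, u). Z u \<omega>) \<in> borel_measurable (\<mu> \<Otimes>\<^sub>M borel)"
    and Z_nn: "\<And>\<omega> u. \<omega> \<in> space \<mu> \<Longrightarrow> 0 \<le> Z u \<omega>"
    and Z_bdd: "\<And>\<omega>. \<omega> \<in> space \<mu> \<Longrightarrow> \<exists>B. \<forall>u. 0 \<le> u \<longrightarrow> u \<le> real D \<longrightarrow> Z u \<omega> \<le> B"
    and Z_int: "\<And>u. 0 \<le> u \<Longrightarrow> u \<le> real D \<Longrightarrow> integrable \<mu> (Z u)"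
    and Z_mean: "\<And>u. 0 \<le> u \<Longrightarrow> u \<le> real D \<Longrightarrow> (\<integral>\<omega>. Z u \<omega> \<partial>\<mu>) \<le> 1"
    and D1: "1 \<le> D"
begin

lemma path:
  assumes "\<omega> \<in> space \<mu>" "1 \<le> N"
  obtains B where "nn_path (\<lambda>u. Z u \<omega>) D N B"
proof -
  obtain B where B: "\<And>u. 0 \<le> u \<Longrightarrow> u \<le> real D \<Longrightarrow> Z u \<omega> \<le> B" using Z_bdd[OF assms(1)] by blast
  have "(\<lambda>u. (\<omega>, u)) \<in> borel \<rightarrow>\<^sub>M \<mu> \<Otimes>\<^sub>M borel" using assms(1) by simp
  from measurable_compose[OF this Z_joint] have "(\<lambda>u. Z u \<omega>) \<in> borel_measurable borel" by simp
  thus ?thesis using that[of B] B Z_nn[OF assms(1)] assms(2) D1 by (auto simp: nn_path_def)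
qed

definition griddist :: "nat \<Rightarrow> real \<Rightarrow> real" where
  "griddist N u = (\<integral>\<omega>. \<bar>Z u \<omega> - Z (gup N u) \<omega>\<bar> \<partial>\<mu>)"

lemma griddist_integrable:
  assumes "1 \<le> N" "0 \<le> u" "u \<le> real D" shows "integrable \<mu> (\<lambda>\<omega>. \<bar>Z u \<omega> - Z (gup N u) \<omega>\<bar>)"
  using Z_int[OF assms(2,3)] Z_int[of "gup N u"] gup_pos[OF assms(1), of u] gup_le[OF assms(1) D1 assms(3)] by auto

lemma griddist_range:
  assumes "1 \<le> N" "0 \<le> u" "u \<le> real D" shows "0 \<le> griddist N u" "griddist N u \<le> 2"
proof -
  show "0 \<le> griddist N u" unfolding griddist_def by (rule Bochner_Integration.integral_nonneg) simp
  have g: "0 \<le> gup N u" "gup N u \<le> real D"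
    using gup_pos[OF assms(1), of u] gup_le[OF assms(1) D1 assms(3)] by auto
  have "griddist N u \<le> (\<integral>\<omega>. Z u \<omega> + Z (gup N u) \<omega> \<partial>\<mu>)"
    unfolding griddist_def
  proof (rule integral_mono[OF griddist_integrable[OF assms]])
    fix \<omega> assume "\<omega> \<in> space \<mu>"
    thus "\<bar>Z u \<omega> - Z (gup N u) \<omega>\<bar> \<le> Z u \<omega> + Z (gup N u) \<omega>"
      using Z_nn[of \<omega> u] Z_nn[of \<omega> "gup N u"] by linarith
  qed (use Z_int assms g in auto)
  also have "\<dots> = (\<integral>\<omega>. Z u \<omega> \<partial>\<mu>) + (\<integral>\<omega>. Z (gup N u) \<omega> \<partial>\<mu>)" using Z_int assms g by simp
  finally show "griddist N u \<le> 2" using Z_mean[OF assms(2,3)] Z_mean[OF g] by linarith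
qed

lemma joint_diff: "(\<lambda>(\<omega>, u). \<bar>Z u \<omega> - Z (gup N u) \<omega>\<bar>) \<in> borel_measurable (\<mu> \<Otimes>\<^sub>M borel)"
proof -
  have 1[measurable]: "(\<lambda>x. Z (snd x) (fst x)) \<in> borel_measurable (\<mu> \<Otimes>\<^sub>M borel)"
    using Z_joint by (simp add: case_prod_unfold)
  have [measurable]: "(\<lambda>x. Z (gup N (snd x)) (fst x)) \<in> borel_measurable (\<mu> \<Otimes>\<^sub>M borel)"
  proof -
    have "(\<lambda>x. (fst x, gup N (snd x))) \<in> \<mu> \<Otimes>\<^sub>M borel \<rightarrow>\<^sub>M \<mu> \<Otimes>\<^sub>M borel" by measurable
    from measurable_compose[OF this 1] show ?thesis by simp
  qed
  have "(\<lambda>x. \<bar>Z (snd x) (fst x) - Z (gup N (snd x)) (fst x)\<bar>) \<in> borel_measurable (\<mu> \<Otimes>\<^sub>M borel)"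
    by measurable
  thus ?thesis by (simp add: case_prod_unfold)
qed

lemma griddist_meas [measurable]: "griddist N \<in> borel_measurable borel"
proof -
  have "(\<lambda>x. (snd x, fst x)) \<in> borel \<Otimes>\<^sub>M \<mu> \<rightarrow>\<^sub>M \<mu> \<Otimes>\<^sub>M borel" by measurable
  from measurable_compose[OF this joint_diff[of N]]
  have "(\<lambda>(u, \<omega>). \<bar>Z u \<omega> - Z (gup N u) \<omega>\<bar>) \<in> borel_measurable (borel \<Otimes>\<^sub>M \<mu>)"
    by (simp add: case_prod_unfold)
  from borel_measurable_lebesgue_integral[OF this] show ?thesis by (simp add: griddist_def[abs_def])
qed

lemma griddist_set_integrable: "1 \<le> N \<Longrightarrow> set_integrable lborel {0..real D} (griddist N)"
  by (rule bounded_integrable(1)[where B=2]) (use griddist_range in \<open>auto simp: abs_of_nonneg\<close>)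

text \<open>Tonelli's theorem exchanges the integral along the path with the expectation; joint
  measurability enters here, and afterwards only the laws at two times matter.\<close>

lemma osc_mean:
  assumes N: "1 \<le> N"
  shows "integrable \<mu> (\<lambda>\<omega>. osc D N (\<lambda>u. Z u \<omega>))"
    and "(\<integral>\<omega>. osc D N (\<lambda>u. Z u \<omega>) \<partial>\<mu>) = (LINT u:{0..real D}|lborel. griddist N u)"
proof -
  interpret pair_sigma_finite \<mu> lborel ..
  let ?z = "\<lambda>\<omega> u. Z u \<omega>" and ?d = "\<lambda>\<omega> u. \<bar>Z u \<omega> - Z (gup N u) \<omega>\<bar>"
  let ?f = "\<lambda>\<omega> u. ennreal (indicator {0..real D} u * ?d \<omega> u)"
  have sp: "sets (\<mu> \<Otimes>\<^sub>M borel) = sets (\<mu> \<Otimes>\<^sub>M lborel)" by (intro sets_pair_measure_cong) auto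
  have 0[measurable]: "(\<lambda>x. ?d (fst x) (snd x)) \<in> borel_measurable (\<mu> \<Otimes>\<^sub>M lborel)"
    using joint_diff[of N] by (simp add: case_prod_unfold measurable_cong_sets[OF sp refl])
  have m: "(\<lambda>x. ?f (fst x) (snd x)) \<in> borel_measurable (\<mu> \<Otimes>\<^sub>M lborel)" by measurable
  have o: "ennreal (osc D N (?z \<omega>)) = (\<integral>\<^sup>+ u. ?f \<omega> u \<partial>lborel)" "0 \<le> osc D N (?z \<omega>)" if w: "\<omega> \<in> space \<mu>" for \<omega>
  proof -
    obtain B where "nn_path (?z \<omega>) D N B" using path[OF w N] by blast
    then interpret nn_path "\<lambda>u. Z u \<omega>" D N B .
    \<comment> \<open>\<open>osc\<close> is a gauge integral; boundedness of the measurable path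
      identifies it with a Lebesgue integral.\<close>
    have si: "set_integrable lborel {0..real D} (?d \<omega>)"
    proof (rule bounded_integrable(1)[where B="2 * B"])
      fix u assume u: "0 \<le> u" "u \<le> real D"
      show "\<bar>?d \<omega> u\<bar> \<le> 2 * B" using y_nn[of u] y_le[OF u] yg_range[OF u] by linarith
    qed measurable
    have "osc D N (?z \<omega>) = (LINT u:{0..real D}|lborel. ?d \<omega> u)"
      unfolding osc_def by (rule set_borel_integral_eq_integral(2)[OF si, symmetric])
    hence "ennreal (osc D N (?z \<omega>)) = ennreal (\<integral>u. indicator {0..real D} u * ?d \<omega> u \<partial>lborel)"
      by (simp add: set_lebesgue_integral_def)
    also have "\<dots> = (\<integral>\<^sup>+ u. ?f \<omega> u \<partial>lborel)"
      by (rule nn_integral_eq_integral[symmetric]) (use si in \<open>auto simp: set_integrable_def\<close>)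
    finally show "ennreal (osc D N (?z \<omega>)) = (\<integral>\<^sup>+ u. ?f \<omega> u \<partial>lborel)" .
    show "0 \<le> osc D N (?z \<omega>)" by (rule osc_nonneg)
  qed
  have mnn: "(\<lambda>\<omega>. \<integral>\<^sup>+ u. ?f \<omega> u \<partial>lborel) \<in> borel_measurable \<mu>"
    by (rule lborel.borel_measurable_nn_integral) (use m in \<open>simp add: case_prod_unfold\<close>)
  have mo: "(\<lambda>\<omega>. osc D N (?z \<omega>)) \<in> borel_measurable \<mu>"
  proof -
    have "(\<lambda>\<omega>. enn2real (\<integral>\<^sup>+ u. ?f \<omega> u \<partial>lborel)) \<in> borel_measurable \<mu>" using mnn by measurable
    moreover have "enn2real (\<integral>\<^sup>+ u. ?f \<omega> u \<partial>lborel) = osc D N (?z \<omega>)" if "\<omega> \<in> space \<mu>" for \<omega>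
      using o[OF that] by (metis enn2real_ennreal)
    ultimately show ?thesis by (simp cong: measurable_cong)
  qed
  have "(\<integral>\<^sup>+ \<omega>. ennreal (osc D N (?z \<omega>)) \<partial>\<mu>) = (\<integral>\<^sup>+ \<omega>. \<integral>\<^sup>+ u. ?f \<omega> u \<partial>lborel \<partial>\<mu>)"
    by (rule nn_integral_cong) (rule o(1))
  also have "\<dots> = (\<integral>\<^sup>+ u. \<integral>\<^sup>+ \<omega>. ?f \<omega> u \<partial>\<mu> \<partial>lborel)"
    by (rule Fubini'[symmetric]) (use m in \<open>simp add: case_prod_unfold\<close>)
  also have "\<dots> = (\<integral>\<^sup>+ u. ennreal (indicator {0..real D} u * griddist N u) \<partial>lborel)"
  proof (rule nn_integral_cong)
    fix u
    show "(\<integral>\<^sup>+ \<omega>. ?f \<omega> u \<partial>\<mu>) = ennreal (indicator {0..real D} u * griddist N u)"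
    proof (cases "u \<in> {0..real D}")
      case True
      have "(\<integral>\<^sup>+ \<omega>. ennreal (?d \<omega> u) \<partial>\<mu>) = ennreal (griddist N u)"
        unfolding griddist_def by (rule nn_integral_eq_integral[OF griddist_integrable[OF N]]) (use True in auto)
      thus ?thesis using True by simp
    qed simp
  qed
  also have "\<dots> = ennreal (\<integral>u. indicator {0..real D} u * griddist N u \<partial>lborel)"
    by (rule nn_integral_eq_integral)
       (use griddist_set_integrable[OF N] griddist_range[OF N] in \<open>auto simp: set_integrable_def indicator_def intro!: AE_I2\<close>)
  finally have nn: "(\<integral>\<^sup>+ \<omega>. ennreal (osc D N (?z \<omega>)) \<partial>\<mu>) = ennreal (LINT u:{0..real D}|lborel. griddist N u)"
    by (simp add: set_lebesgue_integral_def)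
  show "integrable \<mu> (\<lambda>\<omega>. osc D N (?z \<omega>))"
    by (rule integrableI_nonneg[OF mo]) (use o(2) nn in \<open>auto intro!: AE_I2\<close>)
  have "0 \<le> (LINT u:{0..real D}|lborel. griddist N u)"
    unfolding set_lebesgue_integral_def using griddist_range(1)[OF N]
    by (intro Bochner_Integration.integral_nonneg) (auto simp: indicator_def)
  thus "(\<integral>\<omega>. osc D N (?z \<omega>) \<partial>\<mu>) = (LINT u:{0..real D}|lborel. griddist N u)"
    using nn o(2) by (subst integral_eq_nn_integral[OF mo]) (auto intro!: AE_I2)
qed

lemma grid_le_D: "1 \<le> N \<Longrightarrow> k < N * D \<Longrightarrow> 0 \<le> real (Suc k) / real N \<and> real (Suc k) / real N \<le> real D"
  using grid_le_bound[of N "Suc k" D] by auto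

lemma gmax_integrable: "1 \<le> N \<Longrightarrow> integrable \<mu> (\<lambda>\<omega>. gmax D N (\<lambda>u. Z u \<omega>))"
  unfolding ptmax_gmax
  by (rule coord_lipschitz_integrable[OF ptmax_lipschitz[OF _ D1] prob_space_axioms, where Z="\<lambda>k \<omega>. Z (real (Suc k) / real _) \<omega>"])
     (use Z_int grid_le_D in auto)

lemma rsum_max_integrable:
  assumes "1 \<le> N" "finite G" "G \<noteq> {}" "\<And>i. i \<in> G \<Longrightarrow> i + N \<le> N * D"
  shows "integrable \<mu> (\<lambda>\<omega>. Max (rsum N (\<lambda>u. Z u \<omega>) ` G))"
  unfolding winmax_rsum
  by (rule coord_lipschitz_integrable[OF winmax_lipschitz[OF assms] prob_space_axioms, where Z="\<lambda>k \<omega>. Z (real (Suc k) / real N) \<omega>"])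
     (use Z_int grid_le_D[OF assms(1)] in auto)

text \<open>Measurability of the supremum is a hypothesis because \<open>A\<close> may be
  uncountable. It is immediate on a discrete path space; for the limit process it is derived from
  the grid maxima.\<close>

lemma mean_window_close:
  assumes N: "1 \<le> N" and A: "A \<noteq> {}" "\<And>s. s \<in> A \<Longrightarrow> 0 \<le> s \<and> s + 1 \<le> real D"
    and G: "finite G" "G \<noteq> {}" "\<And>i. i \<in> G \<Longrightarrow> i + N \<le> N * D"
    and AG: "\<And>s. s \<in> A \<Longrightarrow> \<exists>i\<in>G. \<bar>s - real i / real N\<bar> \<le> 2 / real N"
    and GA: "\<And>i. i \<in> G \<Longrightarrow> \<exists>s\<in>A. \<bar>s - real i / real N\<bar> \<le> 2 / real N"
    and V: "(\<lambda>\<omega>. SUP s\<in>A. wint (\<lambda>u. Z u \<omega>) s) \<in> borel_measurable \<mu>"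
  shows "integrable \<mu> (\<lambda>\<omega>. SUP s\<in>A. wint (\<lambda>u. Z u \<omega>) s)"
    and "\<bar>(\<integral>\<omega>. (SUP s\<in>A. wint (\<lambda>u. Z u \<omega>) s) \<partial>\<mu>) - (\<integral>\<omega>. Max (rsum N (\<lambda>u. Z u \<omega>) ` G) \<partial>\<mu>)\<bar>
      \<le> 2 * (LINT u:{0..real D}|lborel. griddist N u) + 2 * (\<integral>\<omega>. gmax D N (\<lambda>u. Z u \<omega>) \<partial>\<mu>)"
proof -
  let ?z = "\<lambda>\<omega> u. Z u \<omega>"
  define W where "W = (\<lambda>\<omega>. SUP s\<in>A. wint (?z \<omega>) s)"
  define R where "R = (\<lambda>\<omega>. Max (rsum N (?z \<omega>) ` G))"
  define e where "e = (\<lambda>\<omega>. 2 * osc D N (?z \<omega>) + 2 * gmax D N (?z \<omega>))"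
  have ie: "integrable \<mu> e" unfolding e_def using osc_mean(1)[OF N] gmax_integrable[OF N] by auto
  have iR: "integrable \<mu> R" unfolding R_def by (rule rsum_max_integrable[OF N G])
  have close: "\<bar>W \<omega> - R \<omega>\<bar> \<le> e \<omega>" if w: "\<omega> \<in> space \<mu>" for \<omega>
  proof -
    obtain B where "nn_path (?z \<omega>) D N B" using path[OF w N] by blast
    then interpret nn_path "\<lambda>u. Z u \<omega>" D N B .
    show ?thesis unfolding W_def R_def e_def by (rule sup_window_close[OF A G AG GA])
  qed
  have mW: "W \<in> borel_measurable \<mu>" using V by (simp add: W_def)
  have id: "integrable \<mu> (\<lambda>\<omega>. W \<omega> - R \<omega>)"
  proof (rule Bochner_Integration.integrable_bound[OF ie])
    show "AE \<omega> in \<mu>. norm (W \<omega> - R \<omega>) \<le> norm (e \<omega>)"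
    proof (rule AE_I2)
      fix \<omega> assume "\<omega> \<in> space \<mu>"
      thus "norm (W \<omega> - R \<omega>) \<le> norm (e \<omega>)" using close[of \<omega>] by simp
    qed
  qed (use mW iR in auto)
  have iW: "integrable \<mu> W" using Bochner_Integration.integrable_add[OF id iR] by simp
  thus "integrable \<mu> (\<lambda>\<omega>. SUP s\<in>A. wint (?z \<omega>) s)" by (simp add: W_def)
  have "(\<integral>\<omega>. W \<omega> \<partial>\<mu>) - (\<integral>\<omega>. R \<omega> \<partial>\<mu>) = (\<integral>\<omega>. W \<omega> - R \<omega> \<partial>\<mu>)" using iW iR by simp
  also have "\<bar>\<dots>\<bar> \<le> (\<integral>\<omega>. \<bar>W \<omega> - R \<omega>\<bar> \<partial>\<mu>)" by (rule integral_abs_bound)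
  also have "\<dots> \<le> (\<integral>\<omega>. e \<omega> \<partial>\<mu>)" by (rule integral_mono) (use id ie close in auto)
  also have "\<dots> = 2 * (LINT u:{0..real D}|lborel. griddist N u) + 2 * (\<integral>\<omega>. gmax D N (?z \<omega>) \<partial>\<mu>)"
    unfolding e_def using osc_mean[OF N] gmax_integrable[OF N] by simp
  finally show "\<bar>(\<integral>\<omega>. (SUP s\<in>A. wint (?z \<omega>) s) \<partial>\<mu>) - (\<integral>\<omega>. Max (rsum N (?z \<omega>) ` G) \<partial>\<mu>)\<bar>
      \<le> 2 * (LINT u:{0..real D}|lborel. griddist N u) + 2 * (\<integral>\<omega>. gmax D N (?z \<omega>) \<partial>\<mu>)"
    by (simp add: W_def R_def)
qed

end

section \<open>Convergence of the window maximum\<close>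

text \<open>Compactness of [0, b] through Bolzano's bisection: right continuity and the left limit
  bound f on both sides of each point. The lower end max 0 a excludes negative times, about which
  the cadlag condition says nothing.\<close>

lemma cadlag_bounded:
  assumes f: "cadlag_on_nonneg f" and b: "0 \<le> b"
  shows "\<exists>B. \<forall>u. 0 \<le> u \<longrightarrow> u \<le> b \<longrightarrow> f u \<le> (B::real)"
proof -
  have "\<exists>B. \<forall>u. max 0 0 \<le> u \<longrightarrow> u \<le> b \<longrightarrow> f u \<le> B"
  proof (rule Bolzano[where P="\<lambda>a b. \<exists>B. \<forall>u. max 0 a \<le> u \<longrightarrow> u \<le> b \<longrightarrow> f u \<le> B", OF b])
    fix a b c :: real
    assume "\<exists>B. \<forall>u. max 0 a \<le> u \<longrightarrow> u \<le> b \<longrightarrow> f u \<le> B" "\<exists>B. \<forall>u. max 0 b \<le> u \<longrightarrow> u \<le> c \<longrightarrow> f u \<le> B"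
    then obtain B C where BC: "\<forall>u. max 0 a \<le> u \<longrightarrow> u \<le> b \<longrightarrow> f u \<le> B" "\<forall>u. max 0 b \<le> u \<longrightarrow> u \<le> c \<longrightarrow> f u \<le> C" by blast
    have "f u \<le> max B C" if "max 0 a \<le> u" "u \<le> c" for u
      using BC(1)[rule_format, of u] BC(2)[rule_format, of u] that by (cases "u \<le> b") auto
    thus "\<exists>B. \<forall>u. max 0 a \<le> u \<longrightarrow> u \<le> c \<longrightarrow> f u \<le> B" by blast
  next
    fix x assume x: "0 \<le> x" "x \<le> b"
    have "(f \<longlongrightarrow> f x) (at_right x)" using f x by (simp add: cadlag_on_nonneg_def continuous_within)
    hence "eventually (\<lambda>u. f u < f x + 1) (at_right x)" by (rule order_tendstoD) simp
    then obtain d1 where d1: "d1 > x" "\<And>u. x < u \<Longrightarrow> u < d1 \<Longrightarrow> f u < f x + 1" by (auto simp: eventually_at_right_field)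
    have "\<exists>d2<x. \<exists>C. \<forall>u. max 0 d2 < u \<longrightarrow> u < x \<longrightarrow> f u \<le> C"
    proof (cases "x = 0")
      case True thus ?thesis by (intro exI[of _ "-1"]) auto
    next
      case False
      hence "0 < x" using x by simp
      moreover have "\<forall>t>0. \<exists>l. (f \<longlongrightarrow> l) (at_left t)" using f unfolding cadlag_on_nonneg_def by (rule conjunct2)
      ultimately obtain l where "(f \<longlongrightarrow> l) (at_left x)" by blast
      hence "eventually (\<lambda>u. f u < l + 1) (at_left x)" by (rule order_tendstoD) simp
      then obtain d2 where d2: "d2 < x" "\<And>u. d2 < u \<Longrightarrow> u < x \<Longrightarrow> f u < l + 1" by (auto simp: eventually_at_left_field)
      have "\<forall>u. max 0 d2 < u \<longrightarrow> u < x \<longrightarrow> f u \<le> l + 1" using d2(2) by (auto simp: less_imp_le)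
      thus ?thesis using d2(1) by blast
    qed
    then obtain d2 C where d2: "d2 < x" "\<And>u. max 0 d2 < u \<Longrightarrow> u < x \<Longrightarrow> f u \<le> C" by blast
    show "\<exists>d>0. \<forall>a b. a \<le> x \<and> x \<le> b \<and> b - a < d \<longrightarrow> (\<exists>B. \<forall>u. max 0 a \<le> u \<longrightarrow> u \<le> b \<longrightarrow> f u \<le> B)"
    proof (rule exI[of _ "min (d1 - x) (x - d2)"], intro conjI allI impI)
      fix a b assume ab: "a \<le> x \<and> x \<le> b \<and> b - a < min (d1 - x) (x - d2)"
      have "f u \<le> max (max C (f 0)) (f x + 1)" if "max 0 a \<le> u" "u \<le> b" for u
      proof -
        have u: "u < d1" "d2 < u" "0 \<le> u" using ab that by auto
        consider "u = 0" | "u = x" | "x < u" | "0 < u" "u < x" using u by linarith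
        thus ?thesis
        proof cases
          case 3 thus ?thesis using d1(2)[of u] u by auto
        next
          case 4 thus ?thesis using d2(2)[of u] u by auto
        qed auto
      qed
      thus "\<exists>B. \<forall>u. max 0 a \<le> u \<longrightarrow> u \<le> b \<longrightarrow> f u \<le> B" by blast
    qed (use d1 d2 in auto)
  qed
  thus ?thesis by simp
qed

text \<open>The next grid point approaches u from the right, or equals u, so right continuity is all
  that is used.\<close>

lemma cadlag_gup:
  assumes f: "cadlag_on_nonneg f" and u: "0 \<le> u"
  shows "(\<lambda>N. f (gup N u)) \<longlonglongrightarrow> (f u :: real)"
proof -
  have l: "(f \<longlongrightarrow> f u) (at_right u)" using f u by (simp add: cadlag_on_nonneg_def continuous_within)
  show ?thesis
  proof (rule topological_tendstoI)
    fix S assume S: "open S" "f u \<in> S"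
    have "eventually (\<lambda>v. f v \<in> S) (at_right u)" using l S by (rule topological_tendstoD)
    then obtain d where d: "d > u" "\<And>v. u < v \<Longrightarrow> v < d \<Longrightarrow> f v \<in> S" by (auto simp: eventually_at_right_field)
    have "eventually (\<lambda>N. gup N u < d) sequentially" using gup_tendsto[OF u] d(1) by (rule order_tendstoD)
    thus "eventually (\<lambda>N. f (gup N u) \<in> S) sequentially"
      using eventually_ge_at_top[of 1]
    proof eventually_elim
      case (elim N)
      show ?case using d(2)[of "gup N u"] S gup_ge[of N u] elim by (cases "gup N u = u") auto
    qed
  qed
qed

locale gw_limit = critical_gw \<xi> \<alpha> L + xstar P \<alpha> ch M Xs
  for \<xi> \<alpha> L P ch and M :: "'a measure" and Xs
begin

text \<open>One of the times has to be 1, since the Laplace formulas on both sides were computed for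
  lists containing the conditioning time.\<close>

lemma Y_lipschitz_lim:
  fixes n :: nat and \<tau> :: "nat \<Rightarrow> real" and \<Psi> :: "(nat \<Rightarrow> real) \<Rightarrow> real"
  assumes J: "filterlim J at_top sequentially" and D: "1 \<le> D"
    and \<tau>: "\<And>i. i < n \<Longrightarrow> 0 < \<tau> i \<and> \<tau> i \<le> real D" "\<And>i k. i < k \<Longrightarrow> k < n \<Longrightarrow> \<tau> i < \<tau> k" "\<exists>i<n. \<tau> i = 1"
    and lip: "\<And>x y. \<bar>\<Psi> x - \<Psi> y\<bar> \<le> C * (\<Sum>i<n. \<bar>x i - y i\<bar>)"
  shows "(\<lambda>m. \<integral>zs. \<Psi> (\<lambda>i. Y (J m) (\<tau> i) zs) \<partial>nu D (J m)) \<longlonglongrightarrow> (\<integral>\<omega>. \<Psi> (\<lambda>i. Xs (\<tau> i) \<omega>) \<partial>M)"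
proof (rule weak_conv_lipschitz[where n=n and C=C and \<Psi>=\<Psi> and Y="\<lambda>m i. Y (J m) (\<tau> i)" and X="\<lambda>i. Xs (\<tau> i)"])
  fix e :: "nat \<Rightarrow> nat"
  define ts where "ts = map (\<lambda>i. (\<tau> i, real (e i))) [0..<n]"
  have s1: "(\<Sum>x\<leftarrow>ts. snd x * F (fst x)) = (\<Sum>i<n. real (e i) * F (\<tau> i))" for F :: "real \<Rightarrow> real"
    by (simp add: ts_def comp_def sum_list_distinct_conv_sum_set atLeast0LessThan)
  have c: "\<forall>x\<in>set ts. 0 < fst x \<and> fst x \<le> real D \<and> 0 \<le> snd x" using \<tau>(1) by (auto simp: ts_def)
  have s: "sorted_wrt (<) (map fst ts)" using \<tau>(2) by (auto simp: ts_def sorted_wrt_iff_nth_less)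
  have o: "1 \<in> fst ` set ts" using \<tau>(3) by (force simp: ts_def)
  have "(\<lambda>m. \<integral>zs. exp (- (\<Sum>x\<leftarrow>ts. snd x * Y (J m) (fst x) zs)) \<partial>nu D (J m)) \<longlonglongrightarrow> Blim \<alpha> 0 ts - Ulim \<alpha> 0 ts"
    by (rule Y_fdd_lim(1)[OF J D c s o])
  moreover have "Blim \<alpha> 0 ts - Ulim \<alpha> 0 ts = (\<integral>\<omega>. exp (- (\<Sum>x\<leftarrow>ts. snd x * Xs (fst x) \<omega>)) \<partial>M)"
    by (rule Xs_laplace[symmetric, OF _ s o]) (use c in auto)
  ultimately show "(\<lambda>m. \<integral>\<omega>. exp (- (\<Sum>i<n. real (e i) * Y (J m) (\<tau> i) \<omega>)) \<partial>nu D (J m)) \<longlonglongrightarrow>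
      (\<integral>\<omega>. exp (- (\<Sum>i<n. real (e i) * Xs (\<tau> i) \<omega>)) \<partial>M)"
    unfolding s1[of "\<lambda>t. Y (J _) t _"] s1[of "\<lambda>t. Xs t _"] by simp
next
  fix i assume i: "i < n"
  show "(\<lambda>m. \<integral>\<omega>. Y (J m) (\<tau> i) \<omega> \<partial>nu D (J m)) \<longlonglongrightarrow> (\<integral>\<omega>. Xs (\<tau> i) \<omega> \<partial>M)"
    unfolding Xs_mean[OF \<tau>(1)[OF i, THEN conjunct1]] by (rule nu_mean_lim[OF J D]) (use \<tau>(1)[OF i] in auto)
next
  show "\<bar>\<Psi> x - \<Psi> y\<bar> \<le> C * (\<Sum>i<n. \<bar>x i - y i\<bar>)" for x y by (rule lip)
qed (use nu_prob[OF D] Y_integrable[OF D] Y_nonneg \<tau>(1) Xs_integrable Xs_nonneg prob_space_axioms in \<open>auto simp: less_imp_le\<close>)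

text \<open>Time 1 is added as a silent coordinate. Sorting the set of the three times takes care of
  their order and of coincidences.\<close>

lemma Y_abs_diff_lim:
  assumes J: "filterlim J at_top sequentially" and D: "1 \<le> D"
    and u: "0 < u" "u \<le> real D" "0 < v" "v \<le> real D"
  shows "(\<lambda>m. \<integral>zs. \<bar>Y (J m) u zs - Y (J m) v zs\<bar> \<partial>nu D (J m)) \<longlonglongrightarrow> (\<integral>\<omega>. \<bar>Xs u \<omega> - Xs v \<omega>\<bar> \<partial>M)"
proof -
  define ts where "ts = sorted_list_of_set {u, v, 1}"
  have st: "set ts = {u, v, 1}" unfolding ts_def by (rule set_sorted_list_of_set) simp
  have ss: "sorted_wrt (<) ts" unfolding ts_def by (rule strict_sorted_list_of_set)
  obtain a where a: "a < length ts" "ts ! a = u" using st by (metis in_set_conv_nth insertI1)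
  obtain b where b: "b < length ts" "ts ! b = v" using st by (metis in_set_conv_nth insertI1 insertI2)
  obtain c where c: "c < length ts" "ts ! c = 1" using st by (metis in_set_conv_nth insertI1 insertI2)
  have "(\<lambda>m. \<integral>zs. (\<lambda>x. \<bar>x a - x b\<bar>) (\<lambda>i. Y (J m) (ts ! i) zs) \<partial>nu D (J m)) \<longlonglongrightarrow> (\<integral>\<omega>. (\<lambda>x. \<bar>x a - x b\<bar>) (\<lambda>i. Xs (ts ! i) \<omega>) \<partial>M)"
  proof (rule Y_lipschitz_lim[OF J D])
    show "0 < ts ! i \<and> ts ! i \<le> real D" if "i < length ts" for i
      using nth_mem[OF that] u D by (auto simp: st)
    show "ts ! i < ts ! k" if "i < k" "k < length ts" for i k using ss that by (simp add: sorted_wrt_iff_nth_less)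
    show "\<exists>i<length ts. ts ! i = 1" using c by auto
    fix x y :: "nat \<Rightarrow> real"
    have "\<bar>x a - y a\<bar> \<le> (\<Sum>i<length ts. \<bar>x i - y i\<bar>)"
      using member_le_sum[of a "{..<length ts}" "\<lambda>i. \<bar>x i - y i\<bar>"] a by simp
    moreover have "\<bar>x b - y b\<bar> \<le> (\<Sum>i<length ts. \<bar>x i - y i\<bar>)"
      using member_le_sum[of b "{..<length ts}" "\<lambda>i. \<bar>x i - y i\<bar>"] b by simp
    ultimately show "\<bar>\<bar>x a - x b\<bar> - \<bar>y a - y b\<bar>\<bar> \<le> 2 * (\<Sum>i<length ts. \<bar>x i - y i\<bar>)" by linarith
  qed
  thus ?thesis using a b by simp
qed

lemma grid_times:
  assumes N: "1 \<le> N" and D: "1 \<le> D"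
  shows "\<And>i. i < N * D \<Longrightarrow> 0 < real (Suc i) / real N \<and> real (Suc i) / real N \<le> real D"
    and "\<And>i k. i < k \<Longrightarrow> k < N * D \<Longrightarrow> real (Suc i) / real N < real (Suc k) / real N"
    and "\<exists>i<N * D. real (Suc i) / real N = 1"
proof -
  fix i assume "i < N * D"
  thus "0 < real (Suc i) / real N \<and> real (Suc i) / real N \<le> real D" using N grid_le_bound[of N "Suc i" D] by simp
next
  show "\<exists>i<N * D. real (Suc i) / real N = 1"
  proof (intro exI conjI)
    have "N * 1 \<le> N * D" using D by (intro mult_le_mono) auto
    thus "N - 1 < N * D" using N by linarith
    show "real (Suc (N - 1)) / real N = 1" using N by simp
  qed
next
  fix i k :: nat assume "i < k" thus "real (Suc i) / real N < real (Suc k) / real N"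
    using N by (intro divide_strict_right_mono) auto
qed

lemma Y_window_lim:
  assumes J: "filterlim J at_top sequentially" and D: "1 \<le> D" and N: "1 \<le> N"
    and G: "finite G" "G \<noteq> {}" "\<And>i. i \<in> G \<Longrightarrow> i + N \<le> N * D"
  shows "(\<lambda>m. \<integral>zs. Max (rsum N (\<lambda>u. Y (J m) u zs) ` G) \<partial>nu D (J m)) \<longlonglongrightarrow> (\<integral>\<omega>. Max (rsum N (\<lambda>u. Xs u \<omega>) ` G) \<partial>M)"
    and "(\<lambda>m. \<integral>zs. gmax D N (\<lambda>u. Y (J m) u zs) \<partial>nu D (J m)) \<longlonglongrightarrow> (\<integral>\<omega>. gmax D N (\<lambda>u. Xs u \<omega>) \<partial>M)"
  unfolding winmax_rsum ptmax_gmax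
  using Y_lipschitz_lim[OF J D grid_times[OF N D] winmax_lipschitz[OF N G]]
    Y_lipschitz_lim[OF J D grid_times[OF N D] ptmax_lipschitz[OF N D]] by simp_all

lemma Y_nn_process:
  assumes D: "1 \<le> D"
  shows "nn_process (nu D J) (Y J) D"
proof (rule nn_process.intro[OF nu_prob[OF D]], unfold_locales)
  have "(\<lambda>x. Y J (snd x) (fst x)) \<in> borel_measurable (count_space UNIV \<Otimes>\<^sub>M borel)"
  proof (rule measurable_pair_measure_countable1)
    show "countable (UNIV :: nat list set)" by simp
    fix zs :: "nat list"
    have "(\<lambda>u. Q J * real (zs ! nat \<lfloor>u * real J\<rfloor>)) \<in> borel_measurable borel"
    proof -
      have "(\<lambda>u. nat \<lfloor>u * real J\<rfloor>) \<in> borel \<rightarrow>\<^sub>M count_space UNIV" by measurable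
      from measurable_compose[OF this, of "\<lambda>i. Q J * real (zs ! i)" borel] show ?thesis by simp
    qed
    thus "(\<lambda>y. Y J (snd (zs, y)) (fst (zs, y))) \<in> borel_measurable borel" by (simp add: Y_def tf_def)
  qed
  moreover have sp: "sets (nu D J \<Otimes>\<^sub>M borel) = sets (count_space UNIV \<Otimes>\<^sub>M (borel :: real measure))"
    by (intro sets_pair_measure_cong) auto
  ultimately show "(\<lambda>(\<omega>, u). Y J u \<omega>) \<in> borel_measurable (nu D J \<Otimes>\<^sub>M borel)"
    unfolding case_prod_unfold measurable_cong_sets[OF sp refl] by simp
next
  fix zs :: "nat list"
  show "\<exists>B. \<forall>u. 0 \<le> u \<longrightarrow> u \<le> real D \<longrightarrow> Y J u zs \<le> B"
  proof (intro exI allI impI)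
    fix u assume "0 \<le> u" "u \<le> real D"
    hence "zs ! tf J u \<le> (\<Sum>i\<le>D * J. zs ! i)" by (intro member_le_sum) (auto simp: tf_le)
    hence "real (zs ! tf J u) \<le> real (\<Sum>i\<le>D * J. zs ! i)" by (rule of_nat_mono)
    thus "Y J u zs \<le> Q J * real (\<Sum>i\<le>D * J. zs ! i)" unfolding Y_def using Q_pos[of J]
      by (intro mult_left_mono) (auto simp: less_imp_le simp del: of_nat_sum)
  qed
qed (use Y_nonneg Y_integrable[OF D] nu_mean_range(2)[OF D] D in auto)

text \<open>The hypotheses say nothing about Xs at negative times, hence the truncation.\<close>

definition X :: "real \<Rightarrow> 'a \<Rightarrow> real" where "X u \<omega> = Xs (max 0 u) \<omega>"

lemma X_eq: "0 \<le> u \<Longrightarrow> X u = Xs u"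
  by (simp add: X_def[abs_def] fun_eq_iff)

lemma X_integrable: "0 \<le> u \<Longrightarrow> integrable M (X u)"
  and X_mean: "0 \<le> u \<Longrightarrow> (\<integral>\<omega>. X u \<omega> \<partial>M) = mulim \<alpha> u"
proof -
  assume u: "0 \<le> u"
  have 0: "integrable M (Xs 0)" "(\<integral>\<omega>. Xs 0 \<omega> \<partial>M) = 0"
    using Xs_0 by (simp_all cong: Bochner_Integration.integrable_cong Bochner_Integration.integral_cong)
  show "integrable M (X u)" using u 0 Xs_integrable[of u] by (cases "u = 0") (auto simp: X_eq)
  show "(\<integral>\<omega>. X u \<omega> \<partial>M) = mulim \<alpha> u" using u 0 Xs_mean[of u] by (cases "u = 0") (auto simp: X_eq mulim_def)
qed

lemma X_gup: "\<omega> \<in> space M \<Longrightarrow> 0 \<le> u \<Longrightarrow> (\<lambda>N. X (gup N u) \<omega>) \<longlonglongrightarrow> X u \<omega>"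
  using cadlag_gup[OF Xs_cadlag, of \<omega> u] by (simp add: X_def gup_def)

text \<open>Joint measurability: by right continuity the process is the pointwise limit of its
  values at the next grid point, and for each N these involve countably many times.\<close>

lemma X_nn_process:
  assumes D: "1 \<le> D"
  shows "nn_process M X D"
proof (rule nn_process.intro[OF prob_space_axioms], unfold_locales)
  have "(\<lambda>x. X (snd x) (fst x)) \<in> borel_measurable (M \<Otimes>\<^sub>M borel)"
  proof (rule borel_measurable_LIMSEQ_real[where u="\<lambda>N x. X (gup N (max 0 (snd x))) (fst x)"])
    fix x assume x: "x \<in> space (M \<Otimes>\<^sub>M (borel :: real measure))"
    hence "(\<lambda>N. X (gup N (max 0 (snd x))) (fst x)) \<longlonglongrightarrow> X (max 0 (snd x)) (fst x)"
      by (intro X_gup) (auto simp: space_pair_measure)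
    thus "(\<lambda>N. X (gup N (max 0 (snd x))) (fst x)) \<longlonglongrightarrow> X (snd x) (fst x)" by (simp add: X_def)
  next
    fix N
    have "(\<lambda>x. (\<lambda>k x. X (real k / real N) (fst x)) (max 1 (nat \<lceil>max 0 (snd x) * real N\<rceil>)) x) \<in> borel_measurable (M \<Otimes>\<^sub>M (borel :: real measure))"
    proof (rule measurable_compose_countable[where f="\<lambda>k x. X (real k / real N) (fst x)"])
      show "(\<lambda>x. max 1 (nat \<lceil>max 0 (snd x) * real N\<rceil>)) \<in> M \<Otimes>\<^sub>M (borel :: real measure) \<rightarrow>\<^sub>M count_space UNIV" by measurable
      show "(\<lambda>x. X (real k / real N) (fst x)) \<in> borel_measurable (M \<Otimes>\<^sub>M (borel :: real measure))" for k
        unfolding X_def by measurable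
    qed
    thus "(\<lambda>x. X (gup N (max 0 (snd x))) (fst x)) \<in> borel_measurable (M \<Otimes>\<^sub>M (borel :: real measure))"
      by (simp add: gup_def)
  qed
  thus "(\<lambda>(\<omega>, u). X u \<omega>) \<in> borel_measurable (M \<Otimes>\<^sub>M borel)" by (simp add: case_prod_unfold)
next
  fix \<omega> assume w: "\<omega> \<in> space M"
  show "\<exists>B. \<forall>u. 0 \<le> u \<longrightarrow> u \<le> real D \<longrightarrow> X u \<omega> \<le> B"
    using cadlag_bounded[OF Xs_cadlag[OF w], of "real D"] by (auto simp: X_def)
next
  fix u :: real assume u: "0 \<le> u" "u \<le> real D"
  have "0 < \<alpha>" using alpha by simp
  from mulim_range[OF this u(1)] show "(\<integral>\<omega>. X u \<omega> \<partial>M) \<le> 1" by (simp add: X_mean[OF u(1)])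
qed (use X_integrable D Xs_nonneg in \<open>auto simp: X_def\<close>)

lemma mulim_tendsto: "(f \<longlongrightarrow> u) F \<Longrightarrow> ((\<lambda>x. mulim \<alpha> (f x)) \<longlongrightarrow> mulim \<alpha> u) F"
proof -
  assume f: "(f \<longlongrightarrow> u) F"
  have m: "mulim \<alpha> v = 1 - max 0 (1 - v) powr (1 + 1 / \<alpha>)" for v by (auto simp: mulim_def max_def)
  have "0 < 1 + 1 / \<alpha>" using alpha by (simp add: add_pos_pos)
  thus ?thesis unfolding m by (intro tendsto_intros tendsto_powr2 f) auto
qed

text \<open>Since |a - b| = a + b - 2 min a b, continuity of the mean replaces any moment bound of higher order.\<close>

lemma X_griddist_lim:
  assumes D: "1 \<le> D" and u: "0 \<le> u"
  shows "(\<lambda>N. \<integral>\<omega>. \<bar>X u \<omega> - X (gup N u) \<omega>\<bar> \<partial>M) \<longlonglongrightarrow> 0"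
proof -
  have g: "0 \<le> gup N u" for N by (simp add: gup_def)
  have nn: "0 \<le> X v \<omega>" if "\<omega> \<in> space M" for v \<omega> using that by (simp add: X_def Xs_nonneg)
  have im: "integrable M (\<lambda>\<omega>. min (X u \<omega>) (X (gup N u) \<omega>))" for N
    by (intro integrable_min X_integrable u g)
  have "(\<integral>\<omega>. \<bar>X u \<omega> - X (gup N u) \<omega>\<bar> \<partial>M) = (\<integral>\<omega>. (X u \<omega> + X (gup N u) \<omega>) - 2 * min (X u \<omega>) (X (gup N u) \<omega>) \<partial>M)" for N
    by (intro Bochner_Integration.integral_cong) (auto simp: min_def)
  also have "\<dots> N = mulim \<alpha> u + mulim \<alpha> (gup N u) - 2 * (\<integral>\<omega>. min (X u \<omega>) (X (gup N u) \<omega>) \<partial>M)" for N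
    using X_integrable[OF u] X_integrable[OF g] im[of N] by (simp add: X_mean u g)
  finally have e: "(\<integral>\<omega>. \<bar>X u \<omega> - X (gup N u) \<omega>\<bar> \<partial>M) = mulim \<alpha> u + mulim \<alpha> (gup N u) - 2 * (\<integral>\<omega>. min (X u \<omega>) (X (gup N u) \<omega>) \<partial>M)" for N .
  have "(\<lambda>N. \<integral>\<omega>. min (X u \<omega>) (X (gup N u) \<omega>) \<partial>M) \<longlonglongrightarrow> (\<integral>\<omega>. X u \<omega> \<partial>M)"
  proof (rule integral_dominated_convergence[where w="X u"])
    show "AE \<omega> in M. (\<lambda>N. min (X u \<omega>) (X (gup N u) \<omega>)) \<longlonglongrightarrow> X u \<omega>"
    proof (rule AE_I2)
      fix \<omega> assume "\<omega> \<in> space M"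
      from tendsto_min[OF tendsto_const[of "X u \<omega>"] X_gup[OF this u]]
      show "(\<lambda>N. min (X u \<omega>) (X (gup N u) \<omega>)) \<longlonglongrightarrow> X u \<omega>" by simp
    qed
    show "AE \<omega> in M. norm (min (X u \<omega>) (X (gup N u) \<omega>)) \<le> X u \<omega>" for N
      by (rule AE_I2) (use nn in \<open>auto simp: min_def\<close>)
  qed (use X_integrable[OF u] im in auto)
  hence "(\<lambda>N. mulim \<alpha> u + mulim \<alpha> (gup N u) - 2 * (\<integral>\<omega>. min (X u \<omega>) (X (gup N u) \<omega>) \<partial>M)) \<longlonglongrightarrow> mulim \<alpha> u + mulim \<alpha> u - 2 * mulim \<alpha> u"
    by (intro tendsto_intros mulim_tendsto gup_tendsto u) (simp add: X_mean[OF u])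
  thus ?thesis unfolding e by simp
qed

end

context nn_path begin

text \<open>For N = 1 this bounds the path integral by two quantities already known to be integrable
  over the probability space.\<close>

lemma path_le_gmax: "integral {0..real D} y \<le> osc D N y + real D * (real N * gmax D N y)"
proof -
  have "integral {0..real D} (\<lambda>u. y (gup N u)) \<le> integral {0..real D} (\<lambda>_. real N * gmax D N y)"
    by (rule integral_le) (use yg_int yg_gmax in auto)
  also have "\<dots> = real D * (real N * gmax D N y)" by simp
  finally show ?thesis using osc_bound[of 0 "real D"] by linarith
qed

end

context gw_limit begin

lemma X_path:
  assumes "\<omega> \<in> space M" "1 \<le> D"
  obtains B where "\<And>N. 1 \<le> N \<Longrightarrow> nn_path (\<lambda>u. X u \<omega>) D N B"
proof -
  obtain B where "nn_path (\<lambda>u. X u \<omega>) D 1 B" using nn_process.path[OF X_nn_process[OF assms(2)] assms(1), of 1] by auto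
  hence "nn_path (\<lambda>u. X u \<omega>) D N B" if "1 \<le> N" for N using that by (simp add: nn_path_def)
  thus ?thesis by (rule that)
qed

lemma X_osc_tendsto:
  assumes w: "\<omega> \<in> space M" and D: "1 \<le> D"
  shows "(\<lambda>N. osc D (Suc N) (\<lambda>u. X u \<omega>)) \<longlonglongrightarrow> 0"
proof -
  obtain B where B: "\<And>N. 1 \<le> N \<Longrightarrow> nn_path (\<lambda>u. X u \<omega>) D N B" using X_path[OF w D] by blast
  have "(\<lambda>N. integral {0..real D} (\<lambda>u. \<bar>X u \<omega> - X (gup (Suc N) u) \<omega>\<bar>)) \<longlonglongrightarrow> integral {0..real D} (\<lambda>u. 0)"
  proof (rule dominated_convergence(2)[where h="\<lambda>_. 2 * B"])
    fix N
    interpret nn_path "\<lambda>u. X u \<omega>" D "Suc N" B by (rule B) simp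
    show "(\<lambda>u. \<bar>X u \<omega> - X (gup (Suc N) u) \<omega>\<bar>) integrable_on {0..real D}" by (rule osc_int) auto
    show "norm \<bar>X u \<omega> - X (gup (Suc N) u) \<omega>\<bar> \<le> 2 * B" if "u \<in> {0..real D}" for u
    proof -
      have u: "0 \<le> u" "u \<le> real D" using that by auto
      have "\<bar>X u \<omega> - X (gup (Suc N) u) \<omega>\<bar> \<le> 2 * B" using y_nn[of u] y_le[OF u] yg_range[OF u] by linarith
      thus ?thesis by simp
    qed
  next
    fix u assume "u \<in> {0..real D}"
    hence "(\<lambda>N. X (gup N u) \<omega>) \<longlonglongrightarrow> X u \<omega>" by (intro X_gup[OF w]) auto
    hence "(\<lambda>N. X (gup (Suc N) u) \<omega>) \<longlonglongrightarrow> X u \<omega>" by (rule LIMSEQ_Suc)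
    hence "(\<lambda>N. \<bar>X u \<omega> - X (gup (Suc N) u) \<omega>\<bar>) \<longlonglongrightarrow> \<bar>X u \<omega> - X u \<omega>\<bar>" by (intro tendsto_intros)
    thus "(\<lambda>N. \<bar>X u \<omega> - X (gup (Suc N) u) \<omega>\<bar>) \<longlonglongrightarrow> 0" by simp
  qed auto
  thus ?thesis by (simp add: osc_def)
qed

lemma X_gmax_tendsto:
  assumes w: "\<omega> \<in> space M" and D: "1 \<le> D"
  shows "(\<lambda>N. gmax D (Suc N) (\<lambda>u. X u \<omega>)) \<longlonglongrightarrow> 0"
proof -
  obtain B where B: "\<And>N. 1 \<le> N \<Longrightarrow> nn_path (\<lambda>u. X u \<omega>) D N B" using X_path[OF w D] by blast
  show ?thesis
  proof (rule tendsto_sandwich[OF _ _ tendsto_const])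
    show "\<forall>\<^sub>F N in sequentially. 0 \<le> gmax D (Suc N) (\<lambda>u. X u \<omega>)"
      by (rule always_eventually) (use nn_path.gmax_nonneg[OF B] in auto)
    show "\<forall>\<^sub>F N in sequentially. gmax D (Suc N) (\<lambda>u. X u \<omega>) \<le> B / real (Suc N)"
      by (rule always_eventually, rule allI, rule nn_path.gmax_le_B, rule B) simp
    show "(\<lambda>N. B / real (Suc N)) \<longlonglongrightarrow> 0" by (rule LIMSEQ_Suc[OF lim_const_over_n])
  qed
qed

lemma X_griddist_integral_lim:
  assumes D: "1 \<le> D"
  shows "(\<lambda>N. LINT u:{0..real D}|lborel. nn_process.griddist M X (Suc N) u) \<longlonglongrightarrow> 0"
proof -
  interpret XP: nn_process M X D by (rule X_nn_process[OF D])
  have "(\<lambda>N. LINT u|lborel. indicator {0..real D} u *\<^sub>R XP.griddist (Suc N) u) \<longlonglongrightarrow> (LINT (u::real)|lborel. (0::real))"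
  proof (rule integral_dominated_convergence[where w="\<lambda>u. indicator {0..real D} u * 2"])
    show "integrable lborel (\<lambda>u. indicator {0..real D} u * (2::real))" by simp
    show "AE u in lborel. (\<lambda>N. indicator {0..real D} u *\<^sub>R XP.griddist (Suc N) u) \<longlonglongrightarrow> 0"
    proof (rule AE_I2)
      fix u :: real
      show "(\<lambda>N. indicator {0..real D} u *\<^sub>R XP.griddist (Suc N) u) \<longlonglongrightarrow> 0"
      proof (cases "u \<in> {0..real D}")
        case True
        hence "(\<lambda>N. XP.griddist (Suc N) u) \<longlonglongrightarrow> 0" unfolding XP.griddist_def by (intro LIMSEQ_Suc[OF X_griddist_lim[OF D]]) auto
        thus ?thesis using True by simp
      qed simp
    qed
    show "AE u in lborel. norm (indicator {0..real D} u *\<^sub>R XP.griddist (Suc N) u) \<le> indicator {0..real D} u * 2" for N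
      by (rule AE_I2) (use XP.griddist_range[of "Suc N"] in \<open>auto simp: indicator_def\<close>)
  qed auto
  thus ?thesis by (simp add: set_lebesgue_integral_def)
qed

text \<open>No moment of the supremum of the path is at hand. The positive part of
  \<open>gmax\<close> - \<open>osc\<close> tends to 0 pathwise and is dominated by the path
  integral, hence by the integrable \<open>W\<close>; the rest is at most \<open>osc\<close>, whose
  mean tends to 0.\<close>

lemma X_gmax_mean_lim:
  assumes D: "1 \<le> D"
  shows "(\<lambda>N. \<integral>\<omega>. gmax D (Suc N) (\<lambda>u. X u \<omega>) \<partial>M) \<longlonglongrightarrow> 0"
proof -
  interpret XP: nn_process M X D by (rule X_nn_process[OF D])
  let ?o = "\<lambda>N \<omega>. osc D N (\<lambda>u. X u \<omega>)" and ?g = "\<lambda>N \<omega>. gmax D N (\<lambda>u. X u \<omega>)"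
  define k where "k N \<omega> = max 0 (?g (Suc N) \<omega> - ?o (Suc N) \<omega>)" for N \<omega>
  define W where "W \<omega> = ?o 1 \<omega> + real D * ?g 1 \<omega>" for \<omega>
  have iW: "integrable M W" unfolding W_def using XP.osc_mean(1)[of 1] XP.gmax_integrable[of 1] by auto
  have ik: "integrable M (k N)" for N unfolding k_def
    using XP.osc_mean(1)[of "Suc N"] XP.gmax_integrable[of "Suc N"] by auto
  have pw: "?g (Suc N) \<omega> \<le> ?o (Suc N) \<omega> + W \<omega>" "0 \<le> ?o (Suc N) \<omega>" "0 \<le> ?g (Suc N) \<omega>" "0 \<le> W \<omega>" if w: "\<omega> \<in> space M" for N \<omega>
  proof -
    obtain B where B: "\<And>N. 1 \<le> N \<Longrightarrow> nn_path (\<lambda>u. X u \<omega>) D N B" using X_path[OF w D] by blast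
    interpret a: nn_path "\<lambda>u. X u \<omega>" D "Suc N" B by (rule B) simp
    interpret b: nn_path "\<lambda>u. X u \<omega>" D 1 B by (rule B) simp
    show "?g (Suc N) \<omega> \<le> ?o (Suc N) \<omega> + W \<omega>" using a.gmax_le_osc b.path_le_gmax by (simp add: W_def)
    show "0 \<le> ?o (Suc N) \<omega>" "0 \<le> ?g (Suc N) \<omega>" by (rule a.osc_nonneg, rule a.gmax_nonneg)
    show "0 \<le> W \<omega>" using b.osc_nonneg b.gmax_nonneg by (simp add: W_def)
  qed
  have "(\<lambda>N. \<integral>\<omega>. k N \<omega> \<partial>M) \<longlonglongrightarrow> (\<integral>\<omega>. 0 \<partial>M)"
  proof (rule integral_dominated_convergence[where w=W])
    show "AE \<omega> in M. (\<lambda>N. k N \<omega>) \<longlonglongrightarrow> 0"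
    proof (rule AE_I2)
      fix \<omega> assume w: "\<omega> \<in> space M"
      have "(\<lambda>N. k N \<omega>) \<longlonglongrightarrow> max 0 (0 - 0)" unfolding k_def
        by (intro tendsto_intros X_gmax_tendsto[OF w D] X_osc_tendsto[OF w D])
      thus "(\<lambda>N. k N \<omega>) \<longlonglongrightarrow> 0" by simp
    qed
    show "AE \<omega> in M. norm (k N \<omega>) \<le> W \<omega>" for N
    proof (rule AE_I2)
      fix \<omega> assume w: "\<omega> \<in> space M"
      show "norm (k N \<omega>) \<le> W \<omega>" using pw(1,2)[OF w, of N] pw(4)[OF w] by (simp add: k_def)
    qed
  qed (use iW ik in auto)
  hence "(\<lambda>N. (LINT u:{0..real D}|lborel. XP.griddist (Suc N) u) + (\<integral>\<omega>. k N \<omega> \<partial>M)) \<longlonglongrightarrow> 0 + 0"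
    by (intro tendsto_add X_griddist_integral_lim[OF D]) simp
  hence lim: "(\<lambda>N. (LINT u:{0..real D}|lborel. XP.griddist (Suc N) u) + (\<integral>\<omega>. k N \<omega> \<partial>M)) \<longlonglongrightarrow> 0" by simp
  show ?thesis
  proof (rule tendsto_sandwich[OF _ _ tendsto_const lim])
    show "\<forall>\<^sub>F N in sequentially. 0 \<le> (\<integral>\<omega>. ?g (Suc N) \<omega> \<partial>M)"
      by (intro always_eventually allI Bochner_Integration.integral_nonneg) (rule pw(3))
    have "(\<integral>\<omega>. ?g (Suc N) \<omega> \<partial>M) \<le> (\<integral>\<omega>. ?o (Suc N) \<omega> + k N \<omega> \<partial>M)" for N
      by (rule integral_mono) (use XP.osc_mean(1)[of "Suc N"] XP.gmax_integrable[of "Suc N"] ik in \<open>auto simp: k_def\<close>)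
    also have "\<dots> N = (LINT u:{0..real D}|lborel. XP.griddist (Suc N) u) + (\<integral>\<omega>. k N \<omega> \<partial>M)" for N
      using XP.osc_mean[of "Suc N"] ik by simp
    finally show "\<forall>\<^sub>F N in sequentially. (\<integral>\<omega>. ?g (Suc N) \<omega> \<partial>M) \<le> (LINT u:{0..real D}|lborel. XP.griddist (Suc N) u) + (\<integral>\<omega>. k N \<omega> \<partial>M)"
      by simp
  qed
qed

text \<open>The bound of \<open>mean_window_close\<close> for the limit process. For fixed N it is
  also the limit of the corresponding bound for the rescaled process.\<close>

definition err :: "nat \<Rightarrow> nat \<Rightarrow> real" where
  "err D N = 2 * (LINT u:{0..real D}|lborel. nn_process.griddist M X N u) + 2 * (\<integral>\<omega>. gmax D N (\<lambda>u. X u \<omega>) \<partial>M)"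

lemma err_lim: "1 \<le> D \<Longrightarrow> (\<lambda>N. err D (Suc N)) \<longlonglongrightarrow> 0"
  unfolding err_def using tendsto_add[OF tendsto_mult[OF tendsto_const X_griddist_integral_lim] tendsto_mult[OF tendsto_const X_gmax_mean_lim]]
  by fastforce

definition grid :: "real \<Rightarrow> nat \<Rightarrow> nat set" where "grid T N = {..nat \<lfloor>(T - 1) * real N\<rfloor>}"

lemma grid_props: "finite (grid T N)" "grid T N \<noteq> {}" by (auto simp: grid_def)

lemma grid_mem: "1 \<le> T \<Longrightarrow> 1 \<le> N \<Longrightarrow> i \<in> grid T N \<longleftrightarrow> real i / real N \<le> T - 1"
  by (simp add: grid_def divide_le_eq le_nat_iff le_floor_iff)

lemma grid_window:
  assumes "1 \<le> T" "1 \<le> N" "T \<le> real D" "i \<in> grid T N" shows "i + N \<le> N * D"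
proof -
  have "real i / real N + 1 \<le> real D" using grid_mem[OF assms(1,2)] assms(3,4) by fastforce
  hence "(real i / real N + 1) * real N \<le> real D * real N" by (intro mult_right_mono) auto
  moreover have "(real i / real N + 1) * real N = real i + real N" using assms(2) by (simp add: distrib_right)
  ultimately have "real (i + N) \<le> real (N * D)" by (simp add: mult.commute)
  thus ?thesis by (rule of_nat_le_iff[THEN iffD1])
qed

lemma Vstar_eq: "Vstar Xs T \<omega> = (SUP s\<in>{0..T - 1}. wint (\<lambda>u. X u \<omega>) s)"
  unfolding Vstar_def wint_def
  by (intro arg_cong[of _ _ Sup] image_cong refl Henstock_Kurzweil_Integration.integral_cong) (auto simp: X_eq)

lemma Vstar_cover:
  assumes T: "1 \<le> T" and N: "1 \<le> N"
  shows "s \<in> {0..T - 1} \<Longrightarrow> \<exists>i\<in>grid T N. \<bar>s - real i / real N\<bar> \<le> 2 / real N"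
    and "i \<in> grid T N \<Longrightarrow> \<exists>s\<in>{0..T - 1}. \<bar>s - real i / real N\<bar> \<le> 2 / real N"
proof -
  assume s: "s \<in> {0..T - 1}"
  let ?i = "nat \<lfloor>s * real N\<rfloor>"
  have "0 \<le> s" using s by simp
  note floor_grid[OF this N]
  moreover have "0 \<le> 1 / real N" by simp
  ultimately have "\<bar>s - real ?i / real N\<bar> \<le> 2 / real N" "real ?i / real N \<le> T - 1" using s by auto
  thus "\<exists>i\<in>grid T N. \<bar>s - real i / real N\<bar> \<le> 2 / real N" using grid_mem[OF T N] by blast
next
  assume "i \<in> grid T N"
  thus "\<exists>s\<in>{0..T - 1}. \<bar>s - real i / real N\<bar> \<le> 2 / real N"
    using grid_mem[OF T N, of i] by (intro bexI[of _ "real i / real N"]) auto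
qed

lemma Vstar_mean_close:
  assumes T: "1 \<le> T" "T \<le> real D" and D: "1 \<le> D"
  shows "integrable M (Vstar Xs T)"
    and "1 \<le> N \<Longrightarrow> \<bar>(\<integral>\<omega>. Vstar Xs T \<omega> \<partial>M) - (\<integral>\<omega>. Max (rsum N (\<lambda>u. X u \<omega>) ` grid T N) \<partial>M)\<bar> \<le> err D N"
proof -
  interpret XP: nn_process M X D by (rule X_nn_process[OF D])
  let ?x = "\<lambda>\<omega> u. X u \<omega>"
  let ?V = "\<lambda>\<omega>. SUP s\<in>{0..T - 1}. wint (?x \<omega>) s" and ?R = "\<lambda>N \<omega>. rsum (Suc N) (?x \<omega>) ` grid T (Suc N)"
  have A: "{0..T - 1} \<noteq> {}" "\<And>s. s \<in> {0..T - 1} \<Longrightarrow> 0 \<le> s \<and> s + 1 \<le> real D" using T by auto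
  \<comment> \<open>The supremum over the interval is the pathwise limit of the measurable grid
    maxima.\<close>
  have meas: "(\<lambda>\<omega>. SUP s\<in>{0..T - 1}. wint (?x \<omega>) s) \<in> borel_measurable M"
  proof (rule borel_measurable_LIMSEQ_real[where u="\<lambda>N \<omega>. Max (?R N \<omega>)"])
    show "(\<lambda>\<omega>. Max (?R N \<omega>)) \<in> borel_measurable M" for N
      by (rule borel_measurable_integrable, rule XP.rsum_max_integrable[OF _ grid_props grid_window[OF T(1) _ T(2)]]) simp_all
    fix \<omega> assume w: "\<omega> \<in> space M"
    obtain B where B: "\<And>N. 1 \<le> N \<Longrightarrow> nn_path (?x \<omega>) D N B" using X_path[OF w D] by blast
    have c: "\<bar>?V \<omega> - Max (?R N \<omega>)\<bar> \<le>
        2 * osc D (Suc N) (?x \<omega>) + 2 * gmax D (Suc N) (?x \<omega>)" for N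
    proof -
      have N: "1 \<le> Suc N" by simp
      show ?thesis
        by (rule nn_path.sup_window_close[OF B[OF N] A grid_props grid_window[OF T(1) N T(2)] Vstar_cover[OF T(1) N]])
    qed
    have lim: "(\<lambda>N. 2 * osc D (Suc N) (?x \<omega>) + 2 * gmax D (Suc N) (?x \<omega>)) \<longlonglongrightarrow> 0"
      using tendsto_add[OF tendsto_mult[OF tendsto_const X_osc_tendsto[OF w D]] tendsto_mult[OF tendsto_const X_gmax_tendsto[OF w D]], of 2 2]
      by (simp only: mult_zero_right add_0)
    have "(\<lambda>N. Max (?R N \<omega>) - ?V \<omega>) \<longlonglongrightarrow> 0"
    proof (rule Lim_null_comparison[OF always_eventually lim], rule allI)
      fix N
      show "norm (Max (?R N \<omega>) - ?V \<omega>) \<le>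
          2 * osc D (Suc N) (?x \<omega>) + 2 * gmax D (Suc N) (?x \<omega>)"
        unfolding real_norm_def by (subst abs_minus_commute) (rule c)
    qed
    thus "(\<lambda>N. Max (?R N \<omega>)) \<longlonglongrightarrow> ?V \<omega>"
      by (rule LIM_zero_cancel)
  qed
  have "integrable M (\<lambda>\<omega>. SUP s\<in>{0..T - 1}. wint (?x \<omega>) s)"
    by (rule XP.mean_window_close(1)[OF le_refl A grid_props grid_window[OF T(1) le_refl T(2)] Vstar_cover[OF T(1) le_refl] meas])
  thus "integrable M (Vstar Xs T)" by (simp add: Vstar_eq[abs_def])
  assume N: "1 \<le> N"
  show "\<bar>(\<integral>\<omega>. Vstar Xs T \<omega> \<partial>M) - (\<integral>\<omega>. Max (rsum N (?x \<omega>) ` grid T N) \<partial>M)\<bar> \<le> err D N"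
    unfolding Vstar_eq err_def
    by (rule XP.mean_window_close(2)[OF N A grid_props grid_window[OF T(1) N T(2)] Vstar_cover[OF T(1) N] meas])
qed

end

section \<open>Splitting of the mean at survival and passage to the limit\<close>

lemma tf_cell:
  assumes "1 \<le> J" "real l / real J < u" "u < real (Suc l) / real J"
  shows "tf J u = l"
proof -
  have "real l < u * real J" "u * real J < real (Suc l)" using assms by (auto simp: divide_less_eq less_divide_eq)
  hence "\<lfloor>u * real J\<rfloor> = int l" by (intro floor_unique) auto
  thus ?thesis by (simp add: tf_def)
qed

text \<open>The integral of (1 - u)^(1 + 1/\<alpha>) over [0,1] is 1 / (2 + 1/\<alpha>). The value 0
  at u <= 0 matches the integrands before the limit, since the means were shown to converge for u >
  0.\<close>

lemma bridge_integral:
  assumes a: "0 < (\<alpha>::real)"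
  shows "((\<lambda>u. if u \<le> 0 then 0 else 1 - mulim \<alpha> u) has_integral \<alpha> / (2 * \<alpha> + 1)) {0..1}"
proof -
  define p where "p = 1 + 1 / \<alpha>"
  have p: "0 < p" using a by (simp add: p_def add_pos_pos)
  define F where "F u = - ((1 - u) powr (p + 1) / (p + 1))" for u :: real
  have "((\<lambda>u. if u \<le> 0 then 0 else 1 - mulim \<alpha> u) has_integral F 1 - F 0) {0..1}"
  proof (rule fundamental_theorem_of_calculus_interior)
    show "continuous_on {0..1} F" unfolding F_def
      by (intro continuous_on_minus continuous_on_divide continuous_on_powr' continuous_on_diff continuous_on_const continuous_on_id) (use p in auto)
    fix x :: real assume x: "x \<in> {0<..<1}"
    have "(F has_real_derivative (1 - x) powr p) (at x)" unfolding F_def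
      by (rule derivative_eq_intros refl | use x p in \<open>simp; fail\<close>)+
    moreover have "(1 - x) powr p = (if x \<le> 0 then 0 else 1 - mulim \<alpha> x)" using x by (simp add: mulim_def p_def)
    ultimately show "(F has_vector_derivative (if x \<le> 0 then 0 else 1 - mulim \<alpha> x)) (at x)"
      by (simp add: has_real_derivative_iff_has_vector_derivative)
  qed simp
  moreover have "F 1 - F 0 = \<alpha> / (2 * \<alpha> + 1)" using a by (simp add: F_def p_def field_simps)
  ultimately show ?thesis by simp
qed

context critical_gw begin

lemma wint_Y:
  assumes "1 \<le> J" shows "wint (\<lambda>u. Y J u zs) (real k / real J) = Q J / real J * real (S_win zs k J)"
proof -
  have "((\<lambda>u. Y J u zs) has_integral (\<Sum>l\<in>{k..<k + J}. Q J * real (zs ! l)) / real J) {real k / real J..real (k + J) / real J}"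
    by (rule step_integral[OF assms]) (auto simp: Y_def tf_cell[OF assms])
  moreover have "real (k + J) / real J = real k / real J + 1" using assms by (simp add: add_divide_distrib)
  moreover have "(\<Sum>l\<in>{k..<k + J}. Q J * real (zs ! l)) / real J = Q J / real J * real (S_win zs k J)"
    by (simp add: S_win_def sum_distrib_left[symmetric])
  ultimately show ?thesis unfolding wint_def by (metis integral_unique)
qed

lemma window_sup_M_max:
  assumes "1 \<le> J"
  shows "(SUP s\<in>(\<lambda>k. real k / real J) ` {0..m - J}. wint (\<lambda>u. Y J u zs) s) = Q J / real J * real (M_max zs m J)"
proof -
  let ?f = "\<lambda>x. Q J / real J * real x"
  have mono: "mono ?f" using Q_pos[of J] by (intro monoI mult_left_mono) auto
  have "(SUP s\<in>(\<lambda>k. real k / real J) ` {0..m - J}. wint (\<lambda>u. Y J u zs) s) = Sup (?f ` (\<lambda>k. S_win zs k J) ` {0..m - J})"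
    unfolding image_image wint_Y[OF assms] ..
  also have "\<dots> = Max (?f ` (\<lambda>k. S_win zs k J) ` {0..m - J})" by (rule cSup_eq_Max) auto
  also have "\<dots> = ?f (Max ((\<lambda>k. S_win zs k J) ` {0..m - J}))" by (rule mono_Max_commute[OF mono, symmetric]) auto
  finally show ?thesis by (simp add: M_max_def)
qed

text \<open>Of the distance 2 / N, one part 1 / N allows for rounding and the other for the
  discrepancy between m / J and T. A point beyond the end of the other set is matched with the last
  point of that set.\<close>

lemma window_cover:
  assumes T: "1 \<le> T" and N: "1 \<le> N" "N \<le> J" "J \<le> m" and cl: "\<bar>real m / real J - T\<bar> \<le> 1 / real N"
  shows "s \<in> (\<lambda>k. real k / real J) ` {0..m - J} \<Longrightarrow> \<exists>i\<in>{..nat \<lfloor>(T - 1) * real N\<rfloor>}. \<bar>s - real i / real N\<bar> \<le> 2 / real N"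
    and "i \<le> nat \<lfloor>(T - 1) * real N\<rfloor> \<Longrightarrow> \<exists>s\<in>(\<lambda>k. real k / real J) ` {0..m - J}. \<bar>s - real i / real N\<bar> \<le> 2 / real N"
proof -
  have J: "1 \<le> J" using N by simp
  have e: "real (m - J) / real J = real m / real J - 1" using J N by (simp add: of_nat_diff diff_divide_distrib)
  have N0: "0 < 1 / real N" "2 / real N = 1 / real N + 1 / real N" using N by auto
  have T0: "0 \<le> T - 1" using T by simp
  have ub: "real (nat \<lfloor>(T - 1) * real N\<rfloor>) / real N \<le> T - 1" "T - 1 < real (nat \<lfloor>(T - 1) * real N\<rfloor>) / real N + 1 / real N"
    using floor_grid[OF T0 N(1)] by auto
  {
    assume "s \<in> (\<lambda>k. real k / real J) ` {0..m - J}"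
    then obtain k where k: "k \<le> m - J" "s = real k / real J" by auto
    have s: "0 \<le> s" "s \<le> T - 1 + 1 / real N"
    proof -
      show "0 \<le> s" using k by simp
      have "s \<le> real (m - J) / real J" unfolding k(2) using k(1) by (intro divide_right_mono) auto
      thus "s \<le> T - 1 + 1 / real N" using e cl by linarith
    qed
    show "\<exists>i\<in>{..nat \<lfloor>(T - 1) * real N\<rfloor>}. \<bar>s - real i / real N\<bar> \<le> 2 / real N"
    proof (cases "nat \<lfloor>s * real N\<rfloor> \<le> nat \<lfloor>(T - 1) * real N\<rfloor>")
      case True
      moreover have "\<bar>s - real (nat \<lfloor>s * real N\<rfloor>) / real N\<bar> \<le> 2 / real N" using floor_grid[OF s(1) N(1)] N0 by linarith
      ultimately show ?thesis by blast
    next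
      case False
      hence "real (nat \<lfloor>(T - 1) * real N\<rfloor>) / real N \<le> real (nat \<lfloor>s * real N\<rfloor>) / real N" by (intro divide_right_mono) auto
      hence "\<bar>s - real (nat \<lfloor>(T - 1) * real N\<rfloor>) / real N\<bar> \<le> 2 / real N" using floor_grid(1)[OF s(1) N(1)] s ub N0 by linarith
      thus ?thesis by blast
    qed
  }
  {
    assume "i \<le> nat \<lfloor>(T - 1) * real N\<rfloor>"
    hence "real i / real N \<le> real (nat \<lfloor>(T - 1) * real N\<rfloor>) / real N" by (intro divide_right_mono) auto
    hence i: "real i / real N \<le> T - 1" using ub by linarith
    have i0: "0 \<le> real i / real N" by simp
    let ?k = "nat \<lfloor>real i / real N * real J\<rfloor>"
    have k: "real ?k / real J \<le> real i / real N" "real i / real N < real ?k / real J + 1 / real J" using floor_grid[OF i0 J] by auto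
    have JN: "1 / real J \<le> 1 / real N" using N by (intro divide_left_mono) auto
    show "\<exists>s\<in>(\<lambda>k. real k / real J) ` {0..m - J}. \<bar>s - real i / real N\<bar> \<le> 2 / real N"
    proof (cases "?k \<le> m - J")
      case True
      have "\<bar>real ?k / real J - real i / real N\<bar> \<le> 2 / real N" using k JN N0 by linarith
      moreover have "real ?k / real J \<in> (\<lambda>k. real k / real J) ` {0..m - J}" using True by (intro imageI) simp
      ultimately show ?thesis by blast
    next
      case False
      hence "real (m - J) / real J \<le> real ?k / real J" by (intro divide_right_mono) auto
      hence "\<bar>real (m - J) / real J - real i / real N\<bar> \<le> 2 / real N" using k e cl i N0 by linarith
      moreover have "real (m - J) / real J \<in> (\<lambda>k. real k / real J) ` {0..m - J}" by (intro imageI) simp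
      ultimately show ?thesis by blast
    qed
  }
qed

lemma M_max_extinct:
  assumes "1 \<le> J" "J \<le> m" "m \<le> n" "zs \<in> set_pmf (gw_from \<xi> z n)" "zs ! J = 0"
  shows "M_max zs m J = (\<Sum>l<J. zs ! l)"
  unfolding M_max_def
proof (rule Max_eqI)
  show "(\<Sum>l<J. zs ! l) \<in> (\<lambda>k. S_win zs k J) ` {0..m - J}"
    by (rule image_eqI[of _ _ 0]) (auto simp: S_win_def atLeast0LessThan)
  fix y assume "y \<in> (\<lambda>k. S_win zs k J) ` {0..m - J}"
  then obtain k where k: "k \<le> m - J" "y = S_win zs k J" by auto
  have z: "zs ! l = 0" if "J \<le> l" "l \<le> n" for l using gw_from_absorbing[OF assms(4) that assms(5)] .
  have "y = (\<Sum>l\<in>{k..<k + J} \<inter> {..<J}. zs ! l)" unfolding k(2) S_win_def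
  proof (rule sum.mono_neutral_right)
    show "\<forall>i\<in>{k..<k + J} - {k..<k + J} \<inter> {..<J}. zs ! i = 0"
    proof
      fix i assume "i \<in> {k..<k + J} - {k..<k + J} \<inter> {..<J}"
      thus "zs ! i = 0" using k(1) assms(1-3) by (intro z) auto
    qed
  qed auto
  also have "\<dots> \<le> (\<Sum>l<J. zs ! l)" by (rule sum_mono2) auto
  finally show "y \<le> (\<Sum>l<J. zs ! l)" .
qed auto

lemma M_max_take: "1 \<le> J \<Longrightarrow> J \<le> m \<Longrightarrow> M_max (take (Suc m) zs) m J = M_max zs m J"
  unfolding M_max_def S_win_def by (intro arg_cong[of _ _ Max] image_cong sum.cong refl nth_take) auto

text \<open>The contribution of extinct paths becomes the integral of a step function in u: the cell
  from l / J to (l + 1) / J carries the mean of Z_l on extinction, which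
  \<open>nu_mean_compl\<close> expresses through the mean given survival.\<close>

lemma bridge_has_integral:
  assumes D: "1 \<le> D" and J: "1 \<le> J"
  shows "((\<lambda>u. if u \<le> 0 then 0 else 1 - (\<integral>zs. Y J u zs \<partial>nu D J)) has_integral
    (\<Sum>l<J. pexp (gw_from \<xi> 1 (D * J)) (\<lambda>zs. of_bool (zs ! J = 0) * real (zs ! l))) / real J) {0..1}"
proof -
  let ?p = "gw_from \<xi> 1 (D * J)"
  have "((\<lambda>u. if u \<le> 0 then 0 else 1 - (\<integral>zs. Y J u zs \<partial>nu D J)) has_integral
      (\<Sum>l\<in>{0..<J}. pexp ?p (\<lambda>zs. of_bool (zs ! J = 0) * real (zs ! l))) / real J) {real 0 / real J..real J / real J}"
  proof (rule step_integral[OF J])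
    fix l u assume l: "l < J" and u: "real l / real J < u" "u < real (Suc l) / real J"
    have "0 \<le> real l / real J" by simp
    hence u0: "0 < u" using u by linarith
    have "real (Suc l) / real J \<le> 1" using l by simp
    hence "u \<le> 1" using u by linarith
    moreover have "1 \<le> real D" using D by simp
    ultimately have uD: "u \<le> real D" by linarith
    show "(if u \<le> 0 then 0 else 1 - (\<integral>zs. Y J u zs \<partial>nu D J)) = pexp ?p (\<lambda>zs. of_bool (zs ! J = 0) * real (zs ! l))"
      using nu_mean_compl[OF D uD, of J] u0 by (simp add: tf_cell[OF J u])
  qed auto
  thus ?thesis using J by (simp add: atLeast0LessThan)
qed

text \<open>On survival the factor Q J of the conditioning is the scaling factor of
  \<open>Y\<close>, so the first summand is a conditional mean of the rescaled window maximum. m <=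
  D * J makes the common horizon long enough.\<close>

lemma EM_split:
  assumes D: "1 \<le> D" and J: "1 \<le> J" "J \<le> m" "m \<le> D * J"
  shows "EM \<xi> m J / real J = (\<integral>zs. Q J / real J * real (M_max zs m J) \<partial>nu D J)
      + integral {0..1} (\<lambda>u. if u \<le> 0 then 0 else 1 - (\<integral>zs. Y J u zs \<partial>nu D J))"
proof -
  let ?p = "gw_from \<xi> 1 (D * J)"
  let ?M = "\<lambda>zs. real (M_max zs m J)"
  have tk: "map_pmf (take (Suc m)) ?p = gw_from \<xi> 1 m" using gw_from_take[of m \<xi> 1 "D * J - m"] J by simp
  have iM: "integrable (measure_pmf ?p) ?M"
  proof -
    have "integrable (measure_pmf (map_pmf (take (Suc m)) ?p)) ?M" unfolding tk by (rule M_max_integrable) (use J in auto)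
    thus ?thesis by (simp add: integrable_map_pmf_eq M_max_take[OF J(1,2)])
  qed
  have "EM \<xi> m J = pexp (map_pmf (take (Suc m)) ?p) ?M"
    unfolding tk by (simp add: EM_def gw_paths_eq)
  also have "\<dots> = pexp ?p ?M" by (simp add: M_max_take[OF J(1,2)])
  also have "\<dots> = pexp ?p (\<lambda>zs. of_bool (0 < zs ! J) * ?M zs + (\<Sum>l<J. of_bool (zs ! J = 0) * real (zs ! l)))"
  proof (rule Bochner_Integration.integral_cong_AE)
    show "AE zs in measure_pmf ?p. ?M zs = of_bool (0 < zs ! J) * ?M zs + (\<Sum>l<J. of_bool (zs ! J = 0) * real (zs ! l))"
    proof (rule AE_pmfI)
      fix zs assume "zs \<in> set_pmf ?p"
      from M_max_extinct[OF J this] show "?M zs = of_bool (0 < zs ! J) * ?M zs + (\<Sum>l<J. of_bool (zs ! J = 0) * real (zs ! l))"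
        by (cases "zs ! J = 0") auto
    qed
  qed auto
  also have "\<dots> = pexp ?p (\<lambda>zs. of_bool (0 < zs ! J) * ?M zs)
      + (\<Sum>l<J. pexp ?p (\<lambda>zs. of_bool (zs ! J = 0) * real (zs ! l)))"
  proof -
    have 1: "integrable (measure_pmf ?p) (\<lambda>zs. of_bool (0 < zs ! J) * ?M zs)"
      by (rule Bochner_Integration.integrable_bound[OF iM]) (auto intro!: AE_I2)
    have lD: "l \<le> D * J" if "l < J" for l using that D by (metis le_trans less_imp_le_nat mult_le_mono1 nat_mult_1)
    have 2: "integrable (measure_pmf ?p) (\<lambda>zs. of_bool (zs ! J = 0) * real (zs ! l))" if "l < J" for l
      by (rule Bochner_Integration.integrable_bound[OF path_integrable[OF lD[OF that]]]) (auto intro!: AE_I2)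
    have 3: "integrable (measure_pmf ?p) (\<lambda>zs. \<Sum>l<J. of_bool (zs ! J = 0) * real (zs ! l))"
      by (rule Bochner_Integration.integrable_sum) (use 2 in blast)
    have "pexp ?p (\<lambda>zs. \<Sum>l<J. of_bool (zs ! J = 0) * real (zs ! l)) =
        (\<Sum>l<J. pexp ?p (\<lambda>zs. of_bool (zs ! J = 0) * real (zs ! l)))"
      by (rule Bochner_Integration.integral_sum) (use 2 in blast)
    thus ?thesis using Bochner_Integration.integral_add[OF 1 3] by (simp only:)
  qed
  finally have e: "EM \<xi> m J = pexp ?p (\<lambda>zs. of_bool (0 < zs ! J) * ?M zs)
      + (\<Sum>l<J. pexp ?p (\<lambda>zs. of_bool (zs ! J = 0) * real (zs ! l)))" .
  have a: "pexp ?p (\<lambda>zs. of_bool (0 < zs ! J) * ?M zs) / real J = (\<integral>zs. Q J / real J * ?M zs \<partial>nu D J)"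
    using Q_pos[of J] by (simp add: nu_integral[OF D])
  show ?thesis unfolding e a[symmetric] integral_unique[OF bridge_has_integral[OF D J(1)]] by (simp add: add_divide_distrib)
qed

lemma bridge_lim:
  assumes J: "filterlim J at_top sequentially" and D: "1 \<le> D"
  shows "(\<lambda>m. integral {0..1} (\<lambda>u. if u \<le> 0 then 0 else 1 - (\<integral>zs. Y (J m) u zs \<partial>nu D (J m)))) \<longlonglongrightarrow> \<alpha> / (2 * \<alpha> + 1)"
proof -
  have a: "0 < \<alpha>" using alpha by simp
  \<comment> \<open>Positive for every m, because the dominated convergence theorem asks for
    integrability at every index.\<close>
  define J' where "J' m = max 1 (J m)" for m
  have J': "filterlim J' at_top sequentially" unfolding J'_def
    by (rule filterlim_at_top_mono[OF J]) auto
  have ev: "eventually (\<lambda>m. J' m = J m) sequentially"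
    using filterlim_at_top[THEN iffD1, OF J, rule_format, of 1] by eventually_elim (simp add: J'_def)
  have D1: "1 \<le> real D" using D by simp
  have "(\<lambda>m. integral {0..1} (\<lambda>u. if u \<le> 0 then 0 else 1 - (\<integral>zs. Y (J' m) u zs \<partial>nu D (J' m)))) \<longlonglongrightarrow>
      integral {0..1} (\<lambda>u. if u \<le> 0 then 0 else 1 - mulim \<alpha> u)"
  proof (rule dominated_convergence(2)[where h="\<lambda>_. 1"])
    fix m
    have "1 \<le> J' m" by (simp add: J'_def)
    thus "(\<lambda>u. if u \<le> 0 then 0 else 1 - (\<integral>zs. Y (J' m) u zs \<partial>nu D (J' m))) integrable_on {0..1}"
      using bridge_has_integral[OF D] by (auto simp: integrable_on_def)
    fix u :: real assume u: "u \<in> {0..1}"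
    show "norm (if u \<le> 0 then 0 else 1 - (\<integral>zs. Y (J' m) u zs \<partial>nu D (J' m))) \<le> 1"
      using nu_mean_range[OF D, of u "J' m"] u D1 by auto
  next
    fix u :: real assume u: "u \<in> {0..1}"
    show "(\<lambda>m. if u \<le> 0 then 0 else 1 - (\<integral>zs. Y (J' m) u zs \<partial>nu D (J' m))) \<longlonglongrightarrow> (if u \<le> 0 then 0 else 1 - mulim \<alpha> u)"
    proof (cases "u \<le> 0")
      case False
      have "(\<lambda>m. \<integral>zs. Y (J' m) u zs \<partial>nu D (J' m)) \<longlonglongrightarrow> mulim \<alpha> u" by (rule nu_mean_lim[OF J' D]) (use False u D1 in auto)
      thus ?thesis using False by (auto intro!: tendsto_intros)
    qed simp
  qed auto
  hence "(\<lambda>m. integral {0..1} (\<lambda>u. if u \<le> 0 then 0 else 1 - (\<integral>zs. Y (J' m) u zs \<partial>nu D (J' m)))) \<longlonglongrightarrow> \<alpha> / (2 * \<alpha> + 1)"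
    by (simp add: integral_unique[OF bridge_integral[OF a]])
  thus ?thesis by (rule Lim_transform_eventually[OF _ eventually_mono[OF ev]]) (simp only:)
qed

end

context gw_limit begin

text \<open>Pointwise convergence at u > 0 comes from the two-time limit, and the bound 2 from means
  at most 1; the point u = 0 is a null set.\<close>

lemma Y_griddist_integral_lim:
  assumes J: "filterlim J at_top sequentially" and D: "1 \<le> D" and N: "1 \<le> N"
  shows "(\<lambda>m. LINT u:{0..real D}|lborel. nn_process.griddist (nu D (J m)) (Y (J m)) N u) \<longlonglongrightarrow> (LINT u:{0..real D}|lborel. nn_process.griddist M X N u)"
  unfolding set_lebesgue_integral_def
proof (rule integral_dominated_convergence[where w="\<lambda>u. indicator {0..real D} u * 2"])
  have YP: "nn_process (nu D (J m)) (Y (J m)) D" for m by (rule Y_nn_process[OF D])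
  have XP: "nn_process M X D" by (rule X_nn_process[OF D])
  show "AE u in lborel. (\<lambda>m. indicator {0..real D} u *\<^sub>R nn_process.griddist (nu D (J m)) (Y (J m)) N u) \<longlonglongrightarrow> indicator {0..real D} u *\<^sub>R nn_process.griddist M X N u"
    using AE_lborel_singleton[of 0]
  proof eventually_elim
    case (elim u)
    show ?case
    proof (cases "u \<in> {0..real D}")
      case True
      hence u: "0 < u" "u \<le> real D" using elim by auto
      have "(\<lambda>m. \<integral>zs. \<bar>Y (J m) u zs - Y (J m) (gup N u) zs\<bar> \<partial>nu D (J m)) \<longlonglongrightarrow> (\<integral>\<omega>. \<bar>Xs u \<omega> - Xs (gup N u) \<omega>\<bar> \<partial>M)"
        by (rule Y_abs_diff_lim[OF J D u gup_pos[OF N] gup_le[OF N D u(2)]])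
      thus ?thesis using True u gup_pos[OF N, of u]
        by (simp add: nn_process.griddist_def[OF YP] nn_process.griddist_def[OF XP] X_eq)
    qed simp
  qed
  show "AE u in lborel. norm (indicator {0..real D} u *\<^sub>R nn_process.griddist (nu D (J m)) (Y (J m)) N u) \<le> indicator {0..real D} u * 2" for m
    by (rule AE_I2) (use nn_process.griddist_range[OF YP N, of _ m] in \<open>auto simp: indicator_def\<close>)
  show "(\<lambda>u. indicator {0..real D} u *\<^sub>R nn_process.griddist M X N u) \<in> borel_measurable lborel"
    using nn_process.griddist_meas[OF XP, of N] by simp
  show "(\<lambda>u. indicator {0..real D} u *\<^sub>R nn_process.griddist (nu D (J m)) (Y (J m)) N u) \<in> borel_measurable lborel" for m
    using nn_process.griddist_meas[OF YP, of m N] by simp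
  show "integrable lborel (\<lambda>u. indicator {0..real D} u * (2::real))" by simp
qed

text \<open>The mesh N is fixed first, by the error for the limit process alone; for this N the grid
  maxima and the error of the rescaled process converge as m grows. T + 1 <= D leaves room for the
  discrete windows, which may end as late as T + 1 / N.\<close>

lemma window_mean_lim:
  assumes J: "filterlim J at_top sequentially" and D: "1 \<le> D" and T: "1 \<le> T" "T + 1 \<le> real D"
    and JT: "(\<lambda>m. real m / real (J m)) \<longlonglongrightarrow> T" and Jm: "eventually (\<lambda>m. J m \<le> m) sequentially"
  shows "(\<lambda>m. \<integral>zs. Q (J m) / real (J m) * real (M_max zs m (J m)) \<partial>nu D (J m)) \<longlonglongrightarrow> (\<integral>\<omega>. Vstar Xs T \<omega> \<partial>M)"
proof (rule tendstoI)
  fix e :: real assume e: "0 < e"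
  hence e4: "0 < e / 4" by simp
  obtain N0 where "err D (Suc N0) < e / 4"
    using order_tendstoD(2)[OF err_lim[OF D] e4] by (auto simp: eventually_sequentially)
  then obtain N where N: "1 \<le> N" "err D N < e / 4" by (metis le_add1 plus_1_eq_Suc)
  have TD: "T \<le> real D" using T by simp
  have XP: "nn_process M X D" by (rule X_nn_process[OF D])
  let ?R = "\<lambda>m. \<integral>zs. Max (rsum N (\<lambda>u. Y (J m) u zs) ` grid T N) \<partial>nu D (J m)"
  let ?RX = "\<integral>\<omega>. Max (rsum N (\<lambda>u. X u \<omega>) ` grid T N) \<partial>M"
  have XXs: "rsum N (\<lambda>u. Xs u \<omega>) = rsum N (\<lambda>u. X u \<omega>)" "gmax D N (\<lambda>u. Xs u \<omega>) = gmax D N (\<lambda>u. X u \<omega>)" for \<omega>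
    by (simp_all add: rsum_def[abs_def] gmax_def X_def)
  have lims: "?R \<longlonglongrightarrow> ?RX" "(\<lambda>m. \<integral>zs. gmax D N (\<lambda>u. Y (J m) u zs) \<partial>nu D (J m)) \<longlonglongrightarrow> (\<integral>\<omega>. gmax D N (\<lambda>u. X u \<omega>) \<partial>M)"
    using Y_window_lim[OF J D N(1) grid_props grid_window[OF T(1) N(1) TD]] by (simp_all add: XXs)
  let ?e = "\<lambda>m. 2 * (LINT u:{0..real D}|lborel. nn_process.griddist (nu D (J m)) (Y (J m)) N u) + 2 * (\<integral>zs. gmax D N (\<lambda>u. Y (J m) u zs) \<partial>nu D (J m))"
  have "?e \<longlonglongrightarrow> err D N" unfolding err_def
    by (intro tendsto_add tendsto_mult tendsto_const Y_griddist_integral_lim[OF J D N(1)] lims(2))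
  hence ev1: "eventually (\<lambda>m. ?e m < e / 4) sequentially" using N(2) by (rule order_tendstoD)
  have ev2: "eventually (\<lambda>m. \<bar>?R m - ?RX\<bar> < e / 4) sequentially" using tendstoD[OF lims(1) e4] by (simp add: dist_real_def)
  have ev3: "eventually (\<lambda>m. N \<le> J m) sequentially" using J by (simp add: filterlim_at_top)
  have "0 < 1 / real N" using N by simp
  from tendstoD[OF JT this] have ev4: "eventually (\<lambda>m. \<bar>real m / real (J m) - T\<bar> < 1 / real N) sequentially" by (simp add: dist_real_def)
  show "eventually (\<lambda>m. dist (\<integral>zs. Q (J m) / real (J m) * real (M_max zs m (J m)) \<partial>nu D (J m)) (\<integral>\<omega>. Vstar Xs T \<omega> \<partial>M) < e) sequentially"
    using ev1 ev2 ev3 ev4 Jm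
  proof eventually_elim
    case (elim m)
    have YP: "nn_process (nu D (J m)) (Y (J m)) D" by (rule Y_nn_process[OF D])
    have J1: "1 \<le> J m" using elim(3) N(1) by simp
    have cl: "\<bar>real m / real (J m) - T\<bar> \<le> 1 / real N" using elim(4) by simp
    let ?A = "(\<lambda>k. real k / real (J m)) ` {0..m - J m}"
    have A: "?A \<noteq> {}" by simp
    have A2: "0 \<le> s \<and> s + 1 \<le> real D" if "s \<in> ?A" for s
    proof -
      obtain k where k: "k \<le> m - J m" "s = real k / real (J m)" using \<open>s \<in> ?A\<close> by auto
      have "s \<le> real (m - J m) / real (J m)" unfolding k(2) using k(1) by (intro divide_right_mono) auto
      also have "\<dots> = real m / real (J m) - 1" using J1 elim(5) by (simp add: of_nat_diff diff_divide_distrib)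
      finally have "s + 1 \<le> T + 1 / real N" using cl by linarith
      also have "\<dots> \<le> T + 1" using N(1) by simp
      finally show ?thesis using T(2) k(2) by simp
    qed
    have mW: "(\<lambda>zs. SUP s\<in>?A. wint (\<lambda>u. Y (J m) u zs) s) \<in> borel_measurable (nu D (J m))" by measurable
    note c = window_cover[OF T(1) N(1) elim(3,5) cl, folded grid_def]
    have "\<bar>(\<integral>zs. (SUP s\<in>?A. wint (\<lambda>u. Y (J m) u zs) s) \<partial>nu D (J m)) - ?R m\<bar> \<le> ?e m"
      by (rule nn_process.mean_window_close(2)[OF YP N(1) A A2 grid_props grid_window[OF T(1) N(1) TD] c(1) c(2) mW])
         (auto simp: grid_def)
    moreover have "\<bar>(\<integral>\<omega>. Vstar Xs T \<omega> \<partial>M) - ?RX\<bar> \<le> err D N" by (rule Vstar_mean_close(2)[OF T(1) TD D N(1)])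
    ultimately show ?case using elim(1,2) N(2) unfolding window_sup_M_max[OF J1] dist_real_def by linarith
  qed
qed

text \<open>Positivity of the limit is what later turns convergence into asymptotic equivalence. It
  needs only the extinct part, as the window means are nonnegative.\<close>

lemma EM_lim:
  assumes j: "\<forall>m\<ge>1. 1 \<le> j m \<and> j m \<le> m" and lim: "(\<lambda>m. real (j m) / real m) \<longlonglongrightarrow> \<eta>" and \<eta>: "0 < \<eta>"
  shows "(\<lambda>m. EM \<xi> m (j m) / real (j m)) \<longlonglongrightarrow> phi \<alpha> M Xs \<eta>"
    and "0 < phi \<alpha> M Xs \<eta>"
proof -
  have ev1: "eventually (\<lambda>m. 1 \<le> j m \<and> j m \<le> m) sequentially"
    using eventually_ge_at_top[of 1] by eventually_elim (use j in auto)
  have \<eta>1: "\<eta> \<le> 1"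
  proof (rule tendsto_upperbound[OF lim])
    show "eventually (\<lambda>m. real (j m) / real m \<le> 1) sequentially" using ev1 by eventually_elim simp
  qed simp
  define T where "T = 1 / \<eta>"
  have T: "1 \<le> T" using \<eta> \<eta>1 by (simp add: T_def)
  define D where "D = nat \<lceil>T\<rceil> + 1"
  have D: "1 \<le> D" "T + 1 \<le> real D" using real_nat_ceiling_ge[of T] by (auto simp: D_def)
  have JT: "(\<lambda>m. real m / real (j m)) \<longlonglongrightarrow> T"
    using tendsto_divide[OF tendsto_const[of 1] lim] \<eta> by (simp add: T_def)
  have J: "filterlim j at_top sequentially"
  proof -
    have "filterlim (\<lambda>m. real (j m) / real m * real m) at_top sequentially"
      by (rule filterlim_tendsto_pos_mult_at_top[OF lim \<eta> filterlim_real_sequentially])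
    moreover have "eventually (\<lambda>m. real (j m) / real m * real m = real (j m)) sequentially"
      using eventually_gt_at_top[of 0] by eventually_elim simp
    ultimately have "filterlim (\<lambda>m. real (j m)) at_top sequentially" by (simp cong: filterlim_cong)
    thus ?thesis by (simp add: filterlim_sequentially_iff_filterlim_real)
  qed
  have Jm: "eventually (\<lambda>m. j m \<le> m) sequentially" using ev1 by eventually_elim simp
  have wl: "(\<lambda>m. \<integral>zs. Q (j m) / real (j m) * real (M_max zs m (j m)) \<partial>nu D (j m)) \<longlonglongrightarrow> (\<integral>\<omega>. Vstar Xs T \<omega> \<partial>M)"
    by (rule window_mean_lim[OF J D(1) T D(2) JT Jm])
  have lim2: "(\<lambda>m. (\<integral>zs. Q (j m) / real (j m) * real (M_max zs m (j m)) \<partial>nu D (j m))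
      + integral {0..1} (\<lambda>u. if u \<le> 0 then 0 else 1 - (\<integral>zs. Y (j m) u zs \<partial>nu D (j m)))) \<longlonglongrightarrow> (\<integral>\<omega>. Vstar Xs T \<omega> \<partial>M) + \<alpha> / (2 * \<alpha> + 1)"
    by (rule tendsto_add[OF wl bridge_lim[OF J D(1)]])
  have "T < real D" using D by simp
  hence "eventually (\<lambda>m. real m / real (j m) < real D) sequentially" using JT by (intro order_tendstoD)
  with ev1 have ev: "eventually (\<lambda>m. (\<integral>zs. Q (j m) / real (j m) * real (M_max zs m (j m)) \<partial>nu D (j m))
      + integral {0..1} (\<lambda>u. if u \<le> 0 then 0 else 1 - (\<integral>zs. Y (j m) u zs \<partial>nu D (j m))) = EM \<xi> m (j m) / real (j m)) sequentially"
  proof eventually_elim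
    case (elim m)
    have "real m < real D * real (j m)" using elim by (simp add: divide_less_eq)
    hence "m \<le> D * j m" by (metis less_imp_le of_nat_less_iff of_nat_mult)
    thus ?case using elim by (intro EM_split[symmetric] D) auto
  qed
  have "(\<lambda>m. EM \<xi> m (j m) / real (j m)) \<longlonglongrightarrow> (\<integral>\<omega>. Vstar Xs T \<omega> \<partial>M) + \<alpha> / (2 * \<alpha> + 1)"
    by (rule Lim_transform_eventually[OF lim2 ev])
  thus "(\<lambda>m. EM \<xi> m (j m) / real (j m)) \<longlonglongrightarrow> phi \<alpha> M Xs \<eta>" by (simp add: phi_def T_def add.commute)
  have "0 \<le> (\<integral>\<omega>. Vstar Xs T \<omega> \<partial>M)"
  proof (rule tendsto_lowerbound[OF wl])
    show "eventually (\<lambda>m. 0 \<le> (\<integral>zs. Q (j m) / real (j m) * real (M_max zs m (j m)) \<partial>nu D (j m))) sequentially"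
      by (intro always_eventually allI Bochner_Integration.integral_nonneg mult_nonneg_nonneg divide_nonneg_nonneg less_imp_le[OF Q_pos]) auto
  qed simp
  moreover have "0 < \<alpha> / (2 * \<alpha> + 1)" using alpha by simp
  ultimately show "0 < phi \<alpha> M Xs \<eta>" by (simp add: phi_def T_def)
qed

text \<open>The uniform bounds are applied to windows of length about e * m, and m tends to infinity
  with e fixed. Their constant depends neither on m nor on the window, hence not on e.\<close>

lemma phi_log_bound:
  assumes eps: "0 < \<epsilon>" "\<epsilon> < 1"
  obtains C where "C \<ge> 0" "\<And>e. 0 < e \<Longrightarrow> e \<le> 1 \<Longrightarrow> \<bar>phi \<alpha> M Xs e - ln (1 / e)\<bar> \<le> \<epsilon> * ln (1 / e) + C"
proof -
  obtain C where C: "C \<ge> 0" "\<And>m j. 1 \<le> j \<Longrightarrow> j \<le> m \<Longrightarrow> \<bar>EM \<xi> m j / real j - ln (real m / real j)\<bar> \<le> \<epsilon> * ln (real m / real j) + C"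
    using EM_log_bounds[OF eps] by blast
  have "\<bar>phi \<alpha> M Xs e - ln (1 / e)\<bar> \<le> \<epsilon> * ln (1 / e) + C" if e: "0 < e" "e \<le> 1" for e
  proof -
    \<comment> \<open>The integer part of e * m may be 0 for small m, and window lengths must be at
      least 1.\<close>
    define j where "j m = max 1 (nat \<lfloor>e * real m\<rfloor>)" for m
    have j: "\<forall>m\<ge>1. 1 \<le> j m \<and> j m \<le> m"
    proof (intro allI impI)
      fix m :: nat assume m: "1 \<le> m"
      have "e * real m \<le> real m" using e by (intro mult_left_le_one_le) auto
      hence "\<lfloor>e * real m\<rfloor> \<le> int m" by linarith
      thus "1 \<le> j m \<and> j m \<le> m" using m by (auto simp: j_def)
    qed
    have lim: "(\<lambda>m. real (j m) / real m) \<longlonglongrightarrow> e"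
    proof (rule tendsto_sandwich)
      have "(\<lambda>m. e - 1 / real m) \<longlonglongrightarrow> e - 0" by (intro tendsto_intros lim_const_over_n)
      thus "(\<lambda>m. e - 1 / real m) \<longlonglongrightarrow> e" by simp
      have "(\<lambda>m. e + 1 / real m) \<longlonglongrightarrow> e + 0" by (intro tendsto_intros lim_const_over_n)
      thus "(\<lambda>m. e + 1 / real m) \<longlonglongrightarrow> e" by simp
      show "eventually (\<lambda>m. e - 1 / real m \<le> real (j m) / real m) sequentially" using eventually_gt_at_top[of 0]
      proof eventually_elim
        case (elim m)
        have "e * real m - 1 \<le> real (nat \<lfloor>e * real m\<rfloor>)" by linarith
        also have "\<dots> \<le> real (j m)" by (simp add: j_def)
        finally have "(e * real m - 1) / real m \<le> real (j m) / real m" by (intro divide_right_mono) auto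
        thus ?case using elim by (simp add: diff_divide_distrib)
      qed
      show "eventually (\<lambda>m. real (j m) / real m \<le> e + 1 / real m) sequentially" using eventually_gt_at_top[of 0]
      proof eventually_elim
        case (elim m)
        have "0 \<le> e * real m" using e by simp
        hence "real (j m) \<le> e * real m + 1" unfolding j_def by (auto simp: max_def) linarith
        hence "real (j m) / real m \<le> (e * real m + 1) / real m" by (intro divide_right_mono) auto
        thus ?case using elim by (simp add: add_divide_distrib)
      qed
    qed
    have JT: "(\<lambda>m. real m / real (j m)) \<longlonglongrightarrow> 1 / e"
      using tendsto_divide[OF tendsto_const[of 1] lim] e by simp
    have ln: "(\<lambda>m. ln (real m / real (j m))) \<longlonglongrightarrow> ln (1 / e)" by (rule tendsto_ln[OF JT]) (use e in auto)
    show ?thesis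
    proof (rule tendsto_le[OF sequentially_bot])
      show "(\<lambda>m. \<epsilon> * ln (real m / real (j m)) + C) \<longlonglongrightarrow> \<epsilon> * ln (1 / e) + C" by (rule tendsto_add[OF tendsto_mult[OF tendsto_const ln] tendsto_const])
      show "(\<lambda>m. \<bar>EM \<xi> m (j m) / real (j m) - ln (real m / real (j m))\<bar>) \<longlonglongrightarrow> \<bar>phi \<alpha> M Xs e - ln (1 / e)\<bar>"
        by (rule tendsto_rabs[OF tendsto_diff[OF EM_lim(1)[OF j lim e(1)] ln]])
      show "eventually (\<lambda>m. \<bar>EM \<xi> m (j m) / real (j m) - ln (real m / real (j m))\<bar> \<le> \<epsilon> * ln (real m / real (j m)) + C) sequentially"
        using eventually_ge_at_top[of 1] by eventually_elim (use j in \<open>intro C(2); blast\<close>)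
    qed
  qed
  with C(1) show ?thesis by (rule that)
qed

lemma phi_asymp: "phi \<alpha> M Xs \<sim>[at_right 0] (\<lambda>e. ln (1 / e))"
proof (rule asymp_equivI', rule ratio_tendsto_1)
  show "filterlim (\<lambda>e::real. ln (1 / e)) at_top (at_right 0)"
    using filterlim_compose[OF ln_at_top filterlim_inverse_at_top_right] by (simp add: inverse_eq_divide)
  fix d :: real assume d: "0 < d" "d < 1"
  obtain C where C: "\<And>e. 0 < e \<Longrightarrow> e \<le> 1 \<Longrightarrow> \<bar>phi \<alpha> M Xs e - ln (1 / e)\<bar> \<le> d * ln (1 / e) + C"
    using phi_log_bound[OF d] by blast
  have "eventually (\<lambda>e::real. 0 < e \<and> e < 1) (at_right 0)" by (rule eventually_pos_less_at_right_0) simp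
  thus "\<exists>C. eventually (\<lambda>e. \<bar>phi \<alpha> M Xs e - ln (1 / e)\<bar> \<le> d * ln (1 / e) + C) (at_right 0)"
    by (intro exI[of _ C]) (auto elim!: eventually_mono intro: C)
qed

end

theorem theorem1:
  fixes \<xi> :: "nat pmf" and \<alpha> :: real and L :: "real \<Rightarrow> real"
    and j :: "nat \<Rightarrow> nat" and \<eta> :: real
    and P :: "real \<Rightarrow> real \<Rightarrow> real measure" and ch :: "real measure"
    and M :: "'a measure" and Xs :: "real \<Rightarrow> 'a \<Rightarrow> real"
  assumes alpha: "0 < \<alpha>" "\<alpha> \<le> 1"
    and mean: "measure_pmf.expectation \<xi> real = 1"
    and L_sv: "slowly_varying_at_0 L"
    and genfun: "\<forall>s\<in>{0..1}. (\<Sum>k. pmf \<xi> k * s ^ k) = s + (1 - s) powr (1 + \<alpha>) * L (1 - s)"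
    and j_range: "\<forall>m\<ge>1. 1 \<le> j m \<and> j m \<le> m"
    and j_lim: "(\<lambda>m. real (j m) / real m) \<longlonglongrightarrow> \<eta>"
    and P_csbp: "csbp_kernel P \<alpha>"
    and chi: "chi_law ch \<alpha>"
    and Xstar: "is_Xstar P ch \<alpha> M Xs"
  shows "(\<eta> = 0 \<longrightarrow>
            (\<lambda>m. EM \<xi> m (j m)) \<sim>[at_top] (\<lambda>m. real (j m) * ln (real m / real (j m))))
       \<and> (0 < \<eta> \<longrightarrow>
            (\<lambda>m. EM \<xi> m (j m)) \<sim>[at_top] (\<lambda>m. real (j m) * phi \<alpha> M Xs \<eta>))
       \<and> (phi \<alpha> M Xs \<sim>[at_right 0] (\<lambda>e. ln (1 / e)))"
proof -
  interpret gw_limit \<xi> \<alpha> L P ch M Xs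
    using assms by unfold_locales auto
  have "(\<lambda>m. EM \<xi> m (j m)) \<sim>[at_top] (\<lambda>m. real (j m) * phi \<alpha> M Xs \<eta>)" if \<eta>: "0 < \<eta>"
  proof (rule asymp_equivI')
    have p: "0 < phi \<alpha> M Xs \<eta>" by (rule EM_lim(2)[OF j_range j_lim \<eta>])
    have "(\<lambda>m. EM \<xi> m (j m) / real (j m) / phi \<alpha> M Xs \<eta>) \<longlonglongrightarrow> phi \<alpha> M Xs \<eta> / phi \<alpha> M Xs \<eta>"
      by (intro tendsto_divide tendsto_const EM_lim(1)[OF j_range j_lim \<eta>]) (use p in simp)
    thus "(\<lambda>m. EM \<xi> m (j m) / (real (j m) * phi \<alpha> M Xs \<eta>)) \<longlonglongrightarrow> 1" using p by simp
  qed
  moreover have "(\<lambda>m. EM \<xi> m (j m)) \<sim>[at_top] (\<lambda>m. real (j m) * ln (real m / real (j m)))" if "\<eta> = 0"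
    by (rule EM_small_window) (use j_range j_lim that in auto)
  ultimately show ?thesis using phi_asymp by blast
qed

end
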